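(* Let $(M,g)$ be a smooth Lorentzian manifold with timelike boundary all of whose lightlike geodesics are non-trapping. Let $\mathcal U'$ be a conic open neighborhood of $\partial LM$ in $\partial TM$ whose corresponding geodesics are non-trapping, let $\mathcal U=\mathcal U'\cap\partial JM$, and let $\mathcal U_-$ be the set of inward pointing vectors in $\mathcal U$. Suppose $g|_{T\partial M\times T\partial M}$ is given. Then the lightlike interior travel time data $(S^{in},\tau^{in})|_{\partial_-LM}$ can be recovered from $S^{in}|_{\mathcal U_-}$. That is: for $j=1,2$, let $(M_j,g_j)$ be a smooth Lorentzian manifold with timelike boundary all of whose lightlike geodesics are non-trapping, let $\mathcal U_j'$ be a conic open neighborhood of $\partial LM_j$ in $\partial TM_j$ whose corresponding geodesics are non-trapping, let $\mathcal U_j=\mathcal U_j'\cap\partial JM_j$, and let $\mathcal U_{j,-}$ be the set of inward pointing vectors in $\mathcal U_j$. If $\varphi_0:\partial M_1\to\partial M_2$ is a boundary isometry with $(\varphi_0)_*(\mathcal U_{1,-})=\mathcal U_{2,-}$ and $(\varphi_0)_*\circ S_1^{in}=S_2^{in}\circ(\varphi_0)_*$ on $\mathcal U_{1,-}$, then $\tau_1^{in}=\tau_2^{in}\circ(\varphi_0)_*$ (and $(\varphi_0)_*\circ S_1^{in}=S_2^{in}\circ(\varphi_0)_*$) on $\partial_-LM_1$.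
   Context: Signature $(-,+,\dots,+)$. $\partial TM$ is $TM$ restricted to $\partial M$; $LM=\{(x,v)\in TM\setminus0:g(v,v)=0\}$, $JM=\{(x,v)\in TM\setminus0:g(v,v)\le0\}$; $\partial LM,\partial JM$ are the parts over $\partial M$. $\nu$ is the outward unit normal, $\partial_-TM=\{(x,v)\in\partial TM:g(v,\nu)<0\}$ (inward), $\partial_-LM=\partial LM\cap\partial_-TM$. Conic means invariant under positive scaling. A geodesic is non-trapping if it exits $M$ in finite (affine) time. Interior travel time data: for $(x,v)\in\partial_-TM$ with geodesic $\gamma$, $\tau^{in}(x,v)=\sup\{t>0:\gamma((0,t))\subset M^\circ\}$; if finite, $S^{in}(x,v)=(\gamma(\tau^{in}),\dot\gamma(\tau^{in}))$. Boundary isometry: diffeomorphism $\varphi_0:\partial M_1\to\partial M_2$ preserving the induced boundary metrics. In boundary normal coordinates ($g=g_{\alpha\beta}dx^\alpha dx^\beta+(dx^n)^2$, interior $x^n>0$), $(\varphi_0)_*$ denotes the map $\partial TM_1\to\partial TM_2$, $(x,v',v^n)\mapsto(\varphi_0(x),(\varphi_0)_*v',v^n)$. *)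

theory Defs
  imports "HOL-Analysis.Analysis"
begin

section \<open>Smooth functions\<close>

primrec Ck_on :: "nat \<Rightarrow> 'a::euclidean_space set \<Rightarrow> ('a \<Rightarrow> 'b::real_normed_vector) \<Rightarrow> bool" where
  "Ck_on 0 U f \<longleftrightarrow> continuous_on U f"
| "Ck_on (Suc k) U f \<longleftrightarrow> (\<forall>x\<in>U. f differentiable (at x)) \<and>
     (\<forall>v. Ck_on k U (\<lambda>x. frechet_derivative f (at x) v))"

text \<open>On an arbitrary subset of a Euclidean space (here: relatively open subsets of a half-space),
  smoothness means local extendability to a smooth function on an open set.\<close>

definition smooth_on :: "'a::euclidean_space set \<Rightarrow> ('a \<Rightarrow> 'b::real_normed_vector) \<Rightarrow> bool" where
  "smooth_on S f \<longleftrightarrow> (\<forall>x\<in>S. \<exists>U F. open U \<and> x \<in> U \<and> (\<forall>k. Ck_on k U F) \<and> (\<forall>y\<in>S \<inter> U. F y = f y))"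

section \<open>Manifolds with boundary, tangent vectors, metrics\<close>

text \<open>The model space is \<open>'e \<times> real\<close>, with coordinates \<open>(x', x\<^sup>n)\<close> and half-space \<open>x\<^sup>n \<ge> 0\<close>; its
  dimension is thus at least 2. The points of the manifold are all elements of the type \<open>'m\<close>. A chart is
  a pair (domain, coordinate map).\<close>

type_synonym ('m, 'e) chart = "'m set \<times> ('m \<Rightarrow> 'e \<times> real)"

definition half_space :: "('e::euclidean_space \<times> real) set" where
  "half_space = {z. 0 \<le> snd z}"

abbreviation cdom :: "('m, 'e) chart \<Rightarrow> 'm set" where
  "cdom c \<equiv> fst c"

abbreviation cmap :: "('m, 'e) chart \<Rightarrow> 'm \<Rightarrow> 'e \<times> real" where
  "cmap c \<equiv> snd c"

definition cinv :: "('m, 'e) chart \<Rightarrow> 'e \<times> real \<Rightarrow> 'm" where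
  "cinv c = inv_into (cdom c) (cmap c)"

definition is_chart :: "('m::topological_space, 'e::euclidean_space) chart \<Rightarrow> bool" where
  "is_chart c \<longleftrightarrow> open (cdom c) \<and> openin (top_of_set half_space) (cmap c ` cdom c) \<and>
     homeomorphism (cdom c) (cmap c ` cdom c) (cmap c) (cinv c)"

definition smooth_atlas :: "('m::topological_space, 'e::euclidean_space) chart set \<Rightarrow> bool" where
  "smooth_atlas A \<longleftrightarrow> (\<forall>c\<in>A. is_chart c) \<and> (\<Union>c\<in>A. cdom c) = UNIV \<and>
     (\<forall>c\<in>A. \<forall>c'\<in>A. smooth_on (cmap c ` (cdom c \<inter> cdom c')) (\<lambda>x. cmap c' (cinv c x)))"

text \<open>A tangent vector at \<open>p\<close> is represented by the family of its coordinate vectors in all charts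
  around \<open>p\<close>, which are related by the Jacobians of the transition maps. The family is set to \<open>0\<close>
  on the remaining charts, so that equality of tangent vectors is equality of functions.\<close>

type_synonym ('m, 'e) tvec = "('m, 'e) chart \<Rightarrow> 'e \<times> real"

record ('m, 'e) metric_manifold =
  charts :: "('m, 'e) chart set"
  metric :: "'m \<Rightarrow> ('m, 'e) tvec \<Rightarrow> ('m, 'e) tvec \<Rightarrow> real"

definition charts_at :: "('m, 'e) metric_manifold \<Rightarrow> 'm \<Rightarrow> ('m, 'e) chart set" where
  "charts_at M p = {c \<in> charts M. p \<in> cdom c}"

definition jacobian :: "('m, 'e::euclidean_space) chart \<Rightarrow> ('m, 'e) chart \<Rightarrow> 'm \<Rightarrow> 'e \<times> real \<Rightarrow> 'e \<times> real" where
  "jacobian c c' p = frechet_derivative (\<lambda>x. cmap c' (cinv c x))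
     (at (cmap c p) within cmap c ` (cdom c \<inter> cdom c'))"

definition tangent_space :: "('m, 'e::euclidean_space) metric_manifold \<Rightarrow> 'm \<Rightarrow> ('m, 'e) tvec set" where
  "tangent_space M p = {v. (\<forall>c\<in>charts_at M p. \<forall>c'\<in>charts_at M p. v c' = jacobian c c' p (v c)) \<and>
     (\<forall>c. c \<notin> charts_at M p \<longrightarrow> v c = 0)}"

text \<open>The tangent vector at \<open>p\<close> whose coordinate vector in the chart \<open>c\<close> is \<open>a\<close>.\<close>

definition tvec_of :: "('m, 'e::euclidean_space) metric_manifold \<Rightarrow> ('m, 'e) chart \<Rightarrow> 'm \<Rightarrow> 'e \<times> real \<Rightarrow> ('m, 'e) tvec" where
  "tvec_of M c p a = (\<lambda>c'. if c' \<in> charts_at M p then jacobian c c' p a else 0)"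

definition tadd :: "('m, 'e::euclidean_space) tvec \<Rightarrow> ('m, 'e) tvec \<Rightarrow> ('m, 'e) tvec" where
  "tadd v w = (\<lambda>c. v c + w c)"

definition tscale :: "real \<Rightarrow> ('m, 'e::euclidean_space) tvec \<Rightarrow> ('m, 'e) tvec" where
  "tscale s v = (\<lambda>c. s *\<^sub>R v c)"

definition metric_coord :: "('m, 'e::euclidean_space) metric_manifold \<Rightarrow> ('m, 'e) chart \<Rightarrow> 'e \<times> real \<Rightarrow> 'e \<times> real \<Rightarrow> 'e \<times> real \<Rightarrow> real" where
  "metric_coord M c x a b =
     metric M (cinv c x) (tvec_of M c (cinv c x) a) (tvec_of M c (cinv c x) b)"

definition boundary :: "('m, 'e::euclidean_space) metric_manifold \<Rightarrow> 'm set" where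
  "boundary M = {p. \<exists>c\<in>charts_at M p. snd (cmap c p) = 0}"

definition interior_part :: "('m, 'e::euclidean_space) metric_manifold \<Rightarrow> 'm set" where
  "interior_part M = - boundary M"

text \<open>The tangent space \<open>T\<^sub>p(\<partial>M)\<close>, as a subspace of \<open>T\<^sub>pM\<close>, at a boundary point \<open>p\<close>.\<close>

definition boundary_tangent_space :: "('m, 'e::euclidean_space) metric_manifold \<Rightarrow> 'm \<Rightarrow> ('m, 'e) tvec set" where
  "boundary_tangent_space M p = {v \<in> tangent_space M p. \<forall>c\<in>charts_at M p. snd (v c) = 0}"

text \<open>Symmetric bilinear forms of signature \<open>(-,+,\<dots>,+)\<close>.\<close>

definition lorentzian_form :: "('v::euclidean_space \<Rightarrow> 'v \<Rightarrow> real) \<Rightarrow> bool" where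
  "lorentzian_form B \<longleftrightarrow> bilinear B \<and> (\<forall>a b. B a b = B b a) \<and>
     (\<exists>e E. e \<notin> E \<and> finite E \<and> independent (insert e E) \<and> span (insert e E) = UNIV \<and>
        B e e = -1 \<and> (\<forall>b\<in>E. B e b = 0 \<and> B b b = 1) \<and> (\<forall>b\<in>E. \<forall>b'\<in>E. b \<noteq> b' \<longrightarrow> B b b' = 0))"

definition lorentzian_metric :: "('m, 'e::euclidean_space) metric_manifold \<Rightarrow> bool" where
  "lorentzian_metric M \<longleftrightarrow> (\<forall>c\<in>charts M.
     (\<forall>x\<in>cmap c ` cdom c. lorentzian_form (metric_coord M c x)) \<and>
     (\<forall>a b. smooth_on (cmap c ` cdom c) (\<lambda>x. metric_coord M c x a b)))"

text \<open>The boundary is timelike if the metric induced on it is Lorentzian.\<close>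

definition timelike_boundary :: "('m, 'e::euclidean_space) metric_manifold \<Rightarrow> bool" where
  "timelike_boundary M \<longleftrightarrow> (\<forall>p\<in>boundary M. \<forall>c\<in>charts_at M p.
     lorentzian_form (\<lambda>a b. metric_coord M c (cmap c p) (a, 0) (b, 0)))"

definition lorentzian_manifold_timelike_boundary ::
    "('m::{t2_space, second_countable_topology}, 'e::euclidean_space) metric_manifold \<Rightarrow> bool" where
  "lorentzian_manifold_timelike_boundary M \<longleftrightarrow>
     smooth_atlas (charts M) \<and> lorentzian_metric M \<and> timelike_boundary M"

section \<open>Geodesics\<close>

text \<open>The vector \<open>\<Gamma>(a,b)\<close> with components \<open>\<Gamma>\<^sup>k\<^sub>i\<^sub>j a\<^sup>i b\<^sup>j\<close> at \<open>x\<close>, in the chart \<open>c\<close>.\<close>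

definition metric_deriv :: "('m, 'e::euclidean_space) metric_manifold \<Rightarrow> ('m, 'e) chart \<Rightarrow> 'e \<times> real \<Rightarrow> 'e \<times> real \<Rightarrow> 'e \<times> real \<Rightarrow> 'e \<times> real \<Rightarrow> real" where
  "metric_deriv M c x d a b =
     frechet_derivative (\<lambda>y. metric_coord M c y a b) (at x within cmap c ` cdom c) d"

definition christoffel :: "('m, 'e::euclidean_space) metric_manifold \<Rightarrow> ('m, 'e) chart \<Rightarrow> 'e \<times> real \<Rightarrow> 'e \<times> real \<Rightarrow> 'e \<times> real \<Rightarrow> 'e \<times> real" where
  "christoffel M c x a b = (THE w. \<forall>d. metric_coord M c x w d =
     (metric_deriv M c x a b d + metric_deriv M c x b a d - metric_deriv M c x d a b) / 2)"

text \<open>A geodesic \<open>\<gamma>\<close> in \<open>M\<close> on the interval \<open>I\<close>, carried together with its velocity field \<open>V\<close>;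
  derivatives at end points of \<open>I\<close> are one-sided. On a one-point interval the velocity is an
  arbitrary tangent vector, which covers geodesics that leave \<open>M\<close> at once.\<close>

definition geodesic :: "('m::topological_space, 'e::euclidean_space) metric_manifold \<Rightarrow> real set \<Rightarrow> (real \<Rightarrow> 'm) \<Rightarrow> (real \<Rightarrow> ('m, 'e) tvec) \<Rightarrow> bool" where
  "geodesic M I \<gamma> V \<longleftrightarrow> is_interval I \<and> continuous_on I \<gamma> \<and>
     (\<forall>t\<in>I. V t \<in> tangent_space M (\<gamma> t) \<and>
        (\<forall>c\<in>charts_at M (\<gamma> t).
           ((\<lambda>s. cmap c (\<gamma> s)) has_vector_derivative V t c) (at t within I) \<and>
           ((\<lambda>s. V s c) has_vector_derivative
              - christoffel M c (cmap c (\<gamma> t)) (V t c) (V t c)) (at t within I)))"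

definition geodesic_from :: "('m::topological_space, 'e::euclidean_space) metric_manifold \<Rightarrow> 'm \<times> ('m, 'e) tvec \<Rightarrow> real set \<Rightarrow> (real \<Rightarrow> 'm) \<Rightarrow> (real \<Rightarrow> ('m, 'e) tvec) \<Rightarrow> bool" where
  "geodesic_from M q I \<gamma> V \<longleftrightarrow> 0 \<in> I \<and> geodesic M I \<gamma> V \<and> \<gamma> 0 = fst q \<and> V 0 = snd q"

text \<open>The geodesic issued from \<open>q\<close> exits \<open>M\<close> in finite time: it exists in \<open>M\<close> up to and including
  some finite time \<open>l\<close>, and it cannot be continued in \<open>M\<close> beyond \<open>l\<close> (so its point at time \<open>l\<close> is
  a boundary point). A geodesic that is merely incomplete, i.e. whose maximal domain is
  half-open, does not count as exiting.\<close>

definition nontrapping :: "('m::topological_space, 'e::euclidean_space) metric_manifold \<Rightarrow> 'm \<times> ('m, 'e) tvec \<Rightarrow> bool" where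
  "nontrapping M q \<longleftrightarrow> (\<exists>l\<ge>0. (\<exists>\<gamma> V. geodesic_from M q {0..l} \<gamma> V) \<and>
     \<not> (\<exists>l'>l. \<exists>\<gamma> V. geodesic_from M q {0..l'} \<gamma> V))"

section \<open>Bundles\<close>

definition bdTM :: "('m, 'e::euclidean_space) metric_manifold \<Rightarrow> ('m \<times> ('m, 'e) tvec) set" where
  "bdTM M = {(p, v). p \<in> boundary M \<and> v \<in> tangent_space M p}"

definition LM :: "('m, 'e::euclidean_space) metric_manifold \<Rightarrow> ('m \<times> ('m, 'e) tvec) set" where
  "LM M = {(p, v). v \<in> tangent_space M p \<and> v \<noteq> (\<lambda>_. 0) \<and> metric M p v v = 0}"

definition JM :: "('m, 'e::euclidean_space) metric_manifold \<Rightarrow> ('m \<times> ('m, 'e) tvec) set" where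
  "JM M = {(p, v). v \<in> tangent_space M p \<and> v \<noteq> (\<lambda>_. 0) \<and> metric M p v v \<le> 0}"

definition bdLM :: "('m, 'e::euclidean_space) metric_manifold \<Rightarrow> ('m \<times> ('m, 'e) tvec) set" where
  "bdLM M = LM M \<inter> bdTM M"

definition bdJM :: "('m, 'e::euclidean_space) metric_manifold \<Rightarrow> ('m \<times> ('m, 'e) tvec) set" where
  "bdJM M = JM M \<inter> bdTM M"

definition outward_normal :: "('m, 'e::euclidean_space) metric_manifold \<Rightarrow> 'm \<Rightarrow> ('m, 'e) tvec" where
  "outward_normal M p = (THE v. v \<in> tangent_space M p \<and>
     (\<forall>u\<in>boundary_tangent_space M p. metric M p v u = 0) \<and> metric M p v v = 1 \<and>
     (\<forall>c\<in>charts_at M p. snd (v c) < 0))"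

definition bd_minus_TM :: "('m, 'e::euclidean_space) metric_manifold \<Rightarrow> ('m \<times> ('m, 'e) tvec) set" where
  "bd_minus_TM M = {(p, v) \<in> bdTM M. metric M p v (outward_normal M p) < 0}"

definition bd_minus_LM :: "('m, 'e::euclidean_space) metric_manifold \<Rightarrow> ('m \<times> ('m, 'e) tvec) set" where
  "bd_minus_LM M = bdLM M \<inter> bd_minus_TM M"

definition conic :: "('m \<times> ('m, 'e::euclidean_space) tvec) set \<Rightarrow> bool" where
  "conic U \<longleftrightarrow> (\<forall>(p, v)\<in>U. \<forall>s>0. (p, tscale s v) \<in> U)"

text \<open>Openness in the manifold \<open>\<partial>TM\<close>, expressed in the charts \<open>(p, v) \<mapsto> (c p, v c)\<close>.\<close>

definition open_in_bdTM :: "('m, 'e::euclidean_space) metric_manifold \<Rightarrow> ('m \<times> ('m, 'e) tvec) set \<Rightarrow> bool" where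
  "open_in_bdTM M U \<longleftrightarrow> U \<subseteq> bdTM M \<and>
     (\<forall>c\<in>charts M. openin (top_of_set ((cmap c ` (cdom c \<inter> boundary M)) \<times> UNIV))
        {(cmap c p, v c) |p v. (p, v) \<in> U \<and> p \<in> cdom c})"

definition nontrapping_conic_nbhd :: "('m::topological_space, 'e::euclidean_space) metric_manifold \<Rightarrow> ('m \<times> ('m, 'e) tvec) set \<Rightarrow> bool" where
  "nontrapping_conic_nbhd M U \<longleftrightarrow>
     conic U \<and> open_in_bdTM M U \<and> bdLM M \<subseteq> U \<and> (\<forall>q\<in>U. nontrapping M q)"

section \<open>Interior travel time data\<close>

definition tau_in :: "('m::topological_space, 'e::euclidean_space) metric_manifold \<Rightarrow> 'm \<times> ('m, 'e) tvec \<Rightarrow> ereal" where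
  "tau_in M q = Sup (ereal ` {t. 0 < t \<and>
     (\<exists>\<gamma> V. geodesic_from M q {0..<t} \<gamma> V \<and> \<gamma> ` {0<..<t} \<subseteq> interior_part M)})"

text \<open>Meaningful only if \<open>tau_in M q\<close> is finite and the geodesic extends to that time.\<close>

definition S_in :: "('m::topological_space, 'e::euclidean_space) metric_manifold \<Rightarrow> 'm \<times> ('m, 'e) tvec \<Rightarrow> 'm \<times> ('m, 'e) tvec" where
  "S_in M q = (THE r. \<exists>t \<gamma> V. tau_in M q = ereal t \<and> geodesic_from M q {0..t} \<gamma> V \<and> r = (\<gamma> t, V t))"

section \<open>Boundary isometries\<close>

text \<open>The coordinate expression of a map between boundaries, with its domain.\<close>

definition bd_coord_dom :: "('m, 'e::euclidean_space) chart \<Rightarrow> ('k, 'f::euclidean_space) chart \<Rightarrow> ('m \<Rightarrow> 'k) \<Rightarrow> 'e set" where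
  "bd_coord_dom c d f = {x. (x, 0) \<in> cmap c ` cdom c \<and> f (cinv c (x, 0)) \<in> cdom d}"

definition bd_coord :: "('m, 'e::euclidean_space) chart \<Rightarrow> ('k, 'f::euclidean_space) chart \<Rightarrow> ('m \<Rightarrow> 'k) \<Rightarrow> 'e \<Rightarrow> 'f" where
  "bd_coord c d f x = fst (cmap d (f (cinv c (x, 0))))"

definition bd_smooth_map :: "('m::topological_space, 'e::euclidean_space) metric_manifold \<Rightarrow> ('k::topological_space, 'f::euclidean_space) metric_manifold \<Rightarrow> ('m \<Rightarrow> 'k) \<Rightarrow> bool" where
  "bd_smooth_map M N f \<longleftrightarrow> f ` boundary M \<subseteq> boundary N \<and> continuous_on (boundary M) f \<and>
     (\<forall>c\<in>charts M. \<forall>d\<in>charts N. smooth_on (bd_coord_dom c d f) (bd_coord c d f))"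

definition bd_diffeo :: "('m::topological_space, 'e::euclidean_space) metric_manifold \<Rightarrow> ('k::topological_space, 'f::euclidean_space) metric_manifold \<Rightarrow> ('m \<Rightarrow> 'k) \<Rightarrow> bool" where
  "bd_diffeo M N f \<longleftrightarrow> bij_betw f (boundary M) (boundary N) \<and> bd_smooth_map M N f \<and>
     bd_smooth_map N M (inv_into (boundary M) f)"

text \<open>The differential \<open>T\<^sub>p(\<partial>M) \<rightarrow> T\<^sub>f\<^sub>(\<^sub>p\<^sub>)(\<partial>N)\<close>.\<close>

definition bd_differential :: "('m, 'e::euclidean_space) metric_manifold \<Rightarrow> ('k, 'f::euclidean_space) metric_manifold \<Rightarrow> ('m \<Rightarrow> 'k) \<Rightarrow> 'm \<Rightarrow> ('m, 'e) tvec \<Rightarrow> ('k, 'f) tvec" where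
  "bd_differential M N f p u = (THE w. w \<in> tangent_space N (f p) \<and>
     (\<forall>c\<in>charts_at M p. \<forall>d\<in>charts_at N (f p).
        w d = (frechet_derivative (bd_coord c d f) (at (fst (cmap c p))) (fst (u c)), 0)))"

definition boundary_isometry :: "('m::topological_space, 'e::euclidean_space) metric_manifold \<Rightarrow> ('k::topological_space, 'f::euclidean_space) metric_manifold \<Rightarrow> ('m \<Rightarrow> 'k) \<Rightarrow> bool" where
  "boundary_isometry M N f \<longleftrightarrow> bd_diffeo M N f \<and>
     (\<forall>p\<in>boundary M. \<forall>u\<in>boundary_tangent_space M p. \<forall>w\<in>boundary_tangent_space M p.
        metric N (f p) (bd_differential M N f p u) (bd_differential M N f p w) = metric M p u w)"

text \<open>In boundary normal coordinates at \<open>p\<close> (\<open>g = g\<^sub>\<alpha>\<^sub>\<beta> dx\<^sup>\<alpha> dx\<^sup>\<beta> + (dx\<^sup>n)\<^sup>2\<close>, \<open>x\<^sup>n > 0\<close> in the interior) one has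
  \<open>\<partial>\<^sub>n = -\<nu>\<close> at the boundary, and \<open>\<partial>\<^sub>n\<close> is orthogonal to \<open>T\<^sub>p(\<partial>M)\<close>. So \<open>v = v' + v\<^sup>n \<partial>\<^sub>n\<close> has the
  normal component \<open>v\<^sup>n = -g(v, \<nu>)\<close> and the tangential part \<open>v' = v - v\<^sup>n \<partial>\<^sub>n\<close>, and the map
  \<open>(x, v', v\<^sup>n) \<mapsto> (f x, df v', v\<^sup>n)\<close> is the following one.\<close>

definition inward_normal :: "('m, 'e::euclidean_space) metric_manifold \<Rightarrow> 'm \<Rightarrow> ('m, 'e) tvec" where
  "inward_normal M p = tscale (-1) (outward_normal M p)"

definition normal_comp :: "('m, 'e::euclidean_space) metric_manifold \<Rightarrow> 'm \<Rightarrow> ('m, 'e) tvec \<Rightarrow> real" where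
  "normal_comp M p v = metric M p v (inward_normal M p)"

definition tangential_part :: "('m, 'e::euclidean_space) metric_manifold \<Rightarrow> 'm \<Rightarrow> ('m, 'e) tvec \<Rightarrow> ('m, 'e) tvec" where
  "tangential_part M p v = tadd v (tscale (- normal_comp M p v) (inward_normal M p))"

definition bd_pushforward :: "('m, 'e::euclidean_space) metric_manifold \<Rightarrow> ('k, 'f::euclidean_space) metric_manifold \<Rightarrow> ('m \<Rightarrow> 'k) \<Rightarrow> 'm \<times> ('m, 'e) tvec \<Rightarrow> 'k \<times> ('k, 'f) tvec" where
  "bd_pushforward M N f = (\<lambda>(p, v). (f p,
     tadd (bd_differential M N f p (tangential_part M p v))
       (tscale (normal_comp M p v) (inward_normal N (f p)))))"

end

theory Submission
  imports Defs
begin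

text \<open>
  Fix a boundary point and vary a lightlike vector \<open>v\<close> there in a family \<open>v\<^sub>s\<close>. If the geodesic of \<open>v\<close> exits
  transversally at \<open>y\<close> with velocity \<open>b\<close>, at time \<open>T\<close>, then the exit points \<open>y\<^sub>s\<close> of the varied geodesics satisfy
  \<open>g(y\<^sub>s - y, b) = T/2 g(v\<^sub>s, v\<^sub>s) + O(s\<^sup>2)\<close> by the first variation formula. With \<open>v\<^sub>s = v + s u\<close> and \<open>g(v, u) < 0\<close> the
  vectors \<open>v\<^sub>s\<close> are timelike with energy of order \<open>s\<close>, so \<open>T\<close> is determined by the exit data and the boundary metric.

  If the geodesic exits tangentially, then the reversed geodesic, from \<open>(y, -b)\<close>, exits transversally, and so do
  the geodesics of the inward lightlike vectors \<open>-b + s N + s\<^sup>2 u\<close> for suitable \<open>u\<close> (\<open>N\<close> being the inward normal).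
  The travel times of these are determined by the first case, and they converge to \<open>T\<close> as \<open>s\<close> tends to \<open>0\<close>.
\<close>

section \<open>Ordinary differential equations\<close>

text \<open>The formula sees \<open>T\<close> only if the energy is of first order in s: for
  lightlike variations it reads g(y_s - y, b) = O(s^2). This is why data on timelike vectors near
  the light cone are used. Since y_s and y lie on the boundary, their displacement is tangent to it
  up to O(s^2). The pairing therefore sees only the tangential part of b, and a boundary isometry
  preserves it.

  Transversality of the exit makes the exit time Lipschitz in s; near a tangential exit it may jump.
  Reversal moves the tangency to the start, where it is harmless if the varied vectors turn inward
  at a rate proportional to s: the varied geodesic then stays above the original one, which is
  itself inside.

  Geodesics can be compared only while both are in the manifold, that is, up to the smaller exit
  time. The rest has length O(s); it adds to the displacement a multiple of b, invisible to the
  pairing because b is lightlike, and an error O(s^2).\<close>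

lemma has_vector_derivative_within_singleton: "(f has_vector_derivative D) (at x within {x})"
  unfolding has_vector_derivative_def has_derivative_def
  by (simp add: bounded_linear_scaleR_left at_within_def)

lemma eventually_small: "\<epsilon> > 0 \<Longrightarrow> \<forall>\<^sub>F s in at_right (0::real). C * s < \<epsilon>"
proof -
  assume "\<epsilon> > 0"
  moreover have "((\<lambda>s. C * s) \<longlongrightarrow> C * 0) (at_right (0::real))" by (intro tendsto_intros)
  ultimately show ?thesis by (auto dest: order_tendstoD(2))
qed

lemma eventually_pos: "\<forall>\<^sub>F s in at_right (0::real). 0 < s"
  by (simp add: eventually_at_right_less)

lemma norm_fst_snd_le: "norm (fst z) \<le> norm z" "norm (snd z) \<le> norm z"
  using norm_fst_le[of "fst z" "snd z"] norm_snd_le[of "snd z" "fst z"] by simp_all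

lemma snd_fst_has_derivative:
  assumes "((\<lambda>t. fst (z t)) has_vector_derivative snd (z t)) (at t within I)"
  shows "((\<lambda>t. snd (fst (z t))) has_real_derivative snd (snd (z t))) (at t within I)"
  using has_derivative_snd[OF assms[unfolded has_vector_derivative_def]]
  unfolding has_real_derivative_iff_has_vector_derivative has_vector_derivative_def by simp

lemma nonneg_derivative_imp_le:
  fixes u :: "real \<Rightarrow> real"
  assumes "s \<le> t" "\<And>r. r \<in> {s..t} \<Longrightarrow> (u has_real_derivative u' r) (at r within {s..t})"
    and "\<And>r. r \<in> {s..t} \<Longrightarrow> 0 \<le> u' r"
  shows "u s \<le> u t"
proof -
  have "\<exists>r\<in>{s..t}. u t - u s = u' r * (t - s)"
    by (rule mvt_very_simple) (use assms in \<open>auto simp: has_field_derivative_def\<close>)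
  then obtain r where "r \<in> {s..t}" "u t - u s = u' r * (t - s)" ..
  moreover have "0 \<le> u' r * (t - s)"
    using assms(1) assms(3)[OF \<open>r \<in> {s..t}\<close>] by auto
  ultimately show ?thesis by simp
qed

lemma pos_derivative_imp_less:
  fixes u :: "real \<Rightarrow> real"
  assumes "s < t" "\<And>r. r \<in> {s..t} \<Longrightarrow> (u has_real_derivative u' r) (at r within {s..t})"
    and "\<And>r. r \<in> {s..t} \<Longrightarrow> 0 < u' r"
  shows "u s < u t"
proof -
  have "\<exists>r\<in>{s..t}. u t - u s = u' r * (t - s)"
    by (rule mvt_very_simple) (use assms in \<open>auto simp: has_field_derivative_def\<close>)
  then obtain r where "r \<in> {s..t}" "u t - u s = u' r * (t - s)" ..
  moreover have "0 < u' r * (t - s)"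
    using assms(1) assms(3)[OF \<open>r \<in> {s..t}\<close>] by auto
  ultimately show ?thesis by simp
qed

text \<open>The squared norm is differentiable even where \<open>d\<close> vanishes, and by
  Cauchy-Schwarz its derivative is at most \<open>2 * K\<close> times itself in absolute value.
  Hence it increases after multiplication by exp(2 K r) and decreases after multiplication by exp(-2
  K r). The second conclusion, backward in time, serves uniqueness to the left of a common
  point.\<close>

lemma gronwall:
  fixes d :: "real \<Rightarrow> 'a::euclidean_space"
  assumes "s \<le> t" and der: "\<And>r. r \<in> {s..t} \<Longrightarrow> (d has_vector_derivative d' r) (at r within {s..t})"
    and bnd: "\<And>r. r \<in> {s..t} \<Longrightarrow> norm (d' r) \<le> K * norm (d r)"
  shows "norm (d t) \<le> exp (K * (t - s)) * norm (d s)"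
    and "norm (d s) \<le> exp (K * (t - s)) * norm (d t)"
proof -
  have ip: "\<bar>d r \<bullet> d' r\<bar> \<le> K * (d r \<bullet> d r)" if "r \<in> {s..t}" for r
  proof -
    have "\<bar>d r \<bullet> d' r\<bar> \<le> norm (d r) * norm (d' r)" by (rule Cauchy_Schwarz_ineq2)
    also have "\<dots> \<le> norm (d r) * (K * norm (d r))" by (intro mult_left_mono bnd that) auto
    finally show ?thesis by (simp add: dot_square_norm power2_eq_square mult_ac)
  qed
  define u where "u k r = exp (2 * k * r) * (d r \<bullet> d r)" for k r
  have du: "(u k has_real_derivative exp (2 * k * r) * (2 * k * (d r \<bullet> d r) + 2 * (d r \<bullet> d' r))) (at r within {s..t})"
    if "r \<in> {s..t}" for k r
    unfolding u_def has_real_derivative_iff_has_vector_derivative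
    using der[OF that] 
    unfolding has_vector_derivative_def
    by (auto intro!: derivative_eq_intros simp: inner_commute algebra_simps)
  have "u K s \<le> u K t"
    by (rule nonneg_derivative_imp_le[OF \<open>s \<le> t\<close> du]) (use ip in fastforce)+
  moreover have "- u (-K) s \<le> - u (-K) t"
    by (rule nonneg_derivative_imp_le[OF \<open>s \<le> t\<close> DERIV_minus[OF du]])
      (use ip in \<open>fastforce simp: mult_le_0_iff\<close>)+
  ultimately have 1: "exp (2 * K * s) * (norm (d s))\<^sup>2 \<le> exp (2 * K * t) * (norm (d t))\<^sup>2"
    and 2: "exp (- (2 * K * t)) * (norm (d t))\<^sup>2 \<le> exp (- (2 * K * s)) * (norm (d s))\<^sup>2"
    by (auto simp: u_def dot_square_norm)
  have e: "exp (K * (t - s)) ^ 2 = exp (2 * K * t) * exp (- (2 * K * s))"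
    by (simp add: exp_double[symmetric] exp_add[symmetric] algebra_simps flip: exp_of_nat_mult)
  have "(norm (d s))\<^sup>2 = exp (- (2 * K * s)) * (exp (2 * K * s) * (norm (d s))\<^sup>2)"
    by (simp add: exp_minus)
  also have "\<dots> \<le> exp (- (2 * K * s)) * (exp (2 * K * t) * (norm (d t))\<^sup>2)"
    using 1 by (intro mult_left_mono) auto
  also have "\<dots> = (exp (K * (t - s)) * norm (d t))\<^sup>2" by (simp add: power_mult_distrib e)
  finally show "norm (d s) \<le> exp (K * (t - s)) * norm (d t)"
    by (rule power2_le_imp_le) auto
  have "(norm (d t))\<^sup>2 = exp (2 * K * t) * (exp (- (2 * K * t)) * (norm (d t))\<^sup>2)"
    by (simp add: exp_minus)
  also have "\<dots> \<le> exp (2 * K * t) * (exp (- (2 * K * s)) * (norm (d s))\<^sup>2)"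
    using 2 by (intro mult_left_mono) auto
  also have "\<dots> = (exp (K * (t - s)) * norm (d s))\<^sup>2" by (simp add: power_mult_distrib e)
  finally show "norm (d t) \<le> exp (K * (t - s)) * norm (d s)"
    by (rule power2_le_imp_le) auto
qed

text \<open>The mean value inequality for \<open>x u - u *\<^sub>R v0\<close>. At the exit both the
  elapsed time and \<open>e\<close> will be O(s), which makes the error quadratic.\<close>

lemma displacement:
  fixes x v :: "real \<Rightarrow> 'a::real_normed_vector"
  assumes "a \<le> b" "\<And>u. u \<in> {a..b} \<Longrightarrow> (x has_vector_derivative v u) (at u within {a..b})"
    and "\<And>u. u \<in> {a..b} \<Longrightarrow> norm (v u - v0) \<le> e"
  shows "norm (x b - x a - (b - a) *\<^sub>R v0) \<le> (b - a) * e"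
proof -
  have "norm ((x b - b *\<^sub>R v0) - (x a - a *\<^sub>R v0)) \<le> e * norm (b - a)"
  proof (rule differentiable_bound[of "{a..b}" _ "\<lambda>u h. h *\<^sub>R (v u - v0)"])
    fix u assume u: "u \<in> {a..b}"
    show "((\<lambda>u. x u - u *\<^sub>R v0) has_derivative (\<lambda>h. h *\<^sub>R (v u - v0))) (at u within {a..b})"
      using assms(2)[OF u] unfolding has_vector_derivative_def
      by (auto intro!: derivative_eq_intros simp: scaleR_diff_right)
    show "onorm (\<lambda>h. h *\<^sub>R (v u - v0)) \<le> e"
    proof (rule onorm_le)
      fix h :: real
      show "norm (h *\<^sub>R (v u - v0)) \<le> e * norm h" using mult_left_mono[OF assms(3)[OF u], of "\<bar>h\<bar>"] by (simp add: mult.commute)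
    qed
  qed (use assms(1) in auto)
  moreover have "(x b - b *\<^sub>R v0) - (x a - a *\<^sub>R v0) = x b - x a - (b - a) *\<^sub>R v0"
    by (simp add: scaleR_diff_left algebra_simps)
  ultimately show ?thesis using assms(1) by (simp add: mult.commute)
qed

definition solves :: "('a::real_normed_vector \<Rightarrow> 'a) \<Rightarrow> real set \<Rightarrow> (real \<Rightarrow> 'a) \<Rightarrow> bool" where
  "solves F I z \<longleftrightarrow> (\<forall>t\<in>I. (z has_vector_derivative F (z t)) (at t within I))"

lemma solves_subset: "solves F I z \<Longrightarrow> J \<subseteq> I \<Longrightarrow> solves F J z"
  unfolding solves_def by (meson has_vector_derivative_within_subset subsetD)

lemma solves_continuous: "solves F I z \<Longrightarrow> continuous_on I z"
  unfolding solves_def continuous_on_eq_continuous_within by (meson has_vector_derivative_continuous)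

lemma solves_speed:
  assumes "solves F I z" "convex I" "\<And>u. u \<in> I \<Longrightarrow> norm (F (z u)) \<le> N" "s \<in> I" "t \<in> I"
  shows "norm (z t - z s) \<le> N * \<bar>t - s\<bar>"
proof -
  have "norm (z t - z s) \<le> N * norm (t - s)"
  proof (rule differentiable_bound[OF assms(2), where f' = "\<lambda>u h. h *\<^sub>R F (z u)"])
    fix u assume u: "u \<in> I"
    show "(z has_derivative (\<lambda>h. h *\<^sub>R F (z u))) (at u within I)"
      using assms(1) u unfolding solves_def has_vector_derivative_def by blast
    show "onorm (\<lambda>h. h *\<^sub>R F (z u)) \<le> N"
    proof (rule onorm_le)
      fix h :: real
      show "norm (h *\<^sub>R F (z u)) \<le> N * norm h" using mult_left_mono[OF assms(3)[OF u], of "\<bar>h\<bar>"] by (simp add: mult.commute)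
    qed
  qed (use assms in auto)
  then show ?thesis by simp
qed

text \<open>At the junction the one-sided derivatives of both pieces have to agree, hence the common
  value \<open>D\<close>. Away from it, only the piece on the side of \<open>t\<close>
  matters.\<close>

lemma has_vector_derivative_concat:
  fixes f g :: "real \<Rightarrow> 'a::real_normed_vector"
  assumes "a \<le> b" "b \<le> c" "f b = g b" "t \<in> {a..c}"
    and f: "t \<le> b \<Longrightarrow> (f has_vector_derivative D) (at t within {a..b})"
    and g: "b \<le> t \<Longrightarrow> (g has_vector_derivative D) (at t within {b..c})"
  shows "((\<lambda>t. if t \<le> b then f t else g t) has_vector_derivative D) (at t within {a..c})"
proof -
  have "((\<lambda>t. if t \<in> {a..b} then f t else g t) has_vector_derivative (if t \<in> {a..b} then D else D))
    (at t within {a..c})"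
  proof (rule has_vector_derivative_If_within_closures[where T = "{b..c}"])
    show "t \<in> {a..b} \<union> {b..c}" using assms by auto
    have un: "{a..b} \<union> closure {a..b} \<inter> closure {b..c} = {a..b}" "{b..c} \<union> closure {a..b} \<inter> closure {b..c} = {b..c}"
      using assms(1,2) by auto
    show "{a..c} = {a..b} \<union> {b..c}" using assms(1,2) by auto
    show "(f has_vector_derivative D) (at t within {a..b} \<union> closure {a..b} \<inter> closure {b..c})"
      if "t \<in> {a..b} \<union> closure {a..b} \<inter> closure {b..c}" using f that unfolding un by simp
    show "(g has_vector_derivative D) (at t within {b..c} \<union> closure {a..b} \<inter> closure {b..c})"
      if "t \<in> {b..c} \<union> closure {a..b} \<inter> closure {b..c}" using g that unfolding un by simp
  qed (use assms in auto)
  then show ?thesis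
    using \<open>t \<in> {a..c}\<close> by (auto intro: has_vector_derivative_transform[rotated -1])
qed

lemma solves_concat:
  assumes "a \<le> b" "b \<le> c" "f b = g b" "solves F {a..b} f" "solves F {b..c} g"
  shows "solves F {a..c} (\<lambda>t. if t \<le> b then f t else g t)"
  unfolding solves_def
proof
  fix t assume "t \<in> {a..c}"
  then show "((\<lambda>t. if t \<le> b then f t else g t) has_vector_derivative F (if t \<le> b then f t else g t))
    (at t within {a..c})"
    using assms unfolding solves_def by (intro has_vector_derivative_concat) (auto simp: order.antisym)
qed

lemma solves_close:
  fixes F :: "'a::euclidean_space \<Rightarrow> 'a"
  assumes "K-lipschitz_on X F" "solves F {s..t} x" "solves F {s..t} y" "s \<le> t"
    and "\<And>r. r \<in> {s..t} \<Longrightarrow> x r \<in> X" "\<And>r. r \<in> {s..t} \<Longrightarrow> y r \<in> X"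
  shows "norm (x t - y t) \<le> exp (K * (t - s)) * norm (x s - y s)"
    "norm (x s - y s) \<le> exp (K * (t - s)) * norm (x t - y t)"
proof -
  have "((\<lambda>r. x r - y r) has_vector_derivative F (x r) - F (y r)) (at r within {s..t})" if "r \<in> {s..t}" for r
    using assms that unfolding solves_def by (intro has_vector_derivative_diff) auto
  moreover have "norm (F (x r) - F (y r)) \<le> K * norm (x r - y r)" if "r \<in> {s..t}" for r
    using assms that by (intro lipschitz_on_normD[of K X]) auto
  ultimately show "norm (x t - y t) \<le> exp (K * (t - s)) * norm (x s - y s)"
    "norm (x s - y s) \<le> exp (K * (t - s)) * norm (x t - y t)"
    using gronwall[OF \<open>s \<le> t\<close>, of "\<lambda>r. x r - y r" "\<lambda>r. F (x r) - F (y r)" K] by blast+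
qed

text \<open>Banach's fixed point theorem for the Picard operator on bounded continuous functions. On
  an interval with \<open>K * (b - a) \<le> 1/2\<close> the operator halves the supremum
  distance.\<close>

lemma picard_short:
  fixes F :: "'a::euclidean_space \<Rightarrow> 'a"
  assumes F: "K-lipschitz_on UNIV F" and "a \<le> b" and small: "K * (b - a) \<le> 1/2"
  shows "\<exists>x. x a = z \<and> solves F {a..b} x"
proof -
  have K: "0 \<le> K" using F by (rule lipschitz_on_nonneg)
  have contF: "continuous_on UNIV F" by (rule lipschitz_on_continuous_on[OF F])
  \<comment> \<open>Clamping the time to \<open>{a..b}\<close> lets the integral operator act on
    functions on the whole line, which form a complete type.\<close>
  define cl where "cl t = max a (min b t)" for t :: real
  have cl: "cl t \<in> {a..b}" for t using \<open>a \<le> b\<close> by (auto simp: cl_def)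
  have cl_id: "cl t = t" if "t \<in> {a..b}" for t using that by (auto simp: cl_def)
  have cont_cl: "continuous_on UNIV cl" unfolding cl_def by (intro continuous_intros)
  define I where "I x t = integral {a..t} (\<lambda>s. F (apply_bcontfun x s))" for x :: "real \<Rightarrow>\<^sub>C 'a" and t
  have contFx: "continuous_on A (\<lambda>s. F (apply_bcontfun x s))" for A and x :: "real \<Rightarrow>\<^sub>C 'a"
    by (rule continuous_on_compose2[OF contF]) auto
  have int: "(\<lambda>s. F (apply_bcontfun x s)) integrable_on {c..d}" for c d and x :: "real \<Rightarrow>\<^sub>C 'a"
    by (rule integrable_continuous_real[OF contFx])
  have contI: "continuous_on {a..b} (I x)" for x
    unfolding I_def by (rule indefinite_integral_continuous_1[OF int])
  have cont: "continuous_on UNIV (\<lambda>t. z + I x (cl t))" for x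
    by (intro continuous_intros continuous_on_compose2[OF contI cont_cl]) (use cl in auto)
  have "bounded (I x ` {a..b})" for x
    by (intro compact_imp_bounded compact_continuous_image contI) auto
  then have bd: "\<exists>B. \<forall>t. norm (z + I x (cl t)) \<le> B" for x
    unfolding bounded_iff using cl
    by (metis (no_types, lifting) add_left_mono image_eqI norm_triangle_le)
  have bc: "(\<lambda>t. z + I x (cl t)) \<in> bcontfun" for x
    using bd[of x] cont[of x] by (auto intro: bcontfun_normI)
  define T where "T x = Bcontfun (\<lambda>t. z + I x (cl t))" for x
  have T: "apply_bcontfun (T x) t = z + I x (cl t)" for x t
    unfolding T_def by (simp add: Bcontfun_inverse[OF bc])
  have "dist (T x) (T y) \<le> 1/2 * dist x y" for x y
  proof (rule dist_bound)
    fix t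
    have ab: "a \<le> cl t" "cl t \<le> b" using cl[of t] by auto
    have "norm (I x (cl t) - I y (cl t)) = norm (integral {a..cl t} (\<lambda>s. F (apply_bcontfun x s) - F (apply_bcontfun y s)))"
      unfolding I_def by (simp add: Henstock_Kurzweil_Integration.integral_diff[OF int int])
    also have "\<dots> \<le> (K * dist x y) * (cl t - a)"
    proof (rule integral_bound)
      show "continuous_on {a..cl t} (\<lambda>s. F (apply_bcontfun x s) - F (apply_bcontfun y s))"
        by (intro continuous_intros contFx)
      fix s
      have "norm (F (apply_bcontfun x s) - F (apply_bcontfun y s)) \<le> K * norm (apply_bcontfun x s - apply_bcontfun y s)"
        using F by (rule lipschitz_on_normD) auto
      also have "\<dots> \<le> K * dist x y"
        using K dist_bounded[of x s y] by (intro mult_left_mono) (auto simp: dist_norm)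
      finally show "norm (F (apply_bcontfun x s) - F (apply_bcontfun y s)) \<le> K * dist x y" .
    qed (use ab in auto)
    also have "\<dots> = (K * (cl t - a)) * dist x y" by simp
    also have "\<dots> \<le> (1/2) * dist x y"
    proof (intro mult_right_mono)
      have "K * (cl t - a) \<le> K * (b - a)" using K ab by (intro mult_left_mono) auto
      then show "K * (cl t - a) \<le> 1/2" using small by simp
    qed auto
    finally show "dist (apply_bcontfun (T x) t) (apply_bcontfun (T y) t) \<le> 1/2 * dist x y"
      by (simp add: T dist_norm)
  qed
  then have "\<exists>!x. T x = x"
    using banach_fix_type[of "1/2" T] by auto
  then obtain x where x: "T x = x" by auto
  have xe: "apply_bcontfun x t = z + I x (cl t)" for t using T[of x t] x by simp
  show ?thesis
  proof (intro exI conjI)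
    show "apply_bcontfun x a = z"
      using xe[of a] cl_id[of a] \<open>a \<le> b\<close> by (simp add: I_def)
    show "solves F {a..b} (apply_bcontfun x)"
      unfolding solves_def
    proof
      fix t assume t: "t \<in> {a..b}"
      have "(I x has_vector_derivative F (apply_bcontfun x t)) (at t within {a..b})"
        unfolding I_def by (rule integral_has_vector_derivative[OF contFx t])
      then have "((\<lambda>t. z + I x t) has_vector_derivative F (apply_bcontfun x t)) (at t within {a..b})"
        by (auto intro!: derivative_eq_intros)
      then show "(apply_bcontfun x has_vector_derivative F (apply_bcontfun x t)) (at t within {a..b})"
        by (rule has_vector_derivative_transform[rotated -1]) (use t xe cl_id in auto)
    qed
  qed
qed

lemma picard:
  fixes F :: "'a::euclidean_space \<Rightarrow> 'a"
  assumes F: "K-lipschitz_on UNIV F" and "a \<le> b"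
  shows "\<exists>x. x a = z \<and> solves F {a..b} x"
proof -
  have K: "0 \<le> K" using F by (rule lipschitz_on_nonneg)
  have "\<forall>z. \<exists>x. x a = z \<and> solves F {a..b} x"
    using \<open>a \<le> b\<close>
  proof (induction rule: Bolzano)
    case (trans a b c)
    show ?case
    proof
      fix z
      obtain x where x: "x a = z" "solves F {a..b} x" using trans by blast
      obtain y where y: "y b = x b" "solves F {b..c} y" using trans by blast
      show "\<exists>x. x a = z \<and> solves F {a..c} x"
        using solves_concat[of a b c x y F] x y trans by (intro exI[of _ "\<lambda>t. if t \<le> b then x t else y t"]) auto
    qed
  next
    case (local x)
    show ?case
    \<comment> \<open>The summand 1 in the denominator covers the case \<open>K = 0\<close>.\<close>
    proof (intro exI[of _ "1 / (2 * K + 1)"] conjI allI impI)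
      show "0 < 1 / (2 * K + 1)" using K by auto
      fix a b z assume ab: "a \<le> x \<and> x \<le> b \<and> b - a < 1 / (2 * K + 1)"
      have "K * (b - a) \<le> K * (1 / (2 * K + 1))" using ab K by (intro mult_left_mono) auto
      also have "\<dots> \<le> 1/2" using K by (auto simp: field_simps)
      finally show "\<exists>x. x a = z \<and> solves F {a..b} x"
        using picard_short[OF F, of a b z] ab by auto
    qed
  qed
  then show ?thesis by blast
qed

section \<open>Smooth functions\<close>

text \<open>In contrast to \<open>smooth_on\<close>, which asks for local extensions, this is
  smoothness on the set itself. It is the property of the extensions.\<close>

definition smooth_fun :: "'a::euclidean_space set \<Rightarrow> ('a \<Rightarrow> 'b::real_normed_vector) \<Rightarrow> bool" where
  "smooth_fun U F \<longleftrightarrow> (\<forall>k. Ck_on k U F)"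

lemma smooth_funD:
  assumes "smooth_fun U F"
  shows "continuous_on U F" "x \<in> U \<Longrightarrow> (F has_derivative frechet_derivative F (at x)) (at x)"
    "smooth_fun U (\<lambda>x. frechet_derivative F (at x) v)"
proof -
  have *: "Ck_on k U F" for k using assms by (simp add: smooth_fun_def)
  show "continuous_on U F" using *[of 0] by simp
  show "x \<in> U \<Longrightarrow> (F has_derivative frechet_derivative F (at x)) (at x)"
    using *[of "Suc 0"] by (simp add: frechet_derivative_works[symmetric])
  show "smooth_fun U (\<lambda>x. frechet_derivative F (at x) v)"
    unfolding smooth_fun_def using *[of "Suc k" for k] by simp
qed

text \<open>\<open>Ck_on\<close> controls the derivative in each fixed direction separately. In
  finite dimension, bounds in the basis directions give one that is uniform in the direction
  \<open>d\<close>.\<close>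

lemma norm_basis_expansion_le:
  fixes f :: "'a::euclidean_space \<Rightarrow> 'b::real_normed_vector"
  assumes "linear f" "\<And>i. i \<in> Basis \<Longrightarrow> norm (f i) \<le> e"
  shows "norm (f d) \<le> real DIM('a) * e * norm d"
proof -
  have "f d = f (\<Sum>i\<in>Basis. (d \<bullet> i) *\<^sub>R i)" by (simp add: euclidean_representation)
  also have "\<dots> = (\<Sum>i\<in>Basis. (d \<bullet> i) *\<^sub>R f i)"
    using assms(1) by (simp add: linear_sum linear_scale)
  also have "norm \<dots> \<le> (\<Sum>i\<in>(Basis::'a set). norm d * e)"
    by (rule sum_norm_le) (auto intro!: mult_mono assms(2) Basis_le_norm)
  finally show ?thesis by (simp add: mult_ac)
qed

lemma smooth_fun_bounded:
  fixes F :: "'a::euclidean_space \<Rightarrow> 'b::real_normed_vector"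
  assumes "smooth_fun U F" "cball x r \<subseteq> U"
  shows "\<exists>M\<ge>0. \<forall>y\<in>cball x r. norm (F y) \<le> M"
proof -
  have "bounded (F ` cball x r)"
    by (intro compact_imp_bounded compact_continuous_image continuous_on_subset[OF smooth_funD(1)[OF assms(1)] assms(2)]) auto
  then obtain M where "\<forall>y\<in>cball x r. norm (F y) \<le> M" unfolding bounded_iff by auto
  then show ?thesis by (intro exI[of _ "max 0 M"]) (auto simp: max.coboundedI2)
qed

text \<open>For bounds that persist when the constant grows, the sum of the absolute values of
  finitely many constants serves all indices at once.\<close>

lemma common_bound:
  fixes P :: "'i \<Rightarrow> real \<Rightarrow> bool"
  assumes "finite I" "\<And>i. i \<in> I \<Longrightarrow> \<exists>M. P i M" "\<And>i M M'. P i M \<Longrightarrow> M \<le> M' \<Longrightarrow> P i M'"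
  shows "\<exists>M. \<forall>i\<in>I. P i M"
proof -
  have "\<forall>i\<in>I. \<exists>M. P i M" using assms(2) by blast
  then obtain M where M: "\<forall>i\<in>I. P i (M i)" by (rule bchoice[THEN exE])
  have "M i \<le> (\<Sum>i\<in>I. \<bar>M i\<bar>)" if "i \<in> I" for i
    using member_le_sum[OF that, of "\<lambda>i. \<bar>M i\<bar>"] assms(1) abs_ge_self[of "M i"] by force
  then show ?thesis using M assms(3) by blast
qed

lemma smooth_fun_deriv_bounded:
  fixes F :: "'a::euclidean_space \<Rightarrow> 'b::real_normed_vector"
  assumes "smooth_fun U F" "cball x r \<subseteq> U"
  shows "\<exists>M\<ge>0. \<forall>y\<in>cball x r. \<forall>d. norm (frechet_derivative F (at y) d) \<le> M * norm d"
proof -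
  have "\<exists>M. \<forall>i\<in>(Basis::'a set). \<forall>y\<in>cball x r. norm (frechet_derivative F (at y) i) \<le> M"
  proof (rule common_bound)
    show "\<exists>M. \<forall>y\<in>cball x r. norm (frechet_derivative F (at y) i) \<le> M" for i
      using smooth_fun_bounded[OF smooth_funD(3)[OF assms(1)] assms(2)] by blast
  qed (auto intro: order_trans)
  then obtain M where M: "\<And>i y. i \<in> Basis \<Longrightarrow> y \<in> cball x r \<Longrightarrow> norm (frechet_derivative F (at y) i) \<le> M" by blast
  have lin: "linear (frechet_derivative F (at y))" if "y \<in> cball x r" for y
    using smooth_funD(2)[OF assms(1)] that assms(2) has_derivative_linear by blast
  show ?thesis
  proof (intro exI[of _ "\<bar>real DIM('a) * M\<bar>"] conjI ballI allI)
    fix y d assume y: "y \<in> cball x r"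
    have "norm (frechet_derivative F (at y) d) \<le> (real DIM('a) * M) * norm d"
      by (rule norm_basis_expansion_le[OF lin[OF y] M[OF _ y]])
    also have "\<dots> \<le> \<bar>real DIM('a) * M\<bar> * norm d" by (intro mult_right_mono) auto
    finally show "norm (frechet_derivative F (at y) d) \<le> \<bar>real DIM('a) * M\<bar> * norm d" .
  qed auto
qed

lemma smooth_fun_lipschitz:
  fixes F :: "'a::euclidean_space \<Rightarrow> 'b::real_normed_vector"
  assumes "smooth_fun U F" "cball x r \<subseteq> U"
  shows "\<exists>M\<ge>0. \<forall>y\<in>cball x r. \<forall>z\<in>cball x r. norm (F y - F z) \<le> M * norm (y - z)"
proof -
  obtain M where M: "M \<ge> 0" "\<forall>y\<in>cball x r. \<forall>d. norm (frechet_derivative F (at y) d) \<le> M * norm d"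
    using smooth_fun_deriv_bounded[OF assms] by auto
  have "norm (F y - F z) \<le> M * norm (y - z)" if "y \<in> cball x r" "z \<in> cball x r" for y z
  proof (rule differentiable_bound[OF convex_cball, where f' = "\<lambda>y. frechet_derivative F (at y)"])
    fix w assume w: "w \<in> cball x r"
    show "(F has_derivative frechet_derivative F (at w)) (at w within cball x r)"
      by (rule has_derivative_at_withinI[OF smooth_funD(2)[OF assms(1) subsetD[OF assms(2) w]]])
    show "onorm (frechet_derivative F (at w)) \<le> M" using M w by (intro onorm_le) auto
  qed (use that in auto)
  then show ?thesis using M by auto
qed

lemma smooth_fun_deriv_lipschitz:
  fixes F :: "'a::euclidean_space \<Rightarrow> 'b::real_normed_vector"
  assumes "smooth_fun U F" "cball x r \<subseteq> U"
  shows "\<exists>M\<ge>0. \<forall>y\<in>cball x r. \<forall>z\<in>cball x r. \<forall>d.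
    norm (frechet_derivative F (at y) d - frechet_derivative F (at z) d) \<le> M * norm (y - z) * norm d"
proof -
  have "\<exists>M. \<forall>i\<in>(Basis::'a set). \<forall>y\<in>cball x r. \<forall>z\<in>cball x r.
     norm (frechet_derivative F (at y) i - frechet_derivative F (at z) i) \<le> M * norm (y - z)"
  proof (rule common_bound)
    fix i :: 'a
    show "\<exists>M. \<forall>y\<in>cball x r. \<forall>z\<in>cball x r.
     norm (frechet_derivative F (at y) i - frechet_derivative F (at z) i) \<le> M * norm (y - z)"
      using smooth_fun_lipschitz[OF smooth_funD(3)[OF assms(1)] assms(2)] by blast
  next
    fix i :: 'a and M M' :: real
    assume M: "\<forall>y\<in>cball x r. \<forall>z\<in>cball x r. norm (frechet_derivative F (at y) i - frechet_derivative F (at z) i) \<le> M * norm (y - z)"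
      and "M \<le> M'"
    then have "M * norm (y - z) \<le> M' * norm (y - z)" for y z :: 'a by (intro mult_right_mono) auto
    then show "\<forall>y\<in>cball x r. \<forall>z\<in>cball x r. norm (frechet_derivative F (at y) i - frechet_derivative F (at z) i) \<le> M' * norm (y - z)"
      using M by (blast intro: order_trans)
  qed auto
  then obtain M where M: "\<And>i y z. i \<in> Basis \<Longrightarrow> y \<in> cball x r \<Longrightarrow> z \<in> cball x r \<Longrightarrow>
     norm (frechet_derivative F (at y) i - frechet_derivative F (at z) i) \<le> M * norm (y - z)" by blast
  have lin: "linear (frechet_derivative F (at y))" if "y \<in> cball x r" for y
    using smooth_funD(2)[OF assms(1)] that assms(2) has_derivative_linear by blast
  show ?thesis
  proof (intro exI[of _ "\<bar>real DIM('a) * M\<bar>"] conjI ballI allI)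
    fix y z d assume y: "y \<in> cball x r" "z \<in> cball x r"
    have "norm (frechet_derivative F (at y) d - frechet_derivative F (at z) d) \<le> real DIM('a) * (M * norm (y - z)) * norm d"
      using norm_basis_expansion_le[OF linear_compose_sub[OF lin[OF y(1)] lin[OF y(2)]] M[OF _ y]] .
    also have "\<dots> = (real DIM('a) * M) * (norm (y - z) * norm d)" by simp
    also have "\<dots> \<le> \<bar>real DIM('a) * M\<bar> * (norm (y - z) * norm d)" by (intro mult_right_mono) auto
    finally show "norm (frechet_derivative F (at y) d - frechet_derivative F (at z) d) \<le> \<bar>real DIM('a) * M\<bar> * norm (y - z) * norm d"
      by (simp add: mult.assoc)
  qed auto
qed

text \<open>Along the segment from \<open>z\<close> to \<open>y\<close> the derivative differs from
  its value at \<open>z\<close> by at most \<open>M * norm (y - z)\<close>, being Lipschitz; the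
  mean value inequality turns this into a quadratic remainder.\<close>

lemma smooth_fun_taylor:
  fixes F :: "'a::euclidean_space \<Rightarrow> 'b::real_normed_vector"
  assumes "smooth_fun U F" "cball x r \<subseteq> U"
  shows "\<exists>M\<ge>0. \<forall>y\<in>cball x r. \<forall>z\<in>cball x r.
    norm (F y - F z - frechet_derivative F (at z) (y - z)) \<le> M * (norm (y - z))\<^sup>2"
proof -
  obtain M where M: "M \<ge> 0" "\<forall>y\<in>cball x r. \<forall>z\<in>cball x r. \<forall>d.
    norm (frechet_derivative F (at y) d - frechet_derivative F (at z) d) \<le> M * norm (y - z) * norm d"
    using smooth_fun_deriv_lipschitz[OF assms] by auto
  have "norm (F y - F z - frechet_derivative F (at z) (y - z)) \<le> M * (norm (y - z))\<^sup>2"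
    if yz: "y \<in> cball x r" "z \<in> cball x r" for y z
  proof -
    have "norm (F y - F z - frechet_derivative F (at z) (y - z)) \<le> norm (y - z) * (M * norm (y - z))"
    proof (rule differentiable_bound_linearization[where S = "closed_segment z y" and f' = "\<lambda>w. frechet_derivative F (at w)"])
      fix w assume w: "w \<in> closed_segment z y"
      then have wc: "w \<in> cball x r" using yz convex_cball[of x r] by (meson convex_contains_segment subsetD)
      show "(F has_derivative frechet_derivative F (at w)) (at w within closed_segment z y)"
        by (rule has_derivative_at_withinI[OF smooth_funD(2)[OF assms(1) subsetD[OF assms(2) wc]]])
      have wn: "norm (w - z) \<le> norm (y - z)" using w
        by (metis dist_in_closed_segment dist_norm norm_minus_commute)
      show "onorm (frechet_derivative F (at w) - frechet_derivative F (at z)) \<le> M * norm (y - z)"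
        unfolding fun_diff_def
      proof (rule onorm_le)
        fix d
        have "norm (frechet_derivative F (at w) d - frechet_derivative F (at z) d) \<le> M * norm (w - z) * norm d"
          using M wc yz by blast
        also have "\<dots> \<le> M * norm (y - z) * norm d"
          using M(1) wn by (intro mult_right_mono mult_left_mono) auto
        finally show "norm (frechet_derivative F (at w) d - frechet_derivative F (at z) d) \<le> M * norm (y - z) * norm d" .
      qed
    next
      fix u :: real assume "u \<in> {0..1}"
      then show "z + u *\<^sub>R (y - z) \<in> closed_segment z y"
        unfolding closed_segment_def by (auto intro!: exI[of _ u] simp: algebra_simps)
    qed auto
    then show ?thesis by (simp add: power2_eq_square mult_ac)
  qed
  then show ?thesis using M by auto
qed

text \<open>The second difference quotient of \<open>F\<close> in the directions \<open>a\<close>, \<open>b\<close> tends to \<open>D (D F b) a\<close>; as it is symmetric in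
  \<open>a\<close> and \<open>b\<close>, so is the limit.\<close>

lemma second_difference:
  fixes F :: "'a::euclidean_space \<Rightarrow> 'b::real_normed_vector"
  assumes F: "smooth_fun U F" and U: "open U" "x \<in> U" and "e > 0"
  shows "\<exists>t0>0. \<forall>t. 0 < t \<and> t < t0 \<longrightarrow>
    norm (F (x + t *\<^sub>R a + t *\<^sub>R b) - F (x + t *\<^sub>R a) - F (x + t *\<^sub>R b) + F x
      - t\<^sup>2 *\<^sub>R frechet_derivative (\<lambda>y. frechet_derivative F (at y) a) (at x) b) \<le> t\<^sup>2 * e"
proof -
  define L where "L = frechet_derivative (\<lambda>y. frechet_derivative F (at y) a) (at x)"
  have L: "((\<lambda>y. frechet_derivative F (at y) a) has_derivative L) (at x)"
    unfolding L_def by (rule smooth_funD(2)[OF smooth_funD(3)[OF F] U(2)])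
  have linL: "linear L" using L by (rule has_derivative_linear)
  \<comment> \<open>\<open>t * N\<close> will bound the sum of the distances from \<open>x\<close>
    of the two points at which the derivative is linearized, for steps up to \<open>t\<close>. The
    summand 1 keeps \<open>N\<close> positive when \<open>a\<close> and \<open>b\<close>
    vanish.\<close>
  define N where "N = 2 * norm a + norm b + 1"
  have N: "N > 0" unfolding N_def by (intro add_nonneg_pos) auto
  have "e / N > 0" using \<open>e > 0\<close> N by auto
  then obtain d1 where d1: "d1 > 0" "\<And>y. norm (y - x) < d1 \<Longrightarrow>
      norm (frechet_derivative F (at y) a - frechet_derivative F (at x) a - L (y - x)) \<le> e / N * norm (y - x)"
    using L unfolding has_derivative_at_alt by metis
  obtain d2 where d2: "d2 > 0" "ball x d2 \<subseteq> U" using U by (meson openE)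
  define d where "d = min d1 d2"
  have d: "d > 0" using d1 d2 by (auto simp: d_def)
  show ?thesis
  proof (intro exI[of _ "d / N"] conjI allI impI)
    show "d / N > 0" using d N by auto
    fix t assume t: "0 < t \<and> t < d / N"
    then have tN: "t * N < d" using N by (auto simp: field_simps)
    have near: "norm (u *\<^sub>R a + s *\<^sub>R b) < d" "norm (u *\<^sub>R a + s *\<^sub>R b) + norm (u *\<^sub>R a) \<le> t * N"
      if "u \<in> {0..t}" "s \<in> {0..t}" for u s
    proof -
      have "norm (u *\<^sub>R a + s *\<^sub>R b) \<le> u * norm a + s * norm b"
        by (rule norm_triangle_le) (use that in auto)
      moreover have "u * norm a \<le> t * norm a" "s * norm b \<le> t * norm b"
        using that by (auto intro!: mult_right_mono)
      ultimately show "norm (u *\<^sub>R a + s *\<^sub>R b) + norm (u *\<^sub>R a) \<le> t * N"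
        using that t by (auto simp: N_def algebra_simps)
      then show "norm (u *\<^sub>R a + s *\<^sub>R b) < d"
        using tN norm_ge_zero[of "u *\<^sub>R a"] by linarith
    qed
    \<comment> \<open>Between \<open>u = 0\<close> and \<open>u = t\<close> this function increases
      by the second difference minus \<open>t\<^sup>2 *\<^sub>R L b\<close>, so a bound
      \<open>t * e\<close> on its derivative suffices.\<close>
    define f where "f u = F (x + u *\<^sub>R a + t *\<^sub>R b) - F (x + u *\<^sub>R a) - (u * t) *\<^sub>R L b" for u
    define f' where "f' u = (\<lambda>h. h *\<^sub>R (frechet_derivative F (at (x + u *\<^sub>R a + t *\<^sub>R b)) a
      - frechet_derivative F (at (x + u *\<^sub>R a)) a - t *\<^sub>R L b))" for u
    have inU: "x + u *\<^sub>R a + s *\<^sub>R b \<in> U" if "u \<in> {0..t}" "s \<in> {0..t}" for u s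
      using near(1)[OF that] d2 by (auto simp: dist_norm d_def norm_minus_commute algebra_simps subset_iff)
    have "norm (f t - f 0) \<le> (t * e) * norm (t - 0)"
    proof (rule differentiable_bound[where f' = f' and S = "{0..t}"])
      fix u assume u: "u \<in> {0..t}"
      have A: "((\<lambda>u. F (x + u *\<^sub>R a + s *\<^sub>R b)) has_derivative
        (\<lambda>h. frechet_derivative F (at (x + u *\<^sub>R a + s *\<^sub>R b)) (h *\<^sub>R a))) (at u within {0..t})"
        if s: "s \<in> {0..t}" for s
      proof (rule has_derivative_compose[where f = "\<lambda>u. x + u *\<^sub>R a + s *\<^sub>R b"])
        show "((\<lambda>u. x + u *\<^sub>R a + s *\<^sub>R b) has_derivative (\<lambda>h. h *\<^sub>R a)) (at u within {0..t})"
          by (auto intro!: derivative_eq_intros)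
      qed (rule smooth_funD(2)[OF F inU[OF u s]])
      have lin: "linear (frechet_derivative F (at (x + u *\<^sub>R a + s *\<^sub>R b)))" if "s \<in> {0..t}" for s
        using smooth_funD(2)[OF F inU[OF u that]] by (rule has_derivative_linear)
      have t0: "t \<in> {0..t}" "0 \<in> {0..t}" using t by auto
      show "(f has_derivative f' u) (at u within {0..t})"
        unfolding f_def[abs_def] f'_def
        using A[OF t0(1)] A[OF t0(2)] lin[OF t0(1)] lin[OF t0(2)]
        by (auto intro!: derivative_eq_intros simp: linear_scale algebra_simps)
      have y: "norm (u *\<^sub>R a + t *\<^sub>R b) < d" "norm (u *\<^sub>R a) < d" "norm (u *\<^sub>R a + t *\<^sub>R b) + norm (u *\<^sub>R a) \<le> t * N"
        using near[OF u t0(1)] near(1)[OF u t0(2)] by auto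
      define E where "E y = frechet_derivative F (at y) a - frechet_derivative F (at x) a - L (y - x)" for y
      have E1: "norm (E (x + u *\<^sub>R a + t *\<^sub>R b)) \<le> e / N * norm (u *\<^sub>R a + t *\<^sub>R b)"
        using d1(2)[of "x + u *\<^sub>R a + t *\<^sub>R b"] y by (auto simp: E_def d_def algebra_simps)
      have E2: "norm (E (x + u *\<^sub>R a)) \<le> e / N * norm (u *\<^sub>R a)"
        using d1(2)[of "x + u *\<^sub>R a"] y by (auto simp: E_def d_def algebra_simps)
      have "frechet_derivative F (at (x + u *\<^sub>R a + t *\<^sub>R b)) a - frechet_derivative F (at (x + u *\<^sub>R a)) a - t *\<^sub>R L b
         = E (x + u *\<^sub>R a + t *\<^sub>R b) - E (x + u *\<^sub>R a)"
        by (simp add: E_def linear_add[OF linL] linear_diff[OF linL] linear_scale[OF linL] algebra_simps)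
      also have "norm \<dots> \<le> e / N * norm (u *\<^sub>R a + t *\<^sub>R b) + e / N * norm (u *\<^sub>R a)"
        using E1 E2 norm_triangle_ineq4[of "E (x + u *\<^sub>R a + t *\<^sub>R b)" "E (x + u *\<^sub>R a)"] by linarith
      also have "\<dots> = e / N * (norm (u *\<^sub>R a + t *\<^sub>R b) + norm (u *\<^sub>R a))" by (simp add: distrib_left)
      also have "\<dots> \<le> e / N * (t * N)" using y(3) \<open>e / N > 0\<close> by (intro mult_left_mono) auto
      also have "\<dots> = t * e" using N by simp
      finally have "norm (frechet_derivative F (at (x + u *\<^sub>R a + t *\<^sub>R b)) a - frechet_derivative F (at (x + u *\<^sub>R a)) a - t *\<^sub>R L b) \<le> t * e" .
      then show "onorm (f' u) \<le> t * e"
        unfolding f'_def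
        by (intro onorm_le) (auto simp: mult.commute intro!: mult_left_mono)
    qed (use t in auto)
    then show "norm (F (x + t *\<^sub>R a + t *\<^sub>R b) - F (x + t *\<^sub>R a) - F (x + t *\<^sub>R b) + F x
      - t\<^sup>2 *\<^sub>R frechet_derivative (\<lambda>y. frechet_derivative F (at y) a) (at x) b) \<le> t\<^sup>2 * e"
      using t unfolding L_def[symmetric] f_def
      by (simp add: power2_eq_square algebra_simps)
  qed
qed

lemma smooth_fun_symmetric:
  fixes F :: "'a::euclidean_space \<Rightarrow> 'b::real_normed_vector"
  assumes F: "smooth_fun U F" and U: "open U" "x \<in> U"
  shows "frechet_derivative (\<lambda>y. frechet_derivative F (at y) a) (at x) b =
    frechet_derivative (\<lambda>y. frechet_derivative F (at y) b) (at x) a" (is "?l = ?r")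
proof (rule ccontr)
  assume "?l \<noteq> ?r"
  \<comment> \<open>One third, so that two errors of size \<open>e\<close> cannot make up the
    difference of the limits: for a common \<open>t\<close> the second differences taken in the two
    orders are the same expression \<open>X\<close>.\<close>
  define e where "e = norm (?l - ?r) / 3"
  have e: "e > 0" using \<open>?l \<noteq> ?r\<close> by (simp add: e_def)
  obtain t1 where t1: "t1 > 0" "\<And>t. 0 < t \<Longrightarrow> t < t1 \<Longrightarrow>
    norm (F (x + t *\<^sub>R a + t *\<^sub>R b) - F (x + t *\<^sub>R a) - F (x + t *\<^sub>R b) + F x - t\<^sup>2 *\<^sub>R ?l) \<le> t\<^sup>2 * e"
    using second_difference[OF F U e, of a b] by blast
  obtain t2 where t2: "t2 > 0" "\<And>t. 0 < t \<Longrightarrow> t < t2 \<Longrightarrow>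
    norm (F (x + t *\<^sub>R b + t *\<^sub>R a) - F (x + t *\<^sub>R b) - F (x + t *\<^sub>R a) + F x - t\<^sup>2 *\<^sub>R ?r) \<le> t\<^sup>2 * e"
    using second_difference[OF F U e, of b a] by blast
  define t where "t = min t1 t2 / 2"
  have t: "0 < t" "t < t1" "t < t2" using t1(1) t2(1) by (auto simp: t_def)
  define X where "X = F (x + t *\<^sub>R a + t *\<^sub>R b) - F (x + t *\<^sub>R a) - F (x + t *\<^sub>R b) + F x"
  have "norm (X - t\<^sup>2 *\<^sub>R ?l) \<le> t\<^sup>2 * e" using t1(2)[OF t(1,2)] by (simp add: X_def)
  moreover have "norm (X - t\<^sup>2 *\<^sub>R ?r) \<le> t\<^sup>2 * e" using t2(2)[OF t(1,3)] by (simp add: X_def algebra_simps)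
  moreover have "norm (t\<^sup>2 *\<^sub>R (?l - ?r)) \<le> norm (X - t\<^sup>2 *\<^sub>R ?r) + norm (X - t\<^sup>2 *\<^sub>R ?l)"
    using norm_triangle_ineq4[of "X - t\<^sup>2 *\<^sub>R ?r" "X - t\<^sup>2 *\<^sub>R ?l"] by (simp add: algebra_simps)
  ultimately have "t\<^sup>2 * norm (?l - ?r) \<le> t\<^sup>2 * (2 * e)" by simp
  then have "norm (?l - ?r) \<le> 2 * e" using t(1) by simp
  then show False using e by (simp add: e_def)
qed

text \<open>Stepping from a point of a thick set in a basis direction does not leave it. This makes
  derivatives within relatively open subsets unique.\<close>

definition thick :: "'a::euclidean_space set \<Rightarrow> bool" where
  "thick H \<longleftrightarrow> (\<forall>x\<in>H. \<forall>i\<in>Basis. \<forall>d>0. x + d *\<^sub>R i \<in> H)"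

lemma thick_UNIV: "thick UNIV" by (simp add: thick_def)

lemma thick_half_space: "thick half_space"
  by (auto simp: thick_def half_space_def Basis_prod_def)

lemma convex_half_space: "convex half_space"
  by (auto simp: convex_def half_space_def)

lemma closed_half_space: "closed half_space"
  unfolding half_space_def by (intro closed_Collect_le continuous_intros)

lemma has_derivative_within_unique_thick:
  assumes "thick H" "openin (top_of_set H) S" "x \<in> S"
    and "(f has_derivative D1) (at x within S)" "(f has_derivative D2) (at x within S)"
  shows "D1 = D2"
proof (rule frechet_derivative_unique_within[OF assms(4,5)])
  fix i :: 'a and e :: real assume i: "i \<in> Basis" "e > 0"
  obtain r where r: "r > 0" "ball x r \<inter> H \<subseteq> S" "S \<subseteq> H"
    using assms(2,3) unfolding openin_contains_ball by blast
  let ?d = "min e r / 2"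
  have "x + ?d *\<^sub>R i \<in> H" using assms(1,3) r i unfolding thick_def by auto
  moreover have "x + ?d *\<^sub>R i \<in> ball x r" using i r by (auto simp: dist_norm)
  ultimately have "x + ?d *\<^sub>R i \<in> S" using r by auto
  then show "\<exists>d. 0 < \<bar>d\<bar> \<and> \<bar>d\<bar> < e \<and> x + d *\<^sub>R i \<in> S"
    using i r by (intro exI[of _ ?d]) (auto simp: min_less_iff_disj abs_if)
qed

lemma frechet_derivative_within_thick:
  assumes "thick H" "openin (top_of_set H) S" "x \<in> S" "(f has_derivative D) (at x within S)"
  shows "frechet_derivative f (at x within S) = D"
proof (rule has_derivative_within_unique_thick[OF assms(1-3) _ assms(4)])
  show "(f has_derivative frechet_derivative f (at x within S)) (at x within S)"
    using assms(4) by (auto simp: frechet_derivative_works[symmetric] intro: differentiableI)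
qed

text \<open>Derivatives are taken within the large set \<open>S\<close>, while the estimates hold on
  the smaller set \<open>B\<close>. One constant serves for value, derivative, their Lipschitz
  constants and the Taylor remainder.\<close>

definition C2_bounds :: "'a::euclidean_space set \<Rightarrow> 'a set \<Rightarrow> ('a \<Rightarrow> 'b::real_normed_vector) \<Rightarrow> real \<Rightarrow> bool" where
  "C2_bounds S B f M \<longleftrightarrow> (let D = (\<lambda>x. frechet_derivative f (at x within S)) in
    \<forall>x\<in>B. (\<forall>d. norm (D x d) \<le> M * norm d) \<and> norm (f x) \<le> M \<and>
      (\<forall>y\<in>B. norm (f x - f y) \<le> M * norm (x - y) \<and>
        (\<forall>d. norm (D x d - D y d) \<le> M * norm (x - y) * norm d) \<and>
        norm (f x - f y - D y (x - y)) \<le> M * (norm (x - y))\<^sup>2))"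

lemma C2_boundsD:
  assumes "C2_bounds S B f M" "x \<in> B" "y \<in> B"
  shows "norm (f x) \<le> M" "norm (f x - f y) \<le> M * norm (x - y)"
    "norm (frechet_derivative f (at x within S) d) \<le> M * norm d"
    "norm (frechet_derivative f (at x within S) d - frechet_derivative f (at y within S) d) \<le> M * norm (x - y) * norm d"
    "norm (f x - f y - frechet_derivative f (at y within S) (x - y)) \<le> M * (norm (x - y))\<^sup>2"
  using assms unfolding C2_bounds_def Let_def by blast+

lemma C2_bounds_mono:
  assumes "C2_bounds S B f M" "M \<le> M'" "B' \<subseteq> B"
  shows "C2_bounds S B' f M'"
proof -
  have m: "M * c \<le> M' * c" if "c \<ge> 0" for c using assms(2) that by (rule mult_right_mono)
  have m2: "M * c * e \<le> M' * c * e" if "c \<ge> 0" "e \<ge> 0" for c e using m[OF that(1)] that(2) by (rule mult_right_mono)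
  show ?thesis
    unfolding C2_bounds_def Let_def
  proof (intro ballI conjI allI)
    fix x y d assume "x \<in> B'" "y \<in> B'"
    then have xy: "x \<in> B" "y \<in> B" using assms(3) by auto
    note D = C2_boundsD[OF assms(1) xy]
    show "norm (f x) \<le> M'" using D(1) assms(2) by simp
    show "norm (f x - f y) \<le> M' * norm (x - y)" using D(2) m[of "norm (x - y)"] by simp
    show "norm (frechet_derivative f (at x within S) d) \<le> M' * norm d" for d
      using D(3)[of d] m[of "norm d"] by simp
    show "norm (frechet_derivative f (at x within S) d - frechet_derivative f (at y within S) d) \<le> M' * norm (x - y) * norm d" for d
      using D(4)[of d] m2[of "norm (x - y)" "norm d"] by simp
    show "norm (f x - f y - frechet_derivative f (at y within S) (x - y)) \<le> M' * (norm (x - y))\<^sup>2"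
      using D(5) m[of "(norm (x - y))\<^sup>2"] by simp
  qed
qed

text \<open>Everything is transferred from an extension \<open>F\<close> to a full neighborhood of
  \<open>x\<close>. The radius is half of the admissible one, so that the closed ball lies in an
  open ball on which \<open>F\<close> is smooth.\<close>

lemma smooth_on_local:
  fixes f :: "'a::euclidean_space \<Rightarrow> 'b::real_normed_vector"
  assumes "smooth_on S f" "thick H" "openin (top_of_set H) S" "x \<in> S"
  obtains r F where "r > 0" "cball x r \<inter> H \<subseteq> S" "smooth_fun (ball x (2 * r)) F"
    "\<And>y. y \<in> S \<Longrightarrow> y \<in> cball x r \<Longrightarrow> f y = F y"
    "\<And>y. y \<in> S \<Longrightarrow> y \<in> cball x r \<Longrightarrow> (f has_derivative frechet_derivative F (at y)) (at y within S)"
    "\<And>y. y \<in> S \<Longrightarrow> y \<in> cball x r \<Longrightarrow> frechet_derivative f (at y within S) = frechet_derivative F (at y)"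
proof -
  obtain U F where UF: "open U" "x \<in> U" "\<forall>k. Ck_on k U F" "\<forall>y\<in>S \<inter> U. F y = f y"
    using assms(1,4) unfolding smooth_on_def by blast
  obtain r1 where r1: "r1 > 0" "ball x r1 \<inter> H \<subseteq> S"
    using assms(3,4) unfolding openin_contains_ball by blast
  obtain r2 where r2: "r2 > 0" "ball x r2 \<subseteq> U" using UF by (meson openE)
  define r where "r = min r1 r2 / 2"
  have sub: "cball x r \<subseteq> ball x (2 * r)" "ball x (2 * r) \<subseteq> U" "cball x r \<subseteq> ball x r1" "r > 0"
    using r1 r2 by (auto simp: r_def subset_iff)
  have Ck: "Ck_on k V G" if "Ck_on k U G" "V \<subseteq> U" for k V and G :: "'a \<Rightarrow> 'b"
    using that by (induction k arbitrary: G) (auto intro: continuous_on_subset)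
  have sm: "smooth_fun U F" "smooth_fun (ball x (2 * r)) F"
    using UF Ck sub by (auto simp: smooth_fun_def)
  have der: "(f has_derivative frechet_derivative F (at y)) (at y within S)" if "y \<in> S" "y \<in> cball x r" for y
  proof -
    have "y \<in> U" using that sub by auto
    then obtain d where d: "d > 0" "ball y d \<subseteq> U" using UF(1) by (meson openE)
    show ?thesis
    proof (rule has_derivative_transform_within[OF _ d(1) that(1)])
      show "(F has_derivative frechet_derivative F (at y)) (at y within S)"
        using smooth_funD(2)[OF sm(1) \<open>y \<in> U\<close>] by (rule has_derivative_at_withinI)
      show "F z = f z" if "z \<in> S" "dist z y < d" for z using UF d that by (auto simp: dist_commute subset_iff)
    qed
  qed
  show thesis
  proof (rule that)
    show "cball x r \<inter> H \<subseteq> S" using sub r1 by auto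
    show "f y = F y" if "y \<in> S" "y \<in> cball x r" for y
      using UF(4) that sub by (metis IntI subsetD)
    show "\<And>y. y \<in> S \<Longrightarrow> y \<in> cball x r \<Longrightarrow> frechet_derivative f (at y within S) = frechet_derivative F (at y)"
      using frechet_derivative_within_thick[OF assms(2,3)] der by blast
  qed (use sub sm der in auto)
qed

lemma smooth_on_has_derivative:
  fixes f :: "'a::euclidean_space \<Rightarrow> 'b::real_normed_vector"
  assumes "smooth_on S f" "thick H" "openin (top_of_set H) S" "x \<in> S"
  shows "(f has_derivative frechet_derivative f (at x within S)) (at x within S)"
proof -
  obtain r F where F: "r > 0"
    "\<And>y. y \<in> S \<Longrightarrow> y \<in> cball x r \<Longrightarrow> (f has_derivative frechet_derivative F (at y)) (at y within S)"
    "\<And>y. y \<in> S \<Longrightarrow> y \<in> cball x r \<Longrightarrow> frechet_derivative f (at y within S) = frechet_derivative F (at y)"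
    by (rule smooth_on_local[OF assms]) blast
  have "x \<in> cball x r" using F(1) by simp
  then show ?thesis using F(2,3)[OF assms(4)] by simp
qed

lemma frechet_derivative_smooth_on_open:
  fixes f :: "'a::euclidean_space \<Rightarrow> 'b::real_normed_vector"
  assumes "smooth_on S f" "open S" "x \<in> S"
  shows "(f has_derivative frechet_derivative f (at x)) (at x)"
  using smooth_on_has_derivative[OF assms(1) thick_UNIV _ assms(3)] assms(2) by (simp add: at_within_open[OF assms(3,2)])

text \<open>The estimates are those of the extension on a full ball, which is compact and convex,
  restricted to the intersection with \<open>H\<close>, where value and derivative agree with those
  of the extension.\<close>

lemma smooth_on_C2_bounds:
  fixes f :: "'a::euclidean_space \<Rightarrow> 'b::real_normed_vector"
  assumes "smooth_on S f" "thick H" "openin (top_of_set H) S" "x \<in> S"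
  shows "\<exists>r>0. \<exists>M\<ge>0. cball x r \<inter> H \<subseteq> S \<and> C2_bounds S (cball x r \<inter> H) f M"
proof -
  obtain r F where F: "r > 0" "cball x r \<inter> H \<subseteq> S" "smooth_fun (ball x (2 * r)) F"
    "\<And>y. y \<in> S \<Longrightarrow> y \<in> cball x r \<Longrightarrow> f y = F y"
    "\<And>y. y \<in> S \<Longrightarrow> y \<in> cball x r \<Longrightarrow> frechet_derivative f (at y within S) = frechet_derivative F (at y)"
    by (rule smooth_on_local[OF assms]) blast
  have sub: "cball x r \<subseteq> ball x (2 * r)" using F(1) by auto
  obtain M1 where M1: "M1 \<ge> 0" "\<forall>y\<in>cball x r. norm (F y) \<le> M1"
    using smooth_fun_bounded[OF F(3) sub] by auto
  obtain M2 where M2: "M2 \<ge> 0" "\<forall>y\<in>cball x r. \<forall>d. norm (frechet_derivative F (at y) d) \<le> M2 * norm d"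
    using smooth_fun_deriv_bounded[OF F(3) sub] by auto
  obtain M3 where M3: "M3 \<ge> 0" "\<forall>y\<in>cball x r. \<forall>z\<in>cball x r. norm (F y - F z) \<le> M3 * norm (y - z)"
    using smooth_fun_lipschitz[OF F(3) sub] by auto
  obtain M4 where M4: "M4 \<ge> 0" "\<forall>y\<in>cball x r. \<forall>z\<in>cball x r. \<forall>d.
    norm (frechet_derivative F (at y) d - frechet_derivative F (at z) d) \<le> M4 * norm (y - z) * norm d"
    using smooth_fun_deriv_lipschitz[OF F(3) sub] by auto
  obtain M5 where M5: "M5 \<ge> 0" "\<forall>y\<in>cball x r. \<forall>z\<in>cball x r.
    norm (F y - F z - frechet_derivative F (at z) (y - z)) \<le> M5 * (norm (y - z))\<^sup>2"
    using smooth_fun_taylor[OF F(3) sub] by auto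
  define M where "M = M1 + M2 + M3 + M4 + M5"
  have MM: "M1 \<le> M" "M2 \<le> M" "M3 \<le> M" "M4 \<le> M" "M5 \<le> M" "M \<ge> 0"
    using M1(1) M2(1) M3(1) M4(1) M5(1) by (auto simp: M_def)
  have m: "A * c \<le> M * c" if "c \<ge> 0" "A \<le> M" for c A using that by (auto intro: mult_right_mono)
  have m2: "A * c * e \<le> M * c * e" if "c \<ge> 0" "e \<ge> 0" "A \<le> M" for c e A
    using m[OF that(1,3)] that(2) by (rule mult_right_mono)
  have "C2_bounds S (cball x r \<inter> H) f M"
    unfolding C2_bounds_def Let_def
  proof (intro ballI conjI allI)
    fix y d assume y: "y \<in> cball x r \<inter> H"
    then have yS: "y \<in> S" "y \<in> cball x r" using F(2) by auto
    show "norm (frechet_derivative f (at y within S) d) \<le> M * norm d"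
      using M2(2)[rule_format, OF yS(2), of d] m[OF norm_ge_zero MM(2), of d] F(5)[OF yS] by simp
    show "norm (f y) \<le> M" using M1 MM(1) yS F(4)[OF yS] by force
    fix z assume z: "z \<in> cball x r \<inter> H"
    then have zS: "z \<in> S" "z \<in> cball x r" using F(2) by auto
    show "norm (f y - f z) \<le> M * norm (y - z)"
      using M3(2)[rule_format, OF yS(2) zS(2)] m[OF norm_ge_zero MM(3), of "y - z"] F(4)[OF yS] F(4)[OF zS] by simp
    show "norm (frechet_derivative f (at y within S) d - frechet_derivative f (at z within S) d) \<le> M * norm (y - z) * norm d" for d
      using M4(2)[rule_format, OF yS(2) zS(2), of d] m2[OF norm_ge_zero norm_ge_zero MM(4), of "y - z" d] F(5)[OF yS] F(5)[OF zS] by simp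
    show "norm (f y - f z - frechet_derivative f (at z within S) (y - z)) \<le> M * (norm (y - z))\<^sup>2"
      using M5(2)[rule_format, OF yS(2) zS(2)] m[OF zero_le_power2 MM(5), of "norm (y - z)"] F(5)[OF zS] F(4)[OF yS] F(4)[OF zS] by simp
  qed
  then show ?thesis using F MM by blast
qed

text \<open>\<open>Q\<close> is the second derivative of a local extension, symmetric by
  \<open>smooth_fun_symmetric\<close>. For transition maps it is the inhomogeneous term in the
  transformation law of the Christoffel symbols.\<close>

lemma smooth_on_second_derivative:
  fixes f :: "'a::euclidean_space \<Rightarrow> 'b::real_normed_vector"
  assumes "smooth_on S f" "thick H" "openin (top_of_set H) S" "x \<in> S"
  obtains Q where
    "\<And>d. ((\<lambda>y. frechet_derivative f (at y within S) d) has_derivative (\<lambda>e. Q e d)) (at x within S)"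
    "\<And>d e. Q e d = Q d e"
proof -
  obtain r F where F: "r > 0" "cball x r \<inter> H \<subseteq> S" "smooth_fun (ball x (2 * r)) F"
    "\<And>y. y \<in> S \<Longrightarrow> y \<in> cball x r \<Longrightarrow> f y = F y"
    "\<And>y. y \<in> S \<Longrightarrow> y \<in> cball x r \<Longrightarrow> frechet_derivative f (at y within S) = frechet_derivative F (at y)"
    by (rule smooth_on_local[OF assms]) blast
  show thesis
  proof (rule that[of "\<lambda>e d. frechet_derivative (\<lambda>y. frechet_derivative F (at y) d) (at x) e"])
    fix d :: 'a
    show "((\<lambda>y. frechet_derivative f (at y within S) d) has_derivative
      frechet_derivative (\<lambda>y. frechet_derivative F (at y) d) (at x)) (at x within S)"
    proof (rule has_derivative_transform_within[OF _ F(1) assms(4)])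
      show "((\<lambda>y. frechet_derivative F (at y) d) has_derivative
        frechet_derivative (\<lambda>y. frechet_derivative F (at y) d) (at x)) (at x within S)"
        by (rule has_derivative_at_withinI[OF smooth_funD(2)[OF smooth_funD(3)[OF F(3)]]]) (use F(1) in simp)
      show "frechet_derivative F (at y) d = frechet_derivative f (at y within S) d" if "y \<in> S" "dist y x < r" for y
        using F(5)[of y] that by (simp add: dist_commute)
    qed
  next
    fix d e :: 'a
    show "frechet_derivative (\<lambda>y. frechet_derivative F (at y) d) (at x) e = frechet_derivative (\<lambda>y. frechet_derivative F (at y) e) (at x) d"
      using smooth_fun_symmetric[OF F(3) open_ball, of x d e] F(1) by simp
  qed
qed

section \<open>Lorentzian forms\<close>

text \<open>Charts are pairs; the simplifier must not split quantifiers over them.\<close>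

declare split_paired_All [simp del] split_paired_Ex [simp del]

definition nondegenerate :: "('v::euclidean_space \<Rightarrow> 'v \<Rightarrow> real) \<Rightarrow> bool" where
  "nondegenerate B \<longleftrightarrow> (\<forall>a. (\<forall>b. B a b = 0) \<longrightarrow> a = 0)"

lemma bilinear_linear:
  "bilinear B \<Longrightarrow> linear (\<lambda>b. B a b)" "bilinear B \<Longrightarrow> linear (\<lambda>a. B a b)"
  by (simp_all add: bilinear_def)

text \<open>The map from \<open>w\<close> to the values of \<open>B w\<close> on the basis is
  injective by nondegeneracy, hence surjective by dimension. This gives the definite description in
  \<open>christoffel\<close> its meaning.\<close>

lemma nondegenerate_riesz:
  fixes B :: "'v::euclidean_space \<Rightarrow> 'v \<Rightarrow> real"
  assumes "bilinear B" "nondegenerate B" "linear \<beta>"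
  shows "\<exists>!w. \<forall>d. B w d = \<beta> d"
proof (rule ex_ex1I)
  define A where "A w = (\<Sum>i\<in>Basis. B w i *\<^sub>R i)" for w
  have ext: "f = g" if "linear f" "linear g" "\<And>i. i \<in> Basis \<Longrightarrow> f i = g i" for f g :: "'v \<Rightarrow> real"
    using linear_eq_stdbasis[OF that(1,2)] that(3) by auto
  have linA: "linear A"
    unfolding A_def using bilinear_linear(2)[OF assms(1)]
    by (intro linear_compose_sum ballI)
      (auto simp: linear_iff algebra_simps)
  have "inj A"
    unfolding linear_injective_0[OF linA]
  proof (intro allI impI)
    fix a assume "A a = 0"
    then have "B a i = 0" if "i \<in> Basis" for i
      using that by (auto simp: A_def euclidean_eq_iff[where 'a='v] inner_sum_left_Basis)
    then have "(\<lambda>b. B a b) = (\<lambda>b. 0)"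
      using ext[OF bilinear_linear(1)[OF assms(1)], of "\<lambda>b. 0"] by (auto simp: linear_iff)
    then show "a = 0" using assms(2) by (meson nondegenerate_def)
  qed
  then have "surj A" using linA by (simp add: linear_injective_imp_surjective)
  then obtain w where w: "A w = (\<Sum>i\<in>Basis. \<beta> i *\<^sub>R i)" by (metis surjD)
  have "B w i = \<beta> i" if "i \<in> Basis" for i
    using arg_cong[OF w, of "\<lambda>z. z \<bullet> i"] that by (simp add: A_def inner_sum_left_Basis)
  then have "(\<lambda>d. B w d) = \<beta>" by (intro ext bilinear_linear(1)[OF assms(1)] assms(3)) auto
  then show "\<exists>w. \<forall>d. B w d = \<beta> d" by (auto intro!: exI[of _ w] simp: fun_eq_iff)
next
  fix w w' assume "\<forall>d. B w d = \<beta> d" "\<forall>d. B w' d = \<beta> d"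
  then have "B (w - w') d = 0" for d using bilinear_lsub[OF assms(1)] by simp
  then show "w = w'" using assms(2) by (force simp: nondegenerate_def)
qed

text \<open>An injective linear map in finite dimension is bounded below. In this quantitative form
  nondegeneracy survives small changes of the form, and vectors defined by duality can be
  estimated.\<close>

lemma nondegenerate_lower_bound:
  fixes B :: "'v::euclidean_space \<Rightarrow> 'v \<Rightarrow> real"
  assumes "bilinear B" "nondegenerate B"
  shows "\<exists>K>0. \<forall>w e. (\<forall>d. \<bar>B w d\<bar> \<le> e * norm d) \<longrightarrow> norm w \<le> K * e"
proof -
  define A where "A w = (\<Sum>i\<in>Basis. B w i *\<^sub>R i)" for w
  have linA: "linear A"
    unfolding A_def using bilinear_linear(2)[OF assms(1)]
    by (intro linear_compose_sum ballI) (auto simp: linear_iff algebra_simps)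
  have "inj A"
    unfolding linear_injective_0[OF linA]
  proof (intro allI impI)
    fix a assume "A a = 0"
    then have z: "B a i = 0" if "i \<in> Basis" for i
      using that by (auto simp: A_def euclidean_eq_iff[where 'a='v] inner_sum_left_Basis)
    have "norm (B a d) \<le> real DIM('v) * 0 * norm d" for d
      by (rule norm_basis_expansion_le[OF bilinear_linear(1)[OF assms(1)]]) (use z in auto)
    then show "a = 0" using assms(2) by (simp add: nondegenerate_def)
  qed
  then obtain m where m: "m > 0" "\<And>w. m * norm w \<le> norm (A w)"
    using linear_inj_bounded_below_pos[OF linA] by auto
  show ?thesis
  proof (intro exI[of _ "real DIM('v) / m"] conjI allI impI)
    show "real DIM('v) / m > 0" using m by auto
    fix w e assume e: "\<forall>d. \<bar>B w d\<bar> \<le> e * norm d"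
    have "norm (A w) \<le> (\<Sum>i\<in>(Basis::'v set). e)"
      unfolding A_def
    proof (rule sum_norm_le)
      fix i :: 'v assume "i \<in> Basis"
      then show "norm (B w i *\<^sub>R i) \<le> e" using e[rule_format, of i] by simp
    qed
    then have "m * norm w \<le> real DIM('v) * e" using m(2)[of w] by simp
    then show "norm w \<le> real DIM('v) / m * e" using m(1) by (simp add: field_simps)
  qed
qed

lemma bilinear_basis_bound:
  fixes f :: "'v::euclidean_space \<Rightarrow> 'v \<Rightarrow> real"
  assumes "bilinear f" "\<And>i j. i \<in> Basis \<Longrightarrow> j \<in> Basis \<Longrightarrow> \<bar>f i j\<bar> \<le> e"
  shows "\<bar>f a b\<bar> \<le> (real DIM('v))\<^sup>2 * e * norm a * norm b"
proof -
  have "norm (f a j) \<le> real DIM('v) * e * norm a" if "j \<in> Basis" for j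
    by (rule norm_basis_expansion_le[OF bilinear_linear(2)[OF assms(1)]]) (use assms(2) that in auto)
  then have "norm (f a b) \<le> real DIM('v) * (real DIM('v) * e * norm a) * norm b"
    by (intro norm_basis_expansion_le[OF bilinear_linear(1)[OF assms(1)]])
  then show ?thesis by (simp add: power2_eq_square mult_ac)
qed

lemma bilinear_basis_expansion:
  fixes f :: "'v::euclidean_space \<Rightarrow> 'v \<Rightarrow> real"
  assumes "bilinear f"
  shows "f a b = (\<Sum>i\<in>Basis. \<Sum>j\<in>Basis. (a \<bullet> i) * (b \<bullet> j) * f i j)"
proof -
  have "f a b = f (\<Sum>i\<in>Basis. (a \<bullet> i) *\<^sub>R i) b" by (simp add: euclidean_representation)
  also have "\<dots> = (\<Sum>i\<in>Basis. (a \<bullet> i) * f i b)"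
    by (subst linear_sum[OF bilinear_linear(2)[OF assms]]) (simp add: bilinear_lmul[OF assms])
  also have "\<dots> = (\<Sum>i\<in>Basis. (a \<bullet> i) * f i (\<Sum>j\<in>Basis. (b \<bullet> j) *\<^sub>R j))" by (simp add: euclidean_representation)
  also have "\<dots> = (\<Sum>i\<in>Basis. (a \<bullet> i) * (\<Sum>j\<in>Basis. (b \<bullet> j) * f i j))"
    by (subst linear_sum[OF bilinear_linear(1)[OF assms]]) (simp add: bilinear_rmul[OF assms])
  finally show ?thesis by (simp add: sum_distrib_left mult.assoc)
qed

lemma bilinear_diff_fun: "bilinear f \<Longrightarrow> bilinear g \<Longrightarrow> bilinear (\<lambda>a b. f a b - g a b)"
  by (simp add: bilinear_def linear_compose_sub)

text \<open>Product rule for a form that varies with the base point. Expansion in the basis reduces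
  it to the entries \<open>H y i j\<close>, which is what smoothness of the metric provides.\<close>

lemma has_derivative_bilinear_family:
  fixes H :: "'a::real_normed_vector \<Rightarrow> 'v::euclidean_space \<Rightarrow> 'v \<Rightarrow> real"
  assumes "x \<in> S" and bil: "\<And>y. y \<in> S \<Longrightarrow> bilinear (H y)" "\<And>e. bilinear (H' e)"
    and H: "\<And>i j. i \<in> Basis \<Longrightarrow> j \<in> Basis \<Longrightarrow> ((\<lambda>y. H y i j) has_derivative (\<lambda>e. H' e i j)) (at x within S)"
    and u: "(u has_derivative u') (at x within S)" and w: "(w has_derivative w') (at x within S)"
  shows "((\<lambda>y. H y (u y) (w y)) has_derivative
    (\<lambda>e. H' e (u x) (w x) + H x (u' e) (w x) + H x (u x) (w' e))) (at x within S)"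
proof -
  have "((\<lambda>y. \<Sum>i\<in>Basis. \<Sum>j\<in>Basis. (u y \<bullet> i) * (w y \<bullet> j) * H y i j) has_derivative
    (\<lambda>e. \<Sum>i\<in>Basis. \<Sum>j\<in>Basis. (u x \<bullet> i) * (w x \<bullet> j) * H' e i j +
       ((u x \<bullet> i) * (w' e \<bullet> j) + (u' e \<bullet> i) * (w x \<bullet> j)) * H x i j)) (at x within S)"
    by (intro has_derivative_sum has_derivative_mult H has_derivative_inner_left u w)
  moreover have "(\<Sum>i\<in>Basis. \<Sum>j\<in>Basis. (u x \<bullet> i) * (w x \<bullet> j) * H' e i j +
       ((u x \<bullet> i) * (w' e \<bullet> j) + (u' e \<bullet> i) * (w x \<bullet> j)) * H x i j) =
    H' e (u x) (w x) + H x (u' e) (w x) + H x (u x) (w' e)" for e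
    unfolding bilinear_basis_expansion[OF bil(2), of e "u x" "w x"]
      bilinear_basis_expansion[OF bil(1)[OF \<open>x \<in> S\<close>], of "u' e" "w x"]
      bilinear_basis_expansion[OF bil(1)[OF \<open>x \<in> S\<close>], of "u x" "w' e"]
    by (simp add: sum.distrib distrib_right)
  ultimately have "((\<lambda>y. \<Sum>i\<in>Basis. \<Sum>j\<in>Basis. (u y \<bullet> i) * (w y \<bullet> j) * H y i j) has_derivative
    (\<lambda>e. H' e (u x) (w x) + H x (u' e) (w x) + H x (u x) (w' e))) (at x within S)" by simp
  then show ?thesis
    by (rule has_derivative_transform_within[OF _ zero_less_one \<open>x \<in> S\<close>])
      (rule bilinear_basis_expansion[OF bil(1), symmetric])
qed

lemma lorentzian_form_expand:
  assumes "lorentzian_form B"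
  obtains e E where "finite E" "e \<notin> E" "B e e = -1" "\<And>b. b \<in> E \<Longrightarrow> B e b = 0 \<and> B b b = 1"
    "\<And>a. \<exists>a0 u. a = a0 *\<^sub>R e + (\<Sum>b\<in>E. u b *\<^sub>R b)"
    "\<And>a0 u b0 w. B (a0 *\<^sub>R e + (\<Sum>b\<in>E. u b *\<^sub>R b)) (b0 *\<^sub>R e + (\<Sum>b\<in>E. w b *\<^sub>R b)) = - a0 * b0 + (\<Sum>b\<in>E. u b * w b)"
proof -
  from assms obtain e E where eE: "e \<notin> E" "finite E" "span (insert e E) = UNIV" "B e e = -1"
    "\<forall>b\<in>E. B e b = 0 \<and> B b b = 1" "\<forall>b\<in>E. \<forall>b'\<in>E. b \<noteq> b' \<longrightarrow> B b b' = 0"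
    and bil: "bilinear B" and sym: "\<And>a b. B a b = B b a"
    unfolding lorentzian_form_def by metis
  show thesis
  proof (rule that)
    fix a
    have "a \<in> span (insert e E)" using eE by simp
    then obtain k where "a - k *\<^sub>R e \<in> span E" by (auto simp: span_insert)
    then obtain u where "a - k *\<^sub>R e = (\<Sum>b\<in>E. u b *\<^sub>R b)" using span_finite[OF eE(2)] by auto
    then show "\<exists>a0 u. a = a0 *\<^sub>R e + (\<Sum>b\<in>E. u b *\<^sub>R b)" by (metis diff_add_cancel add.commute)
  next
    fix a0 u b0 w
    have sy: "B b e = 0" if "b \<in> E" for b using eE(5) that sym[of b e] by simp
    have 1: "B (\<Sum>b\<in>E. u b *\<^sub>R b) x = (\<Sum>b\<in>E. u b * B b x)" for u x
      by (subst linear_sum[OF bilinear_linear(2)[OF bil]]) (simp add: bilinear_lmul[OF bil])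
    have 2: "B x (\<Sum>b\<in>E. u b *\<^sub>R b) = (\<Sum>b\<in>E. u b * B x b)" for u x
      by (subst linear_sum[OF bilinear_linear(1)[OF bil]]) (simp add: bilinear_rmul[OF bil])
    have 3: "(\<Sum>b'\<in>E. u b' * B b' b) = u b" if "b \<in> E" for b
    proof -
      have "(\<Sum>b'\<in>E. u b' * B b' b) = (\<Sum>b'\<in>E. if b' = b then u b' else 0)"
        using that eE by (intro sum.cong) auto
      then show ?thesis using that eE(2) by simp
    qed
    show "B (a0 *\<^sub>R e + (\<Sum>b\<in>E. u b *\<^sub>R b)) (b0 *\<^sub>R e + (\<Sum>b\<in>E. w b *\<^sub>R b)) = - a0 * b0 + (\<Sum>b\<in>E. u b * w b)"
      using eE sy
      by (simp add: bilinear_ladd[OF bil] bilinear_radd[OF bil] bilinear_lmul[OF bil] bilinear_rmul[OF bil] 1 2 3 mult.commute)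
  qed (use eE in auto)
qed

lemma lorentzian_form_nondegenerate:
  assumes "lorentzian_form B"
  shows "nondegenerate B"
proof -
  obtain e E where E: "finite E" "e \<notin> E" "B e e = -1" "\<And>b. b \<in> E \<Longrightarrow> B e b = 0 \<and> B b b = 1"
    "\<And>a. \<exists>a0 u. a = a0 *\<^sub>R e + (\<Sum>b\<in>E. u b *\<^sub>R b)"
    "\<And>a0 u b0 w. B (a0 *\<^sub>R e + (\<Sum>b\<in>E. u b *\<^sub>R b)) (b0 *\<^sub>R e + (\<Sum>b\<in>E. w b *\<^sub>R b)) = - a0 * b0 + (\<Sum>b\<in>E. u b * w b)"
    by (rule lorentzian_form_expand[OF assms]) blast
  show ?thesis
    unfolding nondegenerate_def
  proof (intro allI impI)
    fix a assume z: "\<forall>b. B a b = 0"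
    obtain a0 u where a: "a = a0 *\<^sub>R e + (\<Sum>b\<in>E. u b *\<^sub>R b)" using E(5) by blast
    \<comment> \<open>Testing against \<open>a\<close> with its time component reversed turns the
      Minkowski form into a sum of squares.\<close>
    have "B a ((-a0) *\<^sub>R e + (\<Sum>b\<in>E. u b *\<^sub>R b)) = 0" using z by blast
    then have s: "a0 * a0 + (\<Sum>b\<in>E. u b * u b) = 0" unfolding a E(6) by simp
    moreover have "0 \<le> (\<Sum>b\<in>E. u b * u b)" by (intro sum_nonneg) auto
    ultimately have "a0 * a0 = 0" "(\<Sum>b\<in>E. u b * u b) = 0"
      by (smt (verit) zero_le_square)+
    then have "a0 = 0" "\<forall>b\<in>E. u b = 0" using E(1) by (auto simp: sum_nonneg_eq_0_iff)
    then show "a = 0" using a by simp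
  qed
qed

text \<open>For two timelike vectors the product of the time components exceeds the spatial inner
  product in absolute value, by Cauchy-Schwarz, so the two cannot cancel.\<close>

lemma lorentzian_form_timelike:
  assumes "lorentzian_form B" "B a a < 0" "B b b < 0"
  shows "B a b \<noteq> 0"
proof
  assume 0: "B a b = 0"
  obtain e E where E: "finite E" "e \<notin> E" "B e e = -1" "\<And>b. b \<in> E \<Longrightarrow> B e b = 0 \<and> B b b = 1"
    "\<And>a. \<exists>a0 u. a = a0 *\<^sub>R e + (\<Sum>b\<in>E. u b *\<^sub>R b)"
    "\<And>a0 u b0 w. B (a0 *\<^sub>R e + (\<Sum>b\<in>E. u b *\<^sub>R b)) (b0 *\<^sub>R e + (\<Sum>b\<in>E. w b *\<^sub>R b)) = - a0 * b0 + (\<Sum>b\<in>E. u b * w b)"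
    by (rule lorentzian_form_expand[OF assms(1)]) blast
  obtain a0 u where a: "a = a0 *\<^sub>R e + (\<Sum>b\<in>E. u b *\<^sub>R b)" using E(5) by blast
  obtain b0 w where b: "b = b0 *\<^sub>R e + (\<Sum>b\<in>E. w b *\<^sub>R b)" using E(5) by blast
  have A: "(\<Sum>b\<in>E. u b * u b) < a0 * a0" using assms(2) unfolding a E(6) by simp
  have B: "(\<Sum>b\<in>E. w b * w b) < b0 * b0" using assms(3) unfolding b E(6) by simp
  have C: "(\<Sum>b\<in>E. u b * w b) = a0 * b0" using 0 unfolding a b E(6) by simp
  have "(\<Sum>b\<in>E. u b * w b)\<^sup>2 \<le> (\<Sum>b\<in>E. (u b)\<^sup>2) * (\<Sum>b\<in>E. (w b)\<^sup>2)" by (rule Cauchy_Schwarz_ineq_sum)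
  also have "\<dots> = (\<Sum>b\<in>E. u b * u b) * (\<Sum>b\<in>E. w b * w b)" by (simp add: power2_eq_square)
  also have "\<dots> < (a0 * a0) * (b0 * b0)"
    using A B by (intro mult_strict_mono') (auto intro: sum_nonneg)
  also have "\<dots> = (a0 * b0)\<^sup>2" by (simp add: power2_eq_square mult_ac)
  finally show False using C by simp
qed

abbreviation cimg :: "('m, 'e::euclidean_space) chart \<Rightarrow> ('e \<times> real) set" where
  "cimg c \<equiv> cmap c ` cdom c"

section \<open>Charts and tangent vectors\<close>

lemma tadd_apply [simp]: "tadd v w c = v c + w c" by (simp add: tadd_def)

lemma tscale_apply [simp]: "tscale s v c = s *\<^sub>R v c" by (simp add: tscale_def)

text \<open>Replaces the supremum in \<open>tau_in\<close> and the description in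
  \<open>S_in\<close> by an explicit geodesic; \<open>exits_alongD\<close> converts back. Time 0 is
  excluded from the interior condition because the starting point usually lies on the
  boundary.\<close>

definition exits_along :: "('m::topological_space, 'e::euclidean_space) metric_manifold \<Rightarrow> 'm \<times> ('m, 'e) tvec \<Rightarrow> real \<Rightarrow>
    (real \<Rightarrow> 'm) \<Rightarrow> (real \<Rightarrow> ('m, 'e) tvec) \<Rightarrow> bool" where
  "exits_along M q T \<gamma> V \<longleftrightarrow> 0 < T \<and> geodesic_from M q {0..T} \<gamma> V \<and>
    \<gamma> ` {0<..<T} \<subseteq> interior_part M \<and> \<gamma> T \<in> boundary M"

locale lorentz_mfd =
  fixes M :: "('m::{t2_space, second_countable_topology}, 'e::euclidean_space) metric_manifold"
  assumes mfd: "lorentzian_manifold_timelike_boundary M"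
begin

lemma charts_at_iff: "c \<in> charts_at M p \<longleftrightarrow> c \<in> charts M \<and> p \<in> cdom c"
  by (simp add: charts_at_def)

lemma ex_chart: "\<exists>c. c \<in> charts_at M p"
proof -
  have "(\<Union>c\<in>charts M. cdom c) = UNIV"
    using mfd by (auto simp: lorentzian_manifold_timelike_boundary_def smooth_atlas_def)
  then show ?thesis unfolding charts_at_def by blast
qed

lemma chartD:
  assumes "c \<in> charts M"
  shows "open (cdom c)" "openin (top_of_set half_space) (cimg c)"
    "homeomorphism (cdom c) (cimg c) (cmap c) (cinv c)"
  using mfd assms by (auto simp: lorentzian_manifold_timelike_boundary_def smooth_atlas_def is_chart_def)

lemma cinv_cmap [simp]: "c \<in> charts M \<Longrightarrow> p \<in> cdom c \<Longrightarrow> cinv c (cmap c p) = p"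
  using chartD(3) by (metis homeomorphism_apply1)

lemma cmap_cinv [simp]: "c \<in> charts M \<Longrightarrow> x \<in> cimg c \<Longrightarrow> cmap c (cinv c x) = x"
  by auto

lemma cinv_in [simp]: "c \<in> charts M \<Longrightarrow> x \<in> cimg c \<Longrightarrow> cinv c x \<in> cdom c"
  by auto

lemma cont_cmap: "c \<in> charts M \<Longrightarrow> continuous_on (cdom c) (cmap c)"
  using chartD(3) homeomorphism_cont1 by blast

lemma cont_cinv: "c \<in> charts M \<Longrightarrow> continuous_on (cimg c) (cinv c)"
  using chartD(3) homeomorphism_cont2 by blast

lemma cimg_half: "c \<in> charts M \<Longrightarrow> cimg c \<subseteq> half_space"
  using chartD(2) openin_imp_subset by blast

lemma snd_cmap_nonneg: "c \<in> charts_at M p \<Longrightarrow> 0 \<le> snd (cmap c p)"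
  using cimg_half by (force simp: charts_at_iff half_space_def)

lemma openin_image:
  assumes "c \<in> charts M" "open U"
  shows "openin (top_of_set half_space) (cmap c ` (cdom c \<inter> U))"
  using homeomorphism_imp_open_map[OF chartD(3)[OF assms(1)]] assms chartD(2)[OF assms(1)]
  by (meson openin_open openin_trans)

abbreviation ovl where "ovl c c' \<equiv> cmap c ` (cdom c \<inter> cdom c')"

abbreviation tr where "tr c c' \<equiv> (\<lambda>x. cmap c' (cinv c x))"

lemma openin_ovl: "c \<in> charts M \<Longrightarrow> c' \<in> charts M \<Longrightarrow> openin (top_of_set half_space) (ovl c c')"
  using openin_image chartD(1) by blast

lemma smooth_tr: "c \<in> charts M \<Longrightarrow> c' \<in> charts M \<Longrightarrow> smooth_on (ovl c c') (tr c c')"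
  using mfd by (auto simp: lorentzian_manifold_timelike_boundary_def smooth_atlas_def)

lemma jacobian_has_derivative:
  assumes "c \<in> charts_at M p" "c' \<in> charts_at M p"
  shows "(tr c c' has_derivative jacobian c c' p) (at (cmap c p) within ovl c c')"
  unfolding jacobian_def
  by (rule smooth_on_has_derivative[OF smooth_tr thick_half_space openin_ovl])
    (use assms in \<open>auto simp: charts_at_iff\<close>)

lemma linear_jacobian: "c \<in> charts_at M p \<Longrightarrow> c' \<in> charts_at M p \<Longrightarrow> linear (jacobian c c' p)"
  using jacobian_has_derivative has_derivative_linear by blast

lemma jacobian_id:
  assumes "c \<in> charts_at M p"
  shows "jacobian c c p a = a"
proof -
  have "jacobian c c p = (\<lambda>a. a)"
    unfolding jacobian_def
  proof (rule frechet_derivative_within_thick[OF thick_half_space openin_ovl])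
    show "(tr c c has_derivative (\<lambda>a. a)) (at (cmap c p) within ovl c c)"
      by (rule has_derivative_transform_within[OF has_derivative_ident, of 1])
        (use assms in \<open>auto simp: charts_at_iff\<close>)
  qed (use assms in \<open>auto simp: charts_at_iff\<close>)
  then show ?thesis by simp
qed

text \<open>Chain rule on the triple overlap \<open>S\<close>, which is relatively open in the
  half-space, so that derivatives within it are unique. Invertibility of Jacobians is the case of
  equal first and last charts.\<close>

lemma jacobian_comp:
  assumes c: "c \<in> charts_at M p" "c' \<in> charts_at M p" "c'' \<in> charts_at M p"
  shows "jacobian c' c'' p (jacobian c c' p a) = jacobian c c'' p a"
proof -
  note ch = c[unfolded charts_at_iff]
  define S where "S = cmap c ` (cdom c \<inter> (cdom c' \<inter> cdom c''))"
  have S: "openin (top_of_set half_space) S" "cmap c p \<in> S" "S \<subseteq> ovl c c'" "S \<subseteq> ovl c c''"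
    unfolding S_def using openin_image[of c "cdom c' \<inter> cdom c''"] chartD(1)[of c'] chartD(1)[of c''] ch by auto
  have SS: "tr c c' ` S \<subseteq> ovl c' c''" using ch by (auto simp: S_def)
  have "((\<lambda>x. tr c' c'' (tr c c' x)) has_derivative (\<lambda>a. jacobian c' c'' p (jacobian c c' p a))) (at (cmap c p) within S)"
  proof (rule has_derivative_in_compose[where f = "tr c c'" and g = "tr c' c''" and f' = "jacobian c c' p" and g' = "jacobian c' c'' p"])
    show "(tr c c' has_derivative jacobian c c' p) (at (cmap c p) within S)"
      using has_derivative_subset[OF jacobian_has_derivative[OF c(1,2)] S(3)] .
    have "(tr c' c'' has_derivative jacobian c' c'' p) (at (cmap c' p) within ovl c' c'')"
      by (rule jacobian_has_derivative[OF c(2,3)])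
    then show "(tr c' c'' has_derivative jacobian c' c'' p) (at (tr c c' (cmap c p)) within tr c c' ` S)"
      using has_derivative_subset SS ch by auto
  qed
  then have "(tr c c'' has_derivative (\<lambda>a. jacobian c' c'' p (jacobian c c' p a))) (at (cmap c p) within S)"
    by (rule has_derivative_transform_within[of _ _ _ _ 1]) (use ch S in \<open>auto simp: S_def\<close>)
  moreover have "(tr c c'' has_derivative jacobian c c'' p) (at (cmap c p) within S)"
    using has_derivative_subset[OF jacobian_has_derivative[OF c(1,3)] S(4)] .
  ultimately have "(\<lambda>a. jacobian c' c'' p (jacobian c c' p a)) = jacobian c c'' p"
    using has_derivative_within_unique_thick[OF thick_half_space S(1,2)] by blast
  then show ?thesis by (rule fun_cong)
qed

lemma tangent_spaceD: "v \<in> tangent_space M p \<Longrightarrow> c \<in> charts_at M p \<Longrightarrow> c' \<in> charts_at M p \<Longrightarrow> v c' = jacobian c c' p (v c)"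
  unfolding tangent_space_def by blast

lemma tangent_space_eqI:
  assumes "v \<in> tangent_space M p" "w \<in> tangent_space M p" "c \<in> charts_at M p" "v c = w c"
  shows "v = w"
proof
  fix c'
  show "v c' = w c'"
  proof (cases "c' \<in> charts_at M p")
    case True then show ?thesis using tangent_spaceD[of _ p c c'] assms by metis
  next
    case False
    then have "v c' = 0" "w c' = 0" using assms(1,2) unfolding tangent_space_def by blast+
    then show ?thesis by simp
  qed
qed

lemma tvec_of_tangent: "c \<in> charts_at M p \<Longrightarrow> tvec_of M c p a \<in> tangent_space M p"
  by (auto simp: tvec_of_def tangent_space_def jacobian_comp)

lemma tvec_of_apply: "c \<in> charts_at M p \<Longrightarrow> tvec_of M c p a c = a"
  by (auto simp: tvec_of_def jacobian_id)

lemma tvec_of_coord: "c \<in> charts_at M p \<Longrightarrow> v \<in> tangent_space M p \<Longrightarrow> tvec_of M c p (v c) = v"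
  by (rule tangent_space_eqI[of _ p _ c]) (auto simp: tvec_of_tangent tvec_of_apply)

lemma tangent_space_outside: "v \<in> tangent_space M p \<Longrightarrow> c \<notin> charts_at M p \<Longrightarrow> v c = 0"
  unfolding tangent_space_def by blast

lemma tadd_tangent:
  assumes "v \<in> tangent_space M p" "w \<in> tangent_space M p"
  shows "tadd v w \<in> tangent_space M p"
  unfolding tangent_space_def
proof (intro CollectI conjI ballI allI impI)
  fix c c' assume c: "c \<in> charts_at M p" "c' \<in> charts_at M p"
  show "tadd v w c' = jacobian c c' p (tadd v w c)"
    unfolding tadd_apply linear_add[OF linear_jacobian[OF c]]
      tangent_spaceD[OF assms(1) c] tangent_spaceD[OF assms(2) c] ..
qed (simp add: tangent_space_outside[OF assms(1)] tangent_space_outside[OF assms(2)])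

lemma tscale_tangent:
  assumes "v \<in> tangent_space M p"
  shows "tscale s v \<in> tangent_space M p"
  unfolding tangent_space_def
proof (intro CollectI conjI ballI allI impI)
  fix c c' assume c: "c \<in> charts_at M p" "c' \<in> charts_at M p"
  show "tscale s v c' = jacobian c c' p (tscale s v c)"
    unfolding tscale_apply linear_scale[OF linear_jacobian[OF c]] tangent_spaceD[OF assms(1) c] ..
qed (simp add: tangent_space_outside[OF assms(1)])

lemma metric_eq:
  assumes "c \<in> charts_at M p" "v \<in> tangent_space M p" "w \<in> tangent_space M p"
  shows "metric M p v w = metric_coord M c (cmap c p) (v c) (w c)"
  using assms by (simp add: metric_coord_def charts_at_iff tvec_of_coord)

section \<open>The metric and its Christoffel symbols in a chart\<close>

lemma metric_coord_lorentz:
  assumes "c \<in> charts M" "x \<in> cimg c"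
  shows "lorentzian_form (metric_coord M c x)"
  using mfd assms by (auto simp: lorentzian_manifold_timelike_boundary_def lorentzian_metric_def)

lemma metric_coord_bilinear: "c \<in> charts M \<Longrightarrow> x \<in> cimg c \<Longrightarrow> bilinear (metric_coord M c x)"
  using metric_coord_lorentz unfolding lorentzian_form_def by blast

lemma metric_coord_sym: "c \<in> charts M \<Longrightarrow> x \<in> cimg c \<Longrightarrow> metric_coord M c x a b = metric_coord M c x b a"
  using metric_coord_lorentz unfolding lorentzian_form_def by blast

lemma metric_coord_nondegenerate: "c \<in> charts M \<Longrightarrow> x \<in> cimg c \<Longrightarrow> nondegenerate (metric_coord M c x)"
  by (rule lorentzian_form_nondegenerate[OF metric_coord_lorentz])

lemma metric_coord_smooth: "c \<in> charts M \<Longrightarrow> smooth_on (cimg c) (\<lambda>x. metric_coord M c x a b)"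
  using mfd unfolding lorentzian_manifold_timelike_boundary_def lorentzian_metric_def by blast

lemma metric_deriv_has_derivative:
  assumes "c \<in> charts M" "x \<in> cimg c"
  shows "((\<lambda>y. metric_coord M c y a b) has_derivative (\<lambda>d. metric_deriv M c x d a b)) (at x within cimg c)"
  unfolding metric_deriv_def
  by (rule smooth_on_has_derivative[OF metric_coord_smooth thick_half_space chartD(2)]) (use assms in auto)

lemma metric_deriv_unique:
  assumes "c \<in> charts M" "x \<in> cimg c" "((\<lambda>y. metric_coord M c y a b) has_derivative D) (at x within cimg c)"
  shows "metric_deriv M c x d a b = D d"
  using has_derivative_within_unique_thick[OF thick_half_space chartD(2)[OF assms(1)] assms(2)
      metric_deriv_has_derivative[OF assms(1,2)] assms(3)]
  by (rule fun_cong)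

lemma metric_deriv_linear: "c \<in> charts M \<Longrightarrow> x \<in> cimg c \<Longrightarrow> linear (\<lambda>d. metric_deriv M c x d a b)"
  using metric_deriv_has_derivative has_derivative_linear by blast

lemma metric_deriv_sym:
  assumes "c \<in> charts M" "x \<in> cimg c"
  shows "metric_deriv M c x d a b = metric_deriv M c x d b a"
proof -
  have "((\<lambda>y. metric_coord M c y a b) has_derivative (\<lambda>d. metric_deriv M c x d b a)) (at x within cimg c)"
    by (rule has_derivative_transform_within[OF metric_deriv_has_derivative[OF assms] zero_less_one assms(2)])
      (rule metric_coord_sym[OF assms(1)])
  then show ?thesis by (rule metric_deriv_unique[OF assms])
qed

lemma metric_deriv_bilinear:
  assumes "c \<in> charts M" "x \<in> cimg c"
  shows "bilinear (metric_deriv M c x d)"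
proof -
  have 1: "metric_deriv M c x d a (b + b') = metric_deriv M c x d a b + metric_deriv M c x d a b'" for a b b'
  proof (rule metric_deriv_unique[OF assms])
    show "((\<lambda>y. metric_coord M c y a (b + b')) has_derivative (\<lambda>d. metric_deriv M c x d a b + metric_deriv M c x d a b')) (at x within cimg c)"
      by (rule has_derivative_transform_within[OF has_derivative_add[OF metric_deriv_has_derivative[OF assms] metric_deriv_has_derivative[OF assms]], of 1])
        (use assms bilinear_radd[OF metric_coord_bilinear[OF assms(1)]] in auto)
  qed
  have 2: "metric_deriv M c x d a (k *\<^sub>R b) = k *\<^sub>R metric_deriv M c x d a b" for a b k
  proof (rule metric_deriv_unique[OF assms])
    show "((\<lambda>y. metric_coord M c y a (k *\<^sub>R b)) has_derivative (\<lambda>d. k *\<^sub>R metric_deriv M c x d a b)) (at x within cimg c)"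
      by (rule has_derivative_transform_within[OF has_derivative_scaleR_right[OF metric_deriv_has_derivative[OF assms]], of 1])
        (use assms bilinear_rmul[OF metric_coord_bilinear[OF assms(1)]] in auto)
  qed
  have lin: "linear (\<lambda>b. metric_deriv M c x d a b)" for a
    by (rule linearI) (use 1 2 in auto)
  moreover have "(\<lambda>b. metric_deriv M c x d b a) = (\<lambda>b. metric_deriv M c x d a b)" for a
    by (rule ext) (rule metric_deriv_sym[OF assms])
  ultimately show ?thesis by (simp add: bilinear_def)
qed

text \<open>The right-hand side of the defining equation is linear in \<open>d\<close>, hence
  represented by a unique vector; for equal arguments its first two terms coincide.\<close>

lemma christoffel_eq:
  assumes "c \<in> charts M" "x \<in> cimg c"
  shows "metric_coord M c x (christoffel M c x a a) d = metric_deriv M c x a a d - metric_deriv M c x d a a / 2"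
proof -
  let ?\<beta> = "\<lambda>d. (metric_deriv M c x a a d + metric_deriv M c x a a d - metric_deriv M c x d a a) / 2"
  have "linear ?\<beta>"
    by (rule linearI)
      (simp_all add: linear_add[OF metric_deriv_linear[OF assms]] linear_scale[OF metric_deriv_linear[OF assms]]
        bilinear_radd[OF metric_deriv_bilinear[OF assms]] bilinear_rmul[OF metric_deriv_bilinear[OF assms]] field_simps)
  then have "\<exists>!w. \<forall>d. metric_coord M c x w d = ?\<beta> d"
    by (rule nondegenerate_riesz[OF metric_coord_bilinear[OF assms] metric_coord_nondegenerate[OF assms]])
  from theI'[OF this] have "\<forall>d. metric_coord M c x (christoffel M c x a a) d = ?\<beta> d"
    unfolding christoffel_def .
  then show ?thesis by (simp add: field_simps)
qed

lemma metric_coord_cancel: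
  assumes "c \<in> charts M" "x \<in> cimg c" "\<And>d. metric_coord M c x a d = metric_coord M c x b d"
  shows "a = b"
proof -
  have "metric_coord M c x (a - b) d = 0" for d
    using assms(3) bilinear_lsub[OF metric_coord_bilinear[OF assms(1,2)]] by simp
  then have "a - b = 0" using metric_coord_nondegenerate[OF assms(1,2)] unfolding nondegenerate_def by blast
  then show ?thesis by simp
qed

text \<open>Invariance of the boundary. If \<open>p\<close> were interior in \<open>c\<close> but on
  the boundary in \<open>d\<close>, the last coordinate of the transition map would have an interior
  minimum, hence vanishing derivative, although the Jacobian is invertible.\<close>

lemma boundary_iff:
  assumes c: "c \<in> charts_at M p"
  shows "p \<in> boundary M \<longleftrightarrow> snd (cmap c p) = 0"
proof
  assume "p \<in> boundary M"
  then obtain d where d: "d \<in> charts_at M p" "snd (cmap d p) = 0" unfolding boundary_def by blast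
  note ch = c[unfolded charts_at_iff] d(1)[unfolded charts_at_iff]
  show "snd (cmap c p) = 0"
  proof (rule ccontr)
    assume "snd (cmap c p) \<noteq> 0"
    then have pos: "0 < snd (cmap c p)" using snd_cmap_nonneg[OF c] by simp
    let ?x = "cmap c p" and ?S = "ovl c d"
    have "openin (top_of_set half_space) ?S" "?x \<in> ?S" using openin_ovl ch by auto
    then obtain r where r: "r > 0" "ball ?x r \<inter> half_space \<subseteq> ?S" unfolding openin_contains_ball by blast
    define r' where "r' = min r (snd ?x)"
    have sub: "ball ?x r' \<subseteq> ?S"
    proof
      fix y assume y: "y \<in> ball ?x r'"
      have "norm (snd ?x - snd y) \<le> norm (?x - y)"
        using dist_snd_le[of ?x y] by (simp only: dist_norm)
      then have "y \<in> half_space" using y by (auto simp: half_space_def r'_def dist_norm)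
      then show "y \<in> ?S" using r y by (auto simp: r'_def)
    qed
    have r': "r' > 0" using r pos by (simp add: r'_def)
    have D: "((\<lambda>x. snd (tr c d x)) has_derivative (\<lambda>a. snd (jacobian c d p a))) (at ?x)"
      using has_derivative_subset[OF jacobian_has_derivative[OF c d(1)] sub] r'
      by (intro has_derivative_snd) (simp add: at_within_open[of _ "ball ?x r'"])
    have "(\<lambda>a. snd (jacobian c d p a)) = (\<lambda>a. 0)"
    proof (rule differential_zero_maxmin[OF _ open_ball D])
      show "?x \<in> ball ?x r'" using r' by simp
      show "(\<forall>y\<in>ball ?x r'. snd (tr c d y) \<le> snd (tr c d ?x)) \<or> (\<forall>y\<in>ball ?x r'. snd (tr c d ?x) \<le> snd (tr c d y))"
      proof (rule disjI2, rule ballI)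
        fix y assume "y \<in> ball ?x r'"
        then have "y \<in> ?S" using sub by blast
        then obtain q where "q \<in> cdom c" "q \<in> cdom d" "y = cmap c q" by auto
        then show "snd (tr c d ?x) \<le> snd (tr c d y)"
          using ch d(2) snd_cmap_nonneg[of d q] by (simp add: charts_at_iff)
      qed
    qed
    then have "snd (jacobian c d p (jacobian d c p (0, 1))) = 0" by (rule fun_cong)
    then show False using jacobian_comp[OF d(1) c d(1)] jacobian_id[OF d(1)] by simp
  qed
qed (use c in \<open>unfold boundary_def, blast\<close>)

text \<open>Along the line from the boundary point in the direction \<open>a\<close>, the last
  coordinate in the chart \<open>d\<close> starts at 0 and stays nonnegative, and so does its
  difference quotient.\<close>

lemma jacobian_snd_aux:
  assumes c: "c \<in> charts_at M p" "d \<in> charts_at M p" and p: "p \<in> boundary M" and a: "0 \<le> snd a"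
  shows "0 \<le> snd (jacobian c d p a)"
proof -
  note ch = c[unfolded charts_at_iff]
  let ?x = "cmap c p" and ?S = "ovl c d"
  have x0: "snd ?x = 0" "snd (cmap d p) = 0" using p boundary_iff[OF c(1)] boundary_iff[OF c(2)] by auto
  have "openin (top_of_set half_space) ?S" "?x \<in> ?S" using openin_ovl ch by auto
  then obtain r where r: "r > 0" "ball ?x r \<inter> half_space \<subseteq> ?S" unfolding openin_contains_ball by blast
  define e where "e = r / 2 / (norm a + 1)"
  have e: "e > 0" unfolding e_def using r by (intro divide_pos_pos add_nonneg_pos) auto
  have inS: "?x + t *\<^sub>R a \<in> ?S" if "t \<in> {0..e}" for t
  proof -
    have "norm (t *\<^sub>R a) < r"
    proof -
      have "t * norm a \<le> t * (norm a + 1)" using that by (intro mult_left_mono) auto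
      also have "\<dots> \<le> e * (norm a + 1)" using that by (intro mult_right_mono add_nonneg_nonneg) auto
      also have "\<dots> = r / 2" using add_nonneg_pos[OF norm_ge_zero[of a] zero_less_one] by (simp add: e_def field_simps)
      finally show ?thesis using that r(1) by simp
    qed
    moreover have "?x + t *\<^sub>R a \<in> half_space" using that a x0 by (simp add: half_space_def)
    ultimately show ?thesis using r(2) by (auto simp: dist_norm)
  qed
  have "((\<lambda>t. ?x + t *\<^sub>R a) has_derivative (\<lambda>h. h *\<^sub>R a)) (at 0 within {0..e})"
    by (auto intro!: derivative_eq_intros)
  then have "((\<lambda>t. tr c d (?x + t *\<^sub>R a)) has_derivative (\<lambda>h. jacobian c d p (h *\<^sub>R a))) (at 0 within {0..e})"
    by (rule has_derivative_in_compose)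
      (use has_derivative_subset[OF jacobian_has_derivative[OF c], of "(\<lambda>t. ?x + t *\<^sub>R a) ` {0..e}"] inS
        in \<open>simp add: image_subset_iff\<close>)
  then have "((\<lambda>t. snd (tr c d (?x + t *\<^sub>R a))) has_derivative (\<lambda>h. snd (jacobian c d p (h *\<^sub>R a)))) (at 0 within {0..e})"
    by (rule has_derivative_snd)
  then have "((\<lambda>t. snd (tr c d (?x + t *\<^sub>R a))) has_real_derivative snd (jacobian c d p a)) (at 0 within {0..e})"
    unfolding has_real_derivative_iff_has_vector_derivative has_vector_derivative_def
    by (simp add: linear_scale[OF linear_jacobian[OF c]])
  then have lim: "((\<lambda>t. (snd (tr c d (?x + t *\<^sub>R a)) - snd (tr c d ?x)) / t) \<longlongrightarrow> snd (jacobian c d p a)) (at 0 within {0..e})"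
    by (simp add: has_field_derivative_iff)
  have nontriv: "at 0 within {0..e} \<noteq> bot"
    using e by (simp add: at_within_Icc_at_right)
  have "\<forall>\<^sub>F t in at 0 within {0..e}. 0 \<le> (snd (tr c d (?x + t *\<^sub>R a)) - snd (tr c d ?x)) / t"
    unfolding eventually_at_filter
  proof (rule always_eventually, intro allI impI)
    fix t assume t: "t \<noteq> 0" "t \<in> {0..e}"
    obtain q where q: "q \<in> cdom c" "q \<in> cdom d" "?x + t *\<^sub>R a = cmap c q" using inS[OF t(2)] by auto
    then have "0 \<le> snd (tr c d (?x + t *\<^sub>R a))"
      using ch snd_cmap_nonneg[of d q] by (simp add: charts_at_iff)
    then show "0 \<le> (snd (tr c d (?x + t *\<^sub>R a)) - snd (tr c d ?x)) / t"
      using t x0 ch by simp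
  qed
  then show ?thesis by (rule tendsto_lowerbound[OF lim _ nontriv])
qed

text \<open>The weak inequality, applied to \<open>a\<close>, to \<open>- a\<close> and to the
  inverse Jacobian, becomes an equivalence. Any single chart thereby decides whether a vector is
  inward, tangent or outward.\<close>

lemma jacobian_snd:
  assumes c: "c \<in> charts_at M p" "d \<in> charts_at M p" and p: "p \<in> boundary M"
  shows "snd (jacobian c d p a) = 0 \<longleftrightarrow> snd a = 0" "0 < snd (jacobian c d p a) \<longleftrightarrow> 0 < snd a"
    "snd (jacobian c d p a) < 0 \<longleftrightarrow> snd a < 0"
proof -
  have *: "snd (jacobian c d p a) = 0" if "snd a = 0" "c \<in> charts_at M p" "d \<in> charts_at M p" for a c d
  proof -
    have "0 \<le> snd (jacobian c d p a)" "0 \<le> snd (jacobian c d p (-a))"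
      using jacobian_snd_aux[OF that(2,3) p] that(1) by auto
    then show ?thesis using linear_neg[OF linear_jacobian[OF that(2,3)], of a] by simp
  qed
  have inv: "jacobian d c p (jacobian c d p a) = a" for a
    using jacobian_comp[OF c c(1)] jacobian_id[OF c(1)] by simp
  show z: "snd (jacobian c d p a) = 0 \<longleftrightarrow> snd a = 0" for a
    using *[of a c d] *[of "jacobian c d p a" d c] c inv by auto
  have pos: "0 < snd (jacobian c d p a)" if "0 < snd a" for a
    using jacobian_snd_aux[OF c p, of a] z[of a] that by simp
  moreover have "snd (jacobian c d p a) < 0" if "snd a < 0" for a
    using pos[of "-a"] that linear_neg[OF linear_jacobian[OF c], of a] by simp
  ultimately show "0 < snd (jacobian c d p a) \<longleftrightarrow> 0 < snd a" "snd (jacobian c d p a) < 0 \<longleftrightarrow> snd a < 0"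
    using z[of a] by (metis less_asym linorder_neqE_linordered_idom)+
qed

lemma tangent_snd:
  assumes "v \<in> tangent_space M p" "c \<in> charts_at M p" "d \<in> charts_at M p" "p \<in> boundary M"
  shows "snd (v d) = 0 \<longleftrightarrow> snd (v c) = 0" "0 < snd (v d) \<longleftrightarrow> 0 < snd (v c)" "snd (v d) < 0 \<longleftrightarrow> snd (v c) < 0"
  using jacobian_snd[OF assms(2,3,4), of "v c"] tangent_spaceD[OF assms(1-3)] by auto

lemma open_interior: "open (interior_part M)"
proof (subst open_subopen, rule ballI)
  fix p assume p: "p \<in> interior_part M"
  obtain c where c: "c \<in> charts_at M p" using ex_chart by blast
  note ch = c[unfolded charts_at_iff]
  have cont: "continuous_on (cdom c) (\<lambda>q. snd (cmap c q))"
    using ch by (intro continuous_on_snd cont_cmap) auto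
  have op: "open (cdom c \<inter> (\<lambda>q. snd (cmap c q)) -` {0<..})"
    by (rule continuous_open_preimage[OF cont chartD(1)]) (use ch in auto)
  have "cdom c \<inter> (\<lambda>q. snd (cmap c q)) -` {0<..} \<subseteq> interior_part M"
    using ch boundary_iff by (fastforce simp: interior_part_def charts_at_iff)
  moreover have "p \<in> cdom c \<inter> (\<lambda>q. snd (cmap c q)) -` {0<..}"
    using p ch boundary_iff[OF c] snd_cmap_nonneg[OF c] by (auto simp: interior_part_def)
  ultimately show "\<exists>T. open T \<and> p \<in> T \<and> T \<subseteq> interior_part M" using op by blast
qed

lemma interior_iff:
  assumes "c \<in> charts_at M p"
  shows "p \<in> interior_part M \<longleftrightarrow> 0 < snd (cmap c p)"
  using boundary_iff[OF assms] snd_cmap_nonneg[OF assms] by (auto simp: interior_part_def)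

section \<open>The geodesic vector field in a chart\<close>

text \<open>The last clause is nondegeneracy with a constant uniform over \<open>B\<close>: it
  bounds a vector by its pairings and serves to estimate Christoffel symbols.\<close>

definition metric_bounds :: "('m, 'e) chart \<Rightarrow> ('e \<times> real) set \<Rightarrow> real \<Rightarrow> bool" where
  "metric_bounds c B K \<longleftrightarrow> B \<subseteq> cimg c \<and>
    (\<forall>x\<in>B. \<forall>y\<in>B. \<forall>a b.
      \<bar>metric_coord M c x a b\<bar> \<le> K * norm a * norm b \<and>
      \<bar>metric_coord M c x a b - metric_coord M c y a b\<bar> \<le> K * norm (x - y) * norm a * norm b \<and>
      (\<forall>d. \<bar>metric_deriv M c x d a b\<bar> \<le> K * norm d * norm a * norm b \<and>
        \<bar>metric_deriv M c x d a b - metric_deriv M c y d a b\<bar> \<le> K * norm (x - y) * norm d * norm a * norm b) \<and>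
      \<bar>metric_coord M c x a b - metric_coord M c y a b - metric_deriv M c y (x - y) a b\<bar>
        \<le> K * (norm (x - y))\<^sup>2 * norm a * norm b) \<and>
    (\<forall>x\<in>B. \<forall>w e. (\<forall>d. \<bar>metric_coord M c x w d\<bar> \<le> e * norm d) \<longrightarrow> norm w \<le> K * e)"

lemma metric_boundsD:
  assumes "metric_bounds c B K" "x \<in> B" "y \<in> B"
  shows "x \<in> cimg c"
    "\<bar>metric_coord M c x a b\<bar> \<le> K * norm a * norm b"
    "\<bar>metric_coord M c x a b - metric_coord M c y a b\<bar> \<le> K * norm (x - y) * norm a * norm b"
    "\<bar>metric_deriv M c x d a b\<bar> \<le> K * norm d * norm a * norm b"
    "\<bar>metric_deriv M c x d a b - metric_deriv M c y d a b\<bar> \<le> K * norm (x - y) * norm d * norm a * norm b"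
    "\<bar>metric_coord M c x a b - metric_coord M c y a b - metric_deriv M c y (x - y) a b\<bar>
        \<le> K * (norm (x - y))\<^sup>2 * norm a * norm b"
    "(\<And>d. \<bar>metric_coord M c x w d\<bar> \<le> e * norm d) \<Longrightarrow> norm w \<le> K * e"
  using assms unfolding metric_bounds_def by blast+

text \<open>The number \<open>k\<close> is the bound and its inverse the radius. Enlarging
  \<open>k\<close> weakens both, so the finitely many pairs of basis vectors can share one value by
  \<open>common_bound\<close>.\<close>

lemma metric_coord_C2_bounds:
  assumes c: "c \<in> charts M" "x0 \<in> cimg c"
  shows "\<exists>k>0. cball x0 (1/k) \<inter> half_space \<subseteq> cimg c \<and>
    (\<forall>i\<in>Basis. \<forall>j\<in>Basis. C2_bounds (cimg c) (cball x0 (1/k) \<inter> half_space) (\<lambda>x. metric_coord M c x i j) k)"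
proof -
  define P where "P ij k \<longleftrightarrow> 0 < k \<and> cball x0 (1/k) \<inter> half_space \<subseteq> cimg c \<and>
    C2_bounds (cimg c) (cball x0 (1/k) \<inter> half_space) (\<lambda>x. metric_coord M c x (fst ij) (snd ij)) k" for ij k
  have "\<exists>k. \<forall>ij\<in>Basis \<times> Basis. P ij k"
  proof (rule common_bound)
    fix ij
    obtain r K where rK: "r > 0" "K \<ge> 0" "cball x0 r \<inter> half_space \<subseteq> cimg c"
      "C2_bounds (cimg c) (cball x0 r \<inter> half_space) (\<lambda>x. metric_coord M c x (fst ij) (snd ij)) K"
      using smooth_on_C2_bounds[OF metric_coord_smooth[OF c(1)] thick_half_space chartD(2)[OF c(1)] c(2)] by blast
    define k where "k = 1 / r + K"
    have k: "k > 0" "K \<le> k" "1/k \<le> r" using rK(1,2) by (auto simp: k_def field_simps add_pos_nonneg)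
    have sub: "cball x0 (1/k) \<inter> half_space \<subseteq> cball x0 r \<inter> half_space" using k(3) by auto
    show "\<exists>k. P ij k"
      unfolding P_def using k(1) C2_bounds_mono[OF rK(4) k(2) sub] sub rK(3) by blast
  next
    fix ij k k' assume P: "P ij k" and "k \<le> k'"
    then have k: "0 < k" "0 < k'" "1/k' \<le> 1/k" by (auto simp: P_def frac_le)
    have sub: "cball x0 (1/k') \<inter> half_space \<subseteq> cball x0 (1/k) \<inter> half_space" using k(3) by auto
    show "P ij k'"
      using P k(2) C2_bounds_mono[OF _ \<open>k \<le> k'\<close> sub] sub unfolding P_def by blast
  qed auto
  then obtain k where k: "\<And>i j. i \<in> Basis \<Longrightarrow> j \<in> Basis \<Longrightarrow> P (i, j) k" by blast
  have "(Basis :: ('e \<times> real) set) \<noteq> {}" by simp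
  then obtain i :: "'e \<times> real" where "i \<in> Basis" by blast
  then have "0 < k" "cball x0 (1/k) \<inter> half_space \<subseteq> cimg c" using k[of i i] by (auto simp: P_def)
  then show ?thesis using k unfolding P_def by auto
qed

lemma metric_bounds_ex:
  assumes c: "c \<in> charts M" "x0 \<in> cimg c"
  shows "\<exists>r>0. \<exists>K>0. metric_bounds c (cball x0 r \<inter> half_space) K"
proof -
  obtain k where k: "k > 0" "cball x0 (1/k) \<inter> half_space \<subseteq> cimg c"
    "\<And>i j. i \<in> Basis \<Longrightarrow> j \<in> Basis \<Longrightarrow>
      C2_bounds (cimg c) (cball x0 (1/k) \<inter> half_space) (\<lambda>x. metric_coord M c x i j) k"
    using metric_coord_C2_bounds[OF c] by blast
  let ?G = "metric_coord M c" and ?D = "metric_deriv M c"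
  define N where "N = (real DIM('e \<times> real))\<^sup>2"
  define K1 where "K1 = N * k"
  have N: "N > 0" by (simp add: N_def)
  have K1: "K1 > 0" using N k(1) by (simp add: K1_def)
  obtain K2 where K2: "K2 > 0" "\<And>w e. (\<forall>d. \<bar>?G x0 w d\<bar> \<le> e * norm d) \<Longrightarrow> norm w \<le> K2 * e"
    using nondegenerate_lower_bound[OF metric_coord_bilinear[OF c] metric_coord_nondegenerate[OF c]] by blast
  \<comment> \<open>On this ball the metric differs from its value at \<open>x0\<close> by at most
    \<open>K1 * r\<close>. As \<open>K1 * K2 * r \<le> 1/2\<close>, the perturbation is absorbed in
    the lower bound at \<open>x0\<close>, at the price of doubling \<open>K2\<close>.\<close>
  define r where "r = min (1/k) (1 / (2 * K1 * K2))"
  have r: "r > 0" "r \<le> 1/k" "K1 * K2 * r \<le> 1/2"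
  proof -
    show "r > 0" "r \<le> 1/k" using k(1) K1 K2(1) by (auto simp: r_def)
    have "r \<le> 1 / (2 * K1 * K2)" by (simp add: r_def)
    then show "K1 * K2 * r \<le> 1/2" using K1 K2(1) by (simp add: field_simps)
  qed
  let ?B = "cball x0 r \<inter> half_space"
  have BB: "x \<in> cball x0 (1/k) \<inter> half_space" "x \<in> cimg c" if "x \<in> ?B" for x
    using that r(2) k(2) by auto
  have x0B: "x0 \<in> ?B" using r(1) cimg_half[OF c(1)] c(2) by auto
  note bG = metric_coord_bilinear[OF c(1)] and bD = metric_deriv_bilinear[OF c(1)]
  have C: "\<bar>f a b\<bar> \<le> K1 * e * norm a * norm b"
    if "bilinear f" "\<And>i j. i \<in> Basis \<Longrightarrow> j \<in> Basis \<Longrightarrow> \<bar>f i j\<bar> \<le> k * e" for f e and a b :: "'e \<times> real"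
    using bilinear_basis_bound[OF that, of a b] by (simp add: K1_def N_def mult_ac)
  have 1: "\<bar>?G x a b\<bar> \<le> K1 * norm a * norm b" if "x \<in> ?B" for x a b
    using C[OF bG[OF BB(2)[OF that]], of 1 a b] C2_boundsD(1)[OF k(3) BB(1) BB(1), OF _ _ that that] by simp
  have 2: "\<bar>?G x a b - ?G y a b\<bar> \<le> K1 * norm (x - y) * norm a * norm b" if "x \<in> ?B" "y \<in> ?B" for x y a b
    using C[OF bilinear_diff_fun[OF bG[OF BB(2)[OF that(1)]] bG[OF BB(2)[OF that(2)]]], of "norm (x - y)" a b]
      C2_boundsD(2)[OF k(3) BB(1) BB(1), OF _ _ that] by simp
  have 3: "\<bar>?D x d a b\<bar> \<le> K1 * norm d * norm a * norm b" if "x \<in> ?B" for x d a b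
    using C[OF bD[OF BB(2)[OF that], of d], of "norm d" a b]
      C2_boundsD(3)[OF k(3) BB(1) BB(1), OF _ _ that that] by (simp add: metric_deriv_def)
  have 4: "\<bar>?D x d a b - ?D y d a b\<bar> \<le> K1 * (norm (x - y) * norm d) * norm a * norm b" if "x \<in> ?B" "y \<in> ?B" for x y d a b
  proof (rule C)
    show "bilinear (\<lambda>a b. ?D x d a b - ?D y d a b)"
      by (rule bilinear_diff_fun[OF bD[OF BB(2)[OF that(1)]] bD[OF BB(2)[OF that(2)]]])
  qed (use C2_boundsD(4)[OF k(3) BB(1) BB(1), OF _ _ that] in \<open>simp add: metric_deriv_def mult.assoc\<close>)
  have 5: "\<bar>?G x a b - ?G y a b - ?D y (x - y) a b\<bar> \<le> K1 * (norm (x - y))\<^sup>2 * norm a * norm b"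
    if "x \<in> ?B" "y \<in> ?B" for x y a b
  proof (rule C)
    show "bilinear (\<lambda>a b. ?G x a b - ?G y a b - ?D y (x - y) a b)"
      by (rule bilinear_diff_fun[OF bilinear_diff_fun[OF bG[OF BB(2)[OF that(1)]] bG[OF BB(2)[OF that(2)]]] bD[OF BB(2)[OF that(2)]]])
  qed (use C2_boundsD(5)[OF k(3) BB(1) BB(1), OF _ _ that] in \<open>simp add: metric_deriv_def\<close>)
  have 6: "norm w \<le> 2 * K2 * e" if x: "x \<in> ?B" and e: "\<And>d. \<bar>?G x w d\<bar> \<le> e * norm d" for x w e
  proof -
    have "\<bar>?G x0 w d\<bar> \<le> (e + K1 * r * norm w) * norm d" for d
    proof -
      have "norm (x0 - x) \<le> r" using x by (simp add: dist_norm)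
      then have "K1 * norm (x0 - x) * norm w * norm d \<le> K1 * r * norm w * norm d"
        using K1 by (intro mult_right_mono mult_left_mono) auto
      then have "\<bar>?G x0 w d - ?G x w d\<bar> \<le> K1 * r * norm w * norm d"
        using 2[OF x0B x, of w d] by linarith
      then show ?thesis using e[of d] by (simp add: distrib_right)
    qed
    then have "norm w \<le> K2 * (e + K1 * r * norm w)" using K2(2) by blast
    also have "\<dots> = K2 * e + (K1 * K2 * r) * norm w" by (simp add: algebra_simps)
    also have "\<dots> \<le> K2 * e + 1/2 * norm w" using r(3) by (intro add_left_mono mult_right_mono) auto
    finally show ?thesis by simp
  qed
  define K where "K = K1 + 2 * K2"
  have KK: "K1 \<le> K" "2 * K2 \<le> K" "K > 0" using K1 K2(1) by (auto simp: K_def)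
  have m: "K1 * p \<le> K * p" if "p \<ge> 0" for p using KK(1) that by (rule mult_right_mono)
  have "metric_bounds c ?B K"
    unfolding metric_bounds_def
  proof (intro conjI ballI allI impI)
    show "?B \<subseteq> cimg c" using BB(2) by blast
    fix x y a b d assume xy: "x \<in> ?B" "y \<in> ?B"
    show "\<bar>?G x a b\<bar> \<le> K * norm a * norm b"
      using 1[OF xy(1), of a b] m[of "norm a * norm b"] by (simp add: mult.assoc)
    show "\<bar>?G x a b - ?G y a b\<bar> \<le> K * norm (x - y) * norm a * norm b"
      using 2[OF xy, of a b] m[of "norm (x - y) * norm a * norm b"] by (simp add: mult.assoc)
    show "\<bar>?D x d a b\<bar> \<le> K * norm d * norm a * norm b"
      using 3[OF xy(1), of d a b] m[of "norm d * norm a * norm b"] by (simp add: mult.assoc)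
    show "\<bar>?D x d a b - ?D y d a b\<bar> \<le> K * norm (x - y) * norm d * norm a * norm b"
      using 4[OF xy, of d a b] m[of "norm (x - y) * norm d * norm a * norm b"] by (simp add: mult.assoc)
    show "\<bar>?G x a b - ?G y a b - ?D y (x - y) a b\<bar> \<le> K * (norm (x - y))\<^sup>2 * norm a * norm b"
      using 5[OF xy, of a b] m[of "(norm (x - y))\<^sup>2 * norm a * norm b"] by (simp add: mult.assoc)
  next
    fix x w e assume x: "x \<in> ?B" and e: "\<forall>d. \<bar>?G x w d\<bar> \<le> e * norm d"
    have w: "norm w \<le> 2 * K2 * e" using 6[OF x] e by blast
    then have "0 \<le> 2 * K2 * e" using norm_ge_zero[of w] by linarith
    then have "0 \<le> e" using K2(1) by (simp add: zero_le_mult_iff)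
    then show "norm w \<le> K * e" using w mult_right_mono[OF KK(2), of e] by linarith
  qed
  then show ?thesis using r(1) KK(3) by blast
qed

text \<open>The difference is tested against a vector \<open>d\<close>. The derivatives of the
  metric contribute \<open>3/2 * K * R\<^sup>2 + 3 * K * R\<close>. The term with \<open>K^3\<close>
  is the change of the metric between \<open>x\<close> and \<open>y\<close>, applied to a
  Christoffel vector of norm at most \<open>3/2 * K\<^sup>2 * R\<^sup>2\<close>.\<close>

lemma christoffel_lipschitz:
  assumes c: "c \<in> charts M" and K: "metric_bounds c B K" "K \<ge> 0" and xy: "x \<in> B" "y \<in> B"
    and R: "norm a \<le> R" "norm b \<le> R"
  shows "norm (christoffel M c x a a - christoffel M c y b b)
    \<le> K * (3/2 * K * R\<^sup>2 + 3 * K * R + 3/2 * K^3 * R\<^sup>2) * (norm (x - y) + norm (a - b))"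
proof -
  let ?G = "metric_coord M c" and ?D = "metric_deriv M c" and ?\<Gamma> = "christoffel M c"
  have R0: "R \<ge> 0" using R norm_ge_zero[of a] by linarith
  note X = metric_boundsD(1)[OF K(1) xy] and Y = metric_boundsD(1)[OF K(1) xy(2,1)]
  note bG = metric_coord_bilinear[OF c] and bD = metric_deriv_bilinear[OF c]
  have m4: "K * n1 * n2 * n3 * n4 \<le> K * m1 * m2 * m3 * m4"
    if "0 \<le> n1" "0 \<le> n2" "0 \<le> n3" "0 \<le> n4" "n1 \<le> m1" "n2 \<le> m2" "n3 \<le> m3" "n4 \<le> m4" for n1 n2 n3 n4 m1 m2 m3 m4
    by (rule mult_mono[OF mult_mono[OF mult_mono[OF mult_left_mono]]])
      (use K(2) that in \<open>auto intro!: mult_nonneg_nonneg\<close>)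
  have m3: "K * n1 * n2 * n3 \<le> K * m1 * m2 * m3"
    if "0 \<le> n1" "0 \<le> n2" "0 \<le> n3" "n1 \<le> m1" "n2 \<le> m2" "n3 \<le> m3" for n1 n2 n3 m1 m2 m3
    by (rule mult_mono[OF mult_mono[OF mult_left_mono]])
      (use K(2) that in \<open>auto intro!: mult_nonneg_nonneg\<close>)
  have G2: "norm (?\<Gamma> y b b) \<le> K * (3/2 * K * R\<^sup>2)"
  proof (rule metric_boundsD(7)[OF K(1) xy(2,2)])
    fix d
    have 1: "\<bar>?D y b b d\<bar> \<le> K * R * R * norm d"
      by (rule order_trans[OF metric_boundsD(4)[OF K(1) xy(2,2)] m3]) (use R in auto)
    have 2: "\<bar>?D y d b b\<bar> \<le> K * norm d * R * R"
      by (rule order_trans[OF metric_boundsD(4)[OF K(1) xy(2,2)] m3]) (use R in auto)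
    have "\<bar>?D y b b d - ?D y d b b / 2\<bar> \<le> \<bar>?D y b b d\<bar> + \<bar>?D y d b b\<bar> / 2" by simp
    also have "\<dots> \<le> 3/2 * K * R\<^sup>2 * norm d" using 1 2 by (simp add: power2_eq_square mult_ac)
    finally show "\<bar>?G y (?\<Gamma> y b b) d\<bar> \<le> 3/2 * K * R\<^sup>2 * norm d" unfolding christoffel_eq[OF c Y] .
  qed
  have three: "\<bar>u\<bar> \<le> p \<Longrightarrow> \<bar>v\<bar> \<le> p' \<Longrightarrow> \<bar>w\<bar> \<le> p'' \<Longrightarrow> \<bar>u - v / 2 - w\<bar> \<le> p + p' / 2 + p''" for u v w p p' p'' :: real
    by linarith
  define q where "q = norm (x - y) + norm (a - b)"
  have q: "0 \<le> q" "norm (x - y) \<le> q" "norm (a - b) \<le> q" by (auto simp: q_def)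
  have "norm (?\<Gamma> x a a - ?\<Gamma> y b b) \<le> K * ((3/2 * K * R\<^sup>2 + 3 * K * R + 3/2 * K^3 * R\<^sup>2) * q)"
  proof (rule metric_boundsD(7)[OF K(1) xy(1,1)])
    fix d
    have A1: "\<bar>?D x a a d - ?D y b b d\<bar> \<le> (K * R\<^sup>2 + 2 * K * R) * q * norm d"
    proof -
      have "?D x a a d - ?D y b b d = (?D x a a d - ?D y a a d) + ?D y (a - b) a d + ?D y b (a - b) d"
        by (simp add: linear_diff[OF metric_deriv_linear[OF c Y]] bilinear_lsub[OF bD[OF Y]])
      also have "\<bar>\<dots>\<bar> \<le> \<bar>?D x a a d - ?D y a a d\<bar> + \<bar>?D y (a - b) a d\<bar> + \<bar>?D y b (a - b) d\<bar>" by linarith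
      also have "\<dots> \<le> K * q * R * R * norm d + K * q * R * norm d + K * R * q * norm d"
        using q R
        by (intro add_mono order_trans[OF metric_boundsD(5)[OF K(1) xy] m4]
            order_trans[OF metric_boundsD(4)[OF K(1) xy(2,2)] m3]) auto
      finally show ?thesis by (simp add: algebra_simps power2_eq_square)
    qed
    have A2: "\<bar>?D x d a a - ?D y d b b\<bar> \<le> (K * R\<^sup>2 + 2 * K * R) * q * norm d"
    proof -
      have "?D x d a a - ?D y d b b = (?D x d a a - ?D y d a a) + ?D y d (a - b) a + ?D y d b (a - b)"
        by (simp add: bilinear_rsub[OF bD[OF Y]] bilinear_lsub[OF bD[OF Y]])
      also have "\<bar>\<dots>\<bar> \<le> \<bar>?D x d a a - ?D y d a a\<bar> + \<bar>?D y d (a - b) a\<bar> + \<bar>?D y d b (a - b)\<bar>" by linarith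
      also have "\<dots> \<le> K * q * norm d * R * R + K * norm d * q * R + K * norm d * R * q"
        using q R
        by (intro add_mono order_trans[OF metric_boundsD(5)[OF K(1) xy] m4]
            order_trans[OF metric_boundsD(4)[OF K(1) xy(2,2)] m3]) auto
      finally show ?thesis by (simp add: algebra_simps power2_eq_square)
    qed
    have A3: "\<bar>?G x (?\<Gamma> y b b) d - ?G y (?\<Gamma> y b b) d\<bar> \<le> K * q * (K * (3/2 * K * R\<^sup>2)) * norm d"
      using q G2 by (intro order_trans[OF metric_boundsD(3)[OF K(1) xy] m3]) auto
    have "?G x (?\<Gamma> x a a - ?\<Gamma> y b b) d = (?D x a a d - ?D y b b d) - (?D x d a a - ?D y d b b) / 2
       - (?G x (?\<Gamma> y b b) d - ?G y (?\<Gamma> y b b) d)"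
      by (simp add: bilinear_lsub[OF bG[OF X]] christoffel_eq[OF c X] christoffel_eq[OF c Y] field_simps)
    also have "\<bar>\<dots>\<bar> \<le> (K * R\<^sup>2 + 2 * K * R) * q * norm d + (K * R\<^sup>2 + 2 * K * R) * q * norm d / 2
        + K * q * (K * (3/2 * K * R\<^sup>2)) * norm d"
      by (rule three[OF A1 A2 A3])
    also have "\<dots> = (3/2 * K * R\<^sup>2 + 3 * K * R + 3/2 * K^3 * R\<^sup>2) * q * norm d"
      by (simp add: field_simps power2_eq_square power3_eq_cube)
    finally show "\<bar>?G x (?\<Gamma> x a a - ?\<Gamma> y b b) d\<bar> \<le> (3/2 * K * R\<^sup>2 + 3 * K * R + 3/2 * K^3 * R\<^sup>2) * q * norm d" .
  qed
  then show ?thesis by (simp add: q_def mult.assoc)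
qed

text \<open>A globally Lipschitz vector field that agrees, near \<open>(x0, v0)\<close> in the half-space, with the geodesic
  vector field. It is defined by composition with nearest-point projections, which makes an extension of
  the metric across the boundary unnecessary.\<close>

definition local_model :: "('m, 'e) chart \<Rightarrow> 'e \<times> real \<Rightarrow> 'e \<times> real \<Rightarrow> real \<Rightarrow> real \<Rightarrow>
    (('e \<times> real) \<times> ('e \<times> real) \<Rightarrow> ('e \<times> real) \<times> ('e \<times> real)) \<Rightarrow> bool" where
  "local_model c x0 v0 r K F \<longleftrightarrow> r > 0 \<and> K > 0 \<and> metric_bounds c (cball x0 r \<inter> half_space) K \<and>
    K-lipschitz_on UNIV F \<and>
    (\<forall>x. \<forall>w\<in>cball v0 r. fst (F (x, w)) = w) \<and>
    (\<forall>x\<in>cball x0 r \<inter> half_space. \<forall>w\<in>cball v0 r. F (x, w) = (w, - christoffel M c x w w))"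

lemma metric_bounds_mono:
  assumes "metric_bounds c B K" "K \<le> K'"
  shows "metric_bounds c B K'"
proof -
  have m: "K * p \<le> K' * p" if "p \<ge> 0" for p using assms(2) that by (rule mult_right_mono)
  note D = metric_boundsD[OF assms(1)]
  show ?thesis
    unfolding metric_bounds_def
  proof (intro conjI ballI allI impI)
    show "B \<subseteq> cimg c" using assms(1) unfolding metric_bounds_def by blast
    fix x y a b d assume xy: "x \<in> B" "y \<in> B"
    show "\<bar>metric_coord M c x a b\<bar> \<le> K' * norm a * norm b"
      using D(2)[OF xy, of a b] m[of "norm a * norm b"] by (simp add: mult.assoc)
    show "\<bar>metric_coord M c x a b - metric_coord M c y a b\<bar> \<le> K' * norm (x - y) * norm a * norm b"
      using D(3)[OF xy, of a b] m[of "norm (x - y) * norm a * norm b"] by (simp add: mult.assoc)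
    show "\<bar>metric_deriv M c x d a b\<bar> \<le> K' * norm d * norm a * norm b"
      using D(4)[OF xy, of d a b] m[of "norm d * norm a * norm b"] by (simp add: mult.assoc)
    show "\<bar>metric_deriv M c x d a b - metric_deriv M c y d a b\<bar> \<le> K' * norm (x - y) * norm d * norm a * norm b"
      using D(5)[OF xy, of d a b] m[of "norm (x - y) * norm d * norm a * norm b"] by (simp add: mult.assoc)
    show "\<bar>metric_coord M c x a b - metric_coord M c y a b - metric_deriv M c y (x - y) a b\<bar> \<le> K' * (norm (x - y))\<^sup>2 * norm a * norm b"
      using D(6)[OF xy, of a b] m[of "(norm (x - y))\<^sup>2 * norm a * norm b"] by (simp add: mult.assoc)
  next
    fix x w e assume x: "x \<in> B" and e: "\<forall>d. \<bar>metric_coord M c x w d\<bar> \<le> e * norm d"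
    \<comment> \<open>The pairing with a nonzero vector shows that \<open>e\<close> is nonnegative,
      so that enlarging the constant weakens the bound.\<close>
    have "(0, 1) \<noteq> (0 :: 'e \<times> real)" by (simp add: zero_prod_def)
    then have "0 < norm ((0, 1) :: 'e \<times> real)" by simp
    moreover have "0 \<le> e * norm ((0, 1) :: 'e \<times> real)" using e[rule_format, of "(0, 1)"] by linarith
    ultimately have "0 \<le> e" by (simp add: zero_le_mult_iff)
    then show "norm w \<le> K' * e" using D(7)[OF x x, of w e] e m[of e] by fastforce
  qed
qed

lemma local_model_ex:
  assumes c: "c \<in> charts M" "x0 \<in> cimg c"
  shows "\<exists>r K F. local_model c x0 v0 r K F"
proof -
  obtain r K where r: "r > 0" and K: "K > 0" "metric_bounds c (cball x0 r \<inter> half_space) K"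
    using metric_bounds_ex[OF c] by blast
  let ?B = "cball x0 r \<inter> half_space" and ?W = "cball v0 r"
  define R where "R = norm v0 + r"
  have R: "norm w \<le> R" if "w \<in> ?W" for w
    using that norm_triangle_ineq2[of w v0] by (simp add: R_def dist_norm norm_minus_commute)
  define C where "C = K * (3/2 * K * R\<^sup>2 + 3 * K * R + 3/2 * K^3 * R\<^sup>2)"
  have "R \<ge> 0" using r by (simp add: R_def)
  then have C: "C \<ge> 0" unfolding C_def using K(1) by (intro mult_nonneg_nonneg add_nonneg_nonneg) auto
  have "x0 \<in> ?B" using r c cimg_half[OF c(1)] by auto
  then have "?B \<noteq> {}" by blast
  then have B: "convex ?B" "closed ?B" "?B \<noteq> {}"
    using convex_half_space closed_half_space by (auto intro!: convex_Int closed_Int)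
  have W: "convex ?W" "closed ?W" "?W \<noteq> {}" using r by auto
  define pB where "pB = closest_point ?B"
  define pW where "pW = closest_point ?W"
  define F where "F z = (pW (snd z), - christoffel M c (pB (fst z)) (pW (snd z)) (pW (snd z)))" for z
  have p: "pB x \<in> ?B" "pW x \<in> ?W" for x
    using closest_point_in_set[OF B(2,3)] closest_point_in_set[OF W(2,3)] by (simp_all add: pB_def pW_def)
  have lB: "norm (pB x - pB y) \<le> norm (x - y)" for x y
    using closest_point_lipschitz[OF B] by (simp add: pB_def dist_norm)
  have lW: "norm (pW x - pW y) \<le> norm (x - y)" for x y
    using closest_point_lipschitz[OF W] by (simp add: pW_def dist_norm)
  \<comment> \<open>The velocity component contributes 1 and the Christoffel component
    \<open>2 * C\<close>, as it depends on position and velocity, each of which differs by at most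
    \<open>norm (z - z')\<close>.\<close>
  have "(1 + 2 * C)-lipschitz_on UNIV F"
  proof (rule lipschitz_onI)
    fix z z' :: "('e \<times> real) \<times> ('e \<times> real)"
    have n: "norm (fst z - fst z') \<le> norm (z - z')" "norm (snd z - snd z') \<le> norm (z - z')"
      using dist_fst_le[of z z'] dist_snd_le[of z z'] by (simp_all only: dist_norm)
    have "norm (christoffel M c (pB (fst z)) (pW (snd z)) (pW (snd z)) - christoffel M c (pB (fst z')) (pW (snd z')) (pW (snd z')))
        \<le> C * (norm (pB (fst z) - pB (fst z')) + norm (pW (snd z) - pW (snd z')))"
      unfolding C_def using christoffel_lipschitz[OF c(1) K(2) less_imp_le[OF K(1)] p(1) p(1) R[OF p(2)] R[OF p(2)]] .
    also have "\<dots> \<le> C * (norm (z - z') + norm (z - z'))"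
      using C n lB[of "fst z" "fst z'"] lW[of "snd z" "snd z'"] by (intro mult_left_mono add_mono) auto
    finally have 2: "norm (snd (F z) - snd (F z')) \<le> 2 * C * norm (z - z')"
      by (simp add: F_def norm_minus_commute)
    have 1: "norm (fst (F z) - fst (F z')) \<le> norm (z - z')"
      using n lW[of "snd z" "snd z'"] by (simp add: F_def)
    have "norm (F z - F z') \<le> norm (fst (F z) - fst (F z')) + norm (snd (F z) - snd (F z'))"
      using norm_Pair_le[of "fst (F z) - fst (F z')" "snd (F z) - snd (F z')"] by (simp add: minus_prod_def)
    then show "dist (F z) (F z') \<le> (1 + 2 * C) * dist z z'"
      using 1 2 by (simp add: dist_norm distrib_right)
  qed (use C in auto)
  moreover have "fst (F (x, w)) = w" if "w \<in> ?W" for x w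
    using closest_point_self[OF that] by (simp add: F_def pW_def)
  moreover have "F (x, w) = (w, - christoffel M c x w w)" if "x \<in> ?B" "w \<in> ?W" for x w
    using closest_point_self[OF that(1)] closest_point_self[OF that(2)] by (simp add: F_def pW_def pB_def)
  moreover define K' where "K' = K + (1 + 2 * C)"
  ultimately have "local_model c x0 v0 r K' F"
    unfolding local_model_def using r K C metric_bounds_mono[OF K(2), of K']
    by (auto intro: lipschitz_on_mono)
  then show ?thesis by blast
qed

section \<open>Geodesics\<close>

lemma metric_coord_tr:
  assumes "c \<in> charts M" "c' \<in> charts M" "y \<in> ovl c c'"
  shows "metric_coord M c y a d = metric_coord M c' (tr c c' y)
    (jacobian c c' (cinv c y) a) (jacobian c c' (cinv c y) d)"
proof -
  define q where "q = cinv c y"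
  have q: "c \<in> charts_at M q" "c' \<in> charts_at M q" "cmap c q = y"
    using assms by (auto simp: q_def charts_at_iff)
  have "metric_coord M c y a d = metric M q (tvec_of M c q a) (tvec_of M c q d)"
    by (simp add: metric_coord_def q_def)
  also have "\<dots> = metric_coord M c' (cmap c' q) (tvec_of M c q a c') (tvec_of M c q d c')"
    by (rule metric_eq[OF q(2) tvec_of_tangent[OF q(1)] tvec_of_tangent[OF q(1)]])
  finally show ?thesis using q by (simp add: tvec_of_def q_def)
qed

lemma jacobian_cinv:
  assumes "c \<in> charts M" "y \<in> ovl c c'"
  shows "jacobian c c' (cinv c y) = frechet_derivative (tr c c') (at y within ovl c c')"
proof -
  have "y \<in> cimg c" using assms by auto
  then show ?thesis using assms(1) by (simp add: jacobian_def)
qed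

text \<open>\<open>Q\<close> is the second derivative of the transition map.\<close>

lemma christoffel_tr:
  assumes c: "c \<in> charts_at M p" "c' \<in> charts_at M p"
    and Q: "\<And>d. ((\<lambda>y. jacobian c c' (cinv c y) d) has_derivative (\<lambda>e. Q e d)) (at (cmap c p) within ovl c c')"
      "\<And>d e. Q e d = Q d e"
  shows "jacobian c c' p (christoffel M c (cmap c p) a a) - Q a a
    = christoffel M c' (cmap c' p) (jacobian c c' p a) (jacobian c c' p a)"
proof -
  note ch = c[unfolded charts_at_iff]
  define x x' J where "x = cmap c p" and "x' = cmap c' p" and "J = jacobian c c' p"
  let ?G = "metric_coord M c" and ?G' = "metric_coord M c'" and ?D = "metric_deriv M c" and ?D' = "metric_deriv M c'"
  let ?S = "ovl c c'"
  have x: "x \<in> ?S" "x \<in> cimg c" "x' \<in> cimg c'" "cinv c x = p" "tr c c' x = x'"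
    using ch by (auto simp: x_def x'_def)
  have linJ: "linear J" unfolding J_def by (rule linear_jacobian[OF c])
  have Jd: "(tr c c' has_derivative J) (at x within ?S)"
    unfolding x_def J_def by (rule jacobian_has_derivative[OF c])
  \<comment> \<open>The metric in \<open>c\<close> is the pullback of the one in \<open>c'\<close>.
    Its derivative has one term from the base point and two from the Jacobian, and the latter
    contain \<open>Q\<close>.\<close>
  have D: "?D x e a d = ?D' x' (J e) (J a) (J d) + ?G' x' (Q e a) (J d) + ?G' x' (J a) (Q e d)" for a d e
  proof -
    have "((\<lambda>y. ?G' (tr c c' y) (jacobian c c' (cinv c y) a) (jacobian c c' (cinv c y) d)) has_derivative
      (\<lambda>e. ?D' x' (J e) (jacobian c c' (cinv c x) a) (jacobian c c' (cinv c x) d)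
        + ?G' (tr c c' x) (Q e a) (jacobian c c' (cinv c x) d) + ?G' (tr c c' x) (jacobian c c' (cinv c x) a) (Q e d))) (at x within ?S)"
    proof (rule has_derivative_bilinear_family[OF x(1)])
      fix y assume "y \<in> ?S"
      then show "bilinear (?G' (tr c c' y))" using ch by (intro metric_coord_bilinear) auto
    next
      fix e show "bilinear (?D' x' (J e))" using ch x by (intro metric_deriv_bilinear) auto
    next
      fix i j :: "'e \<times> real"
      have sub: "tr c c' ` ?S \<subseteq> cimg c'" using ch by auto
      show "((\<lambda>y. ?G' (tr c c' y) i j) has_derivative (\<lambda>e. ?D' x' (J e) i j)) (at x within ?S)"
        by (rule has_derivative_in_compose[where g' = "\<lambda>e. ?D' x' e i j", OF Jd])
          (use has_derivative_subset[OF metric_deriv_has_derivative sub] x ch in auto)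
    qed (use Q(1) in \<open>simp_all add: x_def\<close>)
    then have "((\<lambda>y. ?G y a d) has_derivative
      (\<lambda>e. ?D' x' (J e) (jacobian c c' (cinv c x) a) (jacobian c c' (cinv c x) d)
        + ?G' (tr c c' x) (Q e a) (jacobian c c' (cinv c x) d) + ?G' (tr c c' x) (jacobian c c' (cinv c x) a) (Q e d))) (at x within ?S)"
      by (rule has_derivative_transform_within[OF _ zero_less_one x(1)])
        (rule metric_coord_tr[symmetric], use ch in auto)
    moreover have "((\<lambda>y. ?G y a d) has_derivative (\<lambda>e. ?D x e a d)) (at x within ?S)"
      by (rule has_derivative_subset[OF metric_deriv_has_derivative[OF _ x(2)]]) (use ch in auto)
    ultimately have "(\<lambda>e. ?D' x' (J e) (jacobian c c' (cinv c x) a) (jacobian c c' (cinv c x) d)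
        + ?G' (tr c c' x) (Q e a) (jacobian c c' (cinv c x) d) + ?G' (tr c c' x) (jacobian c c' (cinv c x) a) (Q e d)) = (\<lambda>e. ?D x e a d)"
      using has_derivative_within_unique_thick[OF thick_half_space openin_ovl[of c c'] x(1)] ch by blast
    from fun_cong[OF this, of e] show ?thesis unfolding x(5) unfolding x(4) J_def by simp
  qed
  have surj: "\<exists>d. J d = d'" for d'
    using jacobian_comp[OF c(2,1,2), of d'] jacobian_id[OF c(2), of d'] unfolding J_def by metis
  show ?thesis
  proof (rule metric_coord_cancel[of c' x'])
    fix d'
    obtain d where d: "J d = d'" using surj by blast
    have b: "bilinear (?G' x')" using metric_coord_bilinear ch x by auto
    have s: "?G' x' u v = ?G' x' v u" for u v by (rule metric_coord_sym) (use ch x in auto)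
    have "?G' x' (J (christoffel M c x a a)) (J d) = ?G x (christoffel M c x a a) d"
      using metric_coord_tr[of c c' x "christoffel M c x a a" d] ch x by (simp add: J_def)
    also have "\<dots> = ?D x a a d - ?D x d a a / 2" by (rule christoffel_eq) (use ch x in auto)
    \<comment> \<open>The terms with \<open>Q a d\<close> and \<open>Q d a\<close> cancel by the
      symmetry of \<open>Q\<close> and of the metric, and only the one with \<open>Q a a\<close>
      survives.\<close>
    also have "\<dots> = ?D' x' (J a) (J a) (J d) - ?D' x' (J d) (J a) (J a) / 2 + ?G' x' (Q a a) (J d)"
      unfolding D[of a a d] D[of d a a] using Q(2)[of a d] s[of "J a" "Q d a"] by (simp add: field_simps)
    also have "\<dots> = ?G' x' (christoffel M c' x' (J a) (J a)) (J d) + ?G' x' (Q a a) (J d)"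
      by (subst christoffel_eq) (use ch x in auto)
    finally have "?G' x' (J (christoffel M c x a a)) d' = ?G' x' (christoffel M c' x' (J a) (J a)) d' + ?G' x' (Q a a) d'"
      unfolding d .
    then show "?G' x' (jacobian c c' p (christoffel M c (cmap c p) a a) - Q a a) d' =
      ?G' x' (christoffel M c' (cmap c' p) (jacobian c c' p a) (jacobian c c' p a)) d'"
      unfolding x_def[symmetric] x'_def[symmetric] J_def[symmetric] bilinear_lsub[OF b] by simp
  qed (use ch x in auto)
qed

lemma second_derivative_tr:
  assumes c: "c \<in> charts_at M p" "c' \<in> charts_at M p"
  obtains Q where
    "\<And>d. ((\<lambda>y. jacobian c c' (cinv c y) d) has_derivative (\<lambda>e. Q e d)) (at (cmap c p) within ovl c c')"
    "\<And>d e. Q e d = Q d e"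
proof -
  note ch = c[unfolded charts_at_iff]
  have x: "cmap c p \<in> ovl c c'" using ch by auto
  have op: "openin (top_of_set half_space) (ovl c c')" "smooth_on (ovl c c') (tr c c')"
    using openin_ovl smooth_tr ch by auto
  obtain Q where Q: "\<And>d. ((\<lambda>y. frechet_derivative (tr c c') (at y within ovl c c') d) has_derivative (\<lambda>e. Q e d)) (at (cmap c p) within ovl c c')"
    "\<And>d e. Q e d = Q d e"
    using smooth_on_second_derivative[OF op(2) thick_half_space op(1) x] by blast
  show thesis
  proof (rule that[OF _ Q(2)])
    fix d
    show "((\<lambda>y. jacobian c c' (cinv c y) d) has_derivative (\<lambda>e. Q e d)) (at (cmap c p) within ovl c c')"
      by (rule has_derivative_transform_within[OF Q(1) zero_less_one x])
        (use jacobian_cinv ch in auto)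
  qed
qed

section \<open>Geodesics as solutions of a differential equation in a chart\<close>

lemma geodesicD:
  assumes "geodesic M I \<gamma> V" "t \<in> I"
  shows "V t \<in> tangent_space M (\<gamma> t)"
    "c \<in> charts_at M (\<gamma> t) \<Longrightarrow> ((\<lambda>s. cmap c (\<gamma> s)) has_vector_derivative V t c) (at t within I)"
    "c \<in> charts_at M (\<gamma> t) \<Longrightarrow> ((\<lambda>s. V s c) has_vector_derivative
              - christoffel M c (cmap c (\<gamma> t)) (V t c) (V t c)) (at t within I)"
  using assms unfolding geodesic_def by blast+

lemma geodesic_interval: "geodesic M I \<gamma> V \<Longrightarrow> is_interval I"
  and geodesic_continuous: "geodesic M I \<gamma> V \<Longrightarrow> continuous_on I \<gamma>"
  unfolding geodesic_def by blast+

lemma geodesic_subset: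
  assumes "geodesic M I \<gamma> V" "J \<subseteq> I" "is_interval J"
  shows "geodesic M J \<gamma> V"
  using assms unfolding geodesic_def
  by (meson continuous_on_subset has_vector_derivative_within_subset subsetD)

text \<open>By the transformation law, the geodesic equation in one chart implies it in all charts.\<close>

lemma geodesic_chart_curve:
  assumes c: "c \<in> charts M" and I: "is_interval I"
    and x: "\<And>t. t \<in> I \<Longrightarrow> x t \<in> cimg c"
    and x': "\<And>t. t \<in> I \<Longrightarrow> (x has_vector_derivative v t) (at t within I)"
    and v': "\<And>t. t \<in> I \<Longrightarrow> (v has_vector_derivative - christoffel M c (x t) (v t) (v t)) (at t within I)"
  shows "geodesic M I (\<lambda>t. cinv c (x t)) (\<lambda>t. tvec_of M c (cinv c (x t)) (v t))"
  unfolding geodesic_def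
proof (intro conjI ballI I)
  have contx: "continuous_on I x"
    using x' unfolding continuous_on_eq_continuous_within by (meson has_vector_derivative_continuous)
  show "continuous_on I (\<lambda>t. cinv c (x t))"
    by (rule continuous_on_compose2[OF cont_cinv[OF c] contx]) (use x in auto)
  fix t assume t: "t \<in> I"
  define p where "p = cinv c (x t)"
  have cp: "c \<in> charts_at M p" "cmap c p = x t" using c x[OF t] by (simp_all add: p_def charts_at_iff)
  show "tvec_of M c (cinv c (x t)) (v t) \<in> tangent_space M (cinv c (x t))"
    using tvec_of_tangent[OF cp(1)] by (simp add: p_def)
  fix c' assume "c' \<in> charts_at M (cinv c (x t))"
  then have c': "c' \<in> charts_at M p" by (simp add: p_def)
  note ch = cp(1)[unfolded charts_at_iff] c'[unfolded charts_at_iff]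
  let ?S = "ovl c c'"
  have xS: "x t \<in> ?S" using ch cp(2) by force
  obtain r where r: "r > 0" "ball (x t) r \<inter> half_space \<subseteq> ?S"
    using openin_ovl[of c c'] xS ch unfolding openin_contains_ball by blast
  have "continuous (at t within I) x" using contx t by (simp add: continuous_on_eq_continuous_within)
  then obtain d where d: "d > 0" "\<And>s. s \<in> I \<Longrightarrow> dist s t < d \<Longrightarrow> dist (x s) (x t) < r"
    using r(1) unfolding continuous_within_eps_delta by blast
  \<comment> \<open>Near \<open>t\<close> the curve stays in the overlap of the two charts, and
    derivatives at \<open>t\<close> depend only on this part of it.\<close>
  define J where "J = I \<inter> ball t d"
  have J: "t \<in> J" "J \<subseteq> I" using t d(1) by (auto simp: J_def)
  have xJ: "x s \<in> ?S" if "s \<in> J" for s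
  proof -
    have "x s \<in> half_space" using x cimg_half[OF c] that by (auto simp: J_def)
    then show ?thesis using r(2) d(2)[of s] that by (auto simp: J_def dist_commute)
  qed
  have atJ: "at t within I = at t within J"
    by (rule at_within_nhd[of t "ball t d"]) (use d(1) in \<open>auto simp: J_def\<close>)
  note x'J = x'[OF t, unfolded atJ has_vector_derivative_def] and v'J = v'[OF t, unfolded atJ]
  obtain Q where Q: "\<And>d. ((\<lambda>y. jacobian c c' (cinv c y) d) has_derivative (\<lambda>e. Q e d)) (at (cmap c p) within ?S)"
    "\<And>d e. Q e d = Q d e" using second_derivative_tr[OF cp(1) c'] by blast
  have sub: "x ` J \<subseteq> ?S" using xJ by auto
  have J1: "((\<lambda>s. tr c c' (x s)) has_derivative (\<lambda>h. jacobian c c' p (h *\<^sub>R v t))) (at t within J)"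
    by (rule has_derivative_in_compose[where g' = "jacobian c c' p", OF x'J])
      (use has_derivative_subset[OF jacobian_has_derivative[OF cp(1) c'] sub] cp in simp)
  have Vt: "tvec_of M c (cinv c (x s)) (v s) c' = jacobian c c' (cinv c (x s)) (v s)" if "s \<in> J" for s
  proof -
    have "cinv c (x s) \<in> cdom c'" using xJ[OF that] c by auto
    then show ?thesis using ch by (simp add: tvec_of_def charts_at_iff)
  qed
  show "((\<lambda>s. cmap c' (cinv c (x s))) has_vector_derivative tvec_of M c (cinv c (x t)) (v t) c') (at t within I)"
    using J1 unfolding has_vector_derivative_def atJ Vt[OF J(1)] linear_scale[OF linear_jacobian[OF cp(1) c']]
    by (simp only: p_def)
  have lin: "linear (jacobian c c' (cinv c (x s)))" if "s \<in> J" for s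
    by (rule linear_jacobian) (use xJ[OF that] c ch in \<open>auto simp: charts_at_iff\<close>)
  have Qd: "((\<lambda>s. jacobian c c' (cinv c (x s)) i) has_derivative (\<lambda>h. Q (h *\<^sub>R v t) i)) (at t within J)" for i
    by (rule has_derivative_in_compose[where g' = "\<lambda>e. Q e i" and f = x and g = "\<lambda>y. jacobian c c' (cinv c y) i", OF x'J])
      (use has_derivative_subset[OF Q(1) sub] cp in simp)
  have linQ: "linear (\<lambda>e. Q e d)" for d using Q(1) has_derivative_linear by blast
  have linQ': "linear (Q e)" for e
  proof -
    have "Q e = (\<lambda>d. Q d e)" by (rule ext) (rule Q(2))
    then show ?thesis using linQ[of e] by simp
  qed
  \<comment> \<open>The Jacobian is known to be differentiable only when applied to fixed vectors,
    so \<open>v s\<close> is expanded in the basis first.\<close>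
  have "((\<lambda>s. \<Sum>i\<in>Basis. (v s \<bullet> i) *\<^sub>R jacobian c c' (cinv c (x s)) i) has_derivative
    (\<lambda>h. \<Sum>i\<in>Basis. (v t \<bullet> i) *\<^sub>R Q (h *\<^sub>R v t) i +
      ((h *\<^sub>R - christoffel M c (x t) (v t) (v t)) \<bullet> i) *\<^sub>R jacobian c c' (cinv c (x t)) i)) (at t within J)"
    using v'J unfolding has_vector_derivative_def
    by (intro has_derivative_sum has_derivative_scaleR Qd has_derivative_inner_left)
  moreover have "(\<Sum>i\<in>Basis. (v t \<bullet> i) *\<^sub>R Q (h *\<^sub>R v t) i +
      ((h *\<^sub>R - christoffel M c (x t) (v t) (v t)) \<bullet> i) *\<^sub>R jacobian c c' (cinv c (x t)) i)
    = h *\<^sub>R (Q (v t) (v t) - jacobian c c' p (christoffel M c (x t) (v t) (v t)))" for h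
  proof -
    have e: "(\<Sum>i\<in>Basis. (a \<bullet> i) *\<^sub>R L i) = L a" if "linear L" for a and L :: "'e \<times> real \<Rightarrow> 'e \<times> real"
    proof -
      have "L a = L (\<Sum>i\<in>Basis. (a \<bullet> i) *\<^sub>R i)" by (simp only: euclidean_representation)
      then show ?thesis using that by (simp only: linear_sum linear_scale)
    qed
    have J': "linear (jacobian c c' p)" by (rule linear_jacobian[OF cp(1) c'])
    show ?thesis
      unfolding sum.distrib e[OF linQ'] p_def[symmetric] e[OF J']
      by (simp only: linear_scale[OF linQ] linear_scale[OF J'] linear_neg[OF J'] scaleR_right_diff_distrib) simp
  qed
  ultimately have "((\<lambda>s. \<Sum>i\<in>Basis. (v s \<bullet> i) *\<^sub>R jacobian c c' (cinv c (x s)) i) has_vector_derivative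
    (Q (v t) (v t) - jacobian c c' p (christoffel M c (x t) (v t) (v t)))) (at t within J)"
    by (simp only: has_vector_derivative_def)
  moreover have "(\<Sum>i\<in>Basis. (v s \<bullet> i) *\<^sub>R jacobian c c' (cinv c (x s)) i) = tvec_of M c (cinv c (x s)) (v s) c'"
    if "s \<in> J" for s
  proof -
    have "jacobian c c' (cinv c (x s)) (v s) = jacobian c c' (cinv c (x s)) (\<Sum>i\<in>Basis. (v s \<bullet> i) *\<^sub>R i)"
      by (simp only: euclidean_representation)
    then show ?thesis unfolding Vt[OF that] by (simp only: linear_sum[OF lin[OF that]] linear_scale[OF lin[OF that]])
  qed
  ultimately have "((\<lambda>s. tvec_of M c (cinv c (x s)) (v s) c') has_vector_derivative
    (Q (v t) (v t) - jacobian c c' p (christoffel M c (x t) (v t) (v t)))) (at t within J)"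
    using J(1) has_vector_derivative_transform by (metis (no_types, lifting))
  moreover have "Q (v t) (v t) - jacobian c c' p (christoffel M c (x t) (v t) (v t)) =
    - christoffel M c' (cmap c' p) (jacobian c c' p (v t)) (jacobian c c' p (v t))"
    using christoffel_tr[OF cp(1) c' Q, of "v t"] cp(2) by (metis minus_diff_eq)
  ultimately show "((\<lambda>s. tvec_of M c (cinv c (x s)) (v s) c') has_vector_derivative
      - christoffel M c' (cmap c' (cinv c (x t))) (tvec_of M c (cinv c (x t)) (v t) c') (tvec_of M c (cinv c (x t)) (v t) c'))
     (at t within I)"
    unfolding atJ Vt[OF J(1)] p_def by simp
qed

lemma geodesic_nhd:
  assumes g: "geodesic M I \<gamma> V" and a: "a \<in> I" and c: "c \<in> charts_at M (\<gamma> a)" and e: "e > 0"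
  shows "\<exists>\<delta>>0. \<forall>t\<in>I. \<bar>t - a\<bar> < \<delta> \<longrightarrow> \<gamma> t \<in> cdom c \<and>
    norm (cmap c (\<gamma> t) - cmap c (\<gamma> a)) < e \<and> norm (V t c - V a c) < e"
proof -
  note ch = c[unfolded charts_at_iff]
  have "continuous (at a within I) \<gamma>"
    using geodesic_continuous[OF g] a by (simp add: continuous_on_eq_continuous_within)
  then have "\<forall>\<^sub>F t in at a within I. \<gamma> t \<in> cdom c"
    using ch chartD(1) unfolding continuous_within by (blast intro: topological_tendstoD)
  moreover have "continuous (at a within I) (\<lambda>t. cmap c (\<gamma> t))" "continuous (at a within I) (\<lambda>t. V t c)"
    using geodesicD(2,3)[OF g a c] has_vector_derivative_continuous by blast+
  then have "\<forall>\<^sub>F t in at a within I. dist (cmap c (\<gamma> t)) (cmap c (\<gamma> a)) < e" "\<forall>\<^sub>F t in at a within I. dist (V t c) (V a c) < e"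
    using e unfolding continuous_within by (auto intro: tendstoD)
  ultimately have "\<forall>\<^sub>F t in at a within I. \<gamma> t \<in> cdom c \<and>
    norm (cmap c (\<gamma> t) - cmap c (\<gamma> a)) < e \<and> norm (V t c - V a c) < e"
    by eventually_elim (auto simp: dist_norm)
  then obtain \<delta> where \<delta>: "\<delta> > 0" "\<And>t. t \<in> I \<Longrightarrow> t \<noteq> a \<Longrightarrow> dist t a < \<delta> \<Longrightarrow> \<gamma> t \<in> cdom c \<and>
    norm (cmap c (\<gamma> t) - cmap c (\<gamma> a)) < e \<and> norm (V t c - V a c) < e"
    unfolding eventually_at by blast
  show ?thesis
  proof (intro exI conjI ballI impI)
    show "\<delta> > 0" by (rule \<delta>(1))
    fix t assume "t \<in> I" "\<bar>t - a\<bar> < \<delta>"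
    then show "\<gamma> t \<in> cdom c" "norm (cmap c (\<gamma> t) - cmap c (\<gamma> a)) < e" "norm (V t c - V a c) < e"
      using \<delta>(2)[of t] ch e by (cases "t = a"; simp add: dist_real_def)+
  qed
qed

lemma geodesic_solves:
  assumes g: "geodesic M I \<gamma> V" and m: "local_model c x0 v0 r K F" and c: "c \<in> charts M" and J: "J \<subseteq> I"
    and near: "\<And>t. t \<in> J \<Longrightarrow> \<gamma> t \<in> cdom c \<and> norm (cmap c (\<gamma> t) - x0) \<le> r \<and> norm (V t c - v0) \<le> r"
  shows "solves F J (\<lambda>t. (cmap c (\<gamma> t), V t c))"
  unfolding solves_def
proof
  fix t assume t: "t \<in> J"
  then have ct: "c \<in> charts_at M (\<gamma> t)" using near c by (auto simp: charts_at_iff)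
  have "cmap c (\<gamma> t) \<in> cball x0 r \<inter> half_space" "V t c \<in> cball v0 r"
    using near[OF t] cimg_half[OF c] by (auto simp: dist_norm norm_minus_commute)
  then have F: "F (cmap c (\<gamma> t), V t c) = (V t c, - christoffel M c (cmap c (\<gamma> t)) (V t c) (V t c))"
    using m unfolding local_model_def by blast
  show "((\<lambda>t. (cmap c (\<gamma> t), V t c)) has_vector_derivative F (cmap c (\<gamma> t), V t c)) (at t within J)"
    unfolding F
    using has_vector_derivative_within_subset[OF geodesicD(2)[OF g subsetD[OF J t] ct] J]
      has_vector_derivative_within_subset[OF geodesicD(3)[OF g subsetD[OF J t] ct] J]
    by (rule has_vector_derivative_Pair)
qed

text \<open>The first component of \<open>F\<close> is the velocity even at positions outside the
  half-space. Position and velocity of a trajectory thus remain linked after it has crossed the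
  boundary, which is needed to locate the exit.\<close>

lemma local_model_fst:
  assumes "local_model c x0 v0 r K F" "solves F I z" "t \<in> I" "norm (snd (z t) - v0) \<le> r"
  shows "((\<lambda>t. fst (z t)) has_vector_derivative snd (z t)) (at t within I)"
proof -
  have "snd (z t) \<in> cball v0 r" using assms(4) by (simp add: dist_norm norm_minus_commute)
  then have F: "fst (F (z t)) = snd (z t)"
    using assms(1) unfolding local_model_def by (metis prod.collapse)
  have "(z has_derivative (\<lambda>h. h *\<^sub>R F (z t))) (at t within I)"
    using assms(2,3) unfolding solves_def has_vector_derivative_def by blast
  from has_derivative_fst[OF this] show ?thesis
    by (simp add: has_vector_derivative_def F)
qed

lemma local_model_snd:
  assumes "local_model c x0 v0 r K F" "solves F I z" "t \<in> I" "norm (snd (z t) - v0) \<le> r"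
    "norm (fst (z t) - x0) \<le> r" "0 \<le> snd (fst (z t))"
  shows "((\<lambda>t. snd (z t)) has_vector_derivative - christoffel M c (fst (z t)) (snd (z t)) (snd (z t))) (at t within I)"
proof -
  have "fst (z t) \<in> cball x0 r \<inter> half_space" "snd (z t) \<in> cball v0 r"
    using assms(4-6) by (auto simp: half_space_def dist_norm norm_minus_commute)
  then have "F (fst (z t), snd (z t)) = (snd (z t), - christoffel M c (fst (z t)) (snd (z t)) (snd (z t)))"
    using assms(1) unfolding local_model_def by blast
  then have F: "snd (F (z t)) = - christoffel M c (fst (z t)) (snd (z t)) (snd (z t))" by simp
  have "(z has_derivative (\<lambda>h. h *\<^sub>R F (z t))) (at t within I)"
    using assms(2,3) unfolding solves_def has_vector_derivative_def by blast
  from has_derivative_snd[OF this] show ?thesis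
    by (simp add: has_vector_derivative_def F)
qed

text \<open>A trajectory of \<open>F\<close> represents a geodesic only while it stays near the base
  data and in the half-space. Beyond the boundary, \<open>F\<close> is merely an auxiliary field
  without geometric meaning.\<close>

lemma solves_geodesic:
  assumes m: "local_model c x0 v0 r K F" and c: "c \<in> charts M" and I: "is_interval I" and z: "solves F I z"
    and near: "\<And>t. t \<in> I \<Longrightarrow> norm (fst (z t) - x0) \<le> r \<and> norm (snd (z t) - v0) \<le> r \<and> 0 \<le> snd (fst (z t))"
  shows "geodesic M I (\<lambda>t. cinv c (fst (z t))) (\<lambda>t. tvec_of M c (cinv c (fst (z t))) (snd (z t)))"
    "\<And>t. t \<in> I \<Longrightarrow> fst (z t) \<in> cimg c"
proof -
  have B: "fst (z t) \<in> cball x0 r \<inter> half_space" "snd (z t) \<in> cball v0 r" if "t \<in> I" for t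
    using near[OF that] by (auto simp: half_space_def dist_norm norm_minus_commute)
  show img: "fst (z t) \<in> cimg c" if "t \<in> I" for t
    using m B(1)[OF that] unfolding local_model_def metric_bounds_def by blast
  show "geodesic M I (\<lambda>t. cinv c (fst (z t))) (\<lambda>t. tvec_of M c (cinv c (fst (z t))) (snd (z t)))"
  proof (rule geodesic_chart_curve[OF c I img])
    fix t assume t: "t \<in> I"
    show "((\<lambda>t. fst (z t)) has_vector_derivative snd (z t)) (at t within I)"
      by (rule local_model_fst[OF m z t]) (use near[OF t] in blast)
    show "((\<lambda>t. snd (z t)) has_vector_derivative - christoffel M c (fst (z t)) (snd (z t)) (snd (z t))) (at t within I)"
      by (rule local_model_snd[OF m z t]) (use near[OF t] in blast)+
  qed auto
qed

lemma local_model_close: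
  assumes m: "local_model c x0 v0 r K F" and "solves F {s..t} z" "solves F {s..t} z'" "s \<le> t"
  shows "norm (z t - z' t) \<le> exp (K * (t - s)) * norm (z s - z' s)"
    "norm (z s - z' s) \<le> exp (K * (t - s)) * norm (z t - z' t)"
  using solves_close[of K UNIV F s t z z'] m assms(2-4) unfolding local_model_def by auto

text \<open>Agreement is locally constant along \<open>I\<close>, which is connected. Near a time of
  different positions the Hausdorff property keeps the curves apart; near a time at which only the
  velocities differ, continuity does. Near common data both curves solve the same Lipschitz
  equation.\<close>

lemma geodesic_unique:
  assumes g: "geodesic M I \<gamma> V" and g': "geodesic M I \<gamma>' V'"
    and t0: "t0 \<in> I" "\<gamma> t0 = \<gamma>' t0" "V t0 = V' t0" and t: "t \<in> I"
  shows "\<gamma> t = \<gamma>' t \<and> V t = V' t"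
proof (rule connected_induction_simple[of I t0 t "\<lambda>t. \<gamma> t = \<gamma>' t \<and> V t = V' t"])
  have intI: "is_interval I" by (rule geodesic_interval[OF g])
  then show "connected I" by (rule is_interval_connected)
  fix a assume a: "a \<in> I"
  let ?P = "\<lambda>t. \<gamma> t = \<gamma>' t \<and> V t = V' t"
  have "\<exists>\<delta>>0. \<forall>x\<in>I. \<forall>y\<in>I. \<bar>x - a\<bar> < \<delta> \<longrightarrow> \<bar>y - a\<bar> < \<delta> \<longrightarrow> ?P x \<longrightarrow> ?P y"
  proof (cases "\<gamma> a = \<gamma>' a")
    case False
    then obtain U W where UW: "open U" "open W" "\<gamma> a \<in> U" "\<gamma>' a \<in> W" "U \<inter> W = {}" by (meson hausdorff)
    have "\<forall>\<^sub>F t in at a within I. \<gamma> t \<in> U" "\<forall>\<^sub>F t in at a within I. \<gamma>' t \<in> W"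
      using geodesic_continuous[OF g] geodesic_continuous[OF g'] a UW(1-4)
      unfolding continuous_on_def by (blast intro: topological_tendstoD)+
    then have "\<forall>\<^sub>F t in at a within I. \<gamma> t \<noteq> \<gamma>' t" by eventually_elim (use UW(5) in auto)
    then obtain \<delta> where \<delta>: "\<delta> > 0" "\<And>t. t \<in> I \<Longrightarrow> t \<noteq> a \<Longrightarrow> dist t a < \<delta> \<Longrightarrow> \<gamma> t \<noteq> \<gamma>' t"
      unfolding eventually_at by blast
    have "\<gamma> x \<noteq> \<gamma>' x" if "x \<in> I" "\<bar>x - a\<bar> < \<delta>" for x
      using \<delta>(2)[of x] that False by (cases "x = a") (auto simp: dist_real_def)
    then show ?thesis using \<delta>(1) by blast
  next
    case True
    obtain c where c: "c \<in> charts_at M (\<gamma> a)" using ex_chart by blast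
    then have c': "c \<in> charts_at M (\<gamma>' a)" using True by simp
    note ch = c[unfolded charts_at_iff]
    show ?thesis
    proof (cases "V a = V' a")
      case False
      then have "V a c \<noteq> V' a c"
        using tangent_space_eqI[OF geodesicD(1)[OF g a] geodesicD(1)[OF g' a, folded True] c] by blast
      then have e: "norm (V a c - V' a c) / 2 > 0" by simp
      obtain \<delta>1 where \<delta>1: "\<delta>1 > 0" "\<forall>t\<in>I. \<bar>t - a\<bar> < \<delta>1 \<longrightarrow> \<gamma> t \<in> cdom c \<and>
          norm (cmap c (\<gamma> t) - cmap c (\<gamma> a)) < norm (V a c - V' a c) / 2 \<and> norm (V t c - V a c) < norm (V a c - V' a c) / 2"
        using geodesic_nhd[OF g a c e] by blast
      obtain \<delta>2 where \<delta>2: "\<delta>2 > 0" "\<forall>t\<in>I. \<bar>t - a\<bar> < \<delta>2 \<longrightarrow> \<gamma>' t \<in> cdom c \<and>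
          norm (cmap c (\<gamma>' t) - cmap c (\<gamma>' a)) < norm (V a c - V' a c) / 2 \<and> norm (V' t c - V' a c) < norm (V a c - V' a c) / 2"
        using geodesic_nhd[OF g' a c' e] by blast
      have "V x \<noteq> V' x" if "x \<in> I" "\<bar>x - a\<bar> < min \<delta>1 \<delta>2" for x
      proof
        assume "V x = V' x"
        then have "norm (V a c - V' a c) \<le> norm (V x c - V a c) + norm (V' x c - V' a c)"
          using norm_triangle_ineq4[of "V' x c - V' a c" "V x c - V a c"] by simp
        then show False using \<delta>1(2)[rule_format, of x] \<delta>2(2)[rule_format, of x] that by linarith
      qed
      then show ?thesis using \<delta>1(1) \<delta>2(1) by (intro exI[of _ "min \<delta>1 \<delta>2"]) auto
    next
      case Va: True
      obtain r K F where m: "local_model c (cmap c (\<gamma> a)) (V a c) r K F"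
        using local_model_ex[of c "cmap c (\<gamma> a)" "V a c"] ch by blast
      then have r: "r > 0" unfolding local_model_def by blast
      obtain \<delta>1 where \<delta>1: "\<delta>1 > 0" "\<forall>t\<in>I. \<bar>t - a\<bar> < \<delta>1 \<longrightarrow>
         \<gamma> t \<in> cdom c \<and> norm (cmap c (\<gamma> t) - cmap c (\<gamma> a)) < r \<and> norm (V t c - V a c) < r"
        using geodesic_nhd[OF g a c r] by blast
      obtain \<delta>2 where \<delta>2: "\<delta>2 > 0" "\<forall>t\<in>I. \<bar>t - a\<bar> < \<delta>2 \<longrightarrow>
         \<gamma>' t \<in> cdom c \<and> norm (cmap c (\<gamma>' t) - cmap c (\<gamma>' a)) < r \<and> norm (V' t c - V' a c) < r"
        using geodesic_nhd[OF g' a c' r] by blast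
      define J where "J = I \<inter> {a - min \<delta>1 \<delta>2 <..< a + min \<delta>1 \<delta>2}"
      have J: "J \<subseteq> I" "is_interval J" unfolding J_def using intI by (auto intro: is_interval_Int)
      have J\<delta>: "t \<in> I \<and> \<bar>t - a\<bar> < \<delta>1 \<and> \<bar>t - a\<bar> < \<delta>2" if "t \<in> J" for t using that by (auto simp: J_def)
      have s: "solves F J (\<lambda>t. (cmap c (\<gamma> t), V t c))"
      proof (rule geodesic_solves[OF g m _ J(1)])
        fix t assume "t \<in> J"
        then show "\<gamma> t \<in> cdom c \<and> norm (cmap c (\<gamma> t) - cmap c (\<gamma> a)) \<le> r \<and> norm (V t c - V a c) \<le> r"
          using \<delta>1(2)[rule_format, of t] J\<delta>[of t] by auto
      qed (use ch in blast)
      have s': "solves F J (\<lambda>t. (cmap c (\<gamma>' t), V' t c))"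
      proof (rule geodesic_solves[OF g' m _ J(1)])
        fix t assume "t \<in> J"
        then show "\<gamma>' t \<in> cdom c \<and> norm (cmap c (\<gamma>' t) - cmap c (\<gamma> a)) \<le> r \<and> norm (V' t c - V a c) \<le> r"
          using \<delta>2(2)[rule_format, of t] J\<delta>[of t] True Va by auto
      qed (use ch in blast)
      have "?P y" if xy: "x \<in> J" "y \<in> J" and P: "?P x" for x y
      proof -
        have "{x..y} \<subseteq> J" "{y..x} \<subseteq> J" using J(2) xy unfolding is_interval_1 by (meson atLeastAtMost_iff subsetI)+
        note sub = this
        have so: "solves F {x..y} (\<lambda>t. (cmap c (\<gamma> t), V t c))" "solves F {y..x} (\<lambda>t. (cmap c (\<gamma> t), V t c))"
          "solves F {x..y} (\<lambda>t. (cmap c (\<gamma>' t), V' t c))" "solves F {y..x} (\<lambda>t. (cmap c (\<gamma>' t), V' t c))"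
          by (rule solves_subset[OF s sub(1)] solves_subset[OF s sub(2)] solves_subset[OF s' sub(1)] solves_subset[OF s' sub(2)])+
        have z: "(cmap c (\<gamma> x), V x c) - (cmap c (\<gamma>' x), V' x c) = 0"
          using P by (simp only: diff_self)
        have "norm ((cmap c (\<gamma> y), V y c) - (cmap c (\<gamma>' y), V' y c)) \<le> 0"
        \<comment> \<open>The time \<open>x\<close> of agreement may precede or follow
          \<open>y\<close>; the comparison estimate holds in both time directions.\<close>
        proof (cases "x \<le> y")
          case True
          show ?thesis using local_model_close(1)[OF m so(1) so(3) True] unfolding z by (simp only: norm_zero mult_zero_right)
        next
          case False
          then have "y \<le> x" by simp
          show ?thesis using local_model_close(2)[OF m so(2) so(4) \<open>y \<le> x\<close>] unfolding z by (simp only: norm_zero mult_zero_right)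
        qed
        then have "(cmap c (\<gamma> y), V y c) = (cmap c (\<gamma>' y), V' y c)" by (simp only: norm_le_zero_iff right_minus_eq)
        then have eq: "cmap c (\<gamma> y) = cmap c (\<gamma>' y)" "V y c = V' y c" by blast+
        have y: "y \<in> I" "\<gamma> y \<in> cdom c" "\<gamma>' y \<in> cdom c" using \<delta>1(2) \<delta>2(2) J\<delta>[OF xy(2)] by blast+
        have "\<gamma> y = cinv c (cmap c (\<gamma> y))" using y(2) ch by simp
        also have "\<dots> = \<gamma>' y" unfolding eq(1) using y(3) ch by simp
        finally have "\<gamma> y = \<gamma>' y" .
        moreover have "V y = V' y"
        proof (rule tangent_space_eqI[of _ "\<gamma> y" _ c])
          show "V' y \<in> tangent_space M (\<gamma> y)" using geodesicD(1)[OF g' y(1)] \<open>\<gamma> y = \<gamma>' y\<close> by simp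
        qed (use geodesicD(1)[OF g y(1)] eq(2) y(2) ch in \<open>simp_all add: charts_at_iff\<close>)
        ultimately show ?thesis by simp
      qed
      moreover have "x \<in> J" if "x \<in> I" "\<bar>x - a\<bar> < min \<delta>1 \<delta>2" for x using that unfolding J_def by force
      ultimately show ?thesis using \<delta>1(1) \<delta>2(1) by (intro exI[of _ "min \<delta>1 \<delta>2"]) auto
    qed
  qed
  then obtain \<delta> where \<delta>: "\<delta> > 0" "\<And>x y. x \<in> I \<Longrightarrow> y \<in> I \<Longrightarrow> \<bar>x - a\<bar> < \<delta> \<Longrightarrow> \<bar>y - a\<bar> < \<delta> \<Longrightarrow> ?P x \<Longrightarrow> ?P y" by blast
  show "\<exists>T. openin (top_of_set I) T \<and> a \<in> T \<and> (\<forall>x\<in>T. \<forall>y\<in>T. ?P x \<longrightarrow> ?P y)"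
  proof (intro exI[of _ "I \<inter> ball a \<delta>"] conjI ballI impI)
    show "openin (top_of_set I) (I \<inter> ball a \<delta>)" by blast
    show "a \<in> I \<inter> ball a \<delta>" using a \<delta>(1) by simp
    fix x y assume "x \<in> I \<inter> ball a \<delta>" "y \<in> I \<inter> ball a \<delta>" "?P x"
    then show "\<gamma> y = \<gamma>' y" "V y = V' y" using \<delta>(2)[of x y] by (auto simp: dist_real_def abs_minus_commute)
  qed
qed (use t0 t in auto)

lemma geodesic_concat:
  assumes ab: "a \<le> b" "b \<le> d" and g: "geodesic M {a..b} \<gamma> V" and g': "geodesic M {b..d} \<gamma>' V'"
    and eq: "\<gamma> b = \<gamma>' b" "V b = V' b"
  shows "geodesic M {a..d} (\<lambda>t. if t \<le> b then \<gamma> t else \<gamma>' t) (\<lambda>t. if t \<le> b then V t else V' t)"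
  unfolding geodesic_def
proof (intro conjI ballI)
  show "is_interval {a..d}" by (simp add: is_interval_cc)
  have "continuous_on ({a..b} \<union> {b..d}) (\<lambda>t. if t \<le> b then \<gamma> t else \<gamma>' t)"
    by (rule continuous_on_If) (use geodesic_continuous[OF g] geodesic_continuous[OF g'] eq in \<open>auto simp: order.antisym\<close>)
  moreover have "{a..b} \<union> {b..d} = {a..d}" using ab by auto
  ultimately show "continuous_on {a..d} (\<lambda>t. if t \<le> b then \<gamma> t else \<gamma>' t)" by simp
  fix t assume t: "t \<in> {a..d}"
  have 1: "t \<in> {a..b}" if "t \<le> b" using t that by auto
  have 2: "t \<in> {b..d}" "t = b \<or> \<not> t \<le> b" if "b \<le> t" using t that by auto
  show "(if t \<le> b then V t else V' t) \<in> tangent_space M (if t \<le> b then \<gamma> t else \<gamma>' t)"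
    using geodesicD(1)[OF g 1] geodesicD(1)[OF g' 2(1)] by auto
  fix c assume c: "c \<in> charts_at M (if t \<le> b then \<gamma> t else \<gamma>' t)"
  have "((\<lambda>s. if s \<le> b then cmap c (\<gamma> s) else cmap c (\<gamma>' s)) has_vector_derivative (if t \<le> b then V t else V' t) c) (at t within {a..d})"
  proof (rule has_vector_derivative_concat[OF ab _ t])
    show "((\<lambda>s. cmap c (\<gamma> s)) has_vector_derivative (if t \<le> b then V t else V' t) c) (at t within {a..b})" if "t \<le> b"
      using geodesicD(2)[OF g 1[OF that], of c] c that by simp
    show "((\<lambda>s. cmap c (\<gamma>' s)) has_vector_derivative (if t \<le> b then V t else V' t) c) (at t within {b..d})" if "b \<le> t"
      using geodesicD(2)[OF g' 2(1)[OF that], of c] 2(2)[OF that] c eq by auto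
  qed (use eq in simp)
  then show "((\<lambda>s. cmap c (if s \<le> b then \<gamma> s else \<gamma>' s)) has_vector_derivative (if t \<le> b then V t else V' t) c) (at t within {a..d})"
    by (simp only: if_distrib[of "cmap c"])
  let ?\<gamma> = "if t \<le> b then \<gamma> t else \<gamma>' t" and ?V = "if t \<le> b then V t else V' t"
  have "((\<lambda>s. if s \<le> b then V s c else V' s c) has_vector_derivative - christoffel M c (cmap c ?\<gamma>) (?V c) (?V c)) (at t within {a..d})"
  proof (rule has_vector_derivative_concat[OF ab _ t])
    show "((\<lambda>s. V s c) has_vector_derivative - christoffel M c (cmap c ?\<gamma>) (?V c) (?V c)) (at t within {a..b})" if "t \<le> b"
      using geodesicD(3)[OF g 1[OF that], of c] c that by simp
    show "((\<lambda>s. V' s c) has_vector_derivative - christoffel M c (cmap c ?\<gamma>) (?V c) (?V c)) (at t within {b..d})" if "b \<le> t"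
      using geodesicD(3)[OF g' 2(1)[OF that], of c] 2(2)[OF that] c eq by auto
  qed (use eq in simp)
  moreover have "(\<lambda>s. if s \<le> b then V s c else V' s c) = (\<lambda>s. (if s \<le> b then V s else V' s) c)" by auto
  ultimately show "((\<lambda>s. (if s \<le> b then V s else V' s) c) has_vector_derivative - christoffel M c (cmap c ?\<gamma>) (?V c) (?V c)) (at t within {a..d})"
    by simp
qed

section \<open>Bilinearity of the metric, conservation of energy and time reversal\<close>

lemma metric_sym:
  assumes "v \<in> tangent_space M p" "w \<in> tangent_space M p"
  shows "metric M p v w = metric M p w v"
proof -
  obtain c where c: "c \<in> charts_at M p" using ex_chart by blast
  then have "c \<in> charts M" "cmap c p \<in> cimg c" by (auto simp: charts_at_iff)
  then show ?thesis unfolding metric_eq[OF c assms] metric_eq[OF c assms(2,1)] by (rule metric_coord_sym)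
qed

lemma metric_tadd:
  assumes "u \<in> tangent_space M p" "v \<in> tangent_space M p" "w \<in> tangent_space M p"
  shows "metric M p (tadd u v) w = metric M p u w + metric M p v w"
    "metric M p w (tadd u v) = metric M p w u + metric M p w v"
proof -
  obtain c where c: "c \<in> charts_at M p" using ex_chart by blast
  then have b: "bilinear (metric_coord M c (cmap c p))"
    by (intro metric_coord_bilinear) (auto simp: charts_at_iff)
  show "metric M p (tadd u v) w = metric M p u w + metric M p v w"
    "metric M p w (tadd u v) = metric M p w u + metric M p w v"
    using assms by (simp_all add: metric_eq[OF c] tadd_tangent bilinear_ladd[OF b] bilinear_radd[OF b])
qed

lemma metric_tscale:
  assumes "v \<in> tangent_space M p" "w \<in> tangent_space M p"
  shows "metric M p (tscale s v) w = s * metric M p v w" "metric M p w (tscale s v) = s * metric M p w v"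
proof -
  obtain c where c: "c \<in> charts_at M p" using ex_chart by blast
  then have b: "bilinear (metric_coord M c (cmap c p))"
    by (intro metric_coord_bilinear) (auto simp: charts_at_iff)
  show "metric M p (tscale s v) w = s * metric M p v w" "metric M p w (tscale s v) = s * metric M p w v"
    using assms by (simp_all add: metric_eq[OF c] tscale_tangent bilinear_lmul[OF b] bilinear_rmul[OF b])
qed

text \<open>In a chart the derivative of the energy is the derivative of the metric along the
  velocity minus twice the pairing of the Christoffel vector with the velocity. By
  \<open>christoffel_eq\<close>, tested against the velocity itself, the two cancel.\<close>

lemma geodesic_energy:
  assumes g: "geodesic M I \<gamma> V" and st: "s \<in> I" "t \<in> I"
  shows "metric M (\<gamma> s) (V s) (V s) = metric M (\<gamma> t) (V t) (V t)"
proof -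
  have "((\<lambda>s. metric M (\<gamma> s) (V s) (V s)) has_derivative (\<lambda>h. 0)) (at t within I)" if t: "t \<in> I" for t
  proof -
    obtain c where c: "c \<in> charts_at M (\<gamma> t)" using ex_chart by blast
    note ch = c[unfolded charts_at_iff]
    obtain \<delta> where \<delta>: "\<delta> > 0" "\<forall>s\<in>I. \<bar>s - t\<bar> < \<delta> \<longrightarrow> \<gamma> s \<in> cdom c \<and>
      norm (cmap c (\<gamma> s) - cmap c (\<gamma> t)) < 1 \<and> norm (V s c - V t c) < 1"
      using geodesic_nhd[OF g t c zero_less_one] by blast
    define J where "J = I \<inter> ball t \<delta>"
    have J: "t \<in> J" "J \<subseteq> I" using t \<delta>(1) by (auto simp: J_def)
    have atJ: "at t within I = at t within J"
      by (rule at_within_nhd[of t "ball t \<delta>"]) (use \<delta>(1) in \<open>auto simp: J_def\<close>)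
    have dom: "\<gamma> s \<in> cdom c" if "s \<in> J" for s
      using \<delta>(2) that unfolding J_def by (auto simp: dist_real_def abs_minus_commute)
    have cJ: "c \<in> charts_at M (\<gamma> s)" if "s \<in> J" for s using dom[OF that] ch by (simp add: charts_at_iff)
    let ?x = "\<lambda>s. cmap c (\<gamma> s)" and ?v = "\<lambda>s. V s c"
    let ?\<Gamma> = "christoffel M c (?x t) (?v t) (?v t)"
    have x: "?x t \<in> cimg c" using ch by auto
    note bG = metric_coord_bilinear[OF conjunct1[OF ch] x]
    have x': "(?x has_derivative (\<lambda>h. h *\<^sub>R ?v t)) (at t within J)"
      and v': "(?v has_derivative (\<lambda>h. h *\<^sub>R - ?\<Gamma>)) (at t within J)"
      using geodesicD(2,3)[OF g t c] unfolding atJ has_vector_derivative_def by simp_all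
    have "((\<lambda>s. metric_coord M c (?x s) (?v s) (?v s)) has_derivative
      (\<lambda>h. metric_deriv M c (?x t) (h *\<^sub>R ?v t) (?v t) (?v t) + metric_coord M c (?x t) (h *\<^sub>R - ?\<Gamma>) (?v t)
         + metric_coord M c (?x t) (?v t) (h *\<^sub>R - ?\<Gamma>))) (at t within J)"
    proof (rule has_derivative_bilinear_family[where H' = "\<lambda>h. metric_deriv M c (?x t) (h *\<^sub>R ?v t)" and H = "\<lambda>s. metric_coord M c (?x s)",
          OF J(1) _ _ _ v' v'])
      fix s assume "s \<in> J"
      then show "bilinear (metric_coord M c (?x s))" using dom ch by (intro metric_coord_bilinear) auto
    next
      fix e :: real
      show "bilinear (metric_deriv M c (?x t) (e *\<^sub>R ?v t))" using ch by (intro metric_deriv_bilinear) auto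
    next
      fix i j :: "'e \<times> real"
      have "((\<lambda>y. metric_coord M c y i j) has_derivative (\<lambda>d. metric_deriv M c (?x t) d i j)) (at (?x t) within ?x ` J)"
        by (rule has_derivative_subset[OF metric_deriv_has_derivative[OF _ x]]) (use ch dom in auto)
      then show "((\<lambda>s. metric_coord M c (?x s) i j) has_derivative (\<lambda>e. metric_deriv M c (?x t) (e *\<^sub>R ?v t) i j)) (at t within J)"
        by (rule has_derivative_in_compose[OF x'])
    qed
    moreover have "metric_deriv M c (?x t) (h *\<^sub>R ?v t) (?v t) (?v t) + metric_coord M c (?x t) (h *\<^sub>R - ?\<Gamma>) (?v t)
         + metric_coord M c (?x t) (?v t) (h *\<^sub>R - ?\<Gamma>) = 0" for h
      using christoffel_eq[OF conjunct1[OF ch] x, of "?v t" "?v t"] metric_coord_sym[OF conjunct1[OF ch] x, of "?v t" "?\<Gamma>"]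
      by (simp add: bilinear_lmul[OF bG] bilinear_rmul[OF bG] bilinear_lneg[OF bG] bilinear_rneg[OF bG]
          linear_scale[OF metric_deriv_linear[OF conjunct1[OF ch] x]])
    ultimately have "((\<lambda>s. metric_coord M c (?x s) (?v s) (?v s)) has_derivative (\<lambda>h. 0)) (at t within J)" by simp
    then have "((\<lambda>s. metric M (\<gamma> s) (V s) (V s)) has_derivative (\<lambda>h. 0)) (at t within J)"
    proof (rule has_derivative_transform_within[OF _ zero_less_one J(1)])
      fix s assume s: "s \<in> J"
      show "metric_coord M c (?x s) (?v s) (?v s) = metric M (\<gamma> s) (V s) (V s)"
        using metric_eq[OF cJ[OF s]] geodesicD(1)[OF g] s J(2) by auto
    qed
    then show ?thesis unfolding atJ .
  qed
  moreover have "convex I" using geodesic_interval[OF g] by (simp add: is_interval_convex_1)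
  ultimately obtain k where "\<And>x. x \<in> I \<Longrightarrow> metric M (\<gamma> x) (V x) (V x) = k"
    using has_derivative_zero_constant[of I "\<lambda>s. metric M (\<gamma> s) (V s) (V s)"] by blast
  then show ?thesis using st by simp
qed

lemma christoffel_neg:
  assumes "c \<in> charts M" "x \<in> cimg c"
  shows "christoffel M c x (- a) (- a) = christoffel M c x a a"
  by (rule metric_coord_cancel[OF assms])
    (simp add: christoffel_eq[OF assms] linear_neg[OF metric_deriv_linear[OF assms]]
      bilinear_lneg[OF metric_deriv_bilinear[OF assms]] bilinear_rneg[OF metric_deriv_bilinear[OF assms]])

text \<open>Reversal changes the sign of the velocity but not of the acceleration, and the
  Christoffel vector is even in the velocity.\<close>

lemma geodesic_reverse:
  assumes g: "geodesic M {0..T} \<gamma> V"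
  shows "geodesic M {0..T} (\<lambda>t. \<gamma> (T - t)) (\<lambda>t. tscale (-1) (V (T - t)))"
  unfolding geodesic_def
proof (intro conjI ballI)
  show "is_interval {0..T}" by (simp add: is_interval_cc)
  have im: "(\<lambda>t. T - t) ` {0..T} = {0..T}" by auto
  show "continuous_on {0..T} (\<lambda>t. \<gamma> (T - t))"
    by (rule continuous_on_compose2[OF geodesic_continuous[OF g]]) (auto intro!: continuous_intros)
  fix t assume t: "t \<in> {0..T}"
  then have t': "T - t \<in> {0..T}" by auto
  show "tscale (-1) (V (T - t)) \<in> tangent_space M (\<gamma> (T - t))"
    by (rule tscale_tangent[OF geodesicD(1)[OF g t']])
  fix c assume c: "c \<in> charts_at M (\<gamma> (T - t))"
  have r: "((\<lambda>t. T - t) has_vector_derivative -1) (at t within {0..T})"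
    by (auto intro!: derivative_eq_intros)
  have comp: "((\<lambda>t. f (T - t)) has_vector_derivative - D) (at t within {0..T})"
    if "(f has_vector_derivative D) (at (T - t) within {0..T})" for f :: "real \<Rightarrow> 'e \<times> real" and D
    using vector_diff_chain_within[OF r, of f D] that unfolding im by (simp add: o_def)
  show "((\<lambda>s. cmap c (\<gamma> (T - s))) has_vector_derivative tscale (-1) (V (T - t)) c) (at t within {0..T})"
    using comp[OF geodesicD(2)[OF g t' c]] by simp
  have n: "christoffel M c (cmap c (\<gamma> (T - t))) (- V (T - t) c) (- V (T - t) c)
      = christoffel M c (cmap c (\<gamma> (T - t))) (V (T - t) c) (V (T - t) c)"
    using c by (intro christoffel_neg) (auto simp: charts_at_iff)
  have "((\<lambda>s. - V (T - s) c) has_vector_derivative - christoffel M c (cmap c (\<gamma> (T - t))) (V (T - t) c) (V (T - t) c)) (at t within {0..T})"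
    using has_vector_derivative_minus[OF comp[OF geodesicD(3)[OF g t' c]]] by simp
  then show "((\<lambda>s. tscale (-1) (V (T - s)) c) has_vector_derivative - christoffel M c (cmap c (\<gamma> (T - t)))
     (tscale (-1) (V (T - t)) c) (tscale (-1) (V (T - t)) c)) (at t within {0..T})"
    by (simp add: n)
qed

section \<open>Extension of geodesics and first exit\<close>

lemma local_model_growth:
  assumes m: "local_model c x0 v0 r K F" and z: "solves F {s..t} z" and "s \<le> t"
    and near: "\<And>u. u \<in> {s..t} \<Longrightarrow> norm (snd (z u) - v0) \<le> r"
  shows "(\<And>u. u \<in> {s..t} \<Longrightarrow> \<kappa> \<le> snd (snd (z u))) \<Longrightarrow> snd (fst (z s)) + \<kappa> * (t - s) \<le> snd (fst (z t))"
    "(\<And>u. u \<in> {s..t} \<Longrightarrow> snd (snd (z u)) \<le> \<kappa>) \<Longrightarrow> snd (fst (z t)) \<le> snd (fst (z s)) + \<kappa> * (t - s)"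
proof -
  have D: "((\<lambda>t. snd (fst (z t))) has_real_derivative snd (snd (z u))) (at u within {s..t})" if "u \<in> {s..t}" for u
    by (rule snd_fst_has_derivative[OF local_model_fst[OF m z that near[OF that]]])
  have k: "((\<lambda>t. \<kappa> * t) has_real_derivative \<kappa>) (at u within {s..t})" for u
    by (auto intro!: derivative_eq_intros)
  show "snd (fst (z s)) + \<kappa> * (t - s) \<le> snd (fst (z t))" if "\<And>u. u \<in> {s..t} \<Longrightarrow> \<kappa> \<le> snd (snd (z u))"
    using nonneg_derivative_imp_le[OF \<open>s \<le> t\<close> DERIV_diff[OF D k]] that by (simp add: algebra_simps)
  show "snd (fst (z t)) \<le> snd (fst (z s)) + \<kappa> * (t - s)" if "\<And>u. u \<in> {s..t} \<Longrightarrow> snd (snd (z u)) \<le> \<kappa>"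
    using nonneg_derivative_imp_le[OF \<open>s \<le> t\<close> DERIV_diff[OF k D]] that by (simp add: algebra_simps)
qed

text \<open>At an interior point, or at a boundary point with inward velocity, the trajectory of the
  model field keeps a positive last coordinate for a short time after \<open>l\<close>. It is
  therefore a geodesic of the manifold and can be appended.\<close>

lemma geodesic_extend:
  assumes g: "geodesic M {0..l} \<gamma> V" and l: "0 \<le> l" and c: "c \<in> charts_at M (\<gamma> l)"
    and pos: "0 < snd (cmap c (\<gamma> l)) \<or> 0 < snd (V l c)"
  shows "\<exists>l'>l. \<exists>\<gamma>' V'. geodesic M {0..l'} \<gamma>' V' \<and> \<gamma>' 0 = \<gamma> 0 \<and> V' 0 = V 0 \<and> \<gamma>' ` {l<..l'} \<subseteq> interior_part M"
proof -
  note ch = c[unfolded charts_at_iff]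
  define x0 v0 where "x0 = cmap c (\<gamma> l)" and "v0 = V l c"
  have x0: "x0 \<in> cimg c" using ch by (auto simp: x0_def)
  obtain r K F where m: "local_model c x0 v0 r K F" using local_model_ex[OF _ x0] ch by blast
  then have r: "r > 0" and K: "K-lipschitz_on UNIV F" unfolding local_model_def by blast+
  obtain z where z: "z l = (x0, v0)" "solves F {l..l + 1} z"
    using picard[OF K, of l "l + 1" "(x0, v0)"] by auto
  \<comment> \<open>Within this distance of the initial data the last component of the position, or
    that of the velocity, loses at most half of its positive value.\<close>
  define \<rho> where "\<rho> = (if 0 < snd x0 then min r (snd x0 / 2) else min r (snd v0 / 2))"
  have \<rho>: "\<rho> > 0" "\<rho> \<le> r" using r pos by (auto simp: \<rho>_def x0_def v0_def)
  have "continuous (at l within {l..l + 1}) z"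
    using solves_continuous[OF z(2)] by (simp add: continuous_on_eq_continuous_within)
  then obtain d where d: "d > 0" "\<And>t. t \<in> {l..l + 1} \<Longrightarrow> dist t l < d \<Longrightarrow> dist (z t) (z l) < \<rho>"
    using \<rho>(1) unfolding continuous_within_eps_delta by blast
  define l' where "l' = l + min 1 (d / 2)"
  have l': "l < l'" "{l..l'} \<subseteq> {l..l + 1}" using d(1) by (auto simp: l'_def)
  have near: "norm (fst (z t) - x0) < \<rho>" "norm (snd (z t) - v0) < \<rho>" if "t \<in> {l..l'}" for t
  proof -
    have "t - l \<le> d / 2" using that by (auto simp: l'_def)
    then have "dist (z t) (z l) < \<rho>" using d(1) that l'(2) by (intro d(2)) (auto simp: dist_real_def)
    then have "norm (z t - (x0, v0)) < \<rho>" by (simp add: dist_norm z(1))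
    then show "norm (fst (z t) - x0) < \<rho>" "norm (snd (z t) - v0) < \<rho>"
      using norm_fst_snd_le[of "z t - (x0, v0)"] by simp_all
  qed
  have zl: "solves F {l..l'} z" by (rule solves_subset[OF z(2) l'(2)])
  have x0n: "0 \<le> snd x0" using snd_cmap_nonneg[OF c] by (simp add: x0_def)
  have posz: "0 < snd (fst (z t))" if "t \<in> {l<..l'}" for t
  proof (cases "0 < snd x0")
    case True
    have "\<bar>snd (fst (z t)) - snd x0\<bar> < \<rho>" using near(1)[of t] norm_fst_snd_le(2)[of "fst (z t) - x0"] that by auto
    moreover have "\<rho> \<le> snd x0 / 2" using True by (simp add: \<rho>_def)
    ultimately show ?thesis using True by linarith
  next
    case False
    then have v0: "0 < snd v0" "\<rho> \<le> snd v0 / 2" using pos by (auto simp: x0_def v0_def \<rho>_def)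
    have lt: "l \<le> t" using that by simp
    have "snd (fst (z l)) + snd v0 / 2 * (t - l) \<le> snd (fst (z t))"
    proof (rule local_model_growth(1)[OF m _ lt])
      show "solves F {l..t} z" by (rule solves_subset[OF zl]) (use that in auto)
      fix u assume "u \<in> {l..t}"
      then have u: "u \<in> {l..l'}" using that by auto
      show "norm (snd (z u) - v0) \<le> r" using near(2)[OF u] \<rho>(2) by simp
      have "\<bar>snd (snd (z u)) - snd v0\<bar> < \<rho>" using near(2)[OF u] norm_fst_snd_le(2)[of "snd (z u) - v0"] by simp
      then show "snd v0 / 2 \<le> snd (snd (z u))" using v0(2) by linarith
    qed
    moreover have "0 < snd v0 / 2 * (t - l)" using v0(1) that by simp
    ultimately show ?thesis using x0n by (simp add: z(1))
  qed
  have nn: "0 \<le> snd (fst (z t))" if "t \<in> {l..l'}" for t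
    using posz[of t] that x0n z(1) by (cases "t = l") auto
  have zg: "geodesic M {l..l'} (\<lambda>t. cinv c (fst (z t))) (\<lambda>t. tvec_of M c (cinv c (fst (z t))) (snd (z t)))"
    and img: "\<And>t. t \<in> {l..l'} \<Longrightarrow> fst (z t) \<in> cimg c"
  proof -
    have n: "norm (fst (z t) - x0) \<le> r \<and> norm (snd (z t) - v0) \<le> r \<and> 0 \<le> snd (fst (z t))" if "t \<in> {l..l'}" for t
      using near[OF that] nn[OF that] \<rho>(2) by simp
    show "geodesic M {l..l'} (\<lambda>t. cinv c (fst (z t))) (\<lambda>t. tvec_of M c (cinv c (fst (z t))) (snd (z t)))"
      by (rule solves_geodesic(1)[OF m conjunct1[OF ch] is_interval_cc zl n])
    show "\<And>t. t \<in> {l..l'} \<Longrightarrow> fst (z t) \<in> cimg c"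
      by (rule solves_geodesic(2)[OF m conjunct1[OF ch] is_interval_cc zl n])
  qed
  have eq: "\<gamma> l = cinv c (fst (z l))" "V l = tvec_of M c (cinv c (fst (z l))) (snd (z l))"
    using ch tvec_of_coord[OF c geodesicD(1)[OF g]] l by (simp_all add: z(1) x0_def v0_def)
  show ?thesis
  proof (intro exI conjI)
    show "l < l'" by (rule l')
    show "geodesic M {0..l'} (\<lambda>t. if t \<le> l then \<gamma> t else cinv c (fst (z t)))
      (\<lambda>t. if t \<le> l then V t else tvec_of M c (cinv c (fst (z t))) (snd (z t)))"
      by (rule geodesic_concat[OF l less_imp_le[OF l'(1)] g zg eq])
    show "(\<lambda>t. if t \<le> l then \<gamma> t else cinv c (fst (z t))) ` {l<..l'} \<subseteq> interior_part M"
    proof (rule image_subsetI)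
      fix t assume t: "t \<in> {l<..l'}"
      then have i: "fst (z t) \<in> cimg c" by (intro img) auto
      then have "c \<in> charts_at M (cinv c (fst (z t)))" using ch by (simp add: charts_at_iff)
      then have "cinv c (fst (z t)) \<in> interior_part M"
        using interior_iff posz[OF t] i ch by simp
      then show "(if t \<le> l then \<gamma> t else cinv c (fst (z t))) \<in> interior_part M" using t by simp
    qed
  qed (use l in simp_all)
qed

text \<open>A geodesic that cannot be continued ends at a boundary point, by
  \<open>geodesic_extend\<close>. As it may touch the boundary earlier, \<open>T\<close> is its
  first positive boundary time, a minimum over a compact set.\<close>

lemma first_exit:
  assumes nt: "nontrapping M (p, v)" and c: "c \<in> charts_at M p" and pos: "0 < snd (v c)"
  shows "\<exists>T>0. \<exists>\<gamma> V. geodesic_from M (p, v) {0..T} \<gamma> V \<and> \<gamma> ` {0<..<T} \<subseteq> interior_part M \<and> \<gamma> T \<in> boundary M"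
proof -
  obtain l \<gamma> V where l: "l \<ge> 0" and g: "geodesic_from M (p, v) {0..l} \<gamma> V"
    and max: "\<not> (\<exists>l'>l. \<exists>\<gamma> V. geodesic_from M (p, v) {0..l'} \<gamma> V)"
    using nt unfolding nontrapping_def by blast
  have gg: "geodesic M {0..l} \<gamma> V" and i: "\<gamma> 0 = p" "V 0 = v"
    using g unfolding geodesic_from_def by auto
  have noext: "\<not> (0 < snd (cmap d (\<gamma> l)) \<or> 0 < snd (V l d))" if d: "d \<in> charts_at M (\<gamma> l)" for d
  proof
    assume "0 < snd (cmap d (\<gamma> l)) \<or> 0 < snd (V l d)"
    then obtain l' \<gamma>' V' where "l' > l" "geodesic M {0..l'} \<gamma>' V'" "\<gamma>' 0 = \<gamma> 0" "V' 0 = V 0"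
      using geodesic_extend[OF gg l d] by blast
    moreover have "0 \<in> {0..l'}" using \<open>l' > l\<close> l by simp
    ultimately have "geodesic_from M (p, v) {0..l'} \<gamma>' V'" using i unfolding geodesic_from_def by simp
    then show False using max \<open>l' > l\<close> by blast
  qed
  have l0: "l > 0"
  proof (rule ccontr)
    assume "\<not> l > 0"
    then have "l = 0" using l by simp
    then show False using noext[of c] c pos i by simp
  qed
  obtain d where d: "d \<in> charts_at M (\<gamma> l)" using ex_chart by blast
  have bl: "\<gamma> l \<in> boundary M"
    using noext[OF d] snd_cmap_nonneg[OF d] boundary_iff[OF d] by simp
  have c0: "c \<in> charts_at M (\<gamma> 0)" using c i by simp
  have g0: "geodesic M {0..0} \<gamma> V" by (rule geodesic_subset[OF gg _ is_interval_cc]) (use l in auto)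
  obtain \<delta> \<gamma>' V' where \<delta>: "\<delta> > 0" "geodesic M {0..\<delta>} \<gamma>' V'" "\<gamma>' 0 = \<gamma> 0" "V' 0 = V 0" "\<gamma>' ` {0<..\<delta>} \<subseteq> interior_part M"
    using geodesic_extend[OF g0 order_refl c0] pos i by auto
  \<comment> \<open>Up to time \<open>e\<close> the geodesic is interior because it starts inward.
    The search for boundary times begins at \<open>e\<close>, since the initial point may itself be
    a boundary point.\<close>
  define e where "e = min \<delta> l"
  have e: "e > 0" "e \<le> l" "e \<le> \<delta>" using \<delta>(1) l0 by (auto simp: e_def)
  have int0: "\<gamma> t \<in> interior_part M" if "0 < t" "t \<le> e" for t
  proof -
    have "\<gamma> t = \<gamma>' t"
    proof (rule conjunct1[OF geodesic_unique[where I = "{0..e}" and ?t0.0 = 0]])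
      show "geodesic M {0..e} \<gamma> V" by (rule geodesic_subset[OF gg]) (use e in \<open>auto simp: is_interval_cc\<close>)
      show "geodesic M {0..e} \<gamma>' V'" by (rule geodesic_subset[OF \<delta>(2)]) (use e in \<open>auto simp: is_interval_cc\<close>)
    qed (use that e \<delta>(3,4) in auto)
    moreover have "t \<in> {0<..\<delta>}" using that e by auto
    ultimately show ?thesis using \<delta>(5) by auto
  qed
  define A where "A = {t \<in> {e..l}. \<gamma> t \<in> boundary M}"
  have bd: "closed (boundary M)" using open_interior unfolding interior_part_def closed_def .
  have "continuous_on {e..l} \<gamma>" using geodesic_continuous[OF gg] by (rule continuous_on_subset) (use e in auto)
  then have "closed ({e..l} \<inter> \<gamma> -` boundary M)" by (rule continuous_closed_preimage) (use bd in auto)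
  moreover have "A = {e..l} \<inter> \<gamma> -` boundary M" by (auto simp: A_def)
  ultimately have "closed A" by simp
  moreover have "bounded A" by (rule bounded_subset[of "{e..l}"]) (auto simp: A_def)
  ultimately have "compact A" by (simp add: compact_eq_bounded_closed)
  moreover have "A \<noteq> {}" using bl e by (auto simp: A_def)
  ultimately obtain T where T: "T \<in> A" "\<And>t. t \<in> A \<Longrightarrow> T \<le> t" using compact_attains_inf[of A] by blast
  show ?thesis
  proof (intro exI conjI)
    show "0 < T" using T(1) e by (auto simp: A_def)
    show "\<gamma> T \<in> boundary M" using T(1) by (simp add: A_def)
    show "geodesic_from M (p, v) {0..T} \<gamma> V"
      unfolding geodesic_from_def using geodesic_subset[OF gg, of "{0..T}"] T(1) e(1) i
      by (auto simp: A_def is_interval_cc)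
    show "\<gamma> ` {0<..<T} \<subseteq> interior_part M"
    proof (rule image_subsetI)
      fix t assume t: "t \<in> {0<..<T}"
      show "\<gamma> t \<in> interior_part M"
      proof (cases "t \<le> e")
        case True then show ?thesis using int0 t by simp
      next
        case False
        have "t \<notin> A" using T(2)[of t] t by auto
        then show ?thesis using False t T(1) by (auto simp: A_def interior_part_def)
      qed
    qed
  qed
qed

lemma geodesic_fromD:
  assumes "geodesic_from M (p, v) I \<gamma> V"
  shows "0 \<in> I" "geodesic M I \<gamma> V" "\<gamma> 0 = p" "V 0 = v"
  using assms by (auto simp: geodesic_from_def)

text \<open>By uniqueness every geodesic from the same data that lasts beyond \<open>T\<close> meets
  the boundary at time \<open>T\<close>, so no larger time enters the supremum.\<close>

lemma exit_data:
  assumes g: "geodesic_from M (p, v) {0..T} \<gamma> V" and T: "0 < T"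
    and int: "\<gamma> ` {0<..<T} \<subseteq> interior_part M" and bd: "\<gamma> T \<in> boundary M"
  shows "tau_in M (p, v) = ereal T" "S_in M (p, v) = (\<gamma> T, V T)"
proof -
  let ?A = "{t. 0 < t \<and> (\<exists>\<gamma> V. geodesic_from M (p, v) {0..<t} \<gamma> V \<and> \<gamma> ` {0<..<t} \<subseteq> interior_part M)}"
  note gD = geodesic_fromD[OF g]
  have "geodesic_from M (p, v) {0..<T} \<gamma> V"
    unfolding geodesic_from_def using geodesic_subset[OF gD(2), of "{0..<T}"] gD T
    by (auto simp: is_interval_co subset_iff)
  then have TA: "T \<in> ?A" using T int by blast
  have le: "t \<le> T" if t: "t \<in> ?A" for t
  proof (rule ccontr)
    assume "\<not> t \<le> T"
    obtain \<gamma>' V' where g': "geodesic_from M (p, v) {0..<t} \<gamma>' V'" "\<gamma>' ` {0<..<t} \<subseteq> interior_part M" using t by blast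
    note gD' = geodesic_fromD[OF g'(1)]
    have "\<gamma> T = \<gamma>' T"
    proof (rule conjunct1[OF geodesic_unique[OF gD(2), of \<gamma>' V' 0]])
      show "geodesic M {0..T} \<gamma>' V'"
        by (rule geodesic_subset[OF gD'(2) _ is_interval_cc]) (use \<open>\<not> t \<le> T\<close> in auto)
    qed (use gD(1,3,4) gD'(3,4) T in auto)
    moreover have "\<gamma>' T \<in> interior_part M" using g'(2) T \<open>\<not> t \<le> T\<close> by auto
    ultimately show False using bd by (simp add: interior_part_def)
  qed
  show tau: "tau_in M (p, v) = ereal T"
    unfolding tau_in_def
  proof (rule antisym)
    show "Sup (ereal ` ?A) \<le> ereal T"
    proof (rule Sup_least)
      fix y assume "y \<in> ereal ` ?A"
      then obtain t where "t \<in> ?A" "y = ereal t" by blast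
      then show "y \<le> ereal T" using le[of t] by simp
    qed
    show "ereal T \<le> Sup (ereal ` ?A)" by (rule Sup_upper) (use TA in blast)
  qed
  show "S_in M (p, v) = (\<gamma> T, V T)"
    unfolding S_in_def
  proof (rule the_equality)
    show "\<exists>t \<gamma>' V'. tau_in M (p, v) = ereal t \<and> geodesic_from M (p, v) {0..t} \<gamma>' V' \<and> (\<gamma> T, V T) = (\<gamma>' t, V' t)"
      using tau g by blast
    fix q assume "\<exists>t \<gamma> V. tau_in M (p, v) = ereal t \<and> geodesic_from M (p, v) {0..t} \<gamma> V \<and> q = (\<gamma> t, V t)"
    then obtain \<gamma>' V' where g': "geodesic_from M (p, v) {0..T} \<gamma>' V'" "q = (\<gamma>' T, V' T)" using tau by auto
    note gD' = geodesic_fromD[OF g'(1)]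
    have "\<gamma> T = \<gamma>' T \<and> V T = V' T"
      by (rule geodesic_unique[OF gD(2) gD'(2) gD(1)]) (use gD(3,4) gD'(3,4) T in auto)
    then show "q = (\<gamma> T, V T)" using g'(2) by simp
  qed
qed

section \<open>Normal vectors\<close>

lemma boundary_tangent_space_iff:
  assumes "c \<in> charts_at M p" "p \<in> boundary M"
  shows "u \<in> boundary_tangent_space M p \<longleftrightarrow> u \<in> tangent_space M p \<and> snd (u c) = 0"
  using tangent_snd(1)[OF _ assms(1) _ assms(2)] assms(1) unfolding boundary_tangent_space_def by blast

lemma boundary_metric_lorentz:
  assumes "c \<in> charts_at M p" "p \<in> boundary M"
  shows "lorentzian_form (\<lambda>a b. metric_coord M c (cmap c p) (a, 0) (b, 0))"
  using mfd assms unfolding lorentzian_manifold_timelike_boundary_def timelike_boundary_def by blast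

text \<open>The vectors orthogonal to the boundary form a line because the induced form is
  nondegenerate. This line is spacelike: the boundary contains a timelike direction, and two
  timelike vectors are never orthogonal.\<close>

lemma normal_ex1:
  assumes p: "p \<in> boundary M"
  shows "\<exists>!v. v \<in> tangent_space M p \<and> (\<forall>u\<in>boundary_tangent_space M p. metric M p v u = 0) \<and>
    metric M p v v = 1 \<and> (\<forall>c\<in>charts_at M p. snd (v c) < 0)"
proof -
  obtain c where c: "c \<in> charts_at M p" using ex_chart by blast
  then have x: "c \<in> charts M" "cmap c p \<in> cimg c" by (auto simp: charts_at_iff)
  define B where "B = metric_coord M c (cmap c p)"
  have bil: "bilinear B" and nd: "nondegenerate B" and sym: "\<And>a b. B a b = B b a"
    unfolding B_def using metric_coord_bilinear[OF x] metric_coord_nondegenerate[OF x] metric_coord_sym[OF x] by auto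
  define Bh where "Bh a b = B (a, 0) (b, 0)" for a b
  have lor: "lorentzian_form Bh" unfolding Bh_def[abs_def] B_def by (rule boundary_metric_lorentz[OF c p])
  have "linear (\<lambda>a. B (0, 1) (a, 0))"
  proof (rule linearI)
    fix a b :: 'e and k :: real
    show "B (0, 1) (a + b, 0) = B (0, 1) (a, 0) + B (0, 1) (b, 0)"
      using bilinear_radd[OF bil, of "(0, 1)" "(a, 0)" "(b, 0)"] by simp
    show "B (0, 1) (k *\<^sub>R a, 0) = k *\<^sub>R B (0, 1) (a, 0)"
      using bilinear_rmul[OF bil, of "(0, 1)" k "(a, 0)"] by simp
  qed
  \<comment> \<open>\<open>h\<close> is the tangential projection of \<open>(0, 1)\<close>;
    subtracting it leaves a vector orthogonal to the boundary.\<close>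
  then obtain h where h: "\<And>a. Bh h a = B (0, 1) (a, 0)"
    using nondegenerate_riesz[of Bh] lorentzian_form_nondegenerate[OF lor] lor unfolding lorentzian_form_def by blast
  define n where "n = (- h, 1 :: real)"
  have n0: "B n (a, 0) = 0" for a
  proof -
    have "n = (0, 1) - (h, 0)" by (simp add: n_def)
    then show ?thesis using h[of a] bilinear_lsub[OF bil, of "(0, 1)" "(h, 0)" "(a, 0)"] by (simp add: Bh_def)
  qed
  have split: "w = (fst w + snd w *\<^sub>R h, 0) + snd w *\<^sub>R n" for w :: "'e \<times> real"
    by (simp add: n_def prod_eq_iff)
  define k where "k = B n n"
  have Bn: "B n w = snd w * k" for w
    using n0 by (subst split[of w]) (simp add: bilinear_radd[OF bil] bilinear_rmul[OF bil] k_def)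
  have "n \<noteq> 0" by (simp add: n_def zero_prod_def)
  then have k0: "k \<noteq> 0" using nd Bn unfolding nondegenerate_def by (metis mult_zero_right)
  have "\<not> k < 0"
  proof
    assume "k < 0"
    obtain e E where e: "Bh e e = -1" by (rule lorentzian_form_expand[OF lor])
    have "B n (e, 0) \<noteq> 0"
      using \<open>k < 0\<close> e
      by (intro lorentzian_form_timelike[OF metric_coord_lorentz[OF x, folded B_def]]) (simp_all add: k_def Bh_def)
    then show False using n0 by simp
  qed
  then have k: "k > 0" using k0 by simp
  \<comment> \<open>Normalized to unit length, with the sign that makes the last component negative,
    that is, the vector outward.\<close>
  define m where "m = (- 1 / sqrt k) *\<^sub>R n"
  have snm: "snd m = - 1 / sqrt k" by (simp add: m_def n_def)
  have Bm: "B m w = - snd w * sqrt k" for w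
  proof -
    have "B m w = - snd w * (k / sqrt k)" unfolding m_def bilinear_lmul[OF bil] Bn by simp
    also have "k / sqrt k = sqrt k" using k by (intro real_div_sqrt) simp
    finally show ?thesis .
  qed
  define v where "v = tvec_of M c p m"
  have v: "v \<in> tangent_space M p" "v c = m" using tvec_of_tangent[OF c] tvec_of_apply[OF c] by (auto simp: v_def)
  show ?thesis
  proof (rule ex1I[of _ v], intro conjI ballI)
    show "v \<in> tangent_space M p" by (rule v)
    show "metric M p v u = 0" if "u \<in> boundary_tangent_space M p" for u
      using that metric_eq[OF c v(1), of u] v(2) Bm[of "u c"]
      unfolding boundary_tangent_space_iff[OF c p] B_def by simp
    show "metric M p v v = 1"
      using metric_eq[OF c v(1) v(1)] v(2) Bm[of m] k unfolding B_def snm by simp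
    show "snd (v d) < 0" if "d \<in> charts_at M p" for d
      using tangent_snd(3)[OF v(1) c that p] v(2) snm k by simp
  next
    fix w assume w: "w \<in> tangent_space M p \<and> (\<forall>u\<in>boundary_tangent_space M p. metric M p w u = 0) \<and>
      metric M p w w = 1 \<and> (\<forall>c\<in>charts_at M p. snd (w c) < 0)"
    define s where "s = snd (w c)"
    define y where "y = fst (w c) + s *\<^sub>R h"
    have wc: "w c = (y, 0) + s *\<^sub>R n" using split[of "w c"] by (simp add: y_def s_def)
    have "Bh y a = 0" for a
    proof -
      define u where "u = tvec_of M c p (a, 0)"
      have u: "u \<in> tangent_space M p" "u c = (a, 0)" using tvec_of_tangent[OF c] tvec_of_apply[OF c] by (auto simp: u_def)
      then have "metric M p w u = 0" using w boundary_tangent_space_iff[OF c p] by simp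
      then have "B (w c) (a, 0) = 0" using metric_eq[OF c _ u(1), of w] w u(2) by (simp add: B_def)
      then show ?thesis unfolding wc by (simp add: bilinear_ladd[OF bil] bilinear_lmul[OF bil] n0 Bh_def)
    qed
    then have y: "y = 0" using lorentzian_form_nondegenerate[OF lor] unfolding nondegenerate_def by blast
    have "B (w c) (w c) = 1" using metric_eq[OF c, of w w] w by (simp add: B_def)
    then have "s\<^sup>2 * k = 1"
      unfolding wc y by (simp add: zero_prod_def[symmetric] bilinear_lmul[OF bil] bilinear_rmul[OF bil] k_def power2_eq_square mult.assoc)
    then have "(- s * sqrt k)\<^sup>2 = 1" using k by (simp add: power_mult_distrib)
    moreover have "s < 0" using w c by (simp add: s_def)
    then have "0 \<le> - s * sqrt k" using k by (simp add: mult_nonpos_nonneg)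
    ultimately have "- s * sqrt k = 1" by (metis abs_of_nonneg real_sqrt_abs real_sqrt_one)
    then have "s = - 1 / sqrt k" using k by (simp add: field_simps)
    then have "w c = m" unfolding wc y by (simp add: m_def zero_prod_def[symmetric])
    then show "w = v" using tangent_space_eqI[OF _ v(1) c] w v(2) by simp
  qed
qed

lemma outward_normal:
  assumes p: "p \<in> boundary M"
  shows "outward_normal M p \<in> tangent_space M p"
    "u \<in> boundary_tangent_space M p \<Longrightarrow> metric M p (outward_normal M p) u = 0"
    "metric M p (outward_normal M p) (outward_normal M p) = 1"
    "c \<in> charts_at M p \<Longrightarrow> snd (outward_normal M p c) < 0"
  using theI'[OF normal_ex1[OF p]] unfolding outward_normal_def[symmetric] by blast+

lemma inward_normal:
  assumes p: "p \<in> boundary M"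
  shows "inward_normal M p \<in> tangent_space M p"
    "u \<in> boundary_tangent_space M p \<Longrightarrow> metric M p u (inward_normal M p) = 0"
    "metric M p (inward_normal M p) (inward_normal M p) = 1"
    "c \<in> charts_at M p \<Longrightarrow> 0 < snd (inward_normal M p c)"
proof -
  note o = outward_normal[OF p]
  show t: "inward_normal M p \<in> tangent_space M p" unfolding inward_normal_def by (rule tscale_tangent[OF o(1)])
  show "metric M p (inward_normal M p) (inward_normal M p) = 1"
    unfolding inward_normal_def using o by (simp add: metric_tscale tscale_tangent)
  show "metric M p u (inward_normal M p) = 0" if u: "u \<in> boundary_tangent_space M p"
  proof -
    have "u \<in> tangent_space M p" using u unfolding boundary_tangent_space_def by blast
    then show ?thesis unfolding inward_normal_def
      using o(2)[OF u] metric_sym[OF o(1), of u] by (simp add: metric_tscale[OF o(1)])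
  qed
  show "0 < snd (inward_normal M p c)" if "c \<in> charts_at M p"
    using o(4)[OF that] by (simp add: inward_normal_def)
qed

lemma tangential_part:
  assumes p: "p \<in> boundary M" and v: "v \<in> tangent_space M p"
  shows "tangential_part M p v \<in> boundary_tangent_space M p"
    "v = tadd (tangential_part M p v) (tscale (normal_comp M p v) (inward_normal M p))"
    "c \<in> charts_at M p \<Longrightarrow> snd (v c) = normal_comp M p v * snd (inward_normal M p c)"
proof -
  let ?N = "inward_normal M p"
  note N = inward_normal[OF p]
  have *: "snd (v c) = normal_comp M p v * snd (?N c)" if c: "c \<in> charts_at M p" for c
  proof -
    \<comment> \<open>The multiple of the normal cancels the last component of \<open>v\<close>. The
      remaining vector is tangent to the boundary and hence orthogonal to the normal.\<close>
    define w where "w = tadd v (tscale (- snd (v c) / snd (?N c)) ?N)"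
    have wt: "w \<in> tangent_space M p" unfolding w_def by (intro tadd_tangent tscale_tangent v N)
    have "w \<in> boundary_tangent_space M p"
      unfolding boundary_tangent_space_iff[OF c p] using wt N(4)[OF c] by (simp add: w_def)
    then have "metric M p w ?N = 0" by (rule N(2))
    then have "metric M p v ?N = snd (v c) / snd (?N c)"
      unfolding w_def using v N by (simp add: metric_tadd metric_tscale tscale_tangent)
    then show ?thesis using N(4)[OF c] by (simp add: normal_comp_def)
  qed
  show "c \<in> charts_at M p \<Longrightarrow> snd (v c) = normal_comp M p v * snd (?N c)" by (rule *)
  show "v = tadd (tangential_part M p v) (tscale (normal_comp M p v) ?N)"
    unfolding tangential_part_def by (auto simp: fun_eq_iff)
  obtain c where c: "c \<in> charts_at M p" using ex_chart by blast
  show "tangential_part M p v \<in> boundary_tangent_space M p"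
    unfolding boundary_tangent_space_iff[OF c p]
    using *[OF c] by (auto simp: tangential_part_def intro!: tadd_tangent tscale_tangent v N)
qed

lemma normal_comp_iff:
  assumes p: "p \<in> boundary M" and v: "v \<in> tangent_space M p" and c: "c \<in> charts_at M p"
  shows "0 < normal_comp M p v \<longleftrightarrow> 0 < snd (v c)" "normal_comp M p v < 0 \<longleftrightarrow> snd (v c) < 0"
    "normal_comp M p v = 0 \<longleftrightarrow> snd (v c) = 0"
  using tangential_part(3)[OF p v c] inward_normal(4)[OF p c]
  by (auto simp: zero_less_mult_iff mult_less_0_iff)

lemma bd_minus_TM_iff:
  "(p, v) \<in> bd_minus_TM M \<longleftrightarrow> p \<in> boundary M \<and> v \<in> tangent_space M p \<and> 0 < normal_comp M p v"
proof -
  have "normal_comp M p v = - metric M p v (outward_normal M p)" if "p \<in> boundary M" "v \<in> tangent_space M p"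
    unfolding normal_comp_def inward_normal_def
    using metric_tscale(2)[OF outward_normal(1)[OF that(1)] that(2)] by simp
  then show ?thesis by (auto simp: bd_minus_TM_def bdTM_def)
qed

section \<open>Variations of lightlike geodesics\<close>

lemma geodesic_point: "v \<in> tangent_space M p \<Longrightarrow> geodesic M {0..0} (\<lambda>_. p) (\<lambda>_. v)"
  unfolding geodesic_def
  by (simp add: has_vector_derivative_within_singleton is_interval_1)

text \<open>The trajectory \<open>z\<close> comes from the model field, regardless of the boundary.
  It prolongs the geodesic for as long as its last coordinate is known to be nonnegative.\<close>

lemma geodesic_continue:
  assumes m: "local_model c x0 v0 r K F" and c: "c \<in> charts M"
    and g: "geodesic_from M q {0..t1} \<gamma> V" and t: "0 \<le> t1" "t1 \<le> t2" and dom: "\<gamma> t1 \<in> cdom c"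
    and z: "solves F {t1..t2} z" "z t1 = (cmap c (\<gamma> t1), V t1 c)"
    and near: "\<And>t. t \<in> {t1..t2} \<Longrightarrow> norm (fst (z t) - x0) \<le> r \<and> norm (snd (z t) - v0) \<le> r \<and> 0 \<le> snd (fst (z t))"
  shows "\<exists>\<gamma>' V'. geodesic_from M q {0..t2} \<gamma>' V' \<and> (\<forall>t\<in>{0..t1}. \<gamma>' t = \<gamma> t) \<and>
    (\<forall>t\<in>{t1..t2}. \<gamma>' t \<in> cdom c \<and> cmap c (\<gamma>' t) = fst (z t) \<and> V' t c = snd (z t))"
proof -
  let ?\<gamma> = "\<lambda>t. cinv c (fst (z t))" and ?V = "\<lambda>t. tvec_of M c (cinv c (fst (z t))) (snd (z t))"
  have zg: "geodesic M {t1..t2} ?\<gamma> ?V"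
    by (rule solves_geodesic(1)[OF m c is_interval_cc z(1) near])
  have img: "fst (z t) \<in> cimg c" if "t \<in> {t1..t2}" for t
    by (rule solves_geodesic(2)[OF m c is_interval_cc z(1) near that])
  have gg: "geodesic M {0..t1} \<gamma> V" "\<gamma> 0 = fst q" "V 0 = snd q" using g by (auto simp: geodesic_from_def)
  have c1: "c \<in> charts_at M (\<gamma> t1)" using c dom by (simp add: charts_at_iff)
  have V1: "V t1 \<in> tangent_space M (\<gamma> t1)" by (rule geodesicD(1)[OF gg(1)]) (use t in simp)
  have eq: "\<gamma> t1 = ?\<gamma> t1" "V t1 = ?V t1"
    using c dom tvec_of_coord[OF c1 V1] by (simp_all add: z(2))
  show ?thesis
  proof (intro exI conjI ballI)
    show "geodesic_from M q {0..t2} (\<lambda>t. if t \<le> t1 then \<gamma> t else ?\<gamma> t) (\<lambda>t. if t \<le> t1 then V t else ?V t)"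
      unfolding geodesic_from_def using geodesic_concat[OF t gg(1) zg eq] gg(2,3) t by simp
    fix t assume t: "t \<in> {t1..t2}"
    note i = img[OF t]
    have ct: "c \<in> charts_at M (?\<gamma> t)" using c i by (simp add: charts_at_iff)
    show "(if t \<le> t1 then \<gamma> t else ?\<gamma> t) \<in> cdom c" using c i dom t by (cases "t = t1") simp_all
    show "cmap c (if t \<le> t1 then \<gamma> t else ?\<gamma> t) = fst (z t)"
      using t z(2) c i by (cases "t = t1") simp_all
    show "(if t \<le> t1 then V t else ?V t) c = snd (z t)"
      using t z(2) tvec_of_apply[OF ct] by (cases "t = t1") simp_all
  qed simp
qed

text \<open>The derivative of \<open>g\<^sub>x(x\<^sub>s - x, x')\<close> along two nearby geodesics is half the difference of their (constant) energies,
  up to an error quadratic in their distance. This first variation formula needs only Lipschitz dependence of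
  geodesics on initial data.\<close>

lemma energy_step:
  assumes m: "local_model c x0 v0 r K F" and c: "c \<in> charts M" and le: "t1 \<le> t2"
    and z: "solves F {t1..t2} z" and zs: "solves F {t1..t2} zs"
    and near: "\<And>t. t \<in> {t1..t2} \<Longrightarrow> norm (fst (z t) - x0) \<le> r \<and> norm (snd (z t) - v0) \<le> r \<and> 0 \<le> snd (fst (z t))"
    and nears: "\<And>t. t \<in> {t1..t2} \<Longrightarrow> norm (fst (zs t) - x0) \<le> r \<and> norm (snd (zs t) - v0) \<le> r \<and> 0 \<le> snd (fst (zs t))"
    and e: "\<And>t. t \<in> {t1..t2} \<Longrightarrow> norm (zs t - z t) \<le> e"
    and E0: "\<And>t. t \<in> {t1..t2} \<Longrightarrow> metric_coord M c (fst (z t)) (snd (z t)) (snd (z t)) = 0"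
    and E: "\<And>t. t \<in> {t1..t2} \<Longrightarrow> metric_coord M c (fst (zs t)) (snd (zs t)) (snd (zs t)) = E"
  shows "\<bar>metric_coord M c (fst (z t2)) (fst (zs t2) - fst (z t2)) (snd (z t2))
      - metric_coord M c (fst (z t1)) (fst (zs t1) - fst (z t1)) (snd (z t1)) - (t2 - t1) / 2 * E\<bar>
    \<le> (t2 - t1) * (K * (norm v0 + r + 1)\<^sup>2 * e\<^sup>2)"
proof -
  let ?G = "metric_coord M c" and ?D = "metric_deriv M c"
  define x v xs vs where "x t = fst (z t)" and "v t = snd (z t)" and "xs t = fst (zs t)" and "vs t = snd (zs t)" for t
  let ?I = "{t1..t2}" and ?B = "cball x0 r \<inter> half_space"
  have mm: "r > 0" "K > 0" "metric_bounds c ?B K" using m unfolding local_model_def by blast+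
  have xB: "x t \<in> ?B" "xs t \<in> ?B" if "t \<in> ?I" for t
    using near[OF that] nears[OF that] by (auto simp: x_def xs_def half_space_def dist_norm norm_minus_commute)
  have xi: "x t \<in> cimg c" "xs t \<in> cimg c" if "t \<in> ?I" for t
    using metric_boundsD(1)[OF mm(3)] xB[OF that] by blast+
  \<comment> \<open>The derivative of the pairing: the Christoffel term trades the derivative of the
    metric along the velocity for half of its derivative along the displacement.\<close>
  define P' where "P' t = ?D (x t) (xs t - x t) (v t) (v t) / 2 + ?G (x t) (vs t - v t) (v t)" for t
  have x': "(x has_derivative (\<lambda>h. h *\<^sub>R v t)) (at t within ?I)" if "t \<in> ?I" for t
    using local_model_fst[OF m z that] near[OF that] unfolding x_def[abs_def] v_def has_vector_derivative_def by blast
  have xs': "(xs has_derivative (\<lambda>h. h *\<^sub>R vs t)) (at t within ?I)" if "t \<in> ?I" for t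
    using local_model_fst[OF m zs that] nears[OF that] unfolding xs_def[abs_def] vs_def has_vector_derivative_def by blast
  have v': "(v has_derivative (\<lambda>h. h *\<^sub>R - christoffel M c (x t) (v t) (v t))) (at t within ?I)" if "t \<in> ?I" for t
    using local_model_snd[OF m z that] near[OF that] unfolding x_def v_def[abs_def] has_vector_derivative_def by blast
  have P: "((\<lambda>t. ?G (x t) (xs t - x t) (v t)) has_derivative (\<lambda>h. h * P' t)) (at t within ?I)" if t: "t \<in> ?I" for t
  proof -
    let ?\<Gamma> = "christoffel M c (x t) (v t) (v t)"
    note bG = metric_coord_bilinear[OF c xi(1)[OF t]]
    have "((\<lambda>t. ?G (x t) (xs t - x t) (v t)) has_derivative
      (\<lambda>h. ?D (x t) (h *\<^sub>R v t) (xs t - x t) (v t) + ?G (x t) (h *\<^sub>R (vs t - v t)) (v t) + ?G (x t) (xs t - x t) (h *\<^sub>R - ?\<Gamma>))) (at t within ?I)"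
    proof (rule has_derivative_bilinear_family[where H = "\<lambda>t. ?G (x t)" and H' = "\<lambda>h. ?D (x t) (h *\<^sub>R v t)"
          and u' = "\<lambda>h. h *\<^sub>R (vs t - v t)", OF t _ _ _ _ v'[OF t]])
      show "bilinear (?G (x s))" if "s \<in> ?I" for s by (rule metric_coord_bilinear[OF c xi(1)[OF that]])
      show "bilinear (?D (x t) (h *\<^sub>R v t))" for h by (rule metric_deriv_bilinear[OF c xi(1)[OF t]])
      show "((\<lambda>t. xs t - x t) has_derivative (\<lambda>h. h *\<^sub>R (vs t - v t))) (at t within ?I)"
        using has_derivative_diff[OF xs'[OF t] x'[OF t]] by (simp add: scaleR_diff_right)
      fix i j :: "'e \<times> real"
      have "((\<lambda>y. ?G y i j) has_derivative (\<lambda>d. ?D (x t) d i j)) (at (x t) within x ` ?I)"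
        by (rule has_derivative_subset[OF metric_deriv_has_derivative[OF c xi(1)[OF t]]]) (use xi(1) in blast)
      then show "((\<lambda>s. ?G (x s) i j) has_derivative (\<lambda>h. ?D (x t) (h *\<^sub>R v t) i j)) (at t within ?I)"
        by (rule has_derivative_in_compose[OF x'[OF t]])
    qed
    moreover have "?D (x t) (h *\<^sub>R v t) (xs t - x t) (v t) + ?G (x t) (h *\<^sub>R (vs t - v t)) (v t) + ?G (x t) (xs t - x t) (h *\<^sub>R - ?\<Gamma>) = h * P' t" for h
    proof -
      have "?G (x t) (xs t - x t) ?\<Gamma> = ?D (x t) (v t) (xs t - x t) (v t) - ?D (x t) (xs t - x t) (v t) (v t) / 2"
        using christoffel_eq[OF c xi(1)[OF t], of "v t" "xs t - x t"] metric_coord_sym[OF c xi(1)[OF t], of "xs t - x t" ?\<Gamma>]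
          metric_deriv_sym[OF c xi(1)[OF t], of "v t" "v t" "xs t - x t"] by simp
      then show ?thesis
        by (simp only: linear_scale[OF metric_deriv_linear[OF c xi(1)[OF t]]] bilinear_lmul[OF bG] bilinear_rmul[OF bG] bilinear_rneg[OF bG])
          (simp add: P'_def algebra_simps)
    qed
    ultimately show ?thesis by simp
  qed
  have bound: "\<bar>P' t - E / 2\<bar> \<le> K * (norm v0 + r + 1)\<^sup>2 * e\<^sup>2" if t: "t \<in> ?I" for t
  proof -
    define \<xi> \<eta> where "\<xi> = xs t - x t" and "\<eta> = vs t - v t"
    have ee: "norm \<xi> \<le> e" "norm \<eta> \<le> e" "0 \<le> e"
      using e[OF t] norm_fst_snd_le[of "zs t - z t"] order_trans[OF norm_ge_zero e[OF t]]
      by (simp_all add: \<xi>_def \<eta>_def xs_def x_def vs_def v_def)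
    define R where "R = norm v0 + r"
    have R: "norm (v t) \<le> R" "norm (vs t) \<le> R" "0 \<le> R"
      using near[OF t] nears[OF t] norm_triangle_ineq2[of "v t" v0] norm_triangle_ineq2[of "vs t" v0] mm(1)
      by (auto simp: R_def v_def vs_def)
    note bG = metric_coord_bilinear[OF c xi(1)[OF t]] and bGs = metric_coord_bilinear[OF c xi(2)[OF t]]
    have m2: "K * n1 * n2 \<le> K * m1 * m2" if "0 \<le> n1" "0 \<le> n2" "n1 \<le> m1" "n2 \<le> m2" for n1 n2 m1 m2
      by (rule mult_mono[OF mult_left_mono]) (use mm(2) that in \<open>auto intro!: mult_nonneg_nonneg\<close>)
    have m3: "K * n1 * n2 * n3 \<le> K * m1 * m2 * m3"
      if "0 \<le> n1" "0 \<le> n2" "0 \<le> n3" "n1 \<le> m1" "n2 \<le> m2" "n3 \<le> m3" for n1 n2 n3 m1 m2 m3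
      by (rule mult_mono[OF mult_mono[OF mult_left_mono]])
        (use mm(2) that in \<open>auto intro!: mult_nonneg_nonneg\<close>)
    have b1: "\<bar>?G (xs t) (v t) (v t) - ?G (x t) (v t) (v t) - ?D (x t) \<xi> (v t) (v t)\<bar> \<le> K * e\<^sup>2 * R * R"
      unfolding \<xi>_def
      by (rule order_trans[OF metric_boundsD(6)[OF mm(3) xB(2,1)[OF t]] m3]) (use R ee in \<open>auto simp: \<xi>_def intro: power_mono\<close>)
    have b2: "\<bar>?G (xs t) \<eta> (vs t) - ?G (x t) \<eta> (vs t)\<bar> \<le> K * e * e * R"
      by (rule order_trans[OF metric_boundsD(3)[OF mm(3) xB(2,1)[OF t]] m3]) (use R ee in \<open>auto simp: \<xi>_def\<close>)
    have b3: "\<bar>?G (xs t) (v t) \<eta> - ?G (x t) (v t) \<eta>\<bar> \<le> K * e * R * e"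
      by (rule order_trans[OF metric_boundsD(3)[OF mm(3) xB(2,1)[OF t]] m3]) (use R ee in \<open>auto simp: \<xi>_def\<close>)
    have b4: "\<bar>?G (x t) \<eta> \<eta>\<bar> \<le> K * e * e"
      by (rule order_trans[OF metric_boundsD(2)[OF mm(3) xB(1,1)[OF t]] m2]) (use ee in auto)
    have vs: "vs t = v t + \<eta>" by (simp add: \<eta>_def)
    \<comment> \<open>Each summand is of second order in the distance of the curves: a Taylor
      remainder of the metric, two changes of the metric applied to the velocity difference, and a
      square of this difference. The energy of \<open>z\<close> itself is zero.\<close>
    have "E - 2 * P' t = (?G (xs t) (v t) (v t) - ?G (x t) (v t) (v t) - ?D (x t) \<xi> (v t) (v t))
      + (?G (xs t) \<eta> (vs t) - ?G (x t) \<eta> (vs t)) + (?G (xs t) (v t) \<eta> - ?G (x t) (v t) \<eta>) + ?G (x t) \<eta> \<eta>"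
    proof -
      have "E = ?G (xs t) (vs t) (vs t)" using E[OF t] by (simp add: xs_def vs_def)
      moreover have "?G (x t) (v t) (v t) = 0" using E0[OF t] by (simp add: x_def v_def)
      moreover have "P' t = ?D (x t) \<xi> (v t) (v t) / 2 + ?G (x t) \<eta> (v t)" by (simp add: P'_def \<xi>_def \<eta>_def)
      moreover have "?G (x t) (v t) \<eta> = ?G (x t) \<eta> (v t)" by (rule metric_coord_sym[OF c xi(1)[OF t]])
      ultimately show ?thesis
        unfolding vs by (simp add: bilinear_ladd[OF bG] bilinear_radd[OF bG] bilinear_ladd[OF bGs] bilinear_radd[OF bGs])
    qed
    then have "\<bar>E - 2 * P' t\<bar> \<le> K * e\<^sup>2 * R * R + K * e * e * R + K * e * R * e + K * e * e"
      using b1 b2 b3 b4 by linarith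
    also have "\<dots> = K * (R + 1)\<^sup>2 * e\<^sup>2" by (simp add: power2_eq_square algebra_simps)
    finally have 1: "\<bar>E - 2 * P' t\<bar> \<le> K * (R + 1)\<^sup>2 * e\<^sup>2" .
    have "0 \<le> K * (R + 1)\<^sup>2 * e\<^sup>2" using mm(2) by simp
    then show ?thesis using 1 unfolding R_def by linarith
  qed
  have "\<exists>t\<in>?I. (?G (x t2) (xs t2 - x t2) (v t2) - t2 * (E / 2)) - (?G (x t1) (xs t1 - x t1) (v t1) - t1 * (E / 2))
     = (t2 - t1) * (P' t - E / 2)"
  proof (rule mvt_very_simple[OF le])
    fix t assume "t1 \<le> t" "t \<le> t2"
    then have t: "t \<in> ?I" by simp
    show "((\<lambda>t. ?G (x t) (xs t - x t) (v t) - t * (E / 2)) has_derivative (\<lambda>h. h * (P' t - E / 2))) (at t within ?I)"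
    proof -
      have "((\<lambda>t. t * (E / 2)) has_derivative (\<lambda>h. h * (E / 2))) (at t within ?I)"
        by (rule has_derivative_mult_left[OF has_derivative_ident])
      from has_derivative_diff[OF P[OF t] this] show ?thesis by (simp only: right_diff_distrib)
    qed
  qed
  then obtain t where t: "t \<in> ?I" and eq: "?G (x t2) (xs t2 - x t2) (v t2) - ?G (x t1) (xs t1 - x t1) (v t1) - (t2 - t1) / 2 * E
     = (t2 - t1) * (P' t - E / 2)"
    by (auto simp: algebra_simps diff_divide_distrib)
  have "\<bar>(t2 - t1) * (P' t - E / 2)\<bar> = (t2 - t1) * \<bar>P' t - E / 2\<bar>" using le by (simp add: abs_mult)
  also have "\<dots> \<le> (t2 - t1) * (K * (norm v0 + r + 1)\<^sup>2 * e\<^sup>2)"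
    using bound[OF t] le by (intro mult_left_mono) auto
  finally show ?thesis using eq unfolding x_def v_def xs_def by simp
qed

end

text \<open>Only the limiting curve is assumed to reach the boundary; that the varied geodesics exit
  is a conclusion. The second alternative in \<open>start\<close> admits a limiting vector tangent
  to the boundary, provided that the varied vectors turn inward at a rate proportional to
  \<open>s\<close>.\<close>

locale geodesic_variation = lorentz_mfd M
  for M :: "('m::{t2_space, second_countable_topology}, 'e::euclidean_space) metric_manifold" +
  fixes p :: 'm and a :: "real \<Rightarrow> ('m, 'e) tvec" and \<gamma> :: "real \<Rightarrow> 'm" and V :: "real \<Rightarrow> ('m, 'e) tvec"
    and T C0 :: real and c0 :: "('m, 'e) chart"
  assumes T: "0 < T" and g: "geodesic_from M (p, a 0) {0..T} \<gamma> V"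
    and int: "\<gamma> ` {0<..<T} \<subseteq> interior_part M" and bd: "\<gamma> T \<in> boundary M"
    and c0: "c0 \<in> charts_at M p" and C0: "C0 \<ge> 0"
    and close0: "\<forall>\<^sub>F s in at_right 0. norm (a s c0 - a 0 c0) \<le> C0 * s"
    and tang: "\<And>s. a s \<in> tangent_space M p"
    and start: "0 < snd (a 0 c0) \<or> (\<exists>\<kappa>>0. \<forall>\<^sub>F s in at_right 0. \<kappa> * s \<le> snd (a s c0) - snd (a 0 c0))"
    and exit_transversal: "\<And>c. c \<in> charts_at M (\<gamma> T) \<Longrightarrow> snd (V T c) < 0"
    and null: "metric M p (a 0) (a 0) = 0"
begin

abbreviation En :: "real \<Rightarrow> real" where "En s \<equiv> metric M p (a s) (a s)"

text \<open>The last condition is the first variation formula at time \<open>t\<close>; up to \<open>O(s\<^sup>2)\<close> it does not depend on the chart.\<close>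

definition close :: "('m, 'e) chart \<Rightarrow> real \<Rightarrow> real \<Rightarrow> real \<Rightarrow> (real \<Rightarrow> 'm) \<Rightarrow> (real \<Rightarrow> ('m, 'e) tvec) \<Rightarrow> bool" where
  "close c t C s \<gamma>s Vs \<longleftrightarrow> geodesic_from M (p, a s) {0..t} \<gamma>s Vs \<and> \<gamma>s ` {0<..t} \<subseteq> interior_part M \<and> \<gamma>s t \<in> cdom c \<and>
     norm (cmap c (\<gamma>s t) - cmap c (\<gamma> t)) \<le> C * s \<and> norm (Vs t c - V t c) \<le> C * s \<and>
     \<bar>metric_coord M c (cmap c (\<gamma> t)) (cmap c (\<gamma>s t) - cmap c (\<gamma> t)) (V t c) - t / 2 * En s\<bar> \<le> C * s\<^sup>2"

text \<open>The constant may depend on the time and on the chart but not on \<open>s\<close>; the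
  range of admissible \<open>s\<close> may shrink from one time to the next.\<close>

definition good :: "('m, 'e) chart \<Rightarrow> real \<Rightarrow> bool" where
  "good c t \<longleftrightarrow> (\<exists>C\<ge>0. \<forall>\<^sub>F s in at_right 0. \<exists>\<gamma>s Vs. close c t C s \<gamma>s Vs)"

section \<open>The first variation formula propagated along the geodesic\<close>

lemma geo: "geodesic M {0..T} \<gamma> V" "\<gamma> 0 = p" "V 0 = a 0"
  using geodesic_fromD[OF g] by auto

lemma null_along: "t \<in> {0..T} \<Longrightarrow> metric M (\<gamma> t) (V t) (V t) = 0"
  using geodesic_energy[OF geo(1), of t 0] null geo(2,3) T by simp

lemma energy_along:
  assumes "geodesic_from M (p, a s) {0..t} \<gamma>s Vs" "u \<in> {0..t}"
  shows "metric M (\<gamma>s u) (Vs u) (Vs u) = En s"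
  using geodesic_energy[OF geodesic_fromD(2,1)[OF assms(1)] assms(2)] geodesic_fromD(3,4)[OF assms(1)] by simp

lemma energy_coord:
  assumes "geodesic_from M (p, a s) {0..t} \<gamma>s Vs" "u \<in> {0..t}" "c \<in> charts M" "\<gamma>s u \<in> cdom c"
  shows "metric_coord M c (cmap c (\<gamma>s u)) (Vs u c) (Vs u c) = En s"
  using energy_along[OF assms(1,2)] metric_eq[of c "\<gamma>s u" "Vs u" "Vs u"] assms
    geodesicD(1)[OF geodesic_fromD(2)[OF assms(1)] assms(2)] by (simp add: charts_at_iff)

lemma null_coord:
  assumes "t \<in> {0..T}" "c \<in> charts M" "\<gamma> t \<in> cdom c"
  shows "metric_coord M c (cmap c (\<gamma> t)) (V t c) (V t c) = 0"
  using null_along[OF assms(1)] metric_eq[of c "\<gamma> t" "V t" "V t"] geodesicD(1)[OF geo(1) assms(1)] assms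
  by (simp add: charts_at_iff)

text \<open>At time 0 all curves sit at \<open>p\<close>, so the displacement vanishes and only the
  initial velocities differ.\<close>

lemma good_start: "good c0 0"
proof -
  have c0': "c0 \<in> charts M" "p \<in> cdom c0" using c0 by (auto simp: charts_at_iff)
  then have b: "bilinear (metric_coord M c0 (cmap c0 p))" by (intro metric_coord_bilinear) auto
  have "\<forall>\<^sub>F s in at_right 0. close c0 0 C0 s (\<lambda>_. p) (\<lambda>_. a s)"
    using close0 eventually_pos
  proof eventually_elim
    case (elim s)
    have "geodesic_from M (p, a s) {0..0} (\<lambda>_. p) (\<lambda>_. a s)"
      unfolding geodesic_from_def using geodesic_point[OF tang[of s]] by simp
    then show ?case
      unfolding close_def using elim geo(2,3) c0' C0 by (simp add: bilinear_lzero[OF b])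
  qed
  then have "\<forall>\<^sub>F s in at_right 0. \<exists>\<gamma>s Vs. close c0 0 C0 s \<gamma>s Vs" by (rule eventually_mono) blast
  then show ?thesis unfolding good_def using C0 by blast
qed

text \<open>One step inside a single local model: the distance to the limiting curve grows at most
  by the comparison factor, and \<open>energy_step\<close> adds the increment of the first variation
  formula. The reason why the varied solution stays inside differs between the start and later
  times, and is left to the hypothesis \<open>pos\<close>.\<close>

lemma track:
  assumes m: "local_model c x0 v0 r K F" and c: "c \<in> charts M"
    and t: "0 \<le> t1" "t1 \<le> t2" "t2 \<le> T"
    and near: "\<And>t. t \<in> {t1..t2} \<Longrightarrow> \<gamma> t \<in> cdom c \<and> norm (cmap c (\<gamma> t) - x0) \<le> r / 2 \<and> norm (V t c - v0) \<le> r / 2"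
    and C: "C \<ge> 0" "\<forall>\<^sub>F s in at_right 0. \<exists>\<gamma>s Vs. close c t1 C s \<gamma>s Vs"
    and pos: "\<forall>\<^sub>F s in at_right 0. \<forall>\<gamma>s Vs zs. geodesic_from M (p, a s) {0..t1} \<gamma>s Vs \<longrightarrow> solves F {t1..t2} zs \<longrightarrow>
      zs t1 = (cmap c (\<gamma>s t1), Vs t1 c) \<longrightarrow>
      (\<forall>t\<in>{t1..t2}. norm (zs t - (cmap c (\<gamma> t), V t c)) \<le> exp (K * (t2 - t1)) * (2 * C) * s) \<longrightarrow>
      (\<forall>t\<in>{t1<..t2}. 0 < snd (fst (zs t)))"
  shows "good c t2"
proof -
  define z where "z t = (cmap c (\<gamma> t), V t c)" for t
  \<comment> \<open>The factor 2 adds the errors of position and velocity, each at most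
    \<open>C * s\<close>.\<close>
  define L where "L = exp (K * (t2 - t1)) * (2 * C)"
  define Q where "Q = K * (norm v0 + r + 1)\<^sup>2"
  define C' where "C' = L + C + (t2 - t1) * Q * L\<^sup>2"
  have mm: "r > 0" "K > 0" "K-lipschitz_on UNIV F" using m unfolding local_model_def by blast+
  have L: "L \<ge> 0" using C(1) by (simp add: L_def)
  have Q: "Q \<ge> 0" using mm(2) by (simp add: Q_def)
  have C': "C' \<ge> 0" "L \<le> C'" using L C(1) Q t(2) by (auto simp: C'_def)
  have sz: "solves F {t1..t2} z"
    unfolding z_def
  proof (rule geodesic_solves[OF geo(1) m c])
    fix u assume "u \<in> {t1..t2}"
    then show "\<gamma> u \<in> cdom c \<and> norm (cmap c (\<gamma> u) - x0) \<le> r \<and> norm (V u c - v0) \<le> r"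
      using near[of u] mm(1) by auto
  qed (use t in auto)
  have snn: "0 \<le> snd (fst (z u))" if "u \<in> {t1..t2}" for u
    using near[OF that] snd_cmap_nonneg[of c "\<gamma> u"] c by (simp add: z_def charts_at_iff)
  have "\<forall>\<^sub>F s in at_right 0. \<exists>\<gamma>s Vs. close c t2 C' s \<gamma>s Vs"
    using C(2) pos eventually_pos eventually_small[of "r / 2" L, OF half_gt_zero[OF mm(1)]]
  proof eventually_elim
    case (elim s)
    then obtain \<gamma>s Vs where cl: "close c t1 C s \<gamma>s Vs" by blast
    then have gs: "geodesic_from M (p, a s) {0..t1} \<gamma>s Vs" "\<gamma>s ` {0<..t1} \<subseteq> interior_part M" "\<gamma>s t1 \<in> cdom c"
      "norm (cmap c (\<gamma>s t1) - cmap c (\<gamma> t1)) \<le> C * s" "norm (Vs t1 c - V t1 c) \<le> C * s"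
      "\<bar>metric_coord M c (cmap c (\<gamma> t1)) (cmap c (\<gamma>s t1) - cmap c (\<gamma> t1)) (V t1 c) - t1 / 2 * En s\<bar> \<le> C * s\<^sup>2"
      unfolding close_def by blast+
    obtain zs where zs: "zs t1 = (cmap c (\<gamma>s t1), Vs t1 c)" "solves F {t1..t2} zs"
      using picard[OF mm(3) t(2)] by blast
    have n1: "norm (zs t1 - z t1) \<le> 2 * C * s"
      using norm_Pair_le[of "cmap c (\<gamma>s t1) - cmap c (\<gamma> t1)" "Vs t1 c - V t1 c"] gs(4,5) by (simp add: zs(1) z_def)
    have n: "norm (zs u - z u) \<le> L * s" if u: "u \<in> {t1..t2}" for u
    proof -
      have su: "{t1..u} \<subseteq> {t1..t2}" using u by auto
      have "norm (zs u - z u) \<le> exp (K * (u - t1)) * norm (zs t1 - z t1)"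
        by (rule local_model_close(1)[OF m solves_subset[OF zs(2) su] solves_subset[OF sz su]]) (use u in simp)
      also have "\<dots> \<le> exp (K * (t2 - t1)) * (2 * C * s)"
        using u mm(2) n1 by (intro mult_mono) auto
      finally show ?thesis by (simp add: L_def mult_ac)
    qed
    have p: "0 < snd (fst (zs u))" if "u \<in> {t1<..t2}" for u
    proof -
      have n': "\<forall>t\<in>{t1..t2}. norm (zs t - (cmap c (\<gamma> t), V t c)) \<le> exp (K * (t2 - t1)) * (2 * C) * s"
        using n unfolding z_def L_def by blast
      show ?thesis using elim(2)[rule_format, OF gs(1) zs(2,1) _ that] n' by blast
    qed
    have c1: "c \<in> charts_at M (\<gamma>s t1)" using gs(3) c by (simp add: charts_at_iff)
    have nears: "norm (fst (zs u) - x0) \<le> r \<and> norm (snd (zs u) - v0) \<le> r \<and> 0 \<le> snd (fst (zs u))" if u: "u \<in> {t1..t2}" for u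
    proof (intro conjI)
      have d: "norm (fst (zs u) - fst (z u)) \<le> r / 2" "norm (snd (zs u) - snd (z u)) \<le> r / 2"
        using norm_fst_snd_le[of "zs u - z u"] n[OF u] elim(4) by simp_all
      have d': "norm (fst (z u) - x0) \<le> r / 2" "norm (snd (z u) - v0) \<le> r / 2" using near[OF u] by (simp_all add: z_def)
      show "norm (fst (zs u) - x0) \<le> r" using norm_triangle_le[of "fst (zs u) - fst (z u)" "fst (z u) - x0" r] d d' by simp
      show "norm (snd (zs u) - v0) \<le> r" using norm_triangle_le[of "snd (zs u) - snd (z u)" "snd (z u) - v0" r] d d' by simp
      show "0 \<le> snd (fst (zs u))"
        using p[of u] u zs(1) snd_cmap_nonneg[OF c1] by (cases "u = t1") auto
    qed
    obtain \<gamma>' V' where g': "geodesic_from M (p, a s) {0..t2} \<gamma>' V'" "\<forall>t\<in>{0..t1}. \<gamma>' t = \<gamma>s t"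
      "\<forall>t\<in>{t1..t2}. \<gamma>' t \<in> cdom c \<and> cmap c (\<gamma>' t) = fst (zs t) \<and> V' t c = snd (zs t)"
      using geodesic_continue[OF m c gs(1) t(1,2) gs(3) zs(2,1) nears] by blast
    have E: "metric_coord M c (fst (zs u)) (snd (zs u)) (snd (zs u)) = En s" if u: "u \<in> {t1..t2}" for u
      using energy_coord[OF g'(1) _ c, of u] g'(3) u t by force
    have E0: "metric_coord M c (fst (z u)) (snd (z u)) (snd (z u)) = 0" if u: "u \<in> {t1..t2}" for u
      using null_coord[OF _ c, of u] near[OF u] u t by (simp add: z_def)
    have nearz: "norm (fst (z u) - x0) \<le> r \<and> norm (snd (z u) - v0) \<le> r \<and> 0 \<le> snd (fst (z u))" if u: "u \<in> {t1..t2}" for u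
      using near[OF u] snn[OF u] mm(1) by (simp add: z_def)
    have es: "\<bar>metric_coord M c (fst (z t2)) (fst (zs t2) - fst (z t2)) (snd (z t2))
      - metric_coord M c (fst (z t1)) (fst (zs t1) - fst (z t1)) (snd (z t1)) - (t2 - t1) / 2 * En s\<bar>
      \<le> (t2 - t1) * (Q * (L * s)\<^sup>2)"
      unfolding Q_def by (rule energy_step[OF m c t(2) sz zs(2) nearz nears n E0 E])
    have t2: "t2 \<in> {t1..t2}" using t by simp
    have le: "L * s \<le> C' * s" using C'(2) elim(3) by (intro mult_right_mono) auto
    have "close c t2 C' s \<gamma>' V'"
      unfolding close_def
    proof (intro conjI)
      show "\<gamma>' ` {0<..t2} \<subseteq> interior_part M"
      proof (rule image_subsetI)
        fix u assume u: "u \<in> {0<..t2}"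
        show "\<gamma>' u \<in> interior_part M"
        proof (cases "u \<le> t1")
          case True then show ?thesis using gs(2) g'(2) u by auto
        next
          case False
          then have u': "u \<in> {t1..t2}" using u by auto
          then have "c \<in> charts_at M (\<gamma>' u)" using g'(3) c by (simp add: charts_at_iff)
          then show ?thesis using interior_iff p[of u] g'(3) u' False by auto
        qed
      qed
      show "\<gamma>' t2 \<in> cdom c" using g'(3) t2 by blast
      have d: "norm (fst (zs t2) - fst (z t2)) \<le> L * s" "norm (snd (zs t2) - snd (z t2)) \<le> L * s"
        using norm_fst_snd_le[of "zs t2 - z t2"] n[OF t2] by simp_all
      show "norm (cmap c (\<gamma>' t2) - cmap c (\<gamma> t2)) \<le> C' * s" "norm (V' t2 c - V t2 c) \<le> C' * s"
        using d le g'(3) t2 by (auto simp: z_def)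
      have "\<bar>metric_coord M c (fst (z t2)) (fst (zs t2) - fst (z t2)) (snd (z t2)) - t2 / 2 * En s\<bar>
        \<le> (t2 - t1) * (Q * (L * s)\<^sup>2) + C * s\<^sup>2"
        using es gs(6) by (simp add: z_def zs(1) field_simps)
      also have "\<dots> = ((t2 - t1) * Q * L\<^sup>2 + C) * s\<^sup>2" by (simp add: power_mult_distrib algebra_simps)
      also have "\<dots> \<le> C' * s\<^sup>2" using L by (intro mult_right_mono) (auto simp: C'_def)
      finally show "\<bar>metric_coord M c (cmap c (\<gamma> t2)) (cmap c (\<gamma>' t2) - cmap c (\<gamma> t2)) (V t2 c) - t2 / 2 * En s\<bar> \<le> C' * s\<^sup>2"
        using g'(3) t2 by (simp add: z_def)
    qed (rule g'(1))
    then show ?case by blast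
  qed
  then show ?thesis unfolding good_def using C'(1) by blast
qed

end

context lorentz_mfd
begin

text \<open>Passing from the time \<open>tm\<close>, up to which both curves are inside, to their
  exits changes the displacement by a multiple of \<open>v0\<close> and a quadratic error. The
  multiple of \<open>v0\<close> does not affect the pairing because \<open>v0\<close> is lightlike.
  As the energy is itself O(e), replacing \<open>tm\<close> by \<open>T\<close> costs only
  O(e^2).\<close>

lemma exit_pairing:
  assumes B: "metric_bounds c B K" "K \<ge> 0" and c: "c \<in> charts M"
    and pts: "x0 \<in> B" "xm \<in> B" "xs \<in> B"
    and R: "norm v0 \<le> R" "norm vm \<le> R" "norm vs \<le> R"
    and e: "norm (x0 - xm) \<le> e" "norm (v0 - vm) \<le> e" "norm (xs - xm) \<le> e" "norm (vs - vm) \<le> e" "\<bar>tm - T\<bar> \<le> e"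
    and y: "norm (y - x0 - (xs - xm) - \<alpha> *\<^sub>R v0) \<le> 2 * e\<^sup>2"
    and null: "metric_coord M c x0 v0 v0 = 0" "metric_coord M c xm vm vm = 0"
    and E: "metric_coord M c xs vs vs = E"
    and P: "\<bar>metric_coord M c xm (xs - xm) vm - tm / 2 * E\<bar> \<le> A * e\<^sup>2"
  shows "\<bar>metric_coord M c x0 (y - x0) v0 - T / 2 * E\<bar> \<le> (A + K * (1 + 4 * R + R\<^sup>2)) * e\<^sup>2"
proof -
  let ?G = "metric_coord M c"
  have e0: "0 \<le> e" and R0: "0 \<le> R" using e(1) R(1) norm_ge_zero order_trans by blast+
  have xi: "x0 \<in> cimg c" "xm \<in> cimg c" "xs \<in> cimg c" using B(1) pts unfolding metric_bounds_def by blast+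
  note b0 = metric_coord_bilinear[OF c xi(1)] and bm = metric_coord_bilinear[OF c xi(2)] and bs = metric_coord_bilinear[OF c xi(3)]
  have m2: "K * n1 * n2 \<le> K * m1 * m2" if "0 \<le> n1" "0 \<le> n2" "n1 \<le> m1" "n2 \<le> m2" for n1 n2 m1 m2
    by (rule mult_mono[OF mult_left_mono]) (use B(2) that in \<open>auto intro!: mult_nonneg_nonneg\<close>)
  have m3: "K * n1 * n2 * n3 \<le> K * m1 * m2 * m3"
    if "0 \<le> n1" "0 \<le> n2" "0 \<le> n3" "n1 \<le> m1" "n2 \<le> m2" "n3 \<le> m3" for n1 n2 n3 m1 m2 m3
    by (rule mult_mono[OF mult_mono[OF mult_left_mono]]) (use B(2) that in \<open>auto intro!: mult_nonneg_nonneg\<close>)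
  define \<xi> er where "\<xi> = xs - xm" and "er = y - x0 - \<xi> - \<alpha> *\<^sub>R v0"
  have \<xi>: "norm \<xi> \<le> e" using e by (simp add: \<xi>_def)
  have er: "norm er \<le> 2 * e\<^sup>2" using y by (simp add: er_def \<xi>_def)
  have W: "?G x0 (y - x0) v0 = ?G x0 \<xi> v0 + ?G x0 er v0"
  proof -
    have "y - x0 = \<xi> + (\<alpha> *\<^sub>R v0 + er)" by (simp add: er_def)
    then show ?thesis by (simp add: bilinear_ladd[OF b0] bilinear_lmul[OF b0] null)
  qed
  have 1: "\<bar>?G x0 \<xi> v0 - ?G xm \<xi> v0\<bar> \<le> K * e * e * R"
    by (rule order_trans[OF metric_boundsD(3)[OF B(1) pts(1,2)] m3]) (use e \<xi> R in auto)
  have 2: "\<bar>?G xm \<xi> (v0 - vm)\<bar> \<le> K * e * e"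
    by (rule order_trans[OF metric_boundsD(2)[OF B(1) pts(2,2)] m2]) (use e \<xi> in auto)
  have 3: "\<bar>?G x0 er v0\<bar> \<le> K * (2 * e\<^sup>2) * R"
    by (rule order_trans[OF metric_boundsD(2)[OF B(1) pts(1,1)] m2]) (use er R in auto)
  have E1: "\<bar>?G xs vs vs - ?G xm vs vs\<bar> \<le> K * e * R * R"
    by (rule order_trans[OF metric_boundsD(3)[OF B(1) pts(3,2)] m3]) (use e R in auto)
  have E2: "\<bar>?G xm vs (vs - vm)\<bar> \<le> K * R * e"
    by (rule order_trans[OF metric_boundsD(2)[OF B(1) pts(2,2)] m2]) (use e R in auto)
  have E3: "\<bar>?G xm (vs - vm) vm\<bar> \<le> K * e * R"
    by (rule order_trans[OF metric_boundsD(2)[OF B(1) pts(2,2)] m2]) (use e R in auto)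
  \<comment> \<open>The energy is of first order, because the data at \<open>xs\<close> differ by at
    most \<open>e\<close> from lightlike data at \<open>xm\<close>.\<close>
  have "E = (?G xs vs vs - ?G xm vs vs) + ?G xm vs (vs - vm) + ?G xm (vs - vm) vm"
    using E null(2) by (simp add: bilinear_lsub[OF bm] bilinear_rsub[OF bm])
  then have "\<bar>E\<bar> \<le> K * e * R * R + K * R * e + K * e * R" using E1 E2 E3 by linarith
  then have "\<bar>tm - T\<bar> * \<bar>E\<bar> \<le> e * (K * e * R * R + K * R * e + K * e * R)"
    using e(5) e0 by (intro mult_mono) auto
  moreover have "\<bar>tm / 2 * E - T / 2 * E\<bar> = \<bar>tm - T\<bar> * \<bar>E\<bar> / 2" by (simp add: left_diff_distrib[symmetric] diff_divide_distrib[symmetric] abs_mult)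
  ultimately have 4: "\<bar>tm / 2 * E - T / 2 * E\<bar> \<le> e * (K * e * R * R + K * R * e + K * e * R) / 2" by simp
  have "?G x0 (y - x0) v0 - T / 2 * E = (?G x0 \<xi> v0 - ?G xm \<xi> v0) + ?G xm \<xi> (v0 - vm) + ?G x0 er v0
    + (?G xm \<xi> vm - tm / 2 * E) + (tm / 2 * E - T / 2 * E)"
    by (simp add: W bilinear_rsub[OF bm])
  then have "\<bar>?G x0 (y - x0) v0 - T / 2 * E\<bar> \<le> K * e * e * R + K * e * e + K * (2 * e\<^sup>2) * R + A * e\<^sup>2
     + e * (K * e * R * R + K * R * e + K * e * R) / 2"
    using 1 2 3 4 P[folded \<xi>_def] by linarith
  also have "\<dots> = (A + K * (1 + 4 * R + R\<^sup>2 / 2)) * e\<^sup>2" by (simp add: power2_eq_square field_simps)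
  also have "\<dots> \<le> (A + K * (1 + 4 * R + R\<^sup>2)) * e\<^sup>2"
    using B(2) by (intro mult_right_mono add_left_mono mult_left_mono) auto
  finally show ?thesis .
qed

end

context geodesic_variation
begin

text \<open>The transition map is linear up to second order, so the displacements seen in the two
  charts correspond under the Jacobian up to O(s^2), and the Jacobian preserves the pairing.\<close>

lemma good_change:
  assumes t: "t \<in> {0..T}" and c: "c \<in> charts_at M (\<gamma> t)" "c' \<in> charts_at M (\<gamma> t)" and good: "good c t"
  shows "good c' t"
proof -
  note ch = c[unfolded charts_at_iff]
  let ?S = "ovl c c'" and ?\<psi> = "tr c c'"
  define x0 v0 y0 w0 where "x0 = cmap c (\<gamma> t)" and "v0 = V t c" and "y0 = cmap c' (\<gamma> t)" and "w0 = V t c'"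
  have x0: "x0 \<in> ?S" "x0 \<in> cimg c" "y0 \<in> cimg c'" "cinv c x0 = \<gamma> t" "?\<psi> x0 = y0"
    using ch by (auto simp: x0_def y0_def)
  have op: "openin (top_of_set half_space) ?S" "smooth_on ?S ?\<psi>" using openin_ovl smooth_tr ch by auto
  obtain r N where r: "r > 0" and N: "N \<ge> 0" and sub: "cball x0 r \<inter> half_space \<subseteq> ?S"
    and b: "C2_bounds ?S (cball x0 r \<inter> half_space) ?\<psi> N"
    using smooth_on_C2_bounds[OF op(2) thick_half_space op(1) x0(1)] by blast
  let ?B = "cball x0 r \<inter> half_space"
  have x0B: "x0 \<in> ?B" using r subsetD[OF cimg_half[OF conjunct1[OF ch(1)]] x0(2)] by simp
  define J where "J x = frechet_derivative ?\<psi> (at x within ?S)" for x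
  have J: "jacobian c c' (cinv c x) = J x" if "x \<in> ?S" for x
    unfolding J_def by (rule jacobian_cinv) (use that ch in auto)
  have linJ: "linear (J x)" if "x \<in> ?S" for x
    unfolding J[OF that, symmetric] by (rule linear_jacobian) (use that ch in \<open>auto simp: charts_at_iff\<close>)
  have w0: "w0 = J x0 v0"
    using tangent_spaceD[OF geodesicD(1)[OF geo(1) t] c] J[OF x0(1)] x0(4) by (simp add: w0_def v0_def)
  obtain r' K where K: "r' > 0" "K > 0" "metric_bounds c' (cball y0 r' \<inter> half_space) K"
    using metric_bounds_ex[OF _ x0(3)] ch by blast
  have y0B: "y0 \<in> cball y0 r' \<inter> half_space" using K(1) subsetD[OF cimg_half[OF conjunct1[OF ch(2)]] x0(3)] by simp
  obtain C where C: "C \<ge> 0" "\<forall>\<^sub>F s in at_right 0. \<exists>\<gamma>s Vs. close c t C s \<gamma>s Vs" using good unfolding good_def by blast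
  define C' where "C' = N * C + N * C * norm v0 + K * (N * C\<^sup>2) * norm w0 + C"
  have C': "C' \<ge> 0" "N * C \<le> C'" "N * C + N * C * norm v0 \<le> C'" "K * (N * C\<^sup>2) * norm w0 + C \<le> C'"
    using N C(1) K(2) by (simp_all add: C'_def)
  have "\<forall>\<^sub>F s in at_right 0. \<exists>\<gamma>s Vs. close c' t C' s \<gamma>s Vs"
    using C(2) eventually_pos eventually_small[OF r, of C]
  proof eventually_elim
    case (elim s)
    then obtain \<gamma>s Vs where cl: "close c t C s \<gamma>s Vs" by blast
    define xs vs where "xs = cmap c (\<gamma>s t)" and "vs = Vs t c"
    have gs: "geodesic_from M (p, a s) {0..t} \<gamma>s Vs" "\<gamma>s ` {0<..t} \<subseteq> interior_part M" "\<gamma>s t \<in> cdom c"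
      "norm (xs - x0) \<le> C * s" "norm (vs - v0) \<le> C * s"
      "\<bar>metric_coord M c x0 (xs - x0) v0 - t / 2 * En s\<bar> \<le> C * s\<^sup>2"
      using cl unfolding close_def x0_def v0_def xs_def vs_def by blast+
    have xi: "xs \<in> cimg c" "cinv c xs = \<gamma>s t" using gs(3) ch by (auto simp: xs_def)
    have xsB: "xs \<in> ?B" using gs(4) elim(3) xi(1) cimg_half[of c] ch by (auto simp: dist_norm norm_minus_commute)
    then have xsS: "xs \<in> ?S" using sub by blast
    then have d': "\<gamma>s t \<in> cdom c'" using xi(2) ch by auto
    have \<psi>s: "?\<psi> xs = cmap c' (\<gamma>s t)" using xi by simp
    have cs: "c \<in> charts_at M (\<gamma>s t)" "c' \<in> charts_at M (\<gamma>s t)" using gs(3) d' ch by (auto simp: charts_at_iff)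
    have Vt: "Vs t \<in> tangent_space M (\<gamma>s t)" by (rule geodesicD(1)[OF geodesic_fromD(2)[OF gs(1)]]) (use t in simp)
    have ws: "Vs t c' = J xs vs" using tangent_spaceD[OF Vt cs] J[OF xsS] xi(2) by (simp add: vs_def)
    note D = C2_boundsD[OF b xsB x0B, folded J_def]
    have n1: "norm (cmap c' (\<gamma>s t) - y0) \<le> N * C * s"
      using D(2) mult_left_mono[OF gs(4) N] unfolding \<psi>s x0(5) by (simp add: mult.assoc)
    have "Vs t c' - w0 = J xs (vs - v0) + (J xs v0 - J x0 v0)"
      by (simp add: ws w0 linear_diff[OF linJ[OF xsS]])
    also have "norm \<dots> \<le> N * (C * s) + N * (C * s) * norm v0"
      by (rule order_trans[OF norm_triangle_ineq], rule add_mono,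
          rule order_trans[OF D(3) mult_left_mono[OF gs(5) N]],
          rule order_trans[OF D(4) mult_right_mono[OF mult_left_mono[OF gs(4) N] norm_ge_zero]])
    finally have n2: "norm (Vs t c' - w0) \<le> (N * C + N * C * norm v0) * s" by (simp add: algebra_simps)
    let ?er = "?\<psi> xs - ?\<psi> x0 - J x0 (xs - x0)"
    have er: "norm ?er \<le> N * (C * s)\<^sup>2"
      using D(5) mult_left_mono[OF power_mono[OF gs(4) norm_ge_zero, of 2] N] by linarith
    have b0: "bilinear (metric_coord M c' y0)" using metric_coord_bilinear ch x0(3) by blast
    have "metric_coord M c x0 (xs - x0) v0 = metric_coord M c' y0 (J x0 (xs - x0)) w0"
      using metric_coord_tr[of c c' x0 "xs - x0" v0] x0 ch J[OF x0(1)] by (simp add: w0)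
    then have "metric_coord M c' y0 (cmap c' (\<gamma>s t) - y0) w0 - t / 2 * En s
      = metric_coord M c' y0 ?er w0 + (metric_coord M c x0 (xs - x0) v0 - t / 2 * En s)"
      unfolding \<psi>s x0(5) by (simp add: bilinear_lsub[OF b0])
    moreover have "\<bar>metric_coord M c' y0 ?er w0\<bar> \<le> K * (N * (C * s)\<^sup>2) * norm w0"
      by (rule order_trans[OF metric_boundsD(2)[OF K(3) y0B y0B] mult_right_mono[OF mult_left_mono[OF er]]]) (use K(2) in auto)
    ultimately have n3: "\<bar>metric_coord M c' y0 (cmap c' (\<gamma>s t) - y0) w0 - t / 2 * En s\<bar> \<le> (K * (N * C\<^sup>2) * norm w0 + C) * s\<^sup>2"
      using gs(6) by (simp add: power_mult_distrib algebra_simps)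
    have "close c' t C' s \<gamma>s Vs"
      unfolding close_def
    proof (intro conjI)
      show "norm (cmap c' (\<gamma>s t) - cmap c' (\<gamma> t)) \<le> C' * s"
        by (rule order_trans[OF n1[unfolded y0_def] mult_right_mono[OF C'(2)]]) (use elim(2) in simp)
      show "norm (Vs t c' - V t c') \<le> C' * s"
        by (rule order_trans[OF n2[unfolded w0_def] mult_right_mono[OF C'(3)]]) (use elim(2) in simp)
      show "\<bar>metric_coord M c' (cmap c' (\<gamma> t)) (cmap c' (\<gamma>s t) - cmap c' (\<gamma> t)) (V t c') - t / 2 * En s\<bar> \<le> C' * s\<^sup>2"
        by (rule order_trans[OF n3[unfolded y0_def w0_def] mult_right_mono[OF C'(4)[unfolded w0_def]]]) simp
    qed (use gs d' in auto)
    then show ?case by blast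
  qed
  then show ?thesis unfolding good_def using C'(1) by blast
qed

text \<open>The limiting curve is kept within \<open>r / 2\<close>, so that varied curves close to
  it remain within \<open>r\<close>, where the model is valid.\<close>

lemma model_nhd:
  assumes t: "t \<in> {0..T}" and c: "c \<in> charts_at M (\<gamma> t)"
  obtains r K F \<delta> where "local_model c (cmap c (\<gamma> t)) (V t c) r K F" "\<delta> > 0"
    "\<And>u. u \<in> {0..T} \<Longrightarrow> \<bar>u - t\<bar> < \<delta> \<Longrightarrow> \<gamma> u \<in> cdom c \<and> norm (cmap c (\<gamma> u) - cmap c (\<gamma> t)) \<le> r / 2 \<and>
      norm (V u c - V t c) \<le> r / 2"
proof -
  note ch = c[unfolded charts_at_iff]
  obtain r K F where m: "local_model c (cmap c (\<gamma> t)) (V t c) r K F"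
    using local_model_ex[of c "cmap c (\<gamma> t)" "V t c"] ch by blast
  then have r: "r / 2 > 0" unfolding local_model_def by simp
  obtain \<delta> where \<delta>: "\<delta> > 0" "\<forall>u\<in>{0..T}. \<bar>u - t\<bar> < \<delta> \<longrightarrow> \<gamma> u \<in> cdom c \<and>
    norm (cmap c (\<gamma> u) - cmap c (\<gamma> t)) < r / 2 \<and> norm (V u c - V t c) < r / 2"
    using geodesic_nhd[OF geo(1) t c r] by blast
  show thesis
  proof (rule that[OF m \<delta>(1)])
    fix u assume "u \<in> {0..T}" "\<bar>u - t\<bar> < \<delta>"
    then show "\<gamma> u \<in> cdom c \<and> norm (cmap c (\<gamma> u) - cmap c (\<gamma> t)) \<le> r / 2 \<and> norm (V u c - V t c) \<le> r / 2"
      using \<delta>(2)[rule_format, of u] by simp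
  qed
qed

lemma interior_along:
  assumes "t \<in> {0<..<T}" "c \<in> charts M" "\<gamma> t \<in> cdom c"
  shows "0 < snd (cmap c (\<gamma> t))"
proof -
  have "\<gamma> t \<in> interior_part M" using int assms(1) by blast
  then show ?thesis using interior_iff[of c "\<gamma> t"] assms(2,3) by (simp add: charts_at_iff)
qed

text \<open>Between two interior times the limiting curve has a positive minimal height
  \<open>h\<close> over the boundary, and a varied curve at distance less than \<open>h\<close>
  remains inside.\<close>

lemma good_step:
  assumes x: "x \<in> {0..T}"
  shows "\<exists>c. \<exists>\<delta>>0. (\<forall>t\<in>{0..T}. \<bar>t - x\<bar> < \<delta> \<longrightarrow> c \<in> charts_at M (\<gamma> t)) \<and>
    (\<forall>t1 t2. 0 < t1 \<longrightarrow> t1 \<le> t2 \<longrightarrow> t2 < T \<longrightarrow> \<bar>t1 - x\<bar> < \<delta> \<longrightarrow> \<bar>t2 - x\<bar> < \<delta> \<longrightarrow> good c t1 \<longrightarrow> good c t2)"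
proof -
  obtain c where c: "c \<in> charts_at M (\<gamma> x)" using ex_chart by blast
  note ch = conjunct1[OF c[unfolded charts_at_iff]]
  obtain r K F \<delta> where m: "local_model c (cmap c (\<gamma> x)) (V x c) r K F" and \<delta>: "\<delta> > 0"
    and near: "\<And>u. u \<in> {0..T} \<Longrightarrow> \<bar>u - x\<bar> < \<delta> \<Longrightarrow> \<gamma> u \<in> cdom c \<and> norm (cmap c (\<gamma> u) - cmap c (\<gamma> x)) \<le> r / 2 \<and>
      norm (V u c - V x c) \<le> r / 2"
    using model_nhd[OF x c] by blast
  show ?thesis
  proof (intro exI conjI ballI allI impI)
    show "\<delta> > 0" by (rule \<delta>)
    fix t assume "t \<in> {0..T}" "\<bar>t - x\<bar> < \<delta>"
    then show "c \<in> charts_at M (\<gamma> t)" using near[of t] ch by (simp add: charts_at_iff)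
  next
    fix t1 t2 assume t: "0 < t1" "t1 \<le> t2" "t2 < T" "\<bar>t1 - x\<bar> < \<delta>" "\<bar>t2 - x\<bar> < \<delta>" and "good c t1"
    then obtain C where C: "C \<ge> 0" "\<forall>\<^sub>F s in at_right 0. \<exists>\<gamma>s Vs. close c t1 C s \<gamma>s Vs" unfolding good_def by blast
    have near': "\<gamma> u \<in> cdom c \<and> norm (cmap c (\<gamma> u) - cmap c (\<gamma> x)) \<le> r / 2 \<and> norm (V u c - V x c) \<le> r / 2"
      if "u \<in> {t1..t2}" for u
      by (rule near) (use that t in auto)
    have "continuous_on {t1..t2} (\<lambda>u. cmap c (\<gamma> u))"
      by (rule continuous_on_compose2[OF cont_cmap[OF ch] continuous_on_subset[OF geodesic_continuous[OF geo(1)]]])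
        (use near' t in auto)
    then have "continuous_on {t1..t2} (\<lambda>u. snd (cmap c (\<gamma> u)))" by (rule continuous_on_snd)
    moreover have "{t1..t2} \<noteq> {}" using t(2) by simp
    ultimately obtain u0 where u0: "u0 \<in> {t1..t2}" "\<And>u. u \<in> {t1..t2} \<Longrightarrow> snd (cmap c (\<gamma> u0)) \<le> snd (cmap c (\<gamma> u))"
      using continuous_attains_inf[OF compact_Icc[of t1 t2]] by blast
    define h where "h = snd (cmap c (\<gamma> u0))"
    have h: "h > 0" unfolding h_def by (rule interior_along[OF _ ch]) (use u0(1) near'[OF u0(1)] t in auto)
    show "good c t2"
    proof (rule track[OF m ch _ t(2) _ near' C])
      show "\<forall>\<^sub>F s in at_right 0. \<forall>\<gamma>s Vs zs. geodesic_from M (p, a s) {0..t1} \<gamma>s Vs \<longrightarrow> solves F {t1..t2} zs \<longrightarrow>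
        zs t1 = (cmap c (\<gamma>s t1), Vs t1 c) \<longrightarrow>
        (\<forall>t\<in>{t1..t2}. norm (zs t - (cmap c (\<gamma> t), V t c)) \<le> exp (K * (t2 - t1)) * (2 * C) * s) \<longrightarrow>
        (\<forall>t\<in>{t1<..t2}. 0 < snd (fst (zs t)))"
        using eventually_small[OF h, of "exp (K * (t2 - t1)) * (2 * C)"]
      proof eventually_elim
        case (elim s)
        show ?case
        proof (intro allI impI ballI)
          fix zs u
          assume n: "\<forall>t\<in>{t1..t2}. norm (zs t - (cmap c (\<gamma> t), V t c)) \<le> exp (K * (t2 - t1)) * (2 * C) * s"
            and u: "u \<in> {t1<..t2}"
          have u': "u \<in> {t1..t2}" using u by simp
          have "\<bar>snd (fst (zs u)) - snd (cmap c (\<gamma> u))\<bar> \<le> norm (fst (zs u - (cmap c (\<gamma> u), V u c)))"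
            using norm_fst_snd_le(2)[of "fst (zs u - (cmap c (\<gamma> u), V u c))"] by simp
          also have "\<dots> \<le> norm (zs u - (cmap c (\<gamma> u), V u c))" by (rule norm_fst_snd_le)
          also have "\<dots> < h" using n[rule_format, OF u'] elim by simp
          finally show "0 < snd (fst (zs u))" using u0(2)[OF u'] by (simp add: h_def)
        qed
      qed
    qed (use t in auto)
  qed
qed

text \<open>The height over the boundary may be zero at the start, so the argument of
  \<open>good_step\<close> fails there. For an inward initial vector, the last velocity component of
  the varied curves stays bounded below. Otherwise the varied curve is compared with the limiting
  one: both start at \<open>p\<close>, and the last component of their velocity difference stays
  positive for a time independent of \<open>s\<close>, so the varied curve lies above.\<close>

lemma good_initial:
  obtains \<delta> where "\<delta> > 0" "\<And>t. 0 < t \<Longrightarrow> t < T \<Longrightarrow> t < \<delta> \<Longrightarrow> c0 \<in> charts_at M (\<gamma> t) \<and> good c0 t"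
proof -
  have c: "c0 \<in> charts_at M (\<gamma> 0)" using c0 geo(2) by simp
  note ch = conjunct1[OF c[unfolded charts_at_iff]]
  have z0: "0 \<in> {0..T}" using T by simp
  obtain r K F \<delta>1 where m: "local_model c0 (cmap c0 (\<gamma> 0)) (V 0 c0) r K F" and \<delta>1: "\<delta>1 > 0"
    and near: "\<And>u. u \<in> {0..T} \<Longrightarrow> \<bar>u - 0\<bar> < \<delta>1 \<Longrightarrow> \<gamma> u \<in> cdom c0 \<and> norm (cmap c0 (\<gamma> u) - cmap c0 (\<gamma> 0)) \<le> r / 2 \<and>
      norm (V u c0 - V 0 c0) \<le> r / 2"
    using model_nhd[OF z0 c] by blast
  have mm: "r > 0" "K > 0" "K-lipschitz_on UNIV F" using m unfolding local_model_def by blast+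
  obtain C where C: "C \<ge> 0" "\<forall>\<^sub>F s in at_right 0. \<exists>\<gamma>s Vs. close c0 0 C s \<gamma>s Vs" using good_start unfolding good_def by blast
  \<comment> \<open>Times will be restricted to at most 1, so that \<open>exp K\<close> dominates
    the comparison factors.\<close>
  define L where "L = exp K * (2 * C)"
  have L: "L \<ge> 0" using C(1) by (simp add: L_def)
  define z where "z t = (cmap c0 (\<gamma> t), V t c0)" for t
  have step: "good c0 t" if t: "0 < t" "t < T" "t < \<delta>1" "t \<le> 1"
    and pos: "\<forall>\<^sub>F s in at_right 0. \<forall>zs. solves F {0..t} zs \<longrightarrow> zs 0 = (cmap c0 p, a s c0) \<longrightarrow>
      (\<forall>u\<in>{0..t}. norm (zs u - z u) \<le> L * s) \<longrightarrow> (\<forall>u\<in>{0<..t}. 0 < snd (fst (zs u)))" for t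
  proof (rule track[OF m ch order_refl _ _ _ C])
    show "\<gamma> u \<in> cdom c0 \<and> norm (cmap c0 (\<gamma> u) - cmap c0 (\<gamma> 0)) \<le> r / 2 \<and> norm (V u c0 - V 0 c0) \<le> r / 2"
      if "u \<in> {0..t}" for u by (rule near) (use that t in auto)
    show "\<forall>\<^sub>F s in at_right 0. \<forall>\<gamma>s Vs zs. geodesic_from M (p, a s) {0..0} \<gamma>s Vs \<longrightarrow> solves F {0..t} zs \<longrightarrow>
        zs 0 = (cmap c0 (\<gamma>s 0), Vs 0 c0) \<longrightarrow>
        (\<forall>u\<in>{0..t}. norm (zs u - (cmap c0 (\<gamma> u), V u c0)) \<le> exp (K * (t - 0)) * (2 * C) * s) \<longrightarrow>
        (\<forall>u\<in>{0<..t}. 0 < snd (fst (zs u)))"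
      using pos eventually_pos
    proof eventually_elim
      case (elim s)
      have le: "exp (K * (t - 0)) * (2 * C) * s \<le> L * s"
        unfolding L_def using C(1) mm(2) t(4) elim(2) by (intro mult_right_mono) auto
      show ?case
      proof (intro allI impI)
        fix \<gamma>s Vs zs
        assume gs: "geodesic_from M (p, a s) {0..0} \<gamma>s Vs" and zs: "solves F {0..t} zs" "zs 0 = (cmap c0 (\<gamma>s 0), Vs 0 c0)"
          and n: "\<forall>u\<in>{0..t}. norm (zs u - (cmap c0 (\<gamma> u), V u c0)) \<le> exp (K * (t - 0)) * (2 * C) * s"
        have "zs 0 = (cmap c0 p, a s c0)" using zs(2) geodesic_fromD(3,4)[OF gs] by simp
        moreover have "\<forall>u\<in>{0..t}. norm (zs u - z u) \<le> L * s"
          using n le unfolding z_def by (blast intro: order_trans)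
        ultimately show "\<forall>u\<in>{0<..t}. 0 < snd (fst (zs u))" using elim(1) zs(1) by blast
      qed
    qed
  qed (use t in auto)
  have chart: "c0 \<in> charts_at M (\<gamma> t)" if "0 < t" "t < T" "t < \<delta>1" for t
    using near[of t] that ch by (simp add: charts_at_iff)
  have p0: "0 \<le> snd (cmap c0 p)" by (rule snd_cmap_nonneg[OF c0])
  have zn: "norm (snd (z u) - V 0 c0) \<le> r / 2" "solves F {0..u} z" if "u \<in> {0..T}" "u < \<delta>1" for u
  proof -
    show "norm (snd (z u) - V 0 c0) \<le> r / 2" using near[of u] that by (simp add: z_def)
    show "solves F {0..u} z"
      unfolding z_def
    proof (rule geodesic_solves[OF geo(1) m ch])
      fix w assume "w \<in> {0..u}"
      then show "\<gamma> w \<in> cdom c0 \<and> norm (cmap c0 (\<gamma> w) - cmap c0 (\<gamma> 0)) \<le> r \<and> norm (V w c0 - V 0 c0) \<le> r"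
        using near[of w] that mm(1) by auto
    qed (use that in auto)
  qed
  show thesis
  proof (cases "0 < snd (a 0 c0)")
    case True
    define k where "k = snd (a 0 c0)"
    \<comment> \<open>One quarter of \<open>k\<close> is granted to the drift of the limiting
      velocity and one to the deviation of the varied one; the last component then stays above
      \<open>k / 2\<close>.\<close>
    have k: "k / 4 > 0" using True by (simp add: k_def)
    obtain \<delta>2 where \<delta>2: "\<delta>2 > 0" "\<forall>u\<in>{0..T}. \<bar>u - 0\<bar> < \<delta>2 \<longrightarrow> \<gamma> u \<in> cdom c0 \<and>
      norm (cmap c0 (\<gamma> u) - cmap c0 (\<gamma> 0)) < k / 4 \<and> norm (V u c0 - V 0 c0) < k / 4"
      using geodesic_nhd[OF geo(1) z0 c k] by blast
    show thesis
    proof (rule that[of "Min {\<delta>1, \<delta>2, 1}"])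
      show "0 < Min {\<delta>1, \<delta>2, 1}" using \<delta>1 \<delta>2(1) by simp
      fix t assume t: "0 < t" "t < T" "t < Min {\<delta>1, \<delta>2, 1}"
      then have t': "t < \<delta>1" "t < \<delta>2" "t \<le> 1" by auto
      have "good c0 t"
      proof (rule step[OF t(1,2) t'(1,3)])
        show "\<forall>\<^sub>F s in at_right 0. \<forall>zs. solves F {0..t} zs \<longrightarrow> zs 0 = (cmap c0 p, a s c0) \<longrightarrow>
          (\<forall>u\<in>{0..t}. norm (zs u - z u) \<le> L * s) \<longrightarrow> (\<forall>u\<in>{0<..t}. 0 < snd (fst (zs u)))"
          using eventually_small[OF k, of L] eventually_small[OF half_gt_zero[OF mm(1)], of L]
        proof eventually_elim
          case (elim s)
          show ?case
          proof (intro allI impI ballI)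
            fix zs u assume zs: "solves F {0..t} zs" "zs 0 = (cmap c0 p, a s c0)"
              and n: "\<forall>u\<in>{0..t}. norm (zs u - z u) \<le> L * s" and u: "u \<in> {0<..t}"
            have d: "norm (snd (zs w) - snd (z w)) \<le> L * s" if "w \<in> {0..u}" for w
              using norm_fst_snd_le(2)[of "zs w - z w"] n[rule_format, of w] that u by auto
            have "snd (fst (zs 0)) + k / 2 * (u - 0) \<le> snd (fst (zs u))"
            proof (rule local_model_growth(1)[OF m])
              show "solves F {0..u} zs" by (rule solves_subset[OF zs(1)]) (use u in auto)
              fix w assume w: "w \<in> {0..u}"
              have zw: "norm (snd (z w) - V 0 c0) \<le> r / 2" using zn(1)[of w] w u t t' by auto
              show "norm (snd (zs w) - V 0 c0) \<le> r"
                using norm_triangle_le[of "snd (zs w) - snd (z w)" "snd (z w) - V 0 c0" r] d[OF w] zw elim(2) by simp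
              have "norm (snd (z w) - V 0 c0) < k / 4" using \<delta>2(2)[rule_format, of w] w u t t' by (auto simp: z_def)
              then have "norm (snd (zs w) - V 0 c0) < k / 2"
                using norm_triangle_ineq[of "snd (zs w) - snd (z w)" "snd (z w) - V 0 c0"] d[OF w] elim(1) by simp
              then have "\<bar>snd (snd (zs w)) - k\<bar> < k / 2"
                using norm_fst_snd_le(2)[of "snd (zs w) - V 0 c0"] by (simp add: k_def geo(3))
              then show "k / 2 \<le> snd (snd (zs w))" by linarith
            qed (use u in auto)
            moreover have "0 < k / 2 * (u - 0)" using k u by simp
            ultimately show "0 < snd (fst (zs u))" using p0 zs(2) by simp
          qed
        qed
      qed
      then show "c0 \<in> charts_at M (\<gamma> t) \<and> good c0 t" using chart[OF t(1,2) t'(1)] by simp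
    qed
  next
    case False
    then obtain k where k: "k > 0" "\<forall>\<^sub>F s in at_right 0. k * s \<le> snd (a s c0) - snd (a 0 c0)" using start by blast
    \<comment> \<open>For times below \<open>\<delta>2\<close> the velocity difference changes by at
      most \<open>k / 2 * s\<close>, half of the initial gain \<open>k * s\<close>.\<close>
    define \<delta>2 where "\<delta>2 = k / (2 * (K * L + 1))"
    have \<delta>2: "\<delta>2 > 0" using k(1) L mm(2) by (simp add: \<delta>2_def add_nonneg_pos)
    show thesis
    proof (rule that[of "Min {\<delta>1, \<delta>2, 1}"])
      show "0 < Min {\<delta>1, \<delta>2, 1}" using \<delta>1 \<delta>2 by simp
      fix t assume t: "0 < t" "t < T" "t < Min {\<delta>1, \<delta>2, 1}"
      then have t': "t < \<delta>1" "t < \<delta>2" "t \<le> 1" by auto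
      have tK: "t * (K * L) \<le> k / 2"
      proof -
        have "t * (K * L) \<le> t * (K * L + 1)" using t(1) by (intro mult_left_mono) auto
        also have "\<dots> \<le> \<delta>2 * (K * L + 1)" using t'(2) L mm(2) by (intro mult_right_mono) auto
        also have "\<dots> = k / 2" using L mm(2) add_nonneg_pos[of "K * L" 1] by (simp add: \<delta>2_def field_simps)
        finally show ?thesis .
      qed
      have "good c0 t"
      proof (rule step[OF t(1,2) t'(1,3)])
        show "\<forall>\<^sub>F s in at_right 0. \<forall>zs. solves F {0..t} zs \<longrightarrow> zs 0 = (cmap c0 p, a s c0) \<longrightarrow>
          (\<forall>u\<in>{0..t}. norm (zs u - z u) \<le> L * s) \<longrightarrow> (\<forall>u\<in>{0<..t}. 0 < snd (fst (zs u)))"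
          using k(2) eventually_small[OF half_gt_zero[OF mm(1)], of L] eventually_pos
        proof eventually_elim
          case (elim s)
          show ?case
          proof (intro allI impI ballI)
            fix zs u assume zs: "solves F {0..t} zs" "zs 0 = (cmap c0 p, a s c0)"
              and n: "\<forall>u\<in>{0..t}. norm (zs u - z u) \<le> L * s" and u: "u \<in> {0<..t}"
            have sz: "solves F {0..u} z" "solves F {0..u} zs"
              using zn(2)[of u] u t t' solves_subset[OF zs(1), of "{0..u}"] by auto
            have near_s: "norm (snd (zs w) - V 0 c0) \<le> r" "norm (snd (z w) - V 0 c0) \<le> r" if w: "w \<in> {0..u}" for w
            proof -
              have zw: "norm (snd (z w) - V 0 c0) \<le> r / 2" using zn(1)[of w] w u t t' by auto
              have "norm (snd (zs w) - snd (z w)) \<le> L * s"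
                using norm_fst_snd_le(2)[of "zs w - z w"] n[rule_format, of w] w u by auto
              then show "norm (snd (zs w) - V 0 c0) \<le> r"
                using norm_triangle_le[of "snd (zs w) - snd (z w)" "snd (z w) - V 0 c0" r] zw elim(2) by simp
              show "norm (snd (z w) - V 0 c0) \<le> r" using zw mm(1) by simp
            qed
            have vel: "0 < snd (snd (zs w)) - snd (snd (z w))" if w: "w \<in> {0..u}" for w
            proof -
              \<comment> \<open>The curves are at distance at most \<open>L * s\<close>, so their
                difference changes with speed at most \<open>K * (L * s)\<close>. The drift is small
                in the time and proportional to \<open>s\<close>, hence comparable with the initial
                gain.\<close>
              have "norm ((zs w - z w) - (zs 0 - z 0)) \<le> (K * (L * s)) * norm (w - 0)"
              proof (rule differentiable_bound[of "{0..u}" "\<lambda>w. zs w - z w" "\<lambda>w h. h *\<^sub>R (F (zs w) - F (z w))"])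
                fix x assume x: "x \<in> {0..u}"
                show "((\<lambda>w. zs w - z w) has_derivative (\<lambda>h. h *\<^sub>R (F (zs x) - F (z x)))) (at x within {0..u})"
                  using sz x has_vector_derivative_diff unfolding solves_def has_vector_derivative_def[symmetric] by blast
                have "norm (F (zs x) - F (z x)) \<le> K * norm (zs x - z x)" using lipschitz_on_normD[OF mm(3)] by simp
                also have "\<dots> \<le> K * (L * s)" using n[rule_format, of x] x u mm(2) by (intro mult_left_mono) auto
                finally have b: "norm (F (zs x) - F (z x)) \<le> K * (L * s)" .
                show "onorm (\<lambda>h. h *\<^sub>R (F (zs x) - F (z x))) \<le> K * (L * s)"
                proof (rule onorm_le)
                  fix h :: real
                  show "norm (h *\<^sub>R (F (zs x) - F (z x))) \<le> K * (L * s) * norm h"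
                    using mult_left_mono[OF b, of "\<bar>h\<bar>"] by (simp add: mult.commute)
                qed
              qed (use w u in auto)
              also have "\<dots> = w * (K * L) * s" using w by simp
              also have "\<dots> \<le> t * (K * L) * s" using w u L mm(2) elim(3) by (intro mult_right_mono) auto
              also have "\<dots> \<le> k / 2 * s" using tK elim(3) by (intro mult_right_mono) auto
              finally have nn: "norm ((zs w - z w) - (zs 0 - z 0)) \<le> k / 2 * s" .
              have "\<bar>snd (snd ((zs w - z w) - (zs 0 - z 0)))\<bar> \<le> norm (snd ((zs w - z w) - (zs 0 - z 0)))"
                using norm_fst_snd_le(2)[of "snd ((zs w - z w) - (zs 0 - z 0))"] by simp
              also have "\<dots> \<le> k / 2 * s" using norm_fst_snd_le(2) nn order_trans by blast
              finally have "\<bar>(snd (snd (zs w)) - snd (snd (z w))) - (snd (a s c0) - snd (a 0 c0))\<bar> \<le> k / 2 * s"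
                by (simp add: zs(2) z_def geo(3))
              moreover have "0 < k / 2 * s" using k(1) elim(3) by simp
              ultimately show ?thesis using elim(1) by linarith
            qed
            have "snd (fst (zs 0)) - snd (fst (z 0)) < snd (fst (zs u)) - snd (fst (z u))"
            proof (rule pos_derivative_imp_less[where u' = "\<lambda>w. snd (snd (zs w)) - snd (snd (z w))" and u = "\<lambda>w. snd (fst (zs w)) - snd (fst (z w))"])
              show "0 < u" using u by simp
              fix w assume w: "w \<in> {0..u}"
              show "((\<lambda>w. snd (fst (zs w)) - snd (fst (z w))) has_real_derivative snd (snd (zs w)) - snd (snd (z w))) (at w within {0..u})"
                by (intro DERIV_diff snd_fst_has_derivative local_model_fst[OF m] sz w near_s)
            qed (rule vel)
            moreover have "fst (zs 0) = fst (z 0)" by (simp add: zs(2) z_def geo(2))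
            moreover have "0 \<le> snd (fst (z u))"
              using near[of u] u t t' ch snd_cmap_nonneg[of c0 "\<gamma> u"] by (simp add: z_def charts_at_iff)
            ultimately show "0 < snd (fst (zs u))" by simp
          qed
        qed
      qed
      then show "c0 \<in> charts_at M (\<gamma> t) \<and> good c0 t" using chart[OF t(1,2) t'(1)] by simp
    qed
  qed
qed

text \<open>Bisection between an early time, supplied by \<open>good_initial\<close>, and
  \<open>t\<close>. The property \<open>G\<close> refers to all charts at a point, which lets
  successive steps use different charts.\<close>

lemma good_all:
  assumes t: "0 < t" "t < T" and c: "c \<in> charts_at M (\<gamma> t)"
  shows "good c t"
proof -
  obtain \<delta> where \<delta>: "\<delta> > 0" "\<And>t. 0 < t \<Longrightarrow> t < T \<Longrightarrow> t < \<delta> \<Longrightarrow> c0 \<in> charts_at M (\<gamma> t) \<and> good c0 t"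
    using good_initial by blast
  define ta where "ta = min t (\<delta> / 2)"
  have ta: "0 < ta" "ta \<le> t" "ta < \<delta>" using t \<delta>(1) by (auto simp: ta_def)
  define G where "G u \<longleftrightarrow> (\<forall>c\<in>charts_at M (\<gamma> u). good c u)" for u
  have "ta < T" "ta \<in> {0..T}" using ta t by auto
  then have Ga: "G ta" unfolding G_def using \<delta>(2)[OF ta(1) _ ta(3)] good_change[of ta c0] by blast
  have "0 < ta \<longrightarrow> t < T \<longrightarrow> G ta \<longrightarrow> G t"
    using ta(2)
  proof (induction rule: Bolzano)
    case (trans a b c)
    then show ?case by auto
  next
    case (local x)
    have x: "x \<in> {0..T}" using local ta t by auto
    obtain c \<epsilon> where e: "\<epsilon> > 0" "\<forall>t\<in>{0..T}. \<bar>t - x\<bar> < \<epsilon> \<longrightarrow> c \<in> charts_at M (\<gamma> t)"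
      "\<forall>t1 t2. 0 < t1 \<longrightarrow> t1 \<le> t2 \<longrightarrow> t2 < T \<longrightarrow> \<bar>t1 - x\<bar> < \<epsilon> \<longrightarrow> \<bar>t2 - x\<bar> < \<epsilon> \<longrightarrow> good c t1 \<longrightarrow> good c t2"
      using good_step[OF x] by blast
    show ?case
    proof (intro exI[of _ \<epsilon>] conjI allI impI e(1))
      fix u w assume uw: "u \<le> x \<and> x \<le> w \<and> w - u < \<epsilon>" "0 < u" "w < T" "G u"
      then have r: "u \<in> {0..T}" "w \<in> {0..T}" "\<bar>u - x\<bar> < \<epsilon>" "\<bar>w - x\<bar> < \<epsilon>" "u \<le> w" by auto
      have "good c u" using uw(4) e(2)[rule_format, OF r(1,3)] unfolding G_def by blast
      then have "good c w" by (rule e(3)[rule_format, OF uw(2) r(5) uw(3) r(3,4)])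
      then show "G w" unfolding G_def using good_change[OF r(2) e(2)[rule_format, OF r(2,4)]] by blast
    qed
  qed
  then show ?thesis using Ga ta t c unfolding G_def by blast
qed

text \<open>The model field carries the curves a little past \<open>T\<close>. There the last
  coordinate of a varied solution decreases at least at rate \<open>\<kappa> / 2\<close>, so it
  vanishes at a time \<open>\<tau>\<close> with \<open>\<tau> - T\<close> of order \<open>s\<close>,
  which is the exit time.\<close>

lemma variation_exit:
  assumes c: "c \<in> charts_at M (\<gamma> T)"
  shows "\<exists>C\<ge>0. \<forall>\<^sub>F s in at_right 0. \<exists>\<tau> x b. tau_in M (p, a s) = ereal \<tau> \<and> \<bar>\<tau> - T\<bar> \<le> C * s \<and>
    S_in M (p, a s) = (x, b) \<and> x \<in> boundary M \<and> x \<in> cdom c \<and> b \<in> tangent_space M x \<and> snd (b c) < 0 \<and>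
    norm (cmap c x - cmap c (\<gamma> T)) \<le> C * s \<and>
    \<bar>metric_coord M c (cmap c (\<gamma> T)) (cmap c x - cmap c (\<gamma> T)) (V T c) - T / 2 * En s\<bar> \<le> C * s\<^sup>2"
proof -
  note ch = conjunct1[OF c[unfolded charts_at_iff]] conjunct2[OF c[unfolded charts_at_iff]]
  have TT: "T \<in> {0..T}" using T by simp
  define x0 v0 where "x0 = cmap c (\<gamma> T)" and "v0 = V T c"
  have x0: "x0 \<in> cimg c" using ch by (auto simp: x0_def)
  have sx0: "snd x0 = 0" using boundary_iff[OF c] bd by (simp add: x0_def)
  have null0: "metric_coord M c x0 v0 v0 = 0" unfolding x0_def v0_def by (rule null_coord[OF TT ch])
  define \<kappa> where "\<kappa> = - snd v0"
  have \<kappa>: "\<kappa> > 0" using exit_transversal[OF c] by (simp add: \<kappa>_def v0_def)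
  obtain r K F where m: "local_model c x0 v0 r K F" using local_model_ex[OF ch(1) x0] by blast
  then have mm: "r > 0" "K > 0" "K-lipschitz_on UNIV F" "metric_bounds c (cball x0 r \<inter> half_space) K"
    unfolding local_model_def by blast+
  \<comment> \<open>The limiting data stay within \<open>e\<close> and the varied ones within
    \<open>2 * e\<close> of the exit data. This is at most \<open>r / 2\<close>, hence inside the
    model, and at most \<open>\<kappa> / 4\<close>, so the last velocity component stays below
    \<open>- \<kappa> / 2\<close>.\<close>
  define e where "e = min (r / 4) (\<kappa> / 8)"
  have e: "e > 0" "e \<le> r / 4" "e \<le> \<kappa> / 8" using mm(1) \<kappa> by (auto simp: e_def)
  obtain \<delta> where \<delta>: "\<delta> > 0" "\<forall>t\<in>{0..T}. \<bar>t - T\<bar> < \<delta> \<longrightarrow> \<gamma> t \<in> cdom c \<and>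
    norm (cmap c (\<gamma> t) - x0) < e \<and> norm (V t c - v0) < e"
    using geodesic_nhd[OF geo(1) TT c e(1)] unfolding x0_def v0_def by blast
  define t1 where "t1 = max (T / 2) (T - \<delta> / 2)"
  have t1: "0 < t1" "t1 < T" "T - t1 < \<delta>" using T \<delta>(1) by (auto simp: t1_def max_def)
  have near0: "\<gamma> u \<in> cdom c \<and> norm (cmap c (\<gamma> u) - x0) < e \<and> norm (V u c - v0) < e" if "u \<in> {t1..T}" for u
    using \<delta>(2)[rule_format, of u] that t1 by auto
  have t1T: "t1 \<in> {t1..T}" using t1 by simp
  have ct1: "c \<in> charts_at M (\<gamma> t1)" using near0[OF t1T] ch by (simp add: charts_at_iff)
  obtain C where C: "C \<ge> 0" "\<forall>\<^sub>F s in at_right 0. \<exists>\<gamma>s Vs. close c t1 C s \<gamma>s Vs"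
    using good_all[OF t1(1,2) ct1] unfolding good_def by blast
  define zg where "zg t = (cmap c (\<gamma> t), V t c)" for t
  have szg: "solves F {t1..T} zg"
    unfolding zg_def
  proof (rule geodesic_solves[OF geo(1) m ch(1)])
    fix u assume "u \<in> {t1..T}"
    then show "\<gamma> u \<in> cdom c \<and> norm (cmap c (\<gamma> u) - x0) \<le> r \<and> norm (V u c - v0) \<le> r"
      using near0[of u] e(2) mm(1) by auto
  qed (use t1 in auto)
  \<comment> \<open>While \<open>zg\<close> follows the geodesic and ends at \<open>T\<close>, the
    solution \<open>z\<close> continues across the boundary.\<close>
  have "t1 \<le> T + 1" using t1 by simp
  then obtain z where z: "z t1 = zg t1" "solves F {t1..T + 1} z" using picard[OF mm(3)] by blast
  have zeq: "z u = zg u" if u: "u \<in> {t1..T}" for u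
  proof -
    have "norm (z u - zg u) \<le> exp (K * (u - t1)) * norm (z t1 - zg t1)"
      by (rule local_model_close(1)[OF m solves_subset[OF z(2)] solves_subset[OF szg]]) (use u in auto)
    then show ?thesis by (simp add: z(1))
  qed
  have zT: "z T = (x0, v0)" using zeq[of T] t1 by (simp add: zg_def x0_def v0_def)
  have "continuous (at T within {t1..T + 1}) z"
    using solves_continuous[OF z(2)] t1 by (simp add: continuous_on_eq_continuous_within)
  then obtain d where d: "d > 0" "\<And>t. t \<in> {t1..T + 1} \<Longrightarrow> dist t T < d \<Longrightarrow> dist (z t) (z T) < e"
    using e(1) unfolding continuous_within_eps_delta by blast
  define \<eta> where "\<eta> = min 1 (d / 2)"
  have \<eta>: "\<eta> > 0" "\<eta> \<le> 1" "\<eta> < d" using d(1) by (auto simp: \<eta>_def)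
  define t2 where "t2 = T + \<eta>"
  have t2: "T < t2" "t1 < t2" using \<eta> t1 by (auto simp: t2_def)
  let ?I = "{t1..t2}"
  have TI: "T \<in> ?I" using t1 t2 by simp
  have nearz: "norm (fst (z u) - x0) \<le> e" "norm (snd (z u) - v0) \<le> e" if u: "u \<in> ?I" for u
  proof -
    have "norm (fst (z u) - x0) \<le> e \<and> norm (snd (z u) - v0) \<le> e"
    proof (cases "u \<le> T")
      case True
      then show ?thesis using near0[of u] zeq[of u] u by (simp add: zg_def less_imp_le)
    next
      case False
      have "dist (z u) (z T) < e" by (rule d(2)) (use False u \<eta> in \<open>auto simp: t2_def dist_real_def\<close>)
      then show ?thesis using norm_fst_snd_le[of "z u - z T"] by (simp add: dist_norm zT)
    qed
    then show "norm (fst (z u) - x0) \<le> e" "norm (snd (z u) - v0) \<le> e" by auto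
  qed
  have sz: "solves F ?I z" by (rule solves_subset[OF z(2)]) (use \<eta> in \<open>auto simp: t2_def\<close>)
  \<comment> \<open>A bound for the model field near the exit, by its Lipschitz condition.\<close>
  define N where "N = norm (F (x0, v0)) + K * (2 * e)"
  have N: "N \<ge> 0" using mm(2) e(1) by (simp add: N_def)
  have FN: "norm (F (z u)) \<le> N" if u: "u \<in> ?I" for u
  proof -
    have "norm (z u - (x0, v0)) \<le> norm (fst (z u) - x0) + norm (snd (z u) - v0)"
      using norm_Pair_le[of "fst (z u) - x0" "snd (z u) - v0"] by (simp add: minus_prod_def)
    then have "norm (z u - (x0, v0)) \<le> 2 * e" using nearz[OF u] by linarith
    then have "K * norm (z u - (x0, v0)) \<le> K * (2 * e)" using mm(2) by (intro mult_left_mono) auto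
    moreover have "norm (F (z u) - F (x0, v0)) \<le> K * norm (z u - (x0, v0))" by (rule lipschitz_on_normD[OF mm(3)]) auto
    ultimately show ?thesis
      using norm_triangle_ineq[of "F (z u) - F (x0, v0)" "F (x0, v0)"] by (simp add: N_def)
  qed
  have zsp: "norm (z u - z T) \<le> N * \<bar>u - T\<bar>" if "u \<in> ?I" for u
    by (rule solves_speed[OF sz convex_real_interval(5) FN TI that])
  define L where "L = exp (K * (t2 - t1)) * (2 * C)"
  define h1 where "h1 = snd (cmap c (\<gamma> t1))"
  \<comment> \<open>\<open>C2\<close> bounds the shift of the exit time and \<open>C3\<close> the
    distance from the exit data at times that close to \<open>T\<close>; \<open>A5\<close> dominates
    these and \<open>L\<close>.\<close>
  define C2 where "C2 = 2 * L / \<kappa>"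
  define C3 where "C3 = L + N * C2"
  define A5 where "A5 = 1 + L + C2 + C3"
  define Q where "Q = K * (norm v0 + r + 1)\<^sup>2"
  define R where "R = norm v0 + r"
  define A where "A = T * Q * L\<^sup>2 + C"
  define C' where "C' = A5 + (A + K * (1 + 4 * R + R\<^sup>2)) * A5\<^sup>2"
  have L: "L \<ge> 0" using C(1) by (simp add: L_def)
  have h1: "h1 > 0" unfolding h1_def by (rule interior_along) (use t1 near0[OF t1T] ch in auto)
  have cc: "C2 \<ge> 0" "C3 \<ge> 0" "1 \<le> A5" "L \<le> A5" "C2 \<le> A5" "C3 \<le> A5" "N * C2 \<le> C3" "Q \<ge> 0" "A \<ge> 0" "R \<ge> 0"
    using L \<kappa> N C(1) mm(1,2) T by (simp_all add: C2_def C3_def A5_def Q_def A_def R_def)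
  have C'0: "(A + K * (1 + 4 * R + R\<^sup>2)) * A5\<^sup>2 \<ge> 0" using cc mm(2) by simp
  have C': "C' \<ge> 0" "A5 \<le> C'" "(A + K * (1 + 4 * R + R\<^sup>2)) * A5\<^sup>2 \<le> C'" using C'0 cc(3) by (simp_all add: C'_def)
  have "\<forall>\<^sub>F s in at_right 0. \<exists>\<tau> x b. tau_in M (p, a s) = ereal \<tau> \<and> \<bar>\<tau> - T\<bar> \<le> C' * s \<and>
    S_in M (p, a s) = (x, b) \<and> x \<in> boundary M \<and> x \<in> cdom c \<and> b \<in> tangent_space M x \<and> snd (b c) < 0 \<and>
    norm (cmap c x - x0) \<le> C' * s \<and>
    \<bar>metric_coord M c x0 (cmap c x - x0) v0 - T / 2 * En s\<bar> \<le> C' * s\<^sup>2"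
    using C(2) eventually_pos eventually_small[OF e(1), of L] eventually_small[OF h1, of L]
      eventually_small[OF divide_pos_pos[OF mult_pos_pos[OF \<kappa> \<eta>(1)] zero_less_numeral], of L "num.Bit0 (num.Bit0 num.One)"]
  proof eventually_elim
    case (elim s)
    from elim(1) obtain \<gamma>s Vs where cl: "close c t1 C s \<gamma>s Vs" by blast
    then have gs: "geodesic_from M (p, a s) {0..t1} \<gamma>s Vs" "\<gamma>s ` {0<..t1} \<subseteq> interior_part M" "\<gamma>s t1 \<in> cdom c"
      "norm (cmap c (\<gamma>s t1) - cmap c (\<gamma> t1)) \<le> C * s" "norm (Vs t1 c - V t1 c) \<le> C * s"
      "\<bar>metric_coord M c (cmap c (\<gamma> t1)) (cmap c (\<gamma>s t1) - cmap c (\<gamma> t1)) (V t1 c) - t1 / 2 * En s\<bar> \<le> C * s\<^sup>2"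
      unfolding close_def by blast+
    note s = elim(2)
    obtain zs where zs: "zs t1 = (cmap c (\<gamma>s t1), Vs t1 c)" "solves F ?I zs"
      using picard[OF mm(3) less_imp_le[OF t2(2)]] by blast
    have n1: "norm (zs t1 - z t1) \<le> 2 * C * s"
      using norm_Pair_le[of "cmap c (\<gamma>s t1) - cmap c (\<gamma> t1)" "Vs t1 c - V t1 c"] gs(4,5) by (simp add: zs(1) z(1) zg_def)
    have n: "norm (zs u - z u) \<le> L * s" if u: "u \<in> ?I" for u
    proof -
      have su: "{t1..u} \<subseteq> ?I" using u by auto
      have "norm (zs u - z u) \<le> exp (K * (u - t1)) * norm (zs t1 - z t1)"
        by (rule local_model_close(1)[OF m solves_subset[OF zs(2) su] solves_subset[OF sz su]]) (use u in simp)
      also have "\<dots> \<le> exp (K * (t2 - t1)) * (2 * C * s)"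
        using u mm(2) n1 by (intro mult_mono) auto
      finally show ?thesis by (simp add: L_def mult_ac)
    qed
    have nc: "norm (fst (zs u) - fst (z u)) \<le> L * s" "norm (snd (zs u) - snd (z u)) \<le> L * s" if u: "u \<in> ?I" for u
      using norm_fst_snd_le[of "zs u - z u"] n[OF u] by simp_all
    have nears: "norm (fst (zs u) - x0) \<le> 2 * e" "norm (snd (zs u) - v0) \<le> 2 * e" if u: "u \<in> ?I" for u
      using norm_triangle_le[of "fst (zs u) - fst (z u)" "fst (z u) - x0" "2 * e"]
        norm_triangle_le[of "snd (zs u) - snd (z u)" "snd (z u) - v0" "2 * e"] nc[OF u] nearz[OF u] elim(3) by simp_all
    have nears_r: "norm (fst (zs u) - x0) \<le> r" "norm (snd (zs u) - v0) \<le> r" if u: "u \<in> ?I" for u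
      using nears[OF u] e(2) mm(1) by linarith+
    define f where "f u = snd (fst (zs u))" for u
    have vel: "snd (snd (zs u)) \<le> - \<kappa> / 2" if u: "u \<in> ?I" for u
    proof -
      have "\<bar>snd (snd (zs u)) - snd v0\<bar> \<le> 2 * e"
        using norm_fst_snd_le(2)[of "snd (zs u) - v0"] nears(2)[OF u] by simp
      then show ?thesis using e(3) by (simp add: \<kappa>_def)
    qed
    have growth: "f w \<le> f u - \<kappa> / 2 * (w - u)" if uw: "t1 \<le> u" "u \<le> w" "w \<le> t2" for u w
    proof -
      have "snd (fst (zs w)) \<le> snd (fst (zs u)) + (- \<kappa> / 2) * (w - u)"
      proof (rule local_model_growth(2)[OF m _ uw(2)])
        show "solves F {u..w} zs" by (rule solves_subset[OF zs(2)]) (use uw in auto)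
      qed (use nears_r vel uw in auto)
      then show ?thesis by (simp add: f_def)
    qed
    have fz: "\<bar>f u - snd (fst (z u))\<bar> \<le> L * s" if u: "u \<in> ?I" for u
      using norm_fst_snd_le(2)[of "fst (zs u) - fst (z u)"] nc(1)[OF u] by (simp add: f_def)
    have fT: "\<bar>f T\<bar> \<le> L * s" using fz[OF TI] by (simp add: zT sx0)
    have ft1: "0 < f t1" using fz[of t1] t2 elim(4) by (simp add: z(1) zg_def h1_def)
    \<comment> \<open>From \<open>T\<close> to \<open>t2\<close> the coordinate drops by at least
      \<open>\<kappa> / 2 * \<eta>\<close>, while its value at \<open>T\<close> is less than half of
      that.\<close>
    have ft2: "f t2 < 0"
    proof -
      have "f t2 \<le> f T - \<kappa> / 2 * \<eta>" using growth[of T t2] t1 t2 by (simp add: t2_def)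
      moreover have "0 < \<kappa> * \<eta>" using \<kappa> \<eta>(1) by simp
      ultimately show ?thesis using fT elim(5) by simp
    qed
    have "continuous_on ?I f"
      unfolding f_def by (intro continuous_on_snd continuous_on_fst solves_continuous[OF zs(2)])
    then obtain \<tau> where \<tau>: "t1 \<le> \<tau>" "\<tau> \<le> t2" "f \<tau> = 0"
      using IVT2'[of f t2 0 t1] ft1 ft2 t2 by auto
    have \<tau>1: "t1 < \<tau>" using \<tau> ft1 by (metis less_eq_real_def less_irrefl)
    have \<tau>T: "\<bar>\<tau> - T\<bar> \<le> C2 * s"
    proof -
      have "\<kappa> / 2 * \<bar>\<tau> - T\<bar> \<le> L * s"
      proof (cases "T \<le> \<tau>")
        case True
        then show ?thesis using growth[of T \<tau>] \<tau> t1 fT by simp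
      next
        case False
        then show ?thesis using growth[of \<tau> T] \<tau> t2 fT by simp
      qed
      then show ?thesis using \<kappa> by (simp add: C2_def field_simps)
    qed
    have fpos: "0 < f u" if "t1 \<le> u" "u < \<tau>" for u
    proof -
      have "0 < \<kappa> / 2 * (\<tau> - u)" using \<kappa> that by simp
      then show ?thesis using growth[of u \<tau>] that \<tau> by simp
    qed
    have fnn: "0 \<le> f u" if "t1 \<le> u" "u \<le> \<tau>" for u
      using fpos[of u] \<tau>(3) that by (cases "u = \<tau>") auto
    have sub\<tau>: "{t1..\<tau>} \<subseteq> ?I" using \<tau> by auto
    have near\<tau>: "norm (fst (zs u) - x0) \<le> r \<and> norm (snd (zs u) - v0) \<le> r \<and> 0 \<le> snd (fst (zs u))" if "u \<in> {t1..\<tau>}" for u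
      using nears_r[of u] fnn[of u] that \<tau>(2) by (simp add: f_def)
    obtain \<gamma>' V' where g': "geodesic_from M (p, a s) {0..\<tau>} \<gamma>' V'" "\<forall>t\<in>{0..t1}. \<gamma>' t = \<gamma>s t"
      "\<forall>t\<in>{t1..\<tau>}. \<gamma>' t \<in> cdom c \<and> cmap c (\<gamma>' t) = fst (zs t) \<and> V' t c = snd (zs t)"
      using geodesic_continue[OF m ch(1) gs(1) less_imp_le[OF t1(1)] \<tau>(1) gs(3) solves_subset[OF zs(2) sub\<tau>] zs(1) near\<tau>] by blast
    have \<tau>I: "\<tau> \<in> {t1..\<tau>}" "\<tau> \<in> ?I" using \<tau> by auto
    have c': "c \<in> charts_at M (\<gamma>' u)" if "u \<in> {t1..\<tau>}" for u using g'(3) that ch by (simp add: charts_at_iff)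
    have bd': "\<gamma>' \<tau> \<in> boundary M" using boundary_iff[OF c'[OF \<tau>I(1)]] g'(3) \<tau>I(1) \<tau>(3) by (simp add: f_def)
    have int': "\<gamma>' ` {0<..<\<tau>} \<subseteq> interior_part M"
    proof (rule image_subsetI)
      fix u assume u: "u \<in> {0<..<\<tau>}"
      show "\<gamma>' u \<in> interior_part M"
      proof (cases "u \<le> t1")
        case True then show ?thesis using gs(2) g'(2) u by auto
      next
        case False
        then have u': "u \<in> {t1..\<tau>}" using u by auto
        have "0 < f u" using fpos[of u] u u' by simp
        then show ?thesis using interior_iff[OF c'[OF u']] g'(3) u' by (simp add: f_def)
      qed
    qed
    have \<tau>0: "0 < \<tau>" using \<tau>1 t1 by simp
    note ex = exit_data[OF g'(1) \<tau>0 int' bd']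
    \<comment> \<open>Both curves are in the manifold up to the smaller of the two exit times, and
      the energy comparison reaches only that far. The time left to the other curve is at most
      \<open>C2 * s\<close>.\<close>
    define tm where "tm = min \<tau> T"
    have tm: "t1 \<le> tm" "tm \<le> \<tau>" "tm \<le> T" "tm = \<tau> \<or> tm = T" using \<tau> t1 by (auto simp: tm_def)
    have tmI: "tm \<in> ?I" using tm t2 by auto
    have tmT: "\<bar>tm - T\<bar> \<le> C2 * s" "\<tau> - tm \<le> C2 * s" "T - tm \<le> C2 * s" using \<tau>T cc(1) s by (auto simp: tm_def min_def)
    have E: "metric_coord M c (fst (zs u)) (snd (zs u)) (snd (zs u)) = En s" if u: "u \<in> {t1..\<tau>}" for u
      using energy_coord[OF g'(1) _ ch(1), of u] g'(3) u t1 by force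
    have E0: "metric_coord M c (fst (z u)) (snd (z u)) (snd (z u)) = 0" if u: "u \<in> {t1..T}" for u
      using null_coord[OF _ ch(1), of u] near0[OF u] zeq[OF u] u t1 by (simp add: zg_def)
    have nearz': "norm (fst (z u) - x0) \<le> r \<and> norm (snd (z u) - v0) \<le> r \<and> 0 \<le> snd (fst (z u))" if u: "u \<in> {t1..T}" for u
      using near0[OF u] zeq[OF u] snd_cmap_nonneg[of c "\<gamma> u"] ch(1) e(2) mm(1) by (simp add: zg_def charts_at_iff)
    define P where "P u = metric_coord M c (fst (z u)) (fst (zs u) - fst (z u)) (snd (z u))" for u
    have "\<bar>P tm - P t1 - (tm - t1) / 2 * En s\<bar> \<le> (tm - t1) * (Q * (L * s)\<^sup>2)"
      unfolding P_def Q_def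
    proof (rule energy_step[OF m ch(1) tm(1)])
      show "solves F {t1..tm} z" "solves F {t1..tm} zs"
        using solves_subset[OF sz, of "{t1..tm}"] solves_subset[OF zs(2), of "{t1..tm}"] tmI by auto
    qed (use nearz' near\<tau> n E E0 tm tmI in auto)
    moreover have "\<bar>P t1 - t1 / 2 * En s\<bar> \<le> C * s\<^sup>2" using gs(6) by (simp add: P_def z(1) zg_def zs(1))
    ultimately have "\<bar>P tm - tm / 2 * En s\<bar> \<le> (tm - t1) * (Q * (L * s)\<^sup>2) + C * s\<^sup>2"
      by (simp add: field_simps)
    also have "\<dots> \<le> T * (Q * (L * s)\<^sup>2) + C * s\<^sup>2"
      using tm t1 cc(8) by (intro add_right_mono mult_right_mono) auto
    also have "\<dots> = A * s\<^sup>2" by (simp add: A_def power_mult_distrib algebra_simps)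
    also have "\<dots> \<le> A * (A5 * s)\<^sup>2"
    proof -
      have "s \<le> A5 * s" using cc(3) s by simp
      then show ?thesis using cc(9) s by (intro mult_left_mono power_mono) auto
    qed
    finally have Ptm: "\<bar>P tm - tm / 2 * En s\<bar> \<le> A * (A5 * s)\<^sup>2" .
    have zC3: "norm (z u - z T) \<le> N * C2 * s" if "u \<in> ?I" "\<bar>u - T\<bar> \<le> C2 * s" for u
      using zsp[OF that(1)] mult_left_mono[OF that(2) N] by (simp add: mult.assoc)
    have vz: "norm (snd (z u) - v0) \<le> C3 * s" "norm (fst (z u) - x0) \<le> C3 * s" if "u \<in> ?I" "\<bar>u - T\<bar> \<le> C2 * s" for u
    proof -
      have "norm (z u - z T) \<le> C3 * s"
        by (rule order_trans[OF zC3[OF that] mult_right_mono[OF cc(7)]]) (use s in simp)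
      then show "norm (snd (z u) - v0) \<le> C3 * s" "norm (fst (z u) - x0) \<le> C3 * s"
        using norm_fst_snd_le[of "z u - z T"] by (simp_all add: zT)
    qed
    have vzs: "norm (snd (zs u) - v0) \<le> C3 * s" "norm (fst (zs u) - x0) \<le> C3 * s" if "u \<in> ?I" "\<bar>u - T\<bar> \<le> C2 * s" for u
    proof -
      have "norm (zs u - z T) \<le> norm (zs u - z u) + norm (z u - z T)"
        using norm_triangle_ineq[of "zs u - z u" "z u - z T"] by simp
      also have "\<dots> \<le> C3 * s" using n[OF that(1)] zC3[OF that] by (simp add: C3_def algebra_simps)
      finally show "norm (snd (zs u) - v0) \<le> C3 * s" "norm (fst (zs u) - x0) \<le> C3 * s"
        using norm_fst_snd_le[of "zs u - z T"] by (simp_all add: zT)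
    qed
    have d1: "norm (fst (zs \<tau>) - fst (zs tm) - (\<tau> - tm) *\<^sub>R v0) \<le> (\<tau> - tm) * (C3 * s)"
    proof (rule displacement[OF tm(2), where v = "\<lambda>u. snd (zs u)"])
      fix u assume u: "u \<in> {tm..\<tau>}"
      then have uI: "u \<in> ?I" "\<bar>u - T\<bar> \<le> C2 * s" using tm \<tau> \<tau>T by (auto simp: tm_def min_def split: if_splits)
      show "((\<lambda>u. fst (zs u)) has_vector_derivative snd (zs u)) (at u within {tm..\<tau>})"
        by (rule local_model_fst[OF m solves_subset[OF zs(2)] u nears_r(2)[OF uI(1)]]) (use tm \<tau> in auto)
      show "norm (snd (zs u) - v0) \<le> C3 * s" by (rule vzs(1)[OF uI])
    qed
    have d2: "norm (fst (z T) - fst (z tm) - (T - tm) *\<^sub>R v0) \<le> (T - tm) * (C3 * s)"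
    proof (rule displacement[OF tm(3), where v = "\<lambda>u. snd (z u)"])
      fix u assume u: "u \<in> {tm..T}"
      then have uI: "u \<in> ?I" "\<bar>u - T\<bar> \<le> C2 * s" "u \<in> {t1..T}" using tm t2 tmT by auto
      show "((\<lambda>u. fst (z u)) has_vector_derivative snd (z u)) (at u within {tm..T})"
        by (rule local_model_fst[OF m solves_subset[OF sz] u]) (use tm t2 nearz'[OF uI(3)] in auto)
      show "norm (snd (z u) - v0) \<le> C3 * s" by (rule vz(1)[OF uI(1,2)])
    qed
    \<comment> \<open>Over the remaining times both curves move along \<open>v0\<close> up to second
      order; the difference of these times is the coefficient of \<open>v0\<close> in
      \<open>exit_pairing\<close>.\<close>
    have "norm (fst (zs \<tau>) - x0 - (fst (zs tm) - fst (z tm)) - ((\<tau> - tm) - (T - tm)) *\<^sub>R v0)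
      = norm ((fst (zs \<tau>) - fst (zs tm) - (\<tau> - tm) *\<^sub>R v0) - (fst (z T) - fst (z tm) - (T - tm) *\<^sub>R v0))"
      by (simp add: zT algebra_simps)
    also have "\<dots> \<le> (\<tau> - tm) * (C3 * s) + (T - tm) * (C3 * s)"
      using norm_triangle_ineq4 d1 d2 add_mono order_trans by blast
    also have "\<dots> \<le> (A5 * s) * (A5 * s) + (A5 * s) * (A5 * s)"
    proof -
      have q: "C2 * s \<le> A5 * s" "C3 * s \<le> A5 * s" using cc s by (auto intro: mult_right_mono)
      have "(\<tau> - tm) * (C3 * s) \<le> (A5 * s) * (A5 * s)" "(T - tm) * (C3 * s) \<le> (A5 * s) * (A5 * s)"
        by (rule mult_mono[OF order_trans[OF tmT(2) q(1)] q(2)], use cc s in simp, use cc s in simp)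
          (rule mult_mono[OF order_trans[OF tmT(3) q(1)] q(2)], use cc s in simp, use cc s in simp)
      then show ?thesis by (rule add_mono)
    qed
    finally have disp: "norm (fst (zs \<tau>) - x0 - (fst (zs tm) - fst (z tm)) - ((\<tau> - tm) - (T - tm)) *\<^sub>R v0) \<le> 2 * (A5 * s)\<^sup>2"
      by (simp only: power2_eq_square mult_2)
    have tm\<tau>: "tm \<in> {t1..\<tau>}" "tm \<in> {t1..T}" using tm by auto
    have x0B: "x0 \<in> cball x0 r \<inter> half_space" using mm(1) sx0 by (simp add: half_space_def)
    have xmB: "fst (z tm) \<in> cball x0 r \<inter> half_space"
      using nearz'[OF tm\<tau>(2)] by (simp add: half_space_def dist_norm norm_minus_commute)
    have xsB: "fst (zs tm) \<in> cball x0 r \<inter> half_space"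
      using near\<tau>[OF tm\<tau>(1)] by (simp add: half_space_def dist_norm norm_minus_commute)
    have RR: "norm v0 \<le> R" "norm (snd (z tm)) \<le> R" "norm (snd (zs tm)) \<le> R"
      using nearz'[OF tm\<tau>(2)] near\<tau>[OF tm\<tau>(1)] norm_triangle_ineq2[of "snd (z tm)" v0] norm_triangle_ineq2[of "snd (zs tm)" v0] mm(1)
      by (auto simp: R_def)
    have sm: "k * s \<le> A5 * s" if "k \<le> A5" for k using that s by (intro mult_right_mono) auto
    have ee: "norm (x0 - fst (z tm)) \<le> A5 * s" "norm (v0 - snd (z tm)) \<le> A5 * s"
      "norm (fst (zs tm) - fst (z tm)) \<le> A5 * s" "norm (snd (zs tm) - snd (z tm)) \<le> A5 * s" "\<bar>tm - T\<bar> \<le> A5 * s"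
      using order_trans[OF vz(2)[OF tmI tmT(1)] sm[OF cc(6)]] order_trans[OF vz(1)[OF tmI tmT(1)] sm[OF cc(6)]]
        order_trans[OF nc(1)[OF tmI] sm[OF cc(4)]] order_trans[OF nc(2)[OF tmI] sm[OF cc(4)]] order_trans[OF tmT(1) sm[OF cc(5)]]
      by (simp_all add: norm_minus_commute)
    have fin: "\<bar>metric_coord M c x0 (fst (zs \<tau>) - x0) v0 - T / 2 * En s\<bar> \<le> (A + K * (1 + 4 * R + R\<^sup>2)) * (A5 * s)\<^sup>2"
      by (rule exit_pairing[OF mm(4) less_imp_le[OF mm(2)] ch(1) x0B xmB xsB RR ee disp null0 E0[OF tm\<tau>(2)] E[OF tm\<tau>(1)] Ptm[unfolded P_def]])
    show ?case
    proof (intro exI conjI)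
      show "tau_in M (p, a s) = ereal \<tau>" "S_in M (p, a s) = (\<gamma>' \<tau>, V' \<tau>)" by (rule ex)+
      show "\<bar>\<tau> - T\<bar> \<le> C' * s"
        by (rule order_trans[OF order_trans[OF \<tau>T sm[OF cc(5)]] mult_right_mono[OF C'(2)]]) (use s in simp)
      show "\<gamma>' \<tau> \<in> boundary M" by (rule bd')
      show "\<gamma>' \<tau> \<in> cdom c" using g'(3) \<tau>I by blast
      show "V' \<tau> \<in> tangent_space M (\<gamma>' \<tau>)"
        by (rule geodesicD(1)[OF geodesic_fromD(2)[OF g'(1)]]) (use \<tau>0 in simp)
      show "snd (V' \<tau> c) < 0" using vel[OF \<tau>I(2)] g'(3) \<tau>I(1) \<kappa> by simp
      have "norm (fst (zs \<tau>) - x0) \<le> C' * s"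
        by (rule order_trans[OF order_trans[OF vzs(2)[OF \<tau>I(2) \<tau>T] sm[OF cc(6)]] mult_right_mono[OF C'(2)]]) (use s in simp)
      then show "norm (cmap c (\<gamma>' \<tau>) - x0) \<le> C' * s" using g'(3) \<tau>I(1) by simp
      have "(A + K * (1 + 4 * R + R\<^sup>2)) * (A5 * s)\<^sup>2 = ((A + K * (1 + 4 * R + R\<^sup>2)) * A5\<^sup>2) * s\<^sup>2"
        by (simp add: power_mult_distrib)
      also have "\<dots> \<le> C' * s\<^sup>2" by (rule mult_right_mono[OF C'(3)]) simp
      finally show "\<bar>metric_coord M c x0 (cmap c (\<gamma>' \<tau>) - x0) v0 - T / 2 * En s\<bar> \<le> C' * s\<^sup>2"
        using fin g'(3) \<tau>I(1) by simp
    qed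
  qed
  then show ?thesis unfolding x0_def v0_def using C'(1) by blast
qed

end

context lorentz_mfd
begin

section \<open>Linearity of the normal component, and slices along the boundary\<close>

lemma normal_comp_tadd:
  assumes "p \<in> boundary M" "v \<in> tangent_space M p" "w \<in> tangent_space M p"
  shows "normal_comp M p (tadd v w) = normal_comp M p v + normal_comp M p w"
  unfolding normal_comp_def by (rule metric_tadd(1)[OF assms(2,3) inward_normal(1)[OF assms(1)]])

lemma normal_comp_tscale:
  assumes "p \<in> boundary M" "v \<in> tangent_space M p"
  shows "normal_comp M p (tscale s v) = s * normal_comp M p v"
  unfolding normal_comp_def by (rule metric_tscale(1)[OF assms(2) inward_normal(1)[OF assms(1)]])

lemma boundary_tangentD:
  assumes "u \<in> boundary_tangent_space M p"
  shows "u \<in> tangent_space M p" "c \<in> charts_at M p \<Longrightarrow> snd (u c) = 0"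
  using assms unfolding boundary_tangent_space_def by blast+

text \<open>Coordinate expressions of maps between boundaries thus live on open sets, where
  derivatives are unique.\<close>

lemma openin_boundary_slice:
  assumes "openin (top_of_set half_space) S"
  shows "open {x. (x, 0 :: real) \<in> S}"
proof -
  obtain W where W: "open W" "S = half_space \<inter> W" using assms by (auto simp: openin_open)
  have "{x. (x, 0 :: real) \<in> S} = (\<lambda>x. (x, 0)) -` W" using W(2) by (auto simp: half_space_def)
  moreover have "open ((\<lambda>x. (x, 0 :: real)) -` W)"
    by (rule open_vimage[OF W(1)]) (intro continuous_intros)
  ultimately show ?thesis by simp
qed

end

section \<open>Boundary isometries\<close>

locale bd_iso = A: lorentz_mfd M1 + B: lorentz_mfd M2
  for M1 :: "('m::{t2_space, second_countable_topology}, 'e::euclidean_space) metric_manifold"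
    and M2 :: "('k::{t2_space, second_countable_topology}, 'f::euclidean_space) metric_manifold" +
  fixes f :: "'m \<Rightarrow> 'k"
  assumes iso: "boundary_isometry M1 M2 f"
begin

lemma f_boundary: "p \<in> boundary M1 \<Longrightarrow> f p \<in> boundary M2"
  and f_cont: "continuous_on (boundary M1) f"
  and f_smooth: "c \<in> charts M1 \<Longrightarrow> d \<in> charts M2 \<Longrightarrow> smooth_on (bd_coord_dom c d f) (bd_coord c d f)"
  using iso unfolding boundary_isometry_def bd_diffeo_def bd_smooth_map_def by blast+

lemma slice_boundary:
  assumes "c \<in> charts M1" "(x, 0) \<in> cimg c"
  shows "c \<in> charts_at M1 (cinv c (x, 0))" "cinv c (x, 0) \<in> boundary M1"
proof -
  show c: "c \<in> charts_at M1 (cinv c (x, 0))" using assms by (simp add: A.charts_at_iff)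
  show "cinv c (x, 0) \<in> boundary M1" using A.boundary_iff[OF c] assms by simp
qed

lemma open_bd_coord_dom:
  assumes c: "c \<in> charts M1" and d: "d \<in> charts M2"
  shows "open (bd_coord_dom c d f)"
proof -
  let ?U = "{x. (x, 0 :: real) \<in> cimg c}"
  have U: "open ?U" by (rule A.openin_boundary_slice[OF A.chartD(2)[OF c]])
  have "continuous_on ?U (\<lambda>x. cinv c (x, 0))"
    by (rule continuous_on_compose2[OF A.cont_cinv[OF c]]) (auto intro!: continuous_intros)
  then have "continuous_on ?U (\<lambda>x. f (cinv c (x, 0)))"
    by (rule continuous_on_compose2[OF f_cont]) (use slice_boundary(2)[OF c] in blast)
  then have "open (?U \<inter> (\<lambda>x. f (cinv c (x, 0))) -` cdom d)"
    by (rule continuous_open_preimage[OF _ U B.chartD(1)[OF d]])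
  moreover have "bd_coord_dom c d f = ?U \<inter> (\<lambda>x. f (cinv c (x, 0))) -` cdom d"
    unfolding bd_coord_dom_def by auto
  ultimately show ?thesis by simp
qed

abbreviation bdD :: "('m, 'e) chart \<Rightarrow> ('k, 'f) chart \<Rightarrow> 'm \<Rightarrow> 'e \<Rightarrow> 'f" where
  "bdD c d p \<equiv> frechet_derivative (bd_coord c d f) (at (fst (cmap c p)))"

lemma boundary_coord:
  assumes "p \<in> boundary M1" "c \<in> charts_at M1 p"
  shows "cmap c p = (fst (cmap c p), 0)"
  using A.boundary_iff[OF assms(2)] assms(1) by (simp add: prod_eq_iff)

lemma boundary_coord2:
  assumes "q \<in> boundary M2" "d \<in> charts_at M2 q"
  shows "cmap d q = (fst (cmap d q), 0)"
  using B.boundary_iff[OF assms(2)] assms(1) by (simp add: prod_eq_iff)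

lemma in_bd_coord_dom:
  assumes "p \<in> boundary M1" "c \<in> charts_at M1 p" "d \<in> charts_at M2 (f p)"
  shows "fst (cmap c p) \<in> bd_coord_dom c d f" "cinv c (fst (cmap c p), 0) = p"
    "bd_coord c d f (fst (cmap c p)) = fst (cmap d (f p))"
  using boundary_coord[OF assms(1,2)] assms(2,3)
  by (auto simp: bd_coord_dom_def bd_coord_def A.charts_at_iff B.charts_at_iff image_iff)

lemma bd_coord_has_derivative:
  assumes "p \<in> boundary M1" "c \<in> charts_at M1 p" "d \<in> charts_at M2 (f p)"
  shows "(bd_coord c d f has_derivative bdD c d p) (at (fst (cmap c p)))"
  by (rule frechet_derivative_smooth_on_open[OF f_smooth open_bd_coord_dom in_bd_coord_dom(1)[OF assms]])
    (use assms in \<open>auto simp: A.charts_at_iff B.charts_at_iff\<close>)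

lemma bd_coord_point:
  assumes "c \<in> charts M1" "d \<in> charts M2" "x \<in> bd_coord_dom c d f"
  shows "cmap d (f (cinv c (x, 0))) = (bd_coord c d f x, 0)" "cinv d (bd_coord c d f x, 0) = f (cinv c (x, 0))"
    "f (cinv c (x, 0)) \<in> cdom d" "(x, 0) \<in> cimg c"
proof -
  show x: "(x, 0) \<in> cimg c" and d: "f (cinv c (x, 0)) \<in> cdom d" using assms(3) by (auto simp: bd_coord_dom_def)
  have "d \<in> charts_at M2 (f (cinv c (x, 0)))" using assms(2) d by (simp add: B.charts_at_iff)
  from boundary_coord2[OF f_boundary[OF slice_boundary(2)[OF assms(1) x]] this]
  show 1: "cmap d (f (cinv c (x, 0))) = (bd_coord c d f x, 0)" by (simp add: bd_coord_def)
  show "cinv d (bd_coord c d f x, 0) = f (cinv c (x, 0))"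
    using B.cinv_cmap[OF assms(2) d] unfolding 1 .
qed

text \<open>Chain rule for the transition from \<open>d\<close> to \<open>d'\<close>, restricted to
  the boundary hyperplane. Together with \<open>bdD_source_change\<close> it shows that the
  coordinate vectors prescribed in \<open>bd_differential\<close> for all pairs of charts belong to
  one tangent vector.\<close>

lemma bdD_target_change:
  assumes p: "p \<in> boundary M1" "c \<in> charts_at M1 p" and d: "d \<in> charts_at M2 (f p)" "d' \<in> charts_at M2 (f p)"
  shows "bdD c d' p a = fst (jacobian d d' (f p) (bdD c d p a, 0))"
proof -
  let ?x0 = "fst (cmap c p)"
  have ch: "c \<in> charts M1" "d \<in> charts M2" "d' \<in> charts M2" using p d by (auto simp: A.charts_at_iff B.charts_at_iff)
  define S where "S = bd_coord_dom c d f \<inter> bd_coord_dom c d' f"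
  have S: "open S" "?x0 \<in> S"
    unfolding S_def using open_Int[OF open_bd_coord_dom[OF ch(1,2)] open_bd_coord_dom[OF ch(1,3)]]
      in_bd_coord_dom(1)[OF p d(1)] in_bd_coord_dom(1)[OF p d(2)] by auto
  let ?i = "\<lambda>x. (bd_coord c d f x, 0 :: real)"
  have "(bd_coord c d f has_derivative bdD c d p) (at ?x0 within S)"
    by (rule has_derivative_at_withinI[OF bd_coord_has_derivative[OF p d(1)]])
  then have i: "(?i has_derivative (\<lambda>a. (bdD c d p a, 0))) (at ?x0 within S)"
    by (intro has_derivative_Pair has_derivative_const)
  have im: "?i ` S \<subseteq> B.ovl d d'"
  proof (rule image_subsetI)
    fix x assume x: "x \<in> S"
    show "?i x \<in> B.ovl d d'"
      using bd_coord_point[OF ch(1,2), of x] bd_coord_point(3)[OF ch(1,3), of x] x unfolding S_def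
      by (metis IntD1 IntD2 IntI imageI)
  qed
  have i0: "?i ?x0 = cmap d (f p)"
    using in_bd_coord_dom(3)[OF p d(1)] boundary_coord2[OF f_boundary[OF p(1)] d(1)] by simp
  have "(B.tr d d' has_derivative jacobian d d' (f p)) (at (?i ?x0) within ?i ` S)"
    unfolding i0 by (rule has_derivative_subset[OF B.jacobian_has_derivative[OF d] im])
  from has_derivative_in_compose[OF i this]
  have "((\<lambda>x. B.tr d d' (?i x)) has_derivative (\<lambda>a. jacobian d d' (f p) (bdD c d p a, 0))) (at ?x0 within S)" .
  then have "((\<lambda>x. fst (B.tr d d' (?i x))) has_derivative (\<lambda>a. fst (jacobian d d' (f p) (bdD c d p a, 0)))) (at ?x0 within S)"
    by (rule has_derivative_fst)
  then have "(bd_coord c d' f has_derivative (\<lambda>a. fst (jacobian d d' (f p) (bdD c d p a, 0)))) (at ?x0 within S)"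
  proof (rule has_derivative_transform_within[OF _ zero_less_one S(2)])
    fix x assume x: "x \<in> S"
    then have "cinv d (bd_coord c d f x, 0) = f (cinv c (x, 0))" using bd_coord_point(2)[OF ch(1,2)] by (simp add: S_def)
    then show "fst (B.tr d d' (?i x)) = bd_coord c d' f x" by (simp add: bd_coord_def)
  qed
  then have "(bd_coord c d' f has_derivative (\<lambda>a. fst (jacobian d d' (f p) (bdD c d p a, 0)))) (at ?x0)"
    by (simp add: at_within_open[OF S(2,1)])
  from has_derivative_unique[OF bd_coord_has_derivative[OF p d(2)] this]
  show ?thesis by (rule fun_cong)
qed

lemma bdD_source_change:
  assumes p: "p \<in> boundary M1" and c: "c \<in> charts_at M1 p" "c' \<in> charts_at M1 p" and d: "d \<in> charts_at M2 (f p)"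
  shows "bdD c d p a = bdD c' d p (fst (jacobian c c' p (a, 0)))"
proof -
  let ?x0 = "fst (cmap c p)"
  have ch: "c \<in> charts M1" "c' \<in> charts M1" "d \<in> charts M2" using c d by (auto simp: A.charts_at_iff B.charts_at_iff)
  define S where "S = bd_coord_dom c d f \<inter> {x. (x, 0 :: real) \<in> A.ovl c c'}"
  have x0: "cmap c p = (?x0, 0)" by (rule boundary_coord[OF p c(1)])
  have "cmap c p \<in> A.ovl c c'" using c by (auto simp: A.charts_at_iff)
  then have S: "open S" "?x0 \<in> S"
    unfolding S_def using open_bd_coord_dom[OF ch(1,3)] A.openin_boundary_slice[OF A.openin_ovl[OF ch(1,2)]]
      in_bd_coord_dom(1)[OF p c(1) d] x0 by auto
  let ?i = "\<lambda>x. (x, 0 :: real)" and ?j = "\<lambda>x. fst (A.tr c c' (x, 0))"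
  have i: "(?i has_derivative (\<lambda>a. (a, 0))) (at ?x0 within S)"
    by (intro has_derivative_Pair has_derivative_const has_derivative_ident)
  have "(A.tr c c' has_derivative jacobian c c' p) (at (?i ?x0) within ?i ` S)"
    unfolding x0[symmetric] by (rule has_derivative_subset[OF A.jacobian_has_derivative[OF c]]) (auto simp: S_def)
  from has_derivative_fst[OF has_derivative_in_compose[OF i this]]
  have j: "(?j has_derivative (\<lambda>a. fst (jacobian c c' p (a, 0)))) (at ?x0 within S)" .
  have j0: "?j ?x0 = fst (cmap c' p)" using in_bd_coord_dom(2)[OF p c(1) d] by simp
  have "(bd_coord c' d f has_derivative bdD c' d p) (at (?j ?x0) within ?j ` S)"
    unfolding j0 by (rule has_derivative_at_withinI[OF bd_coord_has_derivative[OF p c(2) d]])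
  from has_derivative_in_compose[OF j this]
  have "((\<lambda>x. bd_coord c' d f (?j x)) has_derivative (\<lambda>a. bdD c' d p (fst (jacobian c c' p (a, 0))))) (at ?x0 within S)" .
  then have "(bd_coord c d f has_derivative (\<lambda>a. bdD c' d p (fst (jacobian c c' p (a, 0))))) (at ?x0 within S)"
  proof (rule has_derivative_transform_within[OF _ zero_less_one S(2)])
    fix x assume x: "x \<in> S"
    then have xo: "(x, 0) \<in> A.ovl c c'" by (simp add: S_def)
    then have xi: "(x, 0) \<in> cimg c" by auto
    have "cinv c (x, 0) \<in> cdom c'" using xo ch by auto
    then have c'x: "c' \<in> charts_at M1 (cinv c (x, 0))" using ch by (simp add: A.charts_at_iff)
    have "cmap c' (cinv c (x, 0)) = (?j x, 0)"
      by (rule boundary_coord[OF slice_boundary(2)[OF ch(1) xi] c'x])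
    then have "cinv c' (?j x, 0) = cinv c (x, 0)"
      using A.cinv_cmap[OF ch(2) \<open>cinv c (x, 0) \<in> cdom c'\<close>] by simp
    then show "bd_coord c' d f (?j x) = bd_coord c d f x" by (simp add: bd_coord_def)
  qed
  then have "(bd_coord c d f has_derivative (\<lambda>a. bdD c' d p (fst (jacobian c c' p (a, 0))))) (at ?x0)"
    by (simp add: at_within_open[OF S(2,1)])
  from has_derivative_unique[OF bd_coord_has_derivative[OF p c(1) d] this]
  show ?thesis by (rule fun_cong)
qed

lemma bd_differential:
  assumes p: "p \<in> boundary M1" and u: "u \<in> boundary_tangent_space M1 p"
  shows "bd_differential M1 M2 f p u \<in> tangent_space M2 (f p)"
    "c \<in> charts_at M1 p \<Longrightarrow> d \<in> charts_at M2 (f p) \<Longrightarrow> bd_differential M1 M2 f p u d = (bdD c d p (fst (u c)), 0)"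
proof -
  obtain c0 where c0: "c0 \<in> charts_at M1 p" using A.ex_chart by blast
  obtain d0 where d0: "d0 \<in> charts_at M2 (f p)" using B.ex_chart by blast
  \<comment> \<open>Built from a single pair of charts; the two chain rules yield the prescribed
    coordinates in all others.\<close>
  define w where "w = tvec_of M2 d0 (f p) (bdD c0 d0 p (fst (u c0)), 0)"
  have w: "w \<in> tangent_space M2 (f p)" unfolding w_def by (rule B.tvec_of_tangent[OF d0])
  have wd: "w d = (bdD c d p (fst (u c)), 0)" if c: "c \<in> charts_at M1 p" and d: "d \<in> charts_at M2 (f p)" for c d
  proof -
    have "w d = jacobian d0 d (f p) (bdD c0 d0 p (fst (u c0)), 0)" using d by (simp add: w_def tvec_of_def)
    moreover have "snd (jacobian d0 d (f p) (bdD c0 d0 p (fst (u c0)), 0)) = 0"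
      using B.jacobian_snd(1)[OF d0 d f_boundary[OF p]] by simp
    moreover have "fst (jacobian d0 d (f p) (bdD c0 d0 p (fst (u c0)), 0)) = bdD c0 d p (fst (u c0))"
      by (rule bdD_target_change[OF p c0 d0 d, symmetric])
    moreover have "bdD c0 d p (fst (u c0)) = bdD c d p (fst (jacobian c0 c p (fst (u c0), 0)))"
      by (rule bdD_source_change[OF p c0 c d])
    moreover have "(fst (u c0), 0) = u c0" using A.boundary_tangentD(2)[OF u c0] by (simp add: prod_eq_iff)
    moreover have "jacobian c0 c p (u c0) = u c"
      by (rule A.tangent_spaceD[OF A.boundary_tangentD(1)[OF u] c0 c, symmetric])
    ultimately show ?thesis by (simp add: prod_eq_iff)
  qed
  have "bd_differential M1 M2 f p u = w"
    unfolding bd_differential_def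
  proof (rule the_equality)
    show "w \<in> tangent_space M2 (f p) \<and> (\<forall>c\<in>charts_at M1 p. \<forall>d\<in>charts_at M2 (f p). w d = (bdD c d p (fst (u c)), 0))"
      using w wd by blast
    fix w' assume w': "w' \<in> tangent_space M2 (f p) \<and> (\<forall>c\<in>charts_at M1 p. \<forall>d\<in>charts_at M2 (f p). w' d = (bdD c d p (fst (u c)), 0))"
    have "w' d0 = w d0" using w' wd[OF c0 d0] c0 d0 by simp
    then show "w' = w" using B.tangent_space_eqI[OF conjunct1[OF w'] w d0] by blast
  qed
  then show "bd_differential M1 M2 f p u \<in> tangent_space M2 (f p)"
    "c \<in> charts_at M1 p \<Longrightarrow> d \<in> charts_at M2 (f p) \<Longrightarrow> bd_differential M1 M2 f p u d = (bdD c d p (fst (u c)), 0)"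
    using w wd by auto
qed

lemma bd_differential_tangent:
  assumes p: "p \<in> boundary M1" and u: "u \<in> boundary_tangent_space M1 p"
  shows "bd_differential M1 M2 f p u \<in> boundary_tangent_space M2 (f p)"
proof -
  obtain c where c: "c \<in> charts_at M1 p" using A.ex_chart by blast
  obtain d where d: "d \<in> charts_at M2 (f p)" using B.ex_chart by blast
  show ?thesis
    unfolding B.boundary_tangent_space_iff[OF d f_boundary[OF p]]
    using bd_differential(1)[OF p u] bd_differential(2)[OF p u c d] by simp
qed

lemma bd_differential_metric:
  assumes "p \<in> boundary M1" "u \<in> boundary_tangent_space M1 p" "w \<in> boundary_tangent_space M1 p"
  shows "metric M2 (f p) (bd_differential M1 M2 f p u) (bd_differential M1 M2 f p w) = metric M1 p u w"
  using iso assms unfolding boundary_isometry_def by blast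

section \<open>The pushforward as a linear isometry of tangent spaces\<close>

abbreviation push :: "'m \<Rightarrow> ('m, 'e) tvec \<Rightarrow> ('k, 'f) tvec" where
  "push p v \<equiv> tadd (bd_differential M1 M2 f p (tangential_part M1 p v))
    (tscale (normal_comp M1 p v) (inward_normal M2 (f p)))"

lemma bd_pushforward_eq: "bd_pushforward M1 M2 f (p, v) = (f p, push p v)"
  by (simp add: bd_pushforward_def)

context
  fixes p assumes p: "p \<in> boundary M1"
begin

lemma push_tangent:
  assumes "v \<in> tangent_space M1 p"
  shows "push p v \<in> tangent_space M2 (f p)"
  by (intro B.tadd_tangent B.tscale_tangent B.inward_normal(1)[OF f_boundary[OF p]]
      bd_differential(1)[OF p A.tangential_part(1)[OF p assms]])

lemma push_coord:
  assumes v: "v \<in> tangent_space M1 p" and c: "c \<in> charts_at M1 p" and d: "d \<in> charts_at M2 (f p)"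
  shows "push p v d = (bdD c d p (fst (tangential_part M1 p v c)), 0) + normal_comp M1 p v *\<^sub>R inward_normal M2 (f p) d"
  using bd_differential(2)[OF p A.tangential_part(1)[OF p v] c d] by simp

text \<open>With \<open>push_tscale\<close>, this allows a variation of an initial vector to be
  pushed forward term by term.\<close>

lemma push_tadd:
  assumes "v \<in> tangent_space M1 p" "w \<in> tangent_space M1 p"
  shows "push p (tadd v w) = tadd (push p v) (push p w)"
proof -
  obtain c where c: "c \<in> charts_at M1 p" using A.ex_chart by blast
  obtain d where d: "d \<in> charts_at M2 (f p)" using B.ex_chart by blast
  have lin: "linear (bdD c d p)" using bd_coord_has_derivative[OF p c d] by (rule has_derivative_linear)
  have vw: "tadd v w \<in> tangent_space M1 p" by (rule A.tadd_tangent[OF assms])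
  have t: "tangential_part M1 p (tadd v w) c = tangential_part M1 p v c + tangential_part M1 p w c"
    unfolding tangential_part_def A.normal_comp_tadd[OF p assms] by (simp add: scaleR_add_left algebra_simps)
  show ?thesis
  proof (rule B.tangent_space_eqI[OF push_tangent[OF vw] B.tadd_tangent[OF push_tangent[OF assms(1)] push_tangent[OF assms(2)]] d])
    show "push p (tadd v w) d = tadd (push p v) (push p w) d"
      unfolding tadd_apply[of "push p v"]
      unfolding push_coord[OF vw c d] push_coord[OF assms(1) c d] push_coord[OF assms(2) c d]
      unfolding t A.normal_comp_tadd[OF p assms]
      by (simp add: linear_add[OF lin] scaleR_add_left prod_eq_iff)
  qed
qed

lemma push_tscale:
  assumes "v \<in> tangent_space M1 p"
  shows "push p (tscale s v) = tscale s (push p v)"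
proof -
  obtain c where c: "c \<in> charts_at M1 p" using A.ex_chart by blast
  obtain d where d: "d \<in> charts_at M2 (f p)" using B.ex_chart by blast
  have lin: "linear (bdD c d p)" using bd_coord_has_derivative[OF p c d] by (rule has_derivative_linear)
  have sv: "tscale s v \<in> tangent_space M1 p" by (rule A.tscale_tangent[OF assms])
  have t: "tangential_part M1 p (tscale s v) c = s *\<^sub>R tangential_part M1 p v c"
    unfolding tangential_part_def A.normal_comp_tscale[OF p assms] by (simp add: algebra_simps)
  show ?thesis
  proof (rule B.tangent_space_eqI[OF push_tangent[OF sv] B.tscale_tangent[OF push_tangent[OF assms(1)]] d])
    show "push p (tscale s v) d = tscale s (push p v) d"
      unfolding tscale_apply[of s "push p v"]
      unfolding push_coord[OF sv c d] push_coord[OF assms(1) c d]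
      unfolding t A.normal_comp_tscale[OF p assms]
      by (simp add: linear_scale[OF lin] scaleR_add_right)
  qed
qed

text \<open>Tangential and normal parts are orthogonal in both manifolds, so the cross terms vanish.
  The tangential parts are compared by the boundary isometry, and the unit normals contribute the
  product of the normal components on either side.\<close>

lemma push_metric:
  assumes v: "v \<in> tangent_space M1 p" and w: "w \<in> tangent_space M1 p"
  shows "metric M2 (f p) (push p v) (push p w) = metric M1 p v w"
proof -
  let ?N = "inward_normal M1 p" and ?N2 = "inward_normal M2 (f p)"
  note N = A.inward_normal[OF p] and N2 = B.inward_normal[OF f_boundary[OF p]]
  define v' w' where "v' = tangential_part M1 p v" and "w' = tangential_part M1 p w"
  have t: "v' \<in> boundary_tangent_space M1 p" "w' \<in> boundary_tangent_space M1 p"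
    unfolding v'_def w'_def using A.tangential_part(1)[OF p] v w by auto
  note tt = A.boundary_tangentD(1)[OF t(1)] A.boundary_tangentD(1)[OF t(2)]
  define dv dw where "dv = bd_differential M1 M2 f p v'" and "dw = bd_differential M1 M2 f p w'"
  have b: "dv \<in> boundary_tangent_space M2 (f p)" "dw \<in> boundary_tangent_space M2 (f p)"
    unfolding dv_def dw_def using bd_differential_tangent[OF p] t by auto
  note bt = B.boundary_tangentD(1)[OF b(1)] B.boundary_tangentD(1)[OF b(2)]
  have z: "metric M2 (f p) dv ?N2 = 0" "metric M2 (f p) ?N2 dw = 0"
    using N2(2)[OF b(1)] N2(2)[OF b(2)] B.metric_sym[OF N2(1) bt(2)] by auto
  have z1: "metric M1 p v' ?N = 0" "metric M1 p ?N w' = 0"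
    using N(2)[OF t(1)] N(2)[OF t(2)] A.metric_sym[OF N(1) tt(2)] by auto
  have "metric M2 (f p) (push p v) (push p w) = metric M2 (f p) dv dw + normal_comp M1 p v * normal_comp M1 p w"
    unfolding v'_def[symmetric] w'_def[symmetric] dv_def[symmetric] dw_def[symmetric]
    using bt N2 z by (simp add: B.metric_tadd B.metric_tscale B.tadd_tangent B.tscale_tangent)
  also have "metric M2 (f p) dv dw = metric M1 p v' w'"
    unfolding dv_def dw_def by (rule bd_differential_metric[OF p t])
  also have "metric M1 p v' w' + normal_comp M1 p v * normal_comp M1 p w
     = metric M1 p (tadd v' (tscale (normal_comp M1 p v) ?N)) (tadd w' (tscale (normal_comp M1 p w) ?N))"
    using tt N z1 by (simp add: A.metric_tadd A.metric_tscale A.tadd_tangent A.tscale_tangent)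
  also have "\<dots> = metric M1 p v w"
    unfolding v'_def w'_def using A.tangential_part(2)[OF p v] A.tangential_part(2)[OF p w] by simp
  finally show ?thesis .
qed

lemma push_normal_comp:
  assumes v: "v \<in> tangent_space M1 p"
  shows "normal_comp M2 (f p) (push p v) = normal_comp M1 p v"
proof -
  note N2 = B.inward_normal[OF f_boundary[OF p]]
  have b: "bd_differential M1 M2 f p (tangential_part M1 p v) \<in> boundary_tangent_space M2 (f p)"
    by (rule bd_differential_tangent[OF p A.tangential_part(1)[OF p v]])
  show ?thesis
    unfolding normal_comp_def[of M2]
    using N2(1,3) N2(2)[OF b] B.boundary_tangentD(1)[OF b]
    by (simp add: B.metric_tadd B.metric_tscale B.tscale_tangent)
qed

lemma push_boundary_coord:
  assumes u: "u \<in> boundary_tangent_space M1 p" and c: "c \<in> charts_at M1 p" and d: "d \<in> charts_at M2 (f p)"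
  shows "push p u d = (bdD c d p (fst (u c)), 0)"
proof -
  have n: "normal_comp M1 p u = 0"
    using A.normal_comp_iff(3)[OF p A.boundary_tangentD(1)[OF u] c] A.boundary_tangentD(2)[OF u c] by simp
  then show ?thesis
    using push_coord[OF A.boundary_tangentD(1)[OF u] c d] by (simp add: tangential_part_def)
qed

end

end

context lorentz_mfd
begin

section \<open>Exit of lightlike geodesics and variations of their initial vectors\<close>

lemma exits_alongD:
  assumes "exits_along M (p, v) T \<gamma> V"
  shows "0 < T" "geodesic_from M (p, v) {0..T} \<gamma> V" "\<gamma> ` {0<..<T} \<subseteq> interior_part M" "\<gamma> T \<in> boundary M"
    "geodesic M {0..T} \<gamma> V" "\<gamma> 0 = p" "V 0 = v" "V T \<in> tangent_space M (\<gamma> T)"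
    "tau_in M (p, v) = ereal T" "S_in M (p, v) = (\<gamma> T, V T)"
proof -
  show 1: "0 < T" "geodesic_from M (p, v) {0..T} \<gamma> V" "\<gamma> ` {0<..<T} \<subseteq> interior_part M" "\<gamma> T \<in> boundary M"
    using assms unfolding exits_along_def by blast+
  show g: "geodesic M {0..T} \<gamma> V" and "\<gamma> 0 = p" "V 0 = v" using geodesic_fromD[OF 1(2)] by blast+
  show "V T \<in> tangent_space M (\<gamma> T)" by (rule geodesicD(1)[OF g]) (use 1(1) in simp)
  show "tau_in M (p, v) = ereal T" "S_in M (p, v) = (\<gamma> T, V T)" by (rule exit_data[OF 1(2,1,3,4)])+
qed

lemma bd_minus_LM_iff:
  "(p, v) \<in> bd_minus_LM M \<longleftrightarrow> p \<in> boundary M \<and> v \<in> tangent_space M p \<and> 0 < normal_comp M p v \<and> metric M p v v = 0"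
proof -
  have "v \<noteq> (\<lambda>_. 0)" if "p \<in> boundary M" "v \<in> tangent_space M p" "0 < normal_comp M p v"
  proof
    assume z: "v = (\<lambda>_. 0)"
    obtain c where "c \<in> charts_at M p" using ex_chart by blast
    then show False using normal_comp_iff(1)[OF that(1,2)] that(3) z by simp
  qed
  then show ?thesis
    unfolding bd_minus_LM_def Int_iff bd_minus_TM_iff bdLM_def LM_def bdTM_def by auto
qed

lemma exits_along_ex:
  assumes "\<forall>q\<in>LM M. nontrapping M q" and q: "(p, v) \<in> bd_minus_LM M"
  shows "\<exists>T \<gamma> V. exits_along M (p, v) T \<gamma> V"
proof -
  obtain c where c: "c \<in> charts_at M p" using ex_chart by blast
  have "nontrapping M (p, v)" using assms unfolding bd_minus_LM_def bdLM_def by blast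
  moreover have "0 < snd (v c)" using q normal_comp_iff(1)[OF _ _ c] unfolding bd_minus_LM_iff by blast
  ultimately show ?thesis using first_exit[OF _ c] unfolding exits_along_def by blast
qed

text \<open>With an inward exit velocity the last coordinate would increase strictly to its value 0
  at \<open>T\<close> and so be negative just before. Tangential exits are not excluded by
  this.\<close>

lemma exit_not_inward:
  assumes ex: "exits_along M (p, v) T \<gamma> V"
  shows "normal_comp M (\<gamma> T) (V T) \<le> 0"
proof (rule ccontr)
  note e = exits_alongD[OF ex]
  assume "\<not> normal_comp M (\<gamma> T) (V T) \<le> 0"
  obtain c where c: "c \<in> charts_at M (\<gamma> T)" using ex_chart by blast
  have pos: "0 < snd (V T c)" using normal_comp_iff(1)[OF e(4,8) c] \<open>\<not> _ \<le> 0\<close> by simp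
  have TT: "T \<in> {0..T}" using e(1) by simp
  obtain \<delta> where \<delta>: "\<delta> > 0" "\<forall>t\<in>{0..T}. \<bar>t - T\<bar> < \<delta> \<longrightarrow> \<gamma> t \<in> cdom c \<and>
    norm (cmap c (\<gamma> t) - cmap c (\<gamma> T)) < 1 \<and> norm (V t c - V T c) < snd (V T c)"
  proof -
    obtain \<delta>1 where 1: "\<delta>1 > 0" "\<forall>t\<in>{0..T}. \<bar>t - T\<bar> < \<delta>1 \<longrightarrow> \<gamma> t \<in> cdom c \<and>
      norm (cmap c (\<gamma> t) - cmap c (\<gamma> T)) < 1 \<and> norm (V t c - V T c) < 1"
      using geodesic_nhd[OF e(5) TT c zero_less_one] by blast
    obtain \<delta>2 where 2: "\<delta>2 > 0" "\<forall>t\<in>{0..T}. \<bar>t - T\<bar> < \<delta>2 \<longrightarrow> \<gamma> t \<in> cdom c \<and>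
      norm (cmap c (\<gamma> t) - cmap c (\<gamma> T)) < snd (V T c) \<and> norm (V t c - V T c) < snd (V T c)"
      using geodesic_nhd[OF e(5) TT c pos] by blast
    show ?thesis by (rule that[of "min \<delta>1 \<delta>2"]) (use 1 2 in auto)
  qed
  define t where "t = max (T / 2) (T - \<delta> / 2)"
  have t: "0 < t" "t < T" "T - t < \<delta>" using e(1) \<delta>(1) by (auto simp: t_def max_def)
  have dom: "\<gamma> u \<in> cdom c" "norm (V u c - V T c) < snd (V T c)" if "u \<in> {t..T}" for u
    using \<delta>(2)[rule_format, of u] that t by auto
  have ch: "c \<in> charts M" using c by (simp add: charts_at_iff)
  have "snd (cmap c (\<gamma> t)) < snd (cmap c (\<gamma> T))"
  proof (rule pos_derivative_imp_less[OF t(2)])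
    fix u assume u: "u \<in> {t..T}"
    then have u': "u \<in> {0..T}" using t by auto
    have cu: "c \<in> charts_at M (\<gamma> u)" using dom(1)[OF u] ch by (simp add: charts_at_iff)
    have "((\<lambda>s. cmap c (\<gamma> s)) has_vector_derivative V u c) (at u within {t..T})"
      by (rule has_vector_derivative_within_subset[OF geodesicD(2)[OF e(5) u' cu]]) (use t in auto)
    then show "((\<lambda>s. snd (cmap c (\<gamma> s))) has_real_derivative snd (V u c)) (at u within {t..T})"
      using snd_fst_has_derivative[of "\<lambda>s. (cmap c (\<gamma> s), V s c)" u "{t..T}"] by simp
    show "0 < snd (V u c)"
      using norm_fst_snd_le(2)[of "V u c - V T c"] dom(2)[OF u] by simp
  qed
  moreover have "snd (cmap c (\<gamma> T)) = 0" using boundary_iff[OF c] e(4) by simp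
  moreover have "0 \<le> snd (cmap c (\<gamma> t))" using dom(1)[of t] t ch by (intro snd_cmap_nonneg) (simp add: charts_at_iff)
  ultimately show False by simp
qed

lemma geodesic_const: "geodesic M {0..T} (\<lambda>_. p) (\<lambda>_ _. 0)"
proof -
  have "christoffel M c (cmap c p) 0 0 = 0" if "c \<in> charts_at M p" for c
  proof -
    have ch: "c \<in> charts M" "cmap c p \<in> cimg c" using that by (auto simp: charts_at_iff)
    show ?thesis
      by (rule metric_coord_cancel[OF ch])
        (simp add: christoffel_eq[OF ch] bilinear_lzero[OF metric_deriv_bilinear[OF ch]]
          bilinear_lzero[OF metric_coord_bilinear[OF ch]])
  qed
  moreover have "(\<lambda>_. 0) \<in> tangent_space M p"
    unfolding tangent_space_def using linear_0[OF linear_jacobian] by simp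
  ultimately show ?thesis unfolding geodesic_def by (simp add: is_interval_cc)
qed

text \<open>A geodesic with zero velocity at some time is constant, by uniqueness, whereas the
  initial velocity points inward.\<close>

lemma exit_velocity_nonzero:
  assumes ex: "exits_along M (p, v) T \<gamma> V" and v: "0 < normal_comp M p v" "p \<in> boundary M" "v \<in> tangent_space M p"
  shows "V T \<noteq> (\<lambda>_. 0)"
proof
  note e = exits_alongD[OF ex]
  assume z: "V T = (\<lambda>_. 0)"
  have "V 0 = (\<lambda>_. 0)"
    by (rule conjunct2[OF geodesic_unique[OF e(5) geodesic_const[of T "\<gamma> T"], of T 0]]) (use e(1) z in auto)
  moreover obtain c where "c \<in> charts_at M p" using ex_chart by blast
  ultimately show False using normal_comp_iff(1)[OF v(2,3)] v(1) e(7) by simp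
qed

text \<open>The starting point \<open>p\<close> turns into the exit point of the reversed geodesic,
  hence it is required to lie on the boundary.\<close>

lemma exits_along_reverse:
  assumes ex: "exits_along M (p, v) T \<gamma> V" and p: "p \<in> boundary M"
  shows "exits_along M (\<gamma> T, tscale (-1) (V T)) T (\<lambda>t. \<gamma> (T - t)) (\<lambda>t. tscale (-1) (V (T - t)))"
proof -
  note e = exits_alongD[OF ex]
  have "(\<lambda>t. \<gamma> (T - t)) ` {0<..<T} \<subseteq> interior_part M" using e(3) by auto
  then show ?thesis
    unfolding exits_along_def geodesic_from_def using geodesic_reverse[OF e(5)] e(1,6) p by simp
qed

text \<open>As the induced form is nondegenerate, some boundary vector pairs nontrivially with
  \<open>w\<close>; adding a multiple of \<open>w\<close> makes it lightlike, and scaling fixes the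
  pairing. The value 1/2 lets the correction \<open>s\<^sup>2 u\<close> cancel the energy
  \<open>s\<^sup>2\<close> of the normal term \<open>s N\<close> in the variation for tangential
  exits.\<close>

lemma boundary_null_partner:
  assumes y: "y \<in> boundary M" and w: "w \<in> boundary_tangent_space M y" "w \<noteq> (\<lambda>_. 0)" "metric M y w w = 0"
  shows "\<exists>u\<in>boundary_tangent_space M y. metric M y w u = 1/2 \<and> metric M y u u = 0"
proof -
  obtain c where c: "c \<in> charts_at M y" using ex_chart by blast
  note wt = boundary_tangentD(1)[OF w(1)]
  define B where "B a b = metric_coord M c (cmap c y) (a, 0) (b, 0)" for a b
  have lor: "lorentzian_form B" unfolding B_def[abs_def] by (rule boundary_metric_lorentz[OF c y])
  have bil: "bilinear B" and sym: "\<And>a b. B a b = B b a" using lor unfolding lorentzian_form_def by blast+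
  define h where "h = fst (w c)"
  have wc: "w c = (h, 0)" using boundary_tangentD(2)[OF w(1) c] by (simp add: h_def prod_eq_iff)
  have "h \<noteq> 0"
  proof
    assume "h = 0"
    then have "w c = 0" using wc by (simp add: zero_prod_def)
    moreover have "(\<lambda>_. 0) \<in> tangent_space M y"
      unfolding tangent_space_def using linear_0[OF linear_jacobian] by simp
    ultimately show False using tangent_space_eqI[OF wt _ c, of "\<lambda>_. 0"] w(2) by simp
  qed
  then obtain b where b: "B h b \<noteq> 0" using lorentzian_form_nondegenerate[OF lor] unfolding nondegenerate_def by blast
  have hh: "B h h = 0" using w(3) metric_eq[OF c wt wt] by (simp add: B_def wc)
  \<comment> \<open>Solves \<open>B b b + 2 * k * B h b = 0\<close>, which makes
    \<open>b + k *\<^sub>R h\<close> null because \<open>h\<close> is.\<close>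
  define k where "k = - B b b / (2 * B h b)"
  define b' where "b' = b + k *\<^sub>R h"
  have kk: "2 * (k * B h b) = - B b b" using b by (simp add: k_def)
  have b': "B h b' = B h b" "B b' b' = 0"
    using kk sym[of b h]
    by (simp_all add: b'_def bilinear_ladd[OF bil] bilinear_radd[OF bil] bilinear_lmul[OF bil] bilinear_rmul[OF bil] hh)
  define a where "a = (1 / (2 * B h b)) *\<^sub>R b'"
  have a: "B h a = 1/2" "B a a = 0"
    using b b' by (simp_all add: a_def bilinear_lmul[OF bil] bilinear_rmul[OF bil])
  define u where "u = tvec_of M c y (a, 0)"
  have u: "u \<in> boundary_tangent_space M y" "u c = (a, 0)"
    using tvec_of_tangent[OF c] tvec_of_apply[OF c] unfolding boundary_tangent_space_iff[OF c y] u_def by auto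
  note ut = boundary_tangentD(1)[OF u(1)]
  have "metric M y w u = 1/2" "metric M y u u = 0"
    using metric_eq[OF c wt ut] metric_eq[OF c ut ut] a by (simp_all add: u(2) wc B_def)
  then show ?thesis using u(1) by blast
qed

text \<open>Covers both kinds of variation: the linear one with \<open>w\<close> zero for
  transversal exits, and the lightlike one with a quadratic correction for tangential exits.\<close>

lemma quadratic_variation:
  assumes ex: "exits_along M (p, v) T \<gamma> V" and tr: "normal_comp M (\<gamma> T) (V T) < 0"
    and t: "v \<in> tangent_space M p" "u \<in> tangent_space M p" "w \<in> tangent_space M p"
    and c: "c \<in> charts_at M p" and null: "metric M p v v = 0" and start: "0 < snd (v c) \<or> 0 < snd (u c)"
  shows "geodesic_variation M p (\<lambda>s. tadd (tadd v (tscale s u)) (tscale (s\<^sup>2) w)) \<gamma> V T (norm (u c) + norm (w c)) c"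
proof -
  note e = exits_alongD[OF ex]
  have a0: "tadd (tadd v (tscale 0 u)) (tscale (0\<^sup>2) w) = v" by (simp add: fun_eq_iff)
  show ?thesis
  proof (unfold_locales, unfold a0)
    show "\<forall>\<^sub>F s in at_right 0. norm (tadd (tadd v (tscale s u)) (tscale (s\<^sup>2) w) c - v c) \<le> (norm (u c) + norm (w c)) * s"
      using eventually_pos eventually_small[OF zero_less_one, of 1]
    proof eventually_elim
      case (elim s)
      have "norm (s *\<^sub>R u c + s\<^sup>2 *\<^sub>R w c) \<le> s * norm (u c) + s\<^sup>2 * norm (w c)"
        using norm_triangle_ineq[of "s *\<^sub>R u c" "s\<^sup>2 *\<^sub>R w c"] elim by simp
      also have "\<dots> \<le> s * norm (u c) + s * norm (w c)"
        using elim by (intro add_left_mono mult_right_mono) (auto simp: power2_eq_square)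
      finally show ?case by (simp add: algebra_simps)
    qed
    show "0 < snd (v c) \<or> (\<exists>\<kappa>>0. \<forall>\<^sub>F s in at_right 0. \<kappa> * s \<le> snd (tadd (tadd v (tscale s u)) (tscale (s\<^sup>2) w) c) - snd (v c))"
    proof (cases "0 < snd (v c)")
      case False
      \<comment> \<open>Half of the linear term compensates for the quadratic one when
        \<open>s\<close> is small.\<close>
      then have k: "snd (u c) / 2 > 0" using start by simp
      have "\<forall>\<^sub>F s in at_right 0. snd (u c) / 2 * s \<le> snd (tadd (tadd v (tscale s u)) (tscale (s\<^sup>2) w) c) - snd (v c)"
        using eventually_pos eventually_small[OF k, of "\<bar>snd (w c)\<bar>"]
      proof eventually_elim
        case (elim s)
        have "s * (\<bar>snd (w c)\<bar> * s) \<le> s * (snd (u c) / 2)" using elim by (intro mult_left_mono) auto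
        moreover have "- (s * (\<bar>snd (w c)\<bar> * s)) \<le> s\<^sup>2 * snd (w c)"
        proof -
          have "s\<^sup>2 * (- \<bar>snd (w c)\<bar>) \<le> s\<^sup>2 * snd (w c)" by (intro mult_left_mono) auto
          then show ?thesis by (simp add: power2_eq_square mult_ac)
        qed
        ultimately show ?case by (simp add: algebra_simps)
      qed
      then show ?thesis using k by blast
    qed simp
    show "tadd (tadd v (tscale s u)) (tscale (s\<^sup>2) w) \<in> tangent_space M p" for s
      by (intro tadd_tangent tscale_tangent t)
    show "snd (V T c') < 0" if "c' \<in> charts_at M (\<gamma> T)" for c'
      using normal_comp_iff(2)[OF e(4,8) that] tr by simp
  qed (use e c null in auto)
qed

end

context bd_iso
begin

section \<open>Recovering the travel time\<close>

text \<open>Exit points, limiting exit velocities and energies all correspond, so the pairings in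
  the two first variation formulas agree up to O(s^2). Hence the energy times \<open>T1 - T2\<close>
  is O(s^2), while the energy is at least \<open>k * s\<close> in absolute value.\<close>

lemma variation_times:
  assumes V1: "geodesic_variation M1 p a \<gamma>1 W1 T1 C1 c1"
    and V2: "geodesic_variation M2 (f p) b \<gamma>2 W2 T2 C2 c2"
    and p: "p \<in> boundary M1" and b: "\<And>s. b s = push p (a s)"
    and y: "\<gamma>2 T2 = f (\<gamma>1 T1)" "W2 T2 = push (\<gamma>1 T1) (W1 T1)"
    and conj: "\<forall>\<^sub>F s in at_right 0. bd_pushforward M1 M2 f (S_in M1 (p, a s)) = S_in M2 (f p, b s)"
    and k: "k > 0" "\<forall>\<^sub>F s in at_right 0. k * s \<le> \<bar>metric M1 p (a s) (a s)\<bar>"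
  shows "T1 = T2"
proof -
  interpret V1: geodesic_variation M1 p a \<gamma>1 W1 T1 C1 c1 by (rule V1)
  interpret V2: geodesic_variation M2 "f p" b \<gamma>2 W2 T2 C2 c2 by (rule V2)
  define q w where "q = \<gamma>1 T1" and "w = W1 T1"
  have q: "q \<in> boundary M1" using V1.bd by (simp add: q_def)
  have w: "w \<in> tangent_space M1 q"
    unfolding q_def w_def by (rule A.geodesicD(1)[OF V1.geo(1)]) (use V1.T in simp)
  obtain c where c: "c \<in> charts_at M1 q" using A.ex_chart by blast
  obtain d where d: "d \<in> charts_at M2 (f q)" using B.ex_chart by blast
  have ch: "c \<in> charts M1" "q \<in> cdom c" "d \<in> charts M2" "f q \<in> cdom d" using c d by (auto simp: A.charts_at_iff B.charts_at_iff)
  obtain D1 where D1: "D1 \<ge> 0" "\<forall>\<^sub>F s in at_right 0. \<exists>\<tau> x v. tau_in M1 (p, a s) = ereal \<tau> \<and> \<bar>\<tau> - T1\<bar> \<le> D1 * s \<and>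
    S_in M1 (p, a s) = (x, v) \<and> x \<in> boundary M1 \<and> x \<in> cdom c \<and> v \<in> tangent_space M1 x \<and> snd (v c) < 0 \<and>
    norm (cmap c x - cmap c q) \<le> D1 * s \<and>
    \<bar>metric_coord M1 c (cmap c q) (cmap c x - cmap c q) (w c) - T1 / 2 * V1.En s\<bar> \<le> D1 * s\<^sup>2"
    using V1.variation_exit[OF c[unfolded q_def]] unfolding q_def w_def by blast
  obtain D2 where D2: "D2 \<ge> 0" "\<forall>\<^sub>F s in at_right 0. \<exists>\<tau> x v. tau_in M2 (f p, b s) = ereal \<tau> \<and> \<bar>\<tau> - T2\<bar> \<le> D2 * s \<and>
    S_in M2 (f p, b s) = (x, v) \<and> x \<in> boundary M2 \<and> x \<in> cdom d \<and> v \<in> tangent_space M2 x \<and> snd (v d) < 0 \<and>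
    norm (cmap d x - cmap d (f q)) \<le> D2 * s \<and>
    \<bar>metric_coord M2 d (cmap d (f q)) (cmap d x - cmap d (f q)) (push q w d) - T2 / 2 * V2.En s\<bar> \<le> D2 * s\<^sup>2"
    using V2.variation_exit[of d] d y unfolding q_def w_def by auto
  let ?x0 = "fst (cmap c q)" and ?S = "bd_coord_dom c d f"
  have S: "open ?S" "?x0 \<in> ?S" using open_bd_coord_dom[OF ch(1,3)] in_bd_coord_dom(1)[OF q c d] by auto
  have opS: "openin (top_of_set UNIV) ?S" using S(1) by simp
  obtain r N where r: "r > 0" "N \<ge> 0" "C2_bounds ?S (cball ?x0 r \<inter> UNIV) (bd_coord c d f) N"
    using smooth_on_C2_bounds[OF f_smooth[OF ch(1,3)] thick_UNIV opS S(2)] by blast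
  have der: "frechet_derivative (bd_coord c d f) (at ?x0 within ?S) = bdD c d q"
    by (simp add: at_within_open[OF S(2,1)])
  have y0: "cmap d (f q) \<in> cimg d" using ch by auto
  obtain r2 K where K: "r2 > 0" "K > 0" "B.metric_bounds d (cball (cmap d (f q)) r2 \<inter> half_space) K"
    using B.metric_bounds_ex[OF ch(3) y0] by blast
  have y0B: "cmap d (f q) \<in> cball (cmap d (f q)) r2 \<inter> half_space"
    using K(1) subsetD[OF B.cimg_half[OF ch(3)] y0] by simp
  note bG = B.metric_coord_bilinear[OF ch(3) y0]
  \<comment> \<open>Collects the errors of the two formulas and that of linearizing \<open>f\<close>
    at \<open>q\<close>.\<close>
  define D where "D = D1 + D2 + K * (N * D1\<^sup>2) * norm (push q w d)"
  have "\<forall>\<^sub>F s in at_right 0. \<bar>T1 - T2\<bar> * k \<le> 2 * D * s"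
    using D1(2) D2(2) conj k(2) eventually_pos eventually_small[OF r(1), of D1]
  proof eventually_elim
    case (elim s)
    from elim(1) obtain x v where x: "S_in M1 (p, a s) = (x, v)" "x \<in> boundary M1" "x \<in> cdom c"
      "norm (cmap c x - cmap c q) \<le> D1 * s"
      "\<bar>metric_coord M1 c (cmap c q) (cmap c x - cmap c q) (w c) - T1 / 2 * V1.En s\<bar> \<le> D1 * s\<^sup>2" by blast
    from elim(2) obtain x' v' where x': "S_in M2 (f p, b s) = (x', v')" "x' \<in> cdom d"
      "\<bar>metric_coord M2 d (cmap d (f q)) (cmap d x' - cmap d (f q)) (push q w d) - T2 / 2 * V2.En s\<bar> \<le> D2 * s\<^sup>2" by blast
    have "x' = f x" using elim(3) unfolding x(1) x'(1) bd_pushforward_eq by simp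
    then have fx: "f x \<in> cdom d" using x'(2) by simp
    have cx: "c \<in> charts_at M1 x" "d \<in> charts_at M2 (f x)" using x(3) fx ch by (auto simp: A.charts_at_iff B.charts_at_iff)
    define h where "h = fst (cmap c x) - ?x0"
    \<comment> \<open>Both points lie on the boundary, so their coordinate difference is a boundary
      vector.\<close>
    have hh: "cmap c x - cmap c q = (h, 0)"
      using boundary_coord[OF x(2) cx(1)] boundary_coord[OF q c] by (simp add: h_def prod_eq_iff)
    have hn: "norm h \<le> D1 * s" using x(4) unfolding hh by simp
    define er where "er = fst (cmap d (f x)) - fst (cmap d (f q)) - bdD c d q h"
    have "fst (cmap c x) \<in> cball ?x0 r \<inter> UNIV" using hn elim(6) by (simp add: h_def dist_norm norm_minus_commute)
    moreover have "?x0 \<in> cball ?x0 r \<inter> UNIV" using r(1) by simp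
    ultimately have "norm er \<le> N * (norm h)\<^sup>2"
      using C2_boundsD(5)[OF r(3)] in_bd_coord_dom(3)[OF x(2) cx] in_bd_coord_dom(3)[OF q c d]
      unfolding er_def h_def der[symmetric] by metis
    also have "\<dots> \<le> N * (D1 * s)\<^sup>2" using hn r(2) by (intro mult_left_mono power_mono) auto
    finally have er: "norm er \<le> N * (D1 * s)\<^sup>2" .
    have dd: "cmap d (f x) - cmap d (f q) = (bdD c d q h, 0) + (er, 0)"
      using boundary_coord2[OF f_boundary[OF x(2)] cx(2)] boundary_coord2[OF f_boundary[OF q] d]
      by (simp add: er_def prod_eq_iff)
    define u where "u = tvec_of M1 c q (h, 0)"
    have u: "u \<in> boundary_tangent_space M1 q" "u c = (h, 0)"
      using A.tvec_of_tangent[OF c] A.tvec_of_apply[OF c] unfolding A.boundary_tangent_space_iff[OF c q] u_def by auto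
    note ut = A.boundary_tangentD(1)[OF u(1)]
    \<comment> \<open>On boundary vectors \<open>push\<close> is the differential of
      \<open>f\<close>. As it preserves the full metric, a boundary vector can be paired with an
      exit velocity that is not tangent to the boundary.\<close>
    have "metric_coord M2 d (cmap d (f q)) (bdD c d q h, 0) (push q w d) = metric M2 (f q) (push q u) (push q w)"
      using B.metric_eq[OF d push_tangent[OF q ut] push_tangent[OF q w]] push_boundary_coord[OF q u(1) c d] u(2) by simp
    also have "\<dots> = metric M1 q u w" by (rule push_metric[OF q ut w])
    also have "\<dots> = metric_coord M1 c (cmap c q) (h, 0) (w c)" using A.metric_eq[OF c ut w] u(2) by simp
    finally have 1: "metric_coord M2 d (cmap d (f q)) (cmap d (f x) - cmap d (f q)) (push q w d)
      = metric_coord M1 c (cmap c q) (h, 0) (w c) + metric_coord M2 d (cmap d (f q)) (er, 0) (push q w d)"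
      unfolding dd by (simp add: bilinear_ladd[OF bG, of "(bdD c d q h, 0)" "(er, 0)"] del: add_Pair)
    have "norm (er, 0 :: real) \<le> N * (D1 * s)\<^sup>2" using er by simp
    then have 2: "\<bar>metric_coord M2 d (cmap d (f q)) (er, 0) (push q w d)\<bar> \<le> K * (N * (D1 * s)\<^sup>2) * norm (push q w d)"
      using K(2) by (intro order_trans[OF B.metric_boundsD(2)[OF K(3) y0B y0B] mult_right_mono[OF mult_left_mono]]) auto
    have En: "V2.En s = V1.En s" unfolding b by (rule push_metric[OF p V1.tang V1.tang])
    have "\<bar>T1 / 2 * V1.En s - T2 / 2 * V1.En s\<bar> \<le> D1 * s\<^sup>2 + D2 * s\<^sup>2 + K * (N * (D1 * s)\<^sup>2) * norm (push q w d)"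
      using x(5) x'(3) 1 2 unfolding En hh \<open>x' = f x\<close> by linarith
    also have "\<dots> = D * s\<^sup>2" by (simp add: D_def power_mult_distrib algebra_simps)
    finally have 3: "\<bar>T1 / 2 * V1.En s - T2 / 2 * V1.En s\<bar> \<le> D * s\<^sup>2" .
    have "\<bar>T1 - T2\<bar> * (k * s) \<le> \<bar>T1 - T2\<bar> * \<bar>V1.En s\<bar>" using elim(4) by (intro mult_left_mono) auto
    also have "\<dots> = 2 * \<bar>T1 / 2 * V1.En s - T2 / 2 * V1.En s\<bar>" by (simp add: left_diff_distrib[symmetric] diff_divide_distrib[symmetric] abs_mult)
    also have "\<dots> \<le> 2 * (D * s\<^sup>2)" using 3 by simp
    finally have "(\<bar>T1 - T2\<bar> * k) * s \<le> (2 * D * s) * s" by (simp add: power2_eq_square mult_ac)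
    then show ?case using elim(5) by simp
  qed
  moreover have "((\<lambda>s. 2 * D * s) \<longlongrightarrow> 2 * D * 0) (at_right 0)" by (intro tendsto_intros)
  ultimately have "\<bar>T1 - T2\<bar> * k \<le> 2 * D * 0"
    by (intro tendsto_lowerbound) (auto simp: trivial_limit_at_right_real)
  then show ?thesis using k(1) by (simp add: mult_le_0_iff)
qed

end

text \<open>Here \<open>U\<close> is the open neighborhood prior to its intersection with the causal
  vectors; openness is what brings the timelike variations into the data.\<close>

locale same_scattering = bd_iso M1 M2 f
  for M1 :: "('m::{t2_space, second_countable_topology}, 'e::euclidean_space) metric_manifold"
    and M2 :: "('k::{t2_space, second_countable_topology}, 'f::euclidean_space) metric_manifold"
    and f :: "'m \<Rightarrow> 'k" +
  fixes U :: "('m \<times> ('m, 'e) tvec) set"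
  assumes nt1: "\<forall>q\<in>LM M1. nontrapping M1 q" and nt2: "\<forall>q\<in>LM M2. nontrapping M2 q"
    and U: "open_in_bdTM M1 U" "bdLM M1 \<subseteq> U"
    and scattering: "\<forall>q\<in>U \<inter> bdJM M1 \<inter> bd_minus_TM M1. bd_pushforward M1 M2 f (S_in M1 q) = S_in M2 (bd_pushforward M1 M2 f q)"
begin

lemma push_bd_minus_LM:
  assumes "(p, v) \<in> bd_minus_LM M1"
  shows "(f p, push p v) \<in> bd_minus_LM M2"
  using assms push_tangent[of p v] push_normal_comp[of p v] push_metric[of p v v] f_boundary[of p]
  unfolding A.bd_minus_LM_iff B.bd_minus_LM_iff by simp

text \<open>Lightlike inward vectors belong to the data, since \<open>U\<close> contains all of
  \<open>bdLM M1\<close> and lightlike vectors are causal.\<close>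

lemma scattering_LM:
  assumes "(p, v) \<in> bd_minus_LM M1"
  shows "bd_pushforward M1 M2 f (S_in M1 (p, v)) = S_in M2 (f p, push p v)"
proof -
  have "(p, v) \<in> U \<inter> bdJM M1 \<inter> bd_minus_TM M1"
    using assms U(2) unfolding bd_minus_LM_def bdLM_def bdJM_def LM_def JM_def by auto
  then show ?thesis using scattering bd_pushforward_eq by fastforce
qed

lemma exit_match:
  assumes q: "(p, v) \<in> bd_minus_LM M1"
    and ex: "exits_along M1 (p, v) T1 \<gamma>1 W1" "exits_along M2 (f p, push p v) T2 \<gamma>2 W2"
  shows "\<gamma>2 T2 = f (\<gamma>1 T1)" "W2 T2 = push (\<gamma>1 T1) (W1 T1)"
  using scattering_LM[OF q] unfolding A.exits_alongD(10)[OF ex(1)] B.exits_alongD(10)[OF ex(2)] bd_pushforward_eq by auto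

text \<open>In a chart, \<open>U\<close> is relatively open in the boundary points times all
  vectors, and the variation moves only in the fiber over \<open>p\<close>.\<close>

lemma eventually_in_U:
  assumes q: "(p, v) \<in> U" and p: "p \<in> boundary M1" and t: "v \<in> tangent_space M1 p" "u \<in> tangent_space M1 p"
  shows "\<forall>\<^sub>F s in at_right 0. (p, tadd v (tscale s u)) \<in> U"
proof -
  obtain c where c: "c \<in> charts_at M1 p" using A.ex_chart by blast
  note ch = c[unfolded A.charts_at_iff]
  let ?O = "{(cmap c p, v c) |p v. (p, v) \<in> U \<and> p \<in> cdom c}"
  have "openin (top_of_set ((cmap c ` (cdom c \<inter> boundary M1)) \<times> UNIV)) ?O"
    using U(1) ch unfolding open_in_bdTM_def by blast
  then obtain W where W: "open W" "?O = ((cmap c ` (cdom c \<inter> boundary M1)) \<times> UNIV) \<inter> W"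
    unfolding openin_open by blast
  have "(cmap c p, v c) \<in> ?O" using q ch by blast
  then have vW: "(cmap c p, v c) \<in> W" using W(2) by blast
  have "((\<lambda>s. (cmap c p, v c + s *\<^sub>R u c)) \<longlongrightarrow> (cmap c p, v c + 0 *\<^sub>R u c)) (at_right 0)"
    by (intro tendsto_intros)
  then have "\<forall>\<^sub>F s in at_right 0. (cmap c p, v c + s *\<^sub>R u c) \<in> W"
    using topological_tendstoD[OF _ W(1)] vW by fastforce
  then show ?thesis
  proof eventually_elim
    case (elim s)
    then have "(cmap c p, v c + s *\<^sub>R u c) \<in> ?O" unfolding W(2) using ch p by blast
    then obtain p' v' where pv: "cmap c p' = cmap c p" "v' c = v c + s *\<^sub>R u c" "(p', v') \<in> U" "p' \<in> cdom c" by auto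
    \<comment> \<open>Membership in the coordinate image yields some element of \<open>U\<close>;
      injectivity of the chart identifies its base point, and the coordinate vector then identifies
      its tangent vector.\<close>
    have pp: "p' = p" using A.cinv_cmap[of c p] A.cinv_cmap[of c p'] pv(1,4) ch by metis
    have "v' \<in> tangent_space M1 p" using U(1) pv(3) pp unfolding open_in_bdTM_def bdTM_def by blast
    then have "v' = tadd v (tscale s u)"
      by (rule A.tangent_space_eqI[OF _ A.tadd_tangent[OF t(1) A.tscale_tangent[OF t(2)]] c]) (simp add: pv(2))
    then show ?case using pv(3) pp by simp
  qed
qed

text \<open>Transversal exit: the variation \<open>v + s u\<close> with \<open>g(v, u) < 0\<close> is timelike for small \<open>s > 0\<close>, hence covered by the data.\<close>

lemma transversal_times:
  assumes q: "(p, v) \<in> bd_minus_LM M1"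
    and ex: "exits_along M1 (p, v) T1 \<gamma>1 W1" "exits_along M2 (f p, push p v) T2 \<gamma>2 W2"
    and tr: "normal_comp M1 (\<gamma>1 T1) (W1 T1) < 0"
  shows "T1 = T2"
proof -
  have qq: "p \<in> boundary M1" "v \<in> tangent_space M1 p" "0 < normal_comp M1 p v" "metric M1 p v v = 0"
    using q unfolding A.bd_minus_LM_iff by auto
  note p = qq(1) and v = qq(2)
  note y = exit_match[OF q ex]
  obtain c where c: "c \<in> charts_at M1 p" using A.ex_chart by blast
  obtain d where d: "d \<in> charts_at M2 (f p)" using B.ex_chart by blast
  note ch = c[unfolded A.charts_at_iff]
  have sv: "0 < snd (v c)" using A.normal_comp_iff(1)[OF p v c] qq(3) by simp
  have "v c \<noteq> 0" using sv by auto
  moreover have x: "cmap c p \<in> cimg c" using ch by auto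
  ultimately obtain b where "metric_coord M1 c (cmap c p) (v c) b \<noteq> 0"
    using A.metric_coord_nondegenerate[OF conjunct1[OF ch] x] unfolding nondegenerate_def by blast
  moreover define u0 where "u0 = tvec_of M1 c p b"
  ultimately have u0: "u0 \<in> tangent_space M1 p" "metric M1 p v u0 \<noteq> 0"
    using A.tvec_of_tangent[OF c] A.tvec_of_apply[OF c] A.metric_eq[OF c v] by (auto simp: u0_def)
  \<comment> \<open>Scaled so that the pairing of \<open>v\<close> with \<open>u\<close> is minus
    the square of a nonzero number.\<close>
  define u where "u = tscale (- metric M1 p v u0) u0"
  have u: "u \<in> tangent_space M1 p" unfolding u_def by (rule A.tscale_tangent[OF u0(1)])
  define k where "k = - metric M1 p v u"
  have k: "k > 0" using u0 by (auto simp: k_def u_def A.metric_tscale[OF u0(1) v] zero_less_mult_iff linorder_neq_iff)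
  \<comment> \<open>The zero vector, written as a multiple of \<open>v\<close>: the variation is
    linear here.\<close>
  define w where "w = tscale 0 v"
  have w: "w \<in> tangent_space M1 p" unfolding w_def by (rule A.tscale_tangent[OF v])
  define a where "a s = tadd (tadd v (tscale s u)) (tscale (s\<^sup>2) w)" for s
  have a_eq: "a s = tadd v (tscale s u)" for s by (auto simp: a_def w_def fun_eq_iff)
  have V1: "geodesic_variation M1 p a \<gamma>1 W1 T1 (norm (u c) + norm (w c)) c"
    unfolding a_def[abs_def] by (rule A.quadratic_variation[OF ex(1) tr v u w c qq(4)]) (use sv in simp)
  have pv: "push p v \<in> tangent_space M2 (f p)" "push p u \<in> tangent_space M2 (f p)" "push p w \<in> tangent_space M2 (f p)"
    using push_tangent[OF p] v u w by auto
  have q2: "(f p, push p v) \<in> bd_minus_LM M2" by (rule push_bd_minus_LM[OF q])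
  have V2: "geodesic_variation M2 (f p) (\<lambda>s. tadd (tadd (push p v) (tscale s (push p u))) (tscale (s\<^sup>2) (push p w)))
      \<gamma>2 W2 T2 (norm (push p u d) + norm (push p w d)) d"
  proof (rule B.quadratic_variation[OF ex(2) _ pv d])
    show "normal_comp M2 (\<gamma>2 T2) (W2 T2) < 0"
      using tr push_normal_comp[OF A.exits_alongD(4,8)[OF ex(1)]] unfolding y by simp
    show "metric M2 (f p) (push p v) (push p v) = 0" using q2 unfolding B.bd_minus_LM_iff by blast
    have "0 < normal_comp M2 (f p) (push p v)" using q2 unfolding B.bd_minus_LM_iff by blast
    then show "0 < snd (push p v d) \<or> 0 < snd (push p u d)"
      using B.normal_comp_iff(1)[OF f_boundary[OF p] pv(1) d] by simp
  qed
  have as: "push p (a s) = tadd (tadd (push p v) (tscale s (push p u))) (tscale (s\<^sup>2) (push p w))" for s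
    unfolding a_def push_tadd[OF p A.tadd_tangent[OF v A.tscale_tangent[OF u]] A.tscale_tangent[OF w]]
      push_tadd[OF p v A.tscale_tangent[OF u]] push_tscale[OF p u] push_tscale[OF p w] ..
  have at: "a s \<in> tangent_space M1 p" for s unfolding a_eq by (rule A.tadd_tangent[OF v A.tscale_tangent[OF u]])
  have En: "metric M1 p (a s) (a s) = - 2 * k * s + s\<^sup>2 * metric M1 p u u" for s
    unfolding a_eq k_def using qq(4) A.metric_sym[OF u v]
    by (simp add: A.metric_tadd A.metric_tscale A.tscale_tangent A.tadd_tangent u v power2_eq_square algebra_simps)
  have vU: "(p, v) \<in> U" using q U(2) unfolding bd_minus_LM_def by blast
  \<comment> \<open>The linear term outweighs the quadratic one. The bound makes the varied vectors
    timelike and gives the energy the linear size that \<open>variation_times\<close>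
    requires.\<close>
  have En': "\<forall>\<^sub>F s in at_right 0. metric M1 p (a s) (a s) \<le> - k * s"
    using eventually_pos eventually_small[OF k, of "\<bar>metric M1 p u u\<bar>"]
  proof eventually_elim
    case (elim s)
    have "s * (s * metric M1 p u u) \<le> s * (\<bar>metric M1 p u u\<bar> * s)"
      using elim by (intro mult_left_mono) (auto simp: mult.commute intro: mult_right_mono)
    also have "\<dots> \<le> s * k" using elim by (intro mult_left_mono) auto
    finally show ?case unfolding En by (simp add: power2_eq_square algebra_simps)
  qed
  have sn: "\<forall>\<^sub>F s in at_right 0. 0 < snd (a s c)"
    using eventually_pos eventually_small[OF sv, of "\<bar>snd (u c)\<bar>"]
  proof eventually_elim
    case (elim s)
    have "- (\<bar>snd (u c)\<bar> * s) \<le> s * snd (u c)" using mult_left_mono[of "- \<bar>snd (u c)\<bar>" "snd (u c)" s] elim by (simp add: mult.commute)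
    then show ?case using elim(2) by (simp add: a_eq)
  qed
  show ?thesis
  proof (rule variation_times[OF V1 V2 p _ y _ k])
    show "tadd (tadd (push p v) (tscale s (push p u))) (tscale (s\<^sup>2) (push p w)) = push p (a s)" for s by (rule as[symmetric])
    show "\<forall>\<^sub>F s in at_right 0. k * s \<le> \<bar>metric M1 p (a s) (a s)\<bar>"
      using En' by eventually_elim simp
    show "\<forall>\<^sub>F s in at_right 0. bd_pushforward M1 M2 f (S_in M1 (p, a s)) =
      S_in M2 (f p, tadd (tadd (push p v) (tscale s (push p u))) (tscale (s\<^sup>2) (push p w)))"
      using En' sn eventually_in_U[OF vU p v u] eventually_pos
    proof eventually_elim
      case (elim s)
      have "a s \<noteq> (\<lambda>_. 0)" using elim(2) by auto
      moreover have "metric M1 p (a s) (a s) \<le> 0" using elim(1) mult_pos_pos[OF k elim(4)] by linarith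
      ultimately have "(p, a s) \<in> bdJM M1" using at p by (simp add: bdJM_def JM_def bdTM_def)
      moreover have "(p, a s) \<in> bd_minus_TM M1"
        unfolding A.bd_minus_TM_iff using A.normal_comp_iff(1)[OF p at c] elim(2) p at by blast
      moreover have "(p, a s) \<in> U" using elim(3) by (simp add: a_eq)
      ultimately have "bd_pushforward M1 M2 f (S_in M1 (p, a s)) = S_in M2 (bd_pushforward M1 M2 f (p, a s))"
        using scattering by blast
      then show ?case unfolding bd_pushforward_eq[of p] as .
    qed
  qed
qed

text \<open>Tangential exit: the reversed geodesic exits transversally, and its initial vector \<open>m\<close> is a limit of inward
  lightlike vectors \<open>m + s N + s\<^sup>2 u\<close>, whose geodesics exit transversally as well.\<close>

lemma tangential_times:
  assumes q: "(p, v) \<in> bd_minus_LM M1"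
    and ex: "exits_along M1 (p, v) T1 \<gamma>1 W1" "exits_along M2 (f p, push p v) T2 \<gamma>2 W2"
    and tangential: "normal_comp M1 (\<gamma>1 T1) (W1 T1) = 0"
  shows "T1 = T2"
proof -
  have qq: "p \<in> boundary M1" "v \<in> tangent_space M1 p" "0 < normal_comp M1 p v" "metric M1 p v v = 0"
    using q unfolding A.bd_minus_LM_iff by auto
  have q2: "f p \<in> boundary M2" "push p v \<in> tangent_space M2 (f p)" "0 < normal_comp M2 (f p) (push p v)"
    using push_bd_minus_LM[OF q] unfolding B.bd_minus_LM_iff by blast+
  note e1 = A.exits_alongD[OF ex(1)] and e2 = B.exits_alongD[OF ex(2)]
  note match = exit_match[OF q ex]
  define y w N where "y = \<gamma>1 T1" and "w = W1 T1" and "N = inward_normal M1 y"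
  have y: "y \<in> boundary M1" and w: "w \<in> tangent_space M1 y" using e1(4,8) by (auto simp: y_def w_def)
  note Nf = A.inward_normal[OF y, folded N_def]
  have fy: "f y \<in> boundary M2" by (rule f_boundary[OF y])
  obtain cy where cy: "cy \<in> charts_at M1 y" using A.ex_chart by blast
  obtain dy where dy: "dy \<in> charts_at M2 (f y)" using B.ex_chart by blast
  obtain c where c: "c \<in> charts_at M1 p" using A.ex_chart by blast
  obtain d where d: "d \<in> charts_at M2 (f p)" using B.ex_chart by blast
  have "w \<in> boundary_tangent_space M1 y"
    unfolding A.boundary_tangent_space_iff[OF cy y] using w A.normal_comp_iff(3)[OF y w cy] tangential by (simp add: y_def w_def)
  moreover have "w \<noteq> (\<lambda>_. 0)" unfolding w_def by (rule A.exit_velocity_nonzero[OF ex(1) qq(3,1,2)])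
  moreover have ww: "metric M1 y w w = 0"
    using A.geodesic_energy[OF e1(5), of T1 0] e1(1,6,7) qq(4) by (simp add: y_def w_def)
  ultimately obtain u where u: "u \<in> boundary_tangent_space M1 y" "metric M1 y w u = 1/2" "metric M1 y u u = 0"
    using A.boundary_null_partner[OF y] by blast
  note ut = A.boundary_tangentD(1)[OF u(1)]
  define m where "m = tscale (-1) w"
  have m: "m \<in> tangent_space M1 y" unfolding m_def by (rule A.tscale_tangent[OF w])
  have nm: "normal_comp M1 y m = 0" using tangential unfolding m_def A.normal_comp_tscale[OF y w] by (simp add: y_def w_def)
  have mm: "metric M1 y m m = 0" by (simp add: m_def A.metric_tscale A.tscale_tangent w ww)
  have nN: "normal_comp M1 y N = 1" using Nf(3) by (simp add: normal_comp_def N_def)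
  have nu: "normal_comp M1 y u = 0" using Nf(2)[OF u(1)] by (simp add: normal_comp_def N_def)
  have mN: "metric M1 y m N = 0" using nm by (simp add: normal_comp_def N_def)
  have uN: "metric M1 y u N = 0" using nu by (simp add: normal_comp_def N_def)
  have mu: "metric M1 y m u = - 1/2" by (simp add: m_def A.metric_tscale[OF w ut] u(2))
  define a where "a s = tadd (tadd m (tscale s N)) (tscale (s\<^sup>2) u)" for s
  have at: "a s \<in> tangent_space M1 y" for s unfolding a_def by (intro A.tadd_tangent A.tscale_tangent m Nf ut)
  \<comment> \<open>The coefficient of \<open>s\<close> vanishes as \<open>m\<close> is tangent to
    the boundary. That of \<open>s\<^sup>2\<close> is \<open>1 + 2 * metric M1 y m u\<close>, zero
    by the choice of \<open>u\<close>, and the higher ones vanish because \<open>u\<close> is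
    lightlike and orthogonal to \<open>N\<close>.\<close>
  have null: "metric M1 y (a s) (a s) = 0" for s
  proof -
    have sym: "metric M1 y N m = 0" "metric M1 y N u = 0" "metric M1 y u m = - 1/2"
      using A.metric_sym[OF m Nf(1)] A.metric_sym[OF ut Nf(1)] A.metric_sym[OF m ut] mN uN mu by auto
    show ?thesis
      unfolding a_def using m Nf(1) ut sym mN uN mu mm u(3) Nf(3)
      by (simp add: A.metric_tadd A.metric_tscale A.tadd_tangent A.tscale_tangent power2_eq_square)
  qed
  have na: "normal_comp M1 y (a s) = s" for s
    unfolding a_def using m Nf(1) ut nm nN nu
    by (simp add: A.normal_comp_tadd[OF y] A.normal_comp_tscale[OF y] A.tadd_tangent A.tscale_tangent)
  have minus: "(y, a s) \<in> bd_minus_LM M1" if "s > 0" for s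
    unfolding A.bd_minus_LM_iff using y at null na that by simp
  have pm: "push y m = tscale (-1) (W2 T2)" 
    using push_tscale[OF y w] unfolding m_def match(2)[folded y_def w_def] .
  have as: "push y (a s) = tadd (tadd (push y m) (tscale s (push y N))) (tscale (s\<^sup>2) (push y u))" for s
    unfolding a_def push_tadd[OF y A.tadd_tangent[OF m A.tscale_tangent[OF Nf(1)]] A.tscale_tangent[OF ut]]
      push_tadd[OF y m A.tscale_tangent[OF Nf(1)]] push_tscale[OF y Nf(1)] push_tscale[OF y ut] ..
  have r1: "exits_along M1 (y, m) T1 (\<lambda>t. \<gamma>1 (T1 - t)) (\<lambda>t. tscale (-1) (W1 (T1 - t)))"
    unfolding y_def m_def w_def by (rule A.exits_along_reverse[OF ex(1) qq(1)])
  have r2: "exits_along M2 (f y, push y m) T2 (\<lambda>t. \<gamma>2 (T2 - t)) (\<lambda>t. tscale (-1) (W2 (T2 - t)))"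
    using B.exits_along_reverse[OF ex(2) q2(1)] unfolding match(1)[folded y_def] pm[symmetric] .
  have V1: "geodesic_variation M1 y a (\<lambda>t. \<gamma>1 (T1 - t)) (\<lambda>t. tscale (-1) (W1 (T1 - t))) T1 (norm (N cy) + norm (u cy)) cy"
    unfolding a_def[abs_def]
  proof (rule A.quadratic_variation[OF r1 _ m Nf(1) ut cy mm])
    \<comment> \<open>The reversed geodesic arrives at \<open>p\<close> with the opposite of the
      inward vector \<open>v\<close>, hence transversally.\<close>
    show "normal_comp M1 (\<gamma>1 (T1 - T1)) (tscale (-1) (W1 (T1 - T1))) < 0"
      using qq(3) e1(6,7) A.normal_comp_tscale[OF qq(1,2), of "-1"] by simp
    show "0 < snd (m cy) \<or> 0 < snd (N cy)" using Nf(4)[OF cy] by simp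
  qed
  have pt: "push y m \<in> tangent_space M2 (f y)" "push y N \<in> tangent_space M2 (f y)" "push y u \<in> tangent_space M2 (f y)"
    using push_tangent[OF y] m Nf(1) ut by auto
  have V2: "geodesic_variation M2 (f y) (\<lambda>s. push y (a s)) (\<lambda>t. \<gamma>2 (T2 - t)) (\<lambda>t. tscale (-1) (W2 (T2 - t))) T2
      (norm (push y N dy) + norm (push y u dy)) dy"
    unfolding as
  proof (rule B.quadratic_variation[OF r2 _ pt dy])
    show "normal_comp M2 (\<gamma>2 (T2 - T2)) (tscale (-1) (W2 (T2 - T2))) < 0"
      using q2(3) e2(6,7) B.normal_comp_tscale[OF q2(1,2), of "-1"] by simp
    show "metric M2 (f y) (push y m) (push y m) = 0" using push_metric[OF y m m] mm by simp
    have "0 < normal_comp M2 (f y) (push y N)" using push_normal_comp[OF y Nf(1)] nN by simp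
    then show "0 < snd (push y m dy) \<or> 0 < snd (push y N dy)" using B.normal_comp_iff(1)[OF fy pt(2) dy] by simp
  qed
  have ends: "\<gamma>1 (T1 - T1) = p" "\<gamma>2 (T2 - T2) = f p" using e1(6) e2(6) by simp_all
  \<comment> \<open>Here \<open>variation_exit\<close> supplies convergence of the exit times and
    transversality of the varied exits.\<close>
  obtain D1 where D1: "\<forall>\<^sub>F s in at_right 0. \<exists>\<tau> x b. tau_in M1 (y, a s) = ereal \<tau> \<and> \<bar>\<tau> - T1\<bar> \<le> D1 * s \<and>
    S_in M1 (y, a s) = (x, b) \<and> x \<in> boundary M1 \<and> x \<in> cdom c \<and> b \<in> tangent_space M1 x \<and> snd (b c) < 0"
    using geodesic_variation.variation_exit[OF V1, unfolded ends, OF c]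
    by (elim exE conjE) (rule that, erule eventually_mono, blast)
  obtain D2 where D2: "\<forall>\<^sub>F s in at_right 0. \<exists>\<tau>. tau_in M2 (f y, push y (a s)) = ereal \<tau> \<and> \<bar>\<tau> - T2\<bar> \<le> D2 * s"
    using geodesic_variation.variation_exit[OF V2, unfolded ends, OF d]
    by (elim exE conjE) (rule that, erule eventually_mono, blast)
  have "\<forall>\<^sub>F s in at_right 0. \<bar>T1 - T2\<bar> \<le> (D1 + D2) * s"
    using D1 D2 eventually_pos
  proof eventually_elim
    case (elim s)
    from elim(1) obtain \<tau> x b where 1: "tau_in M1 (y, a s) = ereal \<tau>" "\<bar>\<tau> - T1\<bar> \<le> D1 * s"
      "S_in M1 (y, a s) = (x, b)" "x \<in> boundary M1" "x \<in> cdom c" "b \<in> tangent_space M1 x" "snd (b c) < 0" by blast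
    from elim(2) obtain \<tau>' where 2: "tau_in M2 (f y, push y (a s)) = ereal \<tau>'" "\<bar>\<tau>' - T2\<bar> \<le> D2 * s" by blast
    note mi = minus[OF elim(3)]
    obtain t1 g1 X1 where x1: "exits_along M1 (y, a s) t1 g1 X1" using A.exits_along_ex[OF nt1 mi] by blast
    obtain t2 g2 X2 where x2: "exits_along M2 (f y, push y (a s)) t2 g2 X2"
      using B.exits_along_ex[OF nt2 push_bd_minus_LM[OF mi]] by blast
    have xb: "g1 t1 = x" "X1 t1 = b" using A.exits_alongD(10)[OF x1] 1(3) by auto
    have "c \<in> charts_at M1 x" using 1(5) c by (simp add: A.charts_at_iff)
    then have "normal_comp M1 (g1 t1) (X1 t1) < 0" unfolding xb using A.normal_comp_iff(2)[OF 1(4,6)] 1(7) by blast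
    \<comment> \<open>The varied vectors are lightlike and inward and their geodesics exit
      transversally, so the first case applies for each small \<open>s\<close>.\<close>
    then have "t1 = t2" by (rule transversal_times[OF mi x1 x2])
    moreover have "t1 = \<tau>" "t2 = \<tau>'" using A.exits_alongD(9)[OF x1] B.exits_alongD(9)[OF x2] 1(1) 2(1) by auto
    ultimately show ?case using 1(2) 2(2) by (simp add: distrib_right)
  qed
  moreover have "((\<lambda>s. (D1 + D2) * s) \<longlongrightarrow> (D1 + D2) * 0) (at_right 0)" by (intro tendsto_intros)
  ultimately have "\<bar>T1 - T2\<bar> \<le> (D1 + D2) * 0"
    by (intro tendsto_lowerbound) (auto simp: trivial_limit_at_right_real)
  then show ?thesis by simp
qed

lemma tau_in_eq:
  assumes q: "(p, v) \<in> bd_minus_LM M1"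
  shows "tau_in M1 (p, v) = tau_in M2 (bd_pushforward M1 M2 f (p, v))"
proof -
  obtain T1 \<gamma>1 W1 where ex1: "exits_along M1 (p, v) T1 \<gamma>1 W1" using A.exits_along_ex[OF nt1 q] by blast
  obtain T2 \<gamma>2 W2 where ex2: "exits_along M2 (f p, push p v) T2 \<gamma>2 W2"
    using B.exits_along_ex[OF nt2 push_bd_minus_LM[OF q]] by blast
  \<comment> \<open>An exit velocity is never inward, so its normal component is negative or zero,
    which are the two cases treated.\<close>
  have "T1 = T2"
    using A.exit_not_inward[OF ex1] transversal_times[OF q ex1 ex2] tangential_times[OF q ex1 ex2] by linarith
  then show ?thesis
    unfolding bd_pushforward_eq using A.exits_alongD(9)[OF ex1] B.exits_alongD(9)[OF ex2] by simp
qed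

end

theorem lemma6p3:
  fixes M1 :: "('m::{t2_space, second_countable_topology}, 'e::euclidean_space) metric_manifold"
    and M2 :: "('k::{t2_space, second_countable_topology}, 'f::euclidean_space) metric_manifold"
    and \<phi>0 :: "'m \<Rightarrow> 'k"
    and U1' U1 U1_minus :: "('m \<times> ('m, 'e) tvec) set"
    and U2' U2 U2_minus :: "('k \<times> ('k, 'f) tvec) set"
  assumes "lorentzian_manifold_timelike_boundary M1"
    and "lorentzian_manifold_timelike_boundary M2"
    and "\<forall>q\<in>LM M1. nontrapping M1 q"
    and "\<forall>q\<in>LM M2. nontrapping M2 q"
    and "nontrapping_conic_nbhd M1 U1'"
    and "nontrapping_conic_nbhd M2 U2'"
    and "U1 = U1' \<inter> bdJM M1"
    and "U2 = U2' \<inter> bdJM M2"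
    and "U1_minus = U1 \<inter> bd_minus_TM M1"
    and "U2_minus = U2 \<inter> bd_minus_TM M2"
    and "boundary_isometry M1 M2 \<phi>0"
    and "bd_pushforward M1 M2 \<phi>0 ` U1_minus = U2_minus"
    and "\<forall>q\<in>U1_minus. bd_pushforward M1 M2 \<phi>0 (S_in M1 q) = S_in M2 (bd_pushforward M1 M2 \<phi>0 q)"
  shows "\<forall>q\<in>bd_minus_LM M1.
    tau_in M1 q = tau_in M2 (bd_pushforward M1 M2 \<phi>0 q) \<and>
    bd_pushforward M1 M2 \<phi>0 (S_in M1 q) = S_in M2 (bd_pushforward M1 M2 \<phi>0 q)"
proof (rule ballI)
  fix q assume "q \<in> bd_minus_LM M1"
  moreover obtain p v where q: "q = (p, v)" by fastforce
  ultimately have pv: "(p, v) \<in> bd_minus_LM M1" by simp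
  interpret same_scattering M1 M2 \<phi>0 U1'
  proof
    show "lorentzian_manifold_timelike_boundary M1" "lorentzian_manifold_timelike_boundary M2"
      "\<forall>q\<in>LM M1. nontrapping M1 q" "\<forall>q\<in>LM M2. nontrapping M2 q" "boundary_isometry M1 M2 \<phi>0"
      using assms(1-4,11) by blast+
    show "open_in_bdTM M1 U1'" "bdLM M1 \<subseteq> U1'" using assms(5) unfolding nontrapping_conic_nbhd_def by blast+
    show "\<forall>q\<in>U1' \<inter> bdJM M1 \<inter> bd_minus_TM M1. bd_pushforward M1 M2 \<phi>0 (S_in M1 q) = S_in M2 (bd_pushforward M1 M2 \<phi>0 q)"
      using assms(13) unfolding assms(9) assms(7) .
  qed
  show "tau_in M1 q = tau_in M2 (bd_pushforward M1 M2 \<phi>0 q) \<and>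
    bd_pushforward M1 M2 \<phi>0 (S_in M1 q) = S_in M2 (bd_pushforward M1 M2 \<phi>0 q)"
    unfolding q using tau_in_eq[OF pv] scattering_LM[OF pv] bd_pushforward_eq[of p v] by simp
qed

end
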